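(* Assume (h1), (h2) and (h3) (stated in the context), and let $F>0$. Then: (i) the operator $H(F)$ is essentially self-adjoint on $L^2(\Omega)$ (its closure is denoted by the same symbol); (ii) the spectrum of $H(F)$ is $\sigma(H(F))=\mathbb{R}$.
   Context: Setting. Fix $d>0$ and $s_0>0$. Let $\gamma:\mathbb{R}\to\mathbb{R}$ have compact support $\mathrm{supp}(\gamma)=[0,s_0]$; put $\alpha(s)=-\int_0^s\gamma(t)\,dt$, $\alpha_0=\alpha(s_0)$, $a(s)=\int_0^s\cos\alpha(t)\,dt$, $b(s)=\int_0^s\sin\alpha(t)\,dt$. The function $\gamma$ is the signed curvature of the planar curve $s\mapsto(a(s),b(s))$, and the curved strip $\{(a(s)-ub'(s),\,b(s)+ua'(s)):\ (s,u)\in\mathbb{R}\times(0,d)\}$ is assumed not to be self-intersecting. Let $\eta\in\mathbb{R}$ be a fixed direction of the electric field. Assumptions: (h1) $\gamma\in C^2(\mathbb{R})$; (h2) $d\,\|\gamma\|_\infty<1$; (h3) $|\eta|<\pi/2$ and $|\eta-\alpha_0|<\pi/2$. Operators. Let $\Omega=\mathbb{R}\times(0,d)$ with coordinates $(s,u)$. Define $g(s,u)=(1+u\gamma(s))^{-2}$, $T_s=-\partial_s g\,\partial_s$, $T_u=-\partial_u^2$, $H_0=T_s+T_u$, with Dirichlet boundary conditions on $\partial\Omega=\mathbb{R}\times\{0,d\}$, and $$V_0(s,u)=-\frac{\gamma(s)^2}{4(1+u\gamma(s))^2}+\frac{u\gamma''(s)}{2(1+u\gamma(s))^3}-\frac54\frac{u^2\gamma'(s)^2}{(1+u\gamma(s))^4}.$$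 For $F>0$, $W(F)$ is the operator of multiplication by $$W(F,s,u)=\begin{cases}F(\cos(\eta)s+\sin(\eta)u), & s<0,\\ F\big(\int_0^s\cos(\eta-\alpha(t))\,dt+\sin(\eta-\alpha(s))u\big), & 0\le s\le s_0,\\ F\big(\cos(\eta-\alpha_0)(s-s_0)+A+\sin(\eta-\alpha_0)u\big), & s>s_0,\end{cases}$$ with $A=\int_0^{s_0}\cos(\eta-\alpha(t))\,dt$. The Stark operator is $H(F)=H_0+W(F)+V_0$ on $L^2(\Omega)$ with Dirichlet boundary conditions, considered initially on the domain $$\mathcal{C}=\{\psi|_{\Omega}:\ \psi\in\mathcal{S}(\mathbb{R}^2),\ \psi(s,0)=\psi(s,d)=0\ \text{for all } s\in\mathbb{R}\},$$ where $\mathcal{S}(\mathbb{R}^2)$ is the Schwartz class. *)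

theory Defs
  imports "HOL-Analysis.Analysis"
begin

section \<open>Unbounded operators in a complex L2 space\<close>

text \<open>
  Elements of the Hilbert space are represented by measurable functions, and equality in the Hilbert
  space is equality almost everywhere. An operator is given by its graph, a set of pairs of
  representatives that is invariant under changing representatives.
\<close>

definition L2 :: "'a measure \<Rightarrow> ('a \<Rightarrow> complex) set" where
  "L2 M = {f. f \<in> borel_measurable M \<and> integrable M (\<lambda>x. (cmod (f x))\<^sup>2)}"

definition L2_inner :: "'a measure \<Rightarrow> ('a \<Rightarrow> complex) \<Rightarrow> ('a \<Rightarrow> complex) \<Rightarrow> complex" where
  "L2_inner M f g = (LINT x|M. cnj (f x) * g x)"

definition L2_norm :: "'a measure \<Rightarrow> ('a \<Rightarrow> complex) \<Rightarrow> real" where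
  "L2_norm M f = sqrt (LINT x|M. (cmod (f x))\<^sup>2)"

type_synonym 'a graph = "(('a \<Rightarrow> complex) \<times> ('a \<Rightarrow> complex)) set"

text \<open>The graph of the operator with formal expression \<open>T\<close> on the domain \<open>D\<close>. That
  \<open>f\<close> and \<open>T f\<close> are square integrable is not built in; it is part of \<open>linear_operator\<close>.\<close>

definition graph_on :: "'a measure \<Rightarrow> ('a \<Rightarrow> complex) set \<Rightarrow>
    (('a \<Rightarrow> complex) \<Rightarrow> ('a \<Rightarrow> complex)) \<Rightarrow> 'a graph" where
  "graph_on M D T = {(f, h). f \<in> borel_measurable M \<and> h \<in> borel_measurable M \<and>
     (\<exists>\<psi>\<in>D. (AE x in M. f x = \<psi> x) \<and> (AE x in M. h x = T \<psi> x))}"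

definition linear_operator :: "'a measure \<Rightarrow> 'a graph \<Rightarrow> bool" where
  "linear_operator M A \<longleftrightarrow>
     A \<subseteq> L2 M \<times> L2 M \<and>
     (\<forall>(f, h)\<in>A. \<forall>f'\<in>L2 M. \<forall>h'\<in>L2 M.
        (AE x in M. f' x = f x) \<longrightarrow> (AE x in M. h' x = h x) \<longrightarrow> (f', h') \<in> A) \<and>
     (\<lambda>x. 0, \<lambda>x. 0) \<in> A \<and>
     (\<forall>(f, h)\<in>A. \<forall>(f', h')\<in>A. (\<lambda>x. f x + f' x, \<lambda>x. h x + h' x) \<in> A) \<and>
     (\<forall>c. \<forall>(f, h)\<in>A. (\<lambda>x. c * f x, \<lambda>x. c * h x) \<in> A) \<and>
     (\<forall>(f, h)\<in>A. \<forall>(f', h')\<in>A. (AE x in M. f x = f' x) \<longrightarrow> (AE x in M. h x = h' x))"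

definition densely_defined :: "'a measure \<Rightarrow> 'a graph \<Rightarrow> bool" where
  "densely_defined M A \<longleftrightarrow>
     (\<forall>f\<in>L2 M. \<forall>\<epsilon>>0. \<exists>g\<in>Domain A. L2_norm M (\<lambda>x. f x - g x) < \<epsilon>)"

definition op_closure :: "'a measure \<Rightarrow> 'a graph \<Rightarrow> 'a graph" where
  "op_closure M A = {(f, h). f \<in> L2 M \<and> h \<in> L2 M \<and>
     (\<exists>p q. (\<forall>n::nat. (p n, q n) \<in> A) \<and>
        (\<lambda>n. L2_norm M (\<lambda>x. p n x - f x)) \<longlonglongrightarrow> 0 \<and>
        (\<lambda>n. L2_norm M (\<lambda>x. q n x - h x)) \<longlonglongrightarrow> 0)}"

definition op_adjoint :: "'a measure \<Rightarrow> 'a graph \<Rightarrow> 'a graph" where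
  "op_adjoint M A = {(g, k). g \<in> L2 M \<and> k \<in> L2 M \<and>
     (\<forall>(f, h)\<in>A. L2_inner M g h = L2_inner M k f)}"

definition symmetric_operator :: "'a measure \<Rightarrow> 'a graph \<Rightarrow> bool" where
  "symmetric_operator M A \<longleftrightarrow>
     linear_operator M A \<and> densely_defined M A \<and> A \<subseteq> op_adjoint M A"

definition self_adjoint :: "'a measure \<Rightarrow> 'a graph \<Rightarrow> bool" where
  "self_adjoint M A \<longleftrightarrow>
     linear_operator M A \<and> densely_defined M A \<and> A = op_adjoint M A"

definition essentially_self_adjoint :: "'a measure \<Rightarrow> 'a graph \<Rightarrow> bool" where
  "essentially_self_adjoint M A \<longleftrightarrow>
     symmetric_operator M A \<and> self_adjoint M (op_closure M A)"

definition everywhere_bounded :: "'a measure \<Rightarrow> 'a graph \<Rightarrow> bool" where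
  "everywhere_bounded M R \<longleftrightarrow>
     linear_operator M R \<and> Domain R = L2 M \<and>
     (\<exists>C. \<forall>(f, h)\<in>R. L2_norm M h \<le> C * L2_norm M f)"

text \<open>The graph of \<open>A - z\<close>.\<close>

definition op_shift :: "'a measure \<Rightarrow> 'a graph \<Rightarrow> complex \<Rightarrow> 'a graph" where
  "op_shift M A z = {(f, k). k \<in> L2 M \<and>
     (\<exists>h. (f, h) \<in> A \<and> (AE x in M. k x = h x - z * f x))}"

text \<open>Since \<open>linear_operator\<close> demands single-valuedness, for an operator \<open>A\<close> the condition says that
  \<open>A - z\<close> is a bijection from the domain of \<open>A\<close> onto the whole space with bounded inverse.\<close>

definition resolvent_set :: "'a measure \<Rightarrow> 'a graph \<Rightarrow> complex set" where
  "resolvent_set M A = {z. everywhere_bounded M ((op_shift M A z)\<inverse>)}"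

definition op_spectrum :: "'a measure \<Rightarrow> 'a graph \<Rightarrow> complex set" where
  "op_spectrum M A = - resolvent_set M A"


section \<open>Schwartz functions on the plane\<close>

definition partial_s :: "(real \<times> real \<Rightarrow> complex) \<Rightarrow> real \<times> real \<Rightarrow> complex" where
  "partial_s \<psi> = (\<lambda>(s, u). vector_derivative (\<lambda>t. \<psi> (t, u)) (at s))"

definition partial_u :: "(real \<times> real \<Rightarrow> complex) \<Rightarrow> real \<times> real \<Rightarrow> complex" where
  "partial_u \<psi> = (\<lambda>(s, u). vector_derivative (\<lambda>t. \<psi> (s, t)) (at u))"

text \<open>Total differentiability of all the functions \<open>\<partial>\<^sub>s\<^sup>m \<partial>\<^sub>u\<^sup>n \<psi>\<close> makes them continuous and makes mixed
  partial derivatives commute, so the first condition is smoothness.\<close>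

definition schwartz :: "(real \<times> real \<Rightarrow> complex) set" where
  "schwartz = {\<psi>.
     (\<forall>m n. (partial_s ^^ m) ((partial_u ^^ n) \<psi>) differentiable_on UNIV) \<and>
     (\<forall>j k m n. \<exists>C. \<forall>s u.
        \<bar>s\<bar> ^ j * \<bar>u\<bar> ^ k * cmod ((partial_s ^^ m) ((partial_u ^^ n) \<psi>) (s, u)) \<le> C)}"


section \<open>The Stark operator in the strip\<close>

text \<open>\<open>LBINT t=0..s\<close> is the oriented integral, so the functions are also correct for \<open>s < 0\<close>.\<close>

definition angle :: "(real \<Rightarrow> real) \<Rightarrow> real \<Rightarrow> real" where
  "angle \<gamma> s = - (LBINT t=0..s. \<gamma> t)"

definition curve_a :: "(real \<Rightarrow> real) \<Rightarrow> real \<Rightarrow> real" where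
  "curve_a \<gamma> s = (LBINT t=0..s. cos (angle \<gamma> t))"

definition curve_b :: "(real \<Rightarrow> real) \<Rightarrow> real \<Rightarrow> real" where
  "curve_b \<gamma> s = (LBINT t=0..s. sin (angle \<gamma> t))"

definition strip :: "real \<Rightarrow> (real \<times> real) set" where
  "strip d = UNIV \<times> {0<..<d}"

definition strip_map :: "(real \<Rightarrow> real) \<Rightarrow> real \<times> real \<Rightarrow> real \<times> real" where
  "strip_map \<gamma> = (\<lambda>(s, u).
     (curve_a \<gamma> s - u * deriv (curve_b \<gamma>) s, curve_b \<gamma> s + u * deriv (curve_a \<gamma>) s))"

definition strip_measure :: "real \<Rightarrow> (real \<times> real) measure" where
  "strip_measure d = restrict_space lborel (strip d)"

definition metric_g :: "(real \<Rightarrow> real) \<Rightarrow> real \<times> real \<Rightarrow> real" where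
  "metric_g \<gamma> = (\<lambda>(s, u). 1 / (1 + u * \<gamma> s)\<^sup>2)"

definition T_s :: "(real \<Rightarrow> real) \<Rightarrow> (real \<times> real \<Rightarrow> complex) \<Rightarrow> real \<times> real \<Rightarrow> complex" where
  "T_s \<gamma> \<psi> = (\<lambda>x. - partial_s (\<lambda>y. of_real (metric_g \<gamma> y) * partial_s \<psi> y) x)"

definition T_u :: "(real \<times> real \<Rightarrow> complex) \<Rightarrow> real \<times> real \<Rightarrow> complex" where
  "T_u \<psi> = (\<lambda>x. - partial_u (partial_u \<psi>) x)"

definition H0 :: "(real \<Rightarrow> real) \<Rightarrow> (real \<times> real \<Rightarrow> complex) \<Rightarrow> real \<times> real \<Rightarrow> complex" where
  "H0 \<gamma> \<psi> = (\<lambda>x. T_s \<gamma> \<psi> x + T_u \<psi> x)"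

definition V0 :: "(real \<Rightarrow> real) \<Rightarrow> real \<times> real \<Rightarrow> real" where
  "V0 \<gamma> = (\<lambda>(s, u).
     - ((\<gamma> s)\<^sup>2 / (4 * (1 + u * \<gamma> s)\<^sup>2))
     + u * deriv (deriv \<gamma>) s / (2 * (1 + u * \<gamma> s) ^ 3)
     - 5 / 4 * (u\<^sup>2 * (deriv \<gamma> s)\<^sup>2 / (1 + u * \<gamma> s) ^ 4))"

definition W :: "(real \<Rightarrow> real) \<Rightarrow> real \<Rightarrow> real \<Rightarrow> real \<Rightarrow> real \<times> real \<Rightarrow> real" where
  "W \<gamma> s\<^sub>0 \<eta> F = (\<lambda>(s, u).
     if s < 0 then F * (cos \<eta> * s + sin \<eta> * u)
     else if s \<le> s\<^sub>0 then
       F * ((LBINT t=0..s. cos (\<eta> - angle \<gamma> t)) + sin (\<eta> - angle \<gamma> s) * u)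
     else
       F * (cos (\<eta> - angle \<gamma> s\<^sub>0) * (s - s\<^sub>0) + (LBINT t=0..s\<^sub>0. cos (\<eta> - angle \<gamma> t))
            + sin (\<eta> - angle \<gamma> s\<^sub>0) * u))"

definition stark_expr :: "(real \<Rightarrow> real) \<Rightarrow> real \<Rightarrow> real \<Rightarrow> real \<Rightarrow>
    (real \<times> real \<Rightarrow> complex) \<Rightarrow> real \<times> real \<Rightarrow> complex" where
  "stark_expr \<gamma> s\<^sub>0 \<eta> F \<psi> =
     (\<lambda>x. H0 \<gamma> \<psi> x + of_real (W \<gamma> s\<^sub>0 \<eta> F x) * \<psi> x + of_real (V0 \<gamma> x) * \<psi> x)"

definition dirichlet_schwartz :: "real \<Rightarrow> (real \<times> real \<Rightarrow> complex) set" where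
  "dirichlet_schwartz d = {\<psi> \<in> schwartz. \<forall>s. \<psi> (s, 0) = 0 \<and> \<psi> (s, d) = 0}"

text \<open>The functions of \<open>dirichlet_schwartz d\<close> live on the whole plane; almost-everywhere equality
  with respect to \<open>strip_measure d\<close> performs the restriction to the strip.\<close>

definition stark_operator ::
    "real \<Rightarrow> (real \<Rightarrow> real) \<Rightarrow> real \<Rightarrow> real \<Rightarrow> real \<Rightarrow> (real \<times> real) graph" where
  "stark_operator d \<gamma> s\<^sub>0 \<eta> F =
     graph_on (strip_measure d) (dirichlet_schwartz d) (stark_expr \<gamma> s\<^sub>0 \<eta> F)"

end

theory Submission
  imports Defs
begin

text \<open>
  Essential self-adjointness follows once the ranges of \<open>H - z\<close> and \<open>H - cnj z\<close> are dense for one non-real \<open>z\<close>.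
  For \<open>- C \<partial>\<^sub>s\<^sup>2 - \<partial>\<^sub>u\<^sup>2\<close> this is a separation of variables: Green's function in \<open>s\<close>, sine modes
  in \<open>u\<close>. Taking \<open>C\<close> above the metric coefficient \<open>g\<close>, a Kato-Rellich argument passes to
  \<open>- \<partial>\<^sub>s g \<partial>\<^sub>s - \<partial>\<^sub>u\<^sup>2\<close> plus a bounded potential. For the linearly growing potential one solves
  approximately with the potential cut off at distance \<open>2 R\<close> and multiplies the solution by a cutoff function;
  the commutator is \<open>O(1 / \<surd>R)\<close>. Density of ranges gives self-adjointness and real spectrum.
  Conversely, on the straight half of the strip \<open>s < 0\<close> the operator is \<open>- \<Delta> + b s + c u\<close> with \<open>b > 0\<close>,
  and products of WKB quasimodes localised around \<open>s = - L\<close>, \<open>L \<longrightarrow> \<infinity>\<close>, show that every real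
  number is an approximate eigenvalue.
\<close>

section \<open>The space of square integrable functions\<close>

text \<open>The operator domain consists of Schwartz functions, while the coefficients are only as
  regular as \<open>\<gamma>''\<close>, so an exact solution of (H - z) \<psi> = f need not lie in
  the domain. Every solvability statement is therefore a density statement: (H - z) \<psi> comes
  arbitrarily close to f for \<psi> in a small explicit space, finite sums of tensor products of
  test functions that vanish for u = 0 and u = d. Density passes through perturbations and cutoffs,
  and symmetry turns it into exact statements about the closure by means of |Im z| ||\<psi>|| \<le>
  ||(H - z) \<psi>||. First-order terms and bounded potentials become small perturbations once z is
  far up or down the imaginary axis, and one returns to the given z at the end.

  Every real energy \<nu> is reached because b s takes all values. The transverse energy E is first
  made as large as the accuracy of the transverse factor demands; the remaining \<nu> - E, however
  negative, is supplied by going further to the left, where the longitudinal momentum is large and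
  WKB errors are small.\<close>

lemma L2_measurable [measurable_dest]: "f \<in> L2 M \<Longrightarrow> f \<in> borel_measurable M"
  by (simp add: L2_def)

lemma L2_integrable_sq: "f \<in> L2 M \<Longrightarrow> integrable M (\<lambda>x. (cmod (f x))\<^sup>2)"
  by (simp add: L2_def)

lemma L2_dominated:
  assumes "f \<in> L2 M" "g \<in> borel_measurable M" "AE x in M. cmod (g x) \<le> cmod (f x)"
  shows "g \<in> L2 M"
proof -
  have "integrable M (\<lambda>x. (cmod (g x))\<^sup>2)"
    by (rule Bochner_Integration.integrable_bound[OF L2_integrable_sq[OF assms(1)]])
       (use assms in \<open>auto simp: power_mono\<close>)
  then show ?thesis using assms by (simp add: L2_def)
qed

lemma L2_zero [simp]: "(\<lambda>x. 0) \<in> L2 M"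
  by (simp add: L2_def)

lemma L2_scale: "f \<in> L2 M \<Longrightarrow> (\<lambda>x. c * f x) \<in> L2 M"
  by (auto simp: L2_def norm_mult power_mult_distrib)

lemma borel_measurable_cnj [measurable (raw)]:
  "f \<in> borel_measurable M \<Longrightarrow> (\<lambda>x. cnj (f x)) \<in> borel_measurable M"
  by (rule borel_measurable_continuous_on[of cnj]) (auto intro!: continuous_intros)

lemma L2_add:
  assumes [measurable]: "f \<in> L2 M" "g \<in> L2 M"
  shows "(\<lambda>x. f x + g x) \<in> L2 M"
proof -
  have "integrable M (\<lambda>x. (cmod (f x + g x))\<^sup>2)"
  proof (rule Bochner_Integration.integrable_bound)
    show "integrable M (\<lambda>x. 2 * (cmod (f x))\<^sup>2 + 2 * (cmod (g x))\<^sup>2)"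
      using assms by (auto simp: L2_def)
    have "(cmod (f x + g x))\<^sup>2 \<le> 2 * (cmod (f x))\<^sup>2 + 2 * (cmod (g x))\<^sup>2" for x
    proof -
      have "(cmod (f x + g x))\<^sup>2 \<le> (cmod (f x) + cmod (g x))\<^sup>2"
        by (simp add: norm_triangle_ineq power_mono)
      also have "\<dots> \<le> 2 * (cmod (f x))\<^sup>2 + 2 * (cmod (g x))\<^sup>2"
        using sum_squares_bound[of "cmod (f x)" "cmod (g x)"] by (simp add: power2_sum)
      finally show ?thesis .
    qed
    then show "AE x in M. norm ((cmod (f x + g x))\<^sup>2) \<le> norm (2 * (cmod (f x))\<^sup>2 + 2 * (cmod (g x))\<^sup>2)"
      by (intro AE_I2) (simp add: order_trans[OF _ abs_ge_self])
  qed measurable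
  then show ?thesis using assms by (simp add: L2_def)
qed

lemma L2_minus: "f \<in> L2 M \<Longrightarrow> (\<lambda>x. - f x) \<in> L2 M"
  using L2_scale[of f M "-1"] by simp

lemma L2_diff: "f \<in> L2 M \<Longrightarrow> g \<in> L2 M \<Longrightarrow> (\<lambda>x. f x - g x) \<in> L2 M"
  using L2_add[OF _ L2_minus, of f M g] by simp

lemma L2_sum: "(\<And>i. i \<in> I \<Longrightarrow> f i \<in> L2 M) \<Longrightarrow> (\<lambda>x. \<Sum>i\<in>I. f i x) \<in> L2 M"
  by (induction I rule: infinite_finite_induct) (auto intro: L2_add)

lemma L2_inner_integrable:
  assumes [measurable]: "f \<in> L2 M" "g \<in> L2 M"
  shows "integrable M (\<lambda>x. cnj (f x) * g x)"
proof (rule Bochner_Integration.integrable_bound)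
  show "integrable M (\<lambda>x. (cmod (f x))\<^sup>2 + (cmod (g x))\<^sup>2)"
    using assms by (auto simp: L2_def)
  have "cmod (f x) * cmod (g x) \<le> (cmod (f x))\<^sup>2 + (cmod (g x))\<^sup>2" for x
  proof -
    have "2 * (cmod (f x) * cmod (g x)) \<le> (cmod (f x))\<^sup>2 + (cmod (g x))\<^sup>2"
      using sum_squares_bound[of "cmod (f x)" "cmod (g x)"] by simp
    moreover have "0 \<le> cmod (f x) * cmod (g x)" by simp
    ultimately show ?thesis by linarith
  qed
  then show "AE x in M. norm (cnj (f x) * g x) \<le> norm ((cmod (f x))\<^sup>2 + (cmod (g x))\<^sup>2)"
    by (intro AE_I2) (simp add: norm_mult order_trans[OF _ abs_ge_self])
qed measurable

section \<open>Norm and inner product\<close>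

lemma L2_norm_nonneg [simp]: "0 \<le> L2_norm M f"
  by (simp add: L2_norm_def)

lemma L2_norm_zero [simp]: "L2_norm M (\<lambda>x. 0) = 0"
  by (simp add: L2_norm_def)

lemma L2_norm_sq: "(L2_norm M f)\<^sup>2 = (LINT x|M. (cmod (f x))\<^sup>2)"
  by (simp add: L2_norm_def)

lemma L2_norm_cong_AE:
  assumes "AE x in M. f x = g x" "f \<in> borel_measurable M" "g \<in> borel_measurable M"
  shows "L2_norm M f = L2_norm M g"
  unfolding L2_norm_def
  by (rule arg_cong[where f=sqrt], rule integral_cong_AE) (use assms in auto)

lemma L2_norm_mono:
  assumes "f \<in> L2 M" "g \<in> borel_measurable M" "AE x in M. cmod (g x) \<le> cmod (f x)"
  shows "L2_norm M g \<le> L2_norm M f"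
  unfolding L2_norm_def
  by (intro real_sqrt_le_mono integral_mono_AE)
     (use L2_dominated[OF assms] assms in \<open>auto simp: L2_def power_mono\<close>)

lemma L2_norm_scale: "L2_norm M (\<lambda>x. c * f x) = cmod c * L2_norm M f"
  by (simp add: L2_norm_def norm_mult power_mult_distrib real_sqrt_mult)

lemma L2_norm_minus: "L2_norm M (\<lambda>x. - f x) = L2_norm M f"
  by (simp add: L2_norm_def)

lemma L2_norm_minus_commute: "L2_norm M (\<lambda>x. f x - g x) = L2_norm M (\<lambda>x. g x - f x)"
  by (simp add: L2_norm_def norm_minus_commute)

lemma L2_norm_eq_0_iff:
  assumes "f \<in> L2 M" shows "L2_norm M f = 0 \<longleftrightarrow> (AE x in M. f x = 0)"
  unfolding L2_norm_def
  using integral_nonneg_eq_0_iff_AE[OF L2_integrable_sq[OF assms]] by auto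

lemma L2_inner_add_right:
  assumes "f \<in> L2 M" "g \<in> L2 M" "h \<in> L2 M"
  shows "L2_inner M f (\<lambda>x. g x + h x) = L2_inner M f g + L2_inner M f h"
  unfolding L2_inner_def
  using Bochner_Integration.integral_add[OF L2_inner_integrable[OF assms(1,2)] L2_inner_integrable[OF assms(1,3)]]
  by (simp add: algebra_simps)

lemma L2_inner_scale_right:
  "L2_inner M f (\<lambda>x. c * g x) = c * L2_inner M f g"
proof -
  have "(\<lambda>x. cnj (f x) * (c * g x)) = (\<lambda>x. c * (cnj (f x) * g x))"
    by (auto simp: algebra_simps)
  then show ?thesis unfolding L2_inner_def by simp
qed

lemma L2_inner_cnj: "L2_inner M g f = cnj (L2_inner M f g)"
proof -
  have "cnj (L2_inner M f g) = (LINT x|M. cnj (cnj (f x) * g x))"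
    unfolding L2_inner_def by (rule Bochner_Integration.integral_cnj[symmetric])
  then show ?thesis unfolding L2_inner_def by (simp add: mult.commute)
qed

lemma L2_inner_diff_right:
  assumes "f \<in> L2 M" "g \<in> L2 M" "h \<in> L2 M"
  shows "L2_inner M f (\<lambda>x. g x - h x) = L2_inner M f g - L2_inner M f h"
  using L2_inner_add_right[OF assms(1,2) L2_scale[OF assms(3), of "-1"]]
    L2_inner_scale_right[of M f "-1" h] by simp

lemma L2_inner_scale_left:
  "L2_inner M (\<lambda>x. c * f x) g = cnj c * L2_inner M f g"
  using L2_inner_scale_right[of M g c f] by (simp add: L2_inner_cnj[of M _ g])

lemma L2_inner_add_left:
  assumes "f \<in> L2 M" "g \<in> L2 M" "h \<in> L2 M"
  shows "L2_inner M (\<lambda>x. g x + h x) f = L2_inner M g f + L2_inner M h f"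
  using L2_inner_add_right[OF assms] by (simp add: L2_inner_cnj[of M _ f])

lemma L2_inner_diff_left:
  assumes "f \<in> L2 M" "g \<in> L2 M" "h \<in> L2 M"
  shows "L2_inner M (\<lambda>x. g x - h x) f = L2_inner M g f - L2_inner M h f"
  using L2_inner_diff_right[OF assms] by (simp add: L2_inner_cnj[of M _ f])

lemma L2_inner_self: "L2_inner M f f = of_real ((L2_norm M f)\<^sup>2)"
proof -
  have "L2_inner M f f = (LINT x|M. of_real ((cmod (f x))\<^sup>2))"
    unfolding L2_inner_def by (metis (no_types) complex_norm_square mult.commute)
  also have "\<dots> = of_real (LINT x|M. (cmod (f x))\<^sup>2)"
    by (rule integral_complex_of_real)
  finally show ?thesis by (simp add: L2_norm_sq)
qed

lemma L2_norm_add_sq: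
  assumes "f \<in> L2 M" "g \<in> L2 M"
  shows "(L2_norm M (\<lambda>x. f x + g x))\<^sup>2 = (L2_norm M f)\<^sup>2 + 2 * Re (L2_inner M f g) + (L2_norm M g)\<^sup>2"
proof -
  have "of_real ((L2_norm M (\<lambda>x. f x + g x))\<^sup>2) = L2_inner M f f + L2_inner M f g + (L2_inner M g f + L2_inner M g g)"
    using assms by (simp add: L2_inner_self[symmetric] L2_inner_add_left L2_inner_add_right L2_add del: of_real_power)
  then have "Re (of_real ((L2_norm M (\<lambda>x. f x + g x))\<^sup>2)) = Re (L2_inner M f f + L2_inner M f g + (L2_inner M g f + L2_inner M g g))"
    by simp
  then show ?thesis
    by (simp add: L2_inner_self L2_inner_cnj[of M g f] del: of_real_power)
qed

text \<open>With w the inner product of f and g, the number ||r f + cnj w g||^2 is a nonnegative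
  quadratic polynomial in the real parameter r; the factor \<open>cnj w\<close> makes its linear
  term the real number 2 r |w|^2.\<close>

lemma L2_cauchy_schwarz:
  assumes "f \<in> L2 M" "g \<in> L2 M"
  shows "cmod (L2_inner M f g) \<le> L2_norm M f * L2_norm M g"
proof -
  let ?A = "L2_norm M f" and ?B = "L2_norm M g" and ?w = "L2_inner M f g"
  have key: "0 \<le> (r * ?A)\<^sup>2 + 2 * r * (cmod ?w)\<^sup>2 + (cmod ?w * ?B)\<^sup>2" for r :: real
  proof -
    have "0 \<le> (L2_norm M (\<lambda>x. of_real r * f x + cnj ?w * g x))\<^sup>2" by simp
    also have "\<dots> = (r * ?A)\<^sup>2 + 2 * Re (of_real r * (cnj ?w * ?w)) + (cmod ?w * ?B)\<^sup>2"
      using assms by (subst L2_norm_add_sq)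
        (auto simp: L2_scale L2_norm_scale L2_inner_scale_left L2_inner_scale_right power_mult_distrib)
    also have "cnj ?w * ?w = of_real ((cmod ?w)\<^sup>2)"
      by (metis complex_norm_square mult.commute)
    finally show ?thesis by (simp flip: of_real_mult of_real_power)
  qed
  show ?thesis
  proof (cases "?w = 0")
    case False
    then have w: "cmod ?w > 0" by simp
    show ?thesis
    proof (cases "?A = 0")
      \<comment> \<open>Here the quadratic term vanishes, so the polynomial is affine with slope 2
        |w|^2 and becomes negative for sufficiently negative r.\<close>
      case True
      let ?q = "(cmod ?w)\<^sup>2"
      have q: "?q > 0" using w by simp
      define X where "X = ?q * ?B\<^sup>2"
      define r where "r = - (X + 1) / ?q"
      have "2 * r * ?q = - 2 * (X + 1)" using q by (simp add: r_def)
      then have "0 \<le> - 2 * (X + 1) + X"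
        using key[of r] True by (simp add: power_mult_distrib X_def)
      moreover have "X \<ge> 0" by (simp add: X_def)
      ultimately have False by (simp add: algebra_simps)
      then show ?thesis ..
    next
      case False
      then have A: "?A > 0" using L2_norm_nonneg[of M f] by linarith
      \<comment> \<open>The minimiser of the quadratic polynomial.\<close>
      let ?r = "- (cmod ?w)\<^sup>2 / ?A\<^sup>2"
      have "0 \<le> (?r * ?A)\<^sup>2 + 2 * ?r * (cmod ?w)\<^sup>2 + (cmod ?w * ?B)\<^sup>2" by (rule key)
      also have "\<dots> = (cmod ?w)\<^sup>2 * (?B\<^sup>2 - (cmod ?w)\<^sup>2 / ?A\<^sup>2)"
        using A by (simp add: field_simps power2_eq_square)
      finally have "0 \<le> ?B\<^sup>2 - (cmod ?w)\<^sup>2 / ?A\<^sup>2"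
        using w by (simp add: zero_le_mult_iff)
      then have "(cmod ?w)\<^sup>2 \<le> (?A * ?B)\<^sup>2"
        using A by (simp add: field_simps power_mult_distrib)
      then show ?thesis by (rule power2_le_imp_le) simp
    qed
  qed simp
qed

lemma L2_norm_triangle:
  assumes "f \<in> L2 M" "g \<in> L2 M"
  shows "L2_norm M (\<lambda>x. f x + g x) \<le> L2_norm M f + L2_norm M g"
proof (rule power2_le_imp_le)
  have "Re (L2_inner M f g) \<le> L2_norm M f * L2_norm M g"
    using complex_Re_le_cmod[of "L2_inner M f g"] L2_cauchy_schwarz[OF assms] by linarith
  then show "(L2_norm M (\<lambda>x. f x + g x))\<^sup>2 \<le> (L2_norm M f + L2_norm M g)\<^sup>2"
    by (simp add: L2_norm_add_sq[OF assms] power2_sum)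
qed simp

lemma L2_norm_triangle3:
  assumes "f \<in> L2 M" "g \<in> L2 M" "h \<in> L2 M"
  shows "L2_norm M (\<lambda>x. f x - h x) \<le> L2_norm M (\<lambda>x. f x - g x) + L2_norm M (\<lambda>x. g x - h x)"
  using L2_norm_triangle[OF L2_diff[OF assms(1,2)] L2_diff[OF assms(2,3)]] by simp

lemma L2_norm_diff_le:
  assumes "f \<in> L2 M" "g \<in> L2 M"
  shows "\<bar>L2_norm M f - L2_norm M g\<bar> \<le> L2_norm M (\<lambda>x. f x - g x)"
  using L2_norm_triangle[OF L2_diff[OF assms] assms(2)] L2_norm_triangle[OF L2_diff[OF assms(2,1)] assms(1)]
  by (simp add: L2_norm_minus_commute[of M f g])

section \<open>Dominated convergence and completeness\<close>

lemma L2_dominated_convergence: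
  assumes w: "w \<in> L2 M" and g: "g \<in> borel_measurable M"
    and f: "\<And>n. f n \<in> borel_measurable M" "\<And>n. AE x in M. cmod (f n x) \<le> cmod (w x)"
    and lim: "AE x in M. (\<lambda>n::nat. f n x) \<longlonglongrightarrow> g x"
  shows "g \<in> L2 M" "\<And>n. f n \<in> L2 M" "(\<lambda>n. L2_norm M (\<lambda>x. f n x - g x)) \<longlonglongrightarrow> 0"
proof -
  have dom: "AE x in M. \<forall>n. cmod (f n x) \<le> cmod (w x)"
    using f(2) by (simp add: AE_all_countable)
  have gw: "AE x in M. cmod (g x) \<le> cmod (w x)"
    using dom lim by eventually_elim (rule LIMSEQ_le_const2[OF tendsto_norm], auto)
  show "g \<in> L2 M" by (rule L2_dominated[OF w g gw])
  show fL: "f n \<in> L2 M" for n by (rule L2_dominated[OF w f])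
  note [measurable] = g f(1) L2_measurable[OF w]
  have "(\<lambda>n. LINT x|M. (cmod (f n x - g x))\<^sup>2) \<longlonglongrightarrow> (LINT x|M. 0)"
  \<comment> \<open>The functions and their limit are all bounded by |w|, so the squared differences
    are bounded by (2 |w|)^2.\<close>
  proof (rule integral_dominated_convergence[where w="\<lambda>x. 4 * (cmod (w x))\<^sup>2"])
    show "integrable M (\<lambda>x. 4 * (cmod (w x))\<^sup>2)" using L2_integrable_sq[OF w] by simp
    show "AE x in M. (\<lambda>n. (cmod (f n x - g x))\<^sup>2) \<longlonglongrightarrow> 0"
      using lim
    proof eventually_elim
      case (elim x)
      have "(\<lambda>n. (cmod (f n x - g x))\<^sup>2) \<longlonglongrightarrow> (cmod (g x - g x))\<^sup>2"
        by (intro tendsto_intros elim)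
      then show ?case by simp
    qed
    show "AE x in M. norm ((cmod (f n x - g x))\<^sup>2) \<le> 4 * (cmod (w x))\<^sup>2" for n
      using dom gw
    proof eventually_elim
      case (elim x)
      have "cmod (f n x - g x) \<le> 2 * cmod (w x)"
        using norm_triangle_ineq4[of "f n x" "g x"] elim by (smt (verit))
      then have "(cmod (f n x - g x))\<^sup>2 \<le> (2 * cmod (w x))\<^sup>2" by (intro power_mono) auto
      then show ?case by (simp add: power_mult_distrib)
    qed
  qed measurable
  then have "(\<lambda>n. sqrt (LINT x|M. (cmod (f n x - g x))\<^sup>2)) \<longlonglongrightarrow> sqrt 0"
    by (intro tendsto_real_sqrt) simp
  then show "(\<lambda>n. L2_norm M (\<lambda>x. f n x - g x)) \<longlonglongrightarrow> 0" by (simp add: L2_norm_def)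
qed

text \<open>Riesz-Fischer. Along a subsequence the increments have norms at most 2^(-k), so the sum
  of their absolute values has norm at most 2. Monotone convergence makes this sum a square
  integrable majorant, which gives convergence almost everywhere and, by domination, in norm. The
  Cauchy property carries the limit over to the whole sequence.\<close>

lemma L2_complete:
  assumes fL: "\<And>n::nat. f n \<in> L2 M"
    and cauchy: "\<And>e. e > 0 \<Longrightarrow> \<exists>N. \<forall>m\<ge>N. \<forall>n\<ge>N. L2_norm M (\<lambda>x. f m x - f n x) < e"
  shows "\<exists>g\<in>L2 M. (\<lambda>n. L2_norm M (\<lambda>x. f n x - g x)) \<longlonglongrightarrow> 0"
proof -
  have "\<exists>N. \<forall>m\<ge>N. \<forall>n\<ge>N. L2_norm M (\<lambda>x. f m x - f n x) < (1/2)^k" for k :: nat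
    by (rule cauchy) simp
  then obtain N where N: "\<And>k m n. m \<ge> N k \<Longrightarrow> n \<ge> N k \<Longrightarrow> L2_norm M (\<lambda>x. f m x - f n x) < (1/2)^k"
    by metis
  \<comment> \<open>Partial sums of \<open>N\<close> are monotone and dominate each
    \<open>N k\<close>, so they serve as subsequence indices.\<close>
  define r where "r k = (\<Sum>j\<le>k. N j)" for k
  have rN: "r k \<ge> N k" for k unfolding r_def by (rule member_le_sum) auto
  have rSuc: "r (Suc k) \<ge> r k" for k by (simp add: r_def)
  note [measurable] = L2_measurable[OF fL]
  define D where "D k x = f (r (Suc k)) x - f (r k) x" for k x
  have DL: "D k \<in> L2 M" for k unfolding D_def by (intro L2_diff fL)
  note [measurable] = L2_measurable[OF DL]
  have Dn: "L2_norm M (D k) \<le> (1/2)^k" for k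
    unfolding D_def by (rule less_imp_le, rule N) (use rN rSuc le_trans in blast)+
  define G where "G n x = (\<Sum>k<n. cmod (D k x))" for n x
  have G0: "G n x \<ge> 0" for n x by (simp add: G_def sum_nonneg)
  have aL: "(\<lambda>x. complex_of_real (cmod (D k x))) \<in> L2 M" for k
    by (rule L2_dominated[OF DL[of k]]) auto
  have an: "L2_norm M (\<lambda>x. complex_of_real (cmod (D k x))) = L2_norm M (D k)" for k
    by (simp add: L2_norm_def)
  have GL: "(\<lambda>x. complex_of_real (G n x)) \<in> L2 M" for n
    unfolding G_def using L2_sum[of "{..<n}", OF aL] by simp
  have Gn: "L2_norm M (\<lambda>x. complex_of_real (G n x)) \<le> (\<Sum>k<n. (1/2)^k)" for n
  proof (induction n)
    case (Suc n)
    have "L2_norm M (\<lambda>x. complex_of_real (G n x) + complex_of_real (cmod (D n x)))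
        \<le> L2_norm M (\<lambda>x. complex_of_real (G n x)) + L2_norm M (\<lambda>x. complex_of_real (cmod (D n x)))"
      by (rule L2_norm_triangle[OF GL aL])
    then show ?case using Suc Dn[of n] by (simp add: G_def an)
  qed (simp add: G_def)
  have geo: "(\<Sum>k<n. (1/2::real)^k) \<le> 2" for n
    by (subst geometric_sum) auto
  have Gn2: "(\<integral>\<^sup>+x. ennreal ((G n x)\<^sup>2) \<partial>M) \<le> 4" for n
  proof -
    have "integrable M (\<lambda>x. (G n x)\<^sup>2)" using L2_integrable_sq[OF GL[of n]] by simp
    then have "(\<integral>\<^sup>+x. ennreal ((G n x)\<^sup>2) \<partial>M) = ennreal (LINT x|M. (G n x)\<^sup>2)"
      by (rule nn_integral_eq_integral) simp
    also have "(LINT x|M. (G n x)\<^sup>2) = (L2_norm M (\<lambda>x. complex_of_real (G n x)))\<^sup>2"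
      by (simp add: L2_norm_sq)
    also have "ennreal \<dots> \<le> ennreal (2\<^sup>2)"
      by (intro ennreal_leI power_mono order_trans[OF Gn geo]) simp
    finally show ?thesis by simp
  qed
  have Gmono: "G m x \<le> G n x" if "m \<le> n" for m n x
    unfolding G_def by (rule sum_mono2) (use that in auto)
  have Gm[measurable]: "(\<lambda>x. G n x) \<in> borel_measurable M" for n
    unfolding G_def by measurable
  define S where "S x = (SUP n. ennreal ((G n x)\<^sup>2))" for x
  have Sm[measurable]: "S \<in> borel_measurable M" unfolding S_def by measurable
  have "(\<integral>\<^sup>+x. S x \<partial>M) = (SUP n. \<integral>\<^sup>+x. ennreal ((G n x)\<^sup>2) \<partial>M)"
    unfolding S_def
    by (rule nn_integral_monotone_convergence_SUP)
       (auto simp: incseq_def le_fun_def intro!: ennreal_leI power_mono Gmono G0)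
  also have "\<dots> \<le> 4" by (rule SUP_least) (rule Gn2)
  finally have S4: "(\<integral>\<^sup>+x. S x \<partial>M) \<le> 4" .
  then have "(\<integral>\<^sup>+x. S x \<partial>M) \<noteq> \<infinity>" by (auto simp: top_unique)
  then have Sfin: "AE x in M. S x \<noteq> \<infinity>" by (rule nn_integral_PInf_AE[OF Sm])
  have Gle: "(G n x)\<^sup>2 \<le> enn2real (S x)" if "S x \<noteq> \<infinity>" for n x
  proof -
    have "ennreal ((G n x)\<^sup>2) \<le> S x" unfolding S_def by (rule SUP_upper) simp
    then have "enn2real (ennreal ((G n x)\<^sup>2)) \<le> enn2real (S x)"
      using that by (intro enn2real_mono) (auto simp: less_top)
    then show ?thesis by simp
  qed
  \<comment> \<open>\<open>enn2real\<close> sends an infinite value to 0; hence \<open>w\<close>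
    dominates the partial sums only off the null set where \<open>S\<close> is infinite.\<close>
  define w where "w x = complex_of_real (sqrt (enn2real (S x)))" for x
  have wm: "w \<in> borel_measurable M"
    unfolding w_def
    by (rule measurable_compose[OF measurable_compose[OF borel_measurable_enn2real[OF Sm]
          borel_measurable_sqrt] borel_measurable_of_real])
  have wL: "w \<in> L2 M"
  proof -
    have "integrable M (\<lambda>x. enn2real (S x))"
    proof (rule integrableI_nonneg)
      have "(\<integral>\<^sup>+x. ennreal (enn2real (S x)) \<partial>M) \<le> (\<integral>\<^sup>+x. S x \<partial>M)"
        by (intro nn_integral_mono) (simp add: ennreal_enn2real_if)
      also have "\<dots> < \<infinity>" using S4 by (auto simp: less_top[symmetric] top_unique)
      finally show "(\<integral>\<^sup>+x. ennreal (enn2real (S x)) \<partial>M) < \<infinity>" .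
    qed auto
    moreover have "(cmod (w x))\<^sup>2 = enn2real (S x)" for x by (simp add: w_def)
    ultimately show ?thesis unfolding L2_def using wm by simp
  qed
  have bd: "AE x in M. \<forall>n. G n x \<le> cmod (w x)"
    using Sfin
  proof eventually_elim
    case (elim x)
    have "G n x \<le> sqrt (enn2real (S x))" for n
      using real_sqrt_le_mono[OF Gle[OF elim, of n]] G0[of n x] by simp
    then show ?case by (simp add: w_def)
  qed
  \<comment> \<open>Where the subsequence diverges \<open>lim\<close> is an arbitrary value; this
    happens on a null set only.\<close>
  define g where "g x = lim (\<lambda>n. f (r n) x)" for x
  have tel: "f (r n) x = f (r 0) x + (\<Sum>k<n. D k x)" for n x
    by (induction n) (simp_all add: D_def)
  have conv: "AE x in M. (\<lambda>n. f (r n) x) \<longlonglongrightarrow> g x"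
    using bd
  proof eventually_elim
    case (elim x)
    have "summable (\<lambda>k. cmod (D k x))"
      by (rule bounded_imp_summable[where B="cmod (w x)"])
         (use elim[rule_format, of "Suc _"] in \<open>auto simp: G_def lessThan_Suc_atMost\<close>)
    then have "summable (\<lambda>k. D k x)" by (rule summable_norm_cancel)
    then have "convergent (\<lambda>n. \<Sum>k<n. D k x)" by (simp add: summable_iff_convergent)
    then have "convergent (\<lambda>n. f (r n) x)"
      by (subst tel) (intro convergent_add convergent_const)
    then show ?case by (simp add: g_def convergent_LIMSEQ_iff)
  qed
  define w2 where "w2 x = complex_of_real (cmod (f (r 0) x)) + w x" for x
  have w2L: "w2 \<in> L2 M"
    unfolding w2_def by (intro L2_add wL L2_dominated[OF fL[of "r 0"]]) auto
  have dom: "AE x in M. cmod (f (r n) x) \<le> cmod (w2 x)" for n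
    using bd
  proof eventually_elim
    case (elim x)
    have "cmod (f (r n) x) \<le> cmod (f (r 0) x) + cmod (\<Sum>k<n. D k x)"
      unfolding tel[of n] by (rule norm_triangle_ineq)
    also have "cmod (\<Sum>k<n. D k x) \<le> G n x" unfolding G_def by (rule norm_sum)
    also have "G n x \<le> cmod (w x)" using elim by simp
    also have "cmod (f (r 0) x) + cmod (w x) = cmod (w2 x)"
    proof -
      have s: "sqrt (enn2real (S x)) \<ge> 0" by simp
      have "w2 x = complex_of_real (cmod (f (r 0) x) + sqrt (enn2real (S x)))"
        by (simp add: w2_def w_def)
      then have "cmod (w2 x) = \<bar>cmod (f (r 0) x) + sqrt (enn2real (S x))\<bar>"
        by (simp only: norm_of_real)
      then show ?thesis using s by (simp add: w_def)
    qed
    finally show ?case by simp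
  qed
  have gm: "g \<in> borel_measurable M" unfolding g_def by measurable
  have gL: "g \<in> L2 M" and sub: "(\<lambda>n. L2_norm M (\<lambda>x. f (r n) x - g x)) \<longlonglongrightarrow> 0"
    by (rule L2_dominated_convergence[OF w2L gm L2_measurable[OF fL] dom conv])+
  have "(\<lambda>n. L2_norm M (\<lambda>x. f n x - g x)) \<longlonglongrightarrow> 0"
  proof (rule LIMSEQ_I)
    fix e :: real assume e: "0 < e"
    obtain K where K: "(1/2)^K < e/2" using real_arch_pow_inv[of "e/2" "1/2"] e by auto
    have "eventually (\<lambda>k. L2_norm M (\<lambda>x. f (r k) x - g x) < e/2) sequentially"
      by (rule order_tendstoD(2)[OF sub]) (use e in simp)
    then obtain k where k: "k \<ge> K" "L2_norm M (\<lambda>x. f (r k) x - g x) < e/2"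
      unfolding eventually_sequentially by (meson le_trans nat_le_linear)
    have rk: "r k \<ge> N K"
    proof -
      have "r k \<ge> r K" using k(1) by (rule lift_Suc_mono_le[of r, OF rSuc])
      then show ?thesis using rN[of K] by linarith
    qed
    have "L2_norm M (\<lambda>x. f n x - g x) < e" if "n \<ge> N K" for n
      using L2_norm_triangle3[OF fL[of n] fL[of "r k"] gL] N[OF that rk] K k(2) by linarith
    then show "\<exists>no. \<forall>n\<ge>no. norm (L2_norm M (\<lambda>x. f n x - g x) - 0) < e" by auto
  qed
  with gL show ?thesis by blast
qed

section \<open>Graphs of operators\<close>

text \<open>Iterating the residual \<open>f - Q \<psi>\<close> makes it geometrically small, so no completeness is needed.\<close>

lemma dense_range_perturb:
  fixes P Q :: "('a \<Rightarrow> complex) \<Rightarrow> 'a \<Rightarrow> complex"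
  assumes zero: "(\<lambda>x. 0) \<in> D"
    and add: "\<And>\<phi> \<psi>. \<phi> \<in> D \<Longrightarrow> \<psi> \<in> D \<Longrightarrow> (\<lambda>x. \<phi> x + \<psi> x) \<in> D"
    and P: "\<And>\<psi>. \<psi> \<in> D \<Longrightarrow> P \<psi> \<in> L2 M" and Q: "\<And>\<psi>. \<psi> \<in> D \<Longrightarrow> Q \<psi> \<in> L2 M"
    and Qadd: "\<And>\<phi> \<psi>. \<phi> \<in> D \<Longrightarrow> \<psi> \<in> D \<Longrightarrow> AE x in M. Q (\<lambda>x. \<phi> x + \<psi> x) x = Q \<phi> x + Q \<psi> x"
    and bound: "\<And>\<psi>. \<psi> \<in> D \<Longrightarrow> L2_norm M (\<lambda>x. Q \<psi> x - P \<psi> x) \<le> \<theta> * L2_norm M (P \<psi>)"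
    and \<theta>: "0 \<le> \<theta>" "\<theta> < 1"
    and dense: "\<And>f \<epsilon>. f \<in> L2 M \<Longrightarrow> \<epsilon> > 0 \<Longrightarrow> \<exists>\<psi>\<in>D. L2_norm M (\<lambda>x. P \<psi> x - f x) < \<epsilon>"
    and f: "f \<in> L2 M" and \<epsilon>: "\<epsilon> > 0"
  shows "\<exists>\<psi>\<in>D. L2_norm M (\<lambda>x. Q \<psi> x - f x) < \<epsilon>"
proof -
  \<comment> \<open>The midpoint of \<theta> and 1 leaves room for the error of inverting
    \<open>P\<close> only approximately. With \<eta> = (1 - \<theta>) / 4 below, \<theta> + \<eta>
    (1 + \<theta>) is at most \<kappa>.\<close>
  define \<kappa> where "\<kappa> = (1 + \<theta>) / 2"
  have \<kappa>: "0 \<le> \<kappa>" "\<kappa> < 1" using \<theta> by (auto simp: \<kappa>_def)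
  have Q0: "AE x in M. Q (\<lambda>x. 0) x = 0" using Qadd[OF zero zero] by simp
  \<comment> \<open>A null function \<open>h\<close> admits no accuracy relative to its norm, so the
    zero function is taken there. Otherwise \<open>P \<psi> = h\<close> is solved up to \<eta> ||h||
    and the same \<psi> is used for \<open>Q\<close>.\<close>
  have step: "\<exists>\<psi>\<in>D. L2_norm M (\<lambda>x. Q \<psi> x - h x) \<le> \<kappa> * L2_norm M h" if h: "h \<in> L2 M" for h
  proof (cases "L2_norm M h = 0")
    case True
    have "AE x in M. h x = 0" using True L2_norm_eq_0_iff[OF h] by simp
    then have "AE x in M. Q (\<lambda>x. 0) x - h x = 0" using Q0 by eventually_elim simp
    then have "L2_norm M (\<lambda>x. Q (\<lambda>x. 0) x - h x) = 0"
      by (subst L2_norm_eq_0_iff[OF L2_diff[OF Q[OF zero] h]])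
    with zero True show ?thesis by force
  next
    case False
    then have pos: "L2_norm M h > 0" using L2_norm_nonneg[of M h] by linarith
    define \<eta> where "\<eta> = (1 - \<theta>) / 4"
    have \<eta>: "\<eta> > 0" using \<theta> by (simp add: \<eta>_def)
    obtain \<psi> where \<psi>: "\<psi> \<in> D" "L2_norm M (\<lambda>x. P \<psi> x - h x) < \<eta> * L2_norm M h"
      using dense[OF h, of "\<eta> * L2_norm M h"] \<eta> pos by auto
    have Pn: "L2_norm M (P \<psi>) \<le> (1 + \<eta>) * L2_norm M h"
      using L2_norm_diff_le[OF P[OF \<psi>(1)] h] \<psi>(2) by (simp add: algebra_simps)
    have "L2_norm M (\<lambda>x. Q \<psi> x - h x) \<le> L2_norm M (\<lambda>x. Q \<psi> x - P \<psi> x) + L2_norm M (\<lambda>x. P \<psi> x - h x)"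
      by (rule L2_norm_triangle3[OF Q[OF \<psi>(1)] P[OF \<psi>(1)] h])
    also have "\<dots> \<le> \<theta> * ((1 + \<eta>) * L2_norm M h) + \<eta> * L2_norm M h"
      using bound[OF \<psi>(1)] mult_left_mono[OF Pn \<theta>(1)] \<psi>(2) by linarith
    also have "\<dots> = (\<theta> + \<eta> * (1 + \<theta>)) * L2_norm M h" by (simp add: algebra_simps)
    also have "\<dots> \<le> \<kappa> * L2_norm M h"
    proof (rule mult_right_mono)
      have "\<eta> * (1 + \<theta>) \<le> \<eta> * 2" using \<eta> \<theta> by (intro mult_left_mono) auto
      then show "\<theta> + \<eta> * (1 + \<theta>) \<le> \<kappa>" by (simp add: \<eta>_def \<kappa>_def field_simps)
    qed simp
    finally show ?thesis using \<psi>(1) by blast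
  qed
  \<comment> \<open>The residual f - Q \<psi> becomes the next right-hand side, and additivity of
    \<open>Q\<close> adds up the corrections.\<close>
  have iter: "\<exists>\<psi>\<in>D. L2_norm M (\<lambda>x. Q \<psi> x - f x) \<le> \<kappa> ^ n * L2_norm M f" for n
  proof (induction n)
    case 0
    have "L2_norm M (\<lambda>x. Q (\<lambda>x. 0) x - f x) = L2_norm M (\<lambda>x. - f x)"
      by (rule L2_norm_cong_AE) (use Q0 L2_measurable[OF L2_diff[OF Q[OF zero] f]] L2_measurable[OF L2_minus[OF f]] in auto)
    then have "L2_norm M (\<lambda>x. Q (\<lambda>x. 0) x - f x) \<le> \<kappa> ^ 0 * L2_norm M f" by (simp add: L2_norm_minus)
    with zero show ?case by blast
  next
    case (Suc n)
    then obtain \<psi> where \<psi>: "\<psi> \<in> D" "L2_norm M (\<lambda>x. Q \<psi> x - f x) \<le> \<kappa> ^ n * L2_norm M f" by blast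
    let ?h = "\<lambda>x. f x - Q \<psi> x"
    have h: "?h \<in> L2 M" by (rule L2_diff[OF f Q[OF \<psi>(1)]])
    obtain \<phi> where \<phi>: "\<phi> \<in> D" "L2_norm M (\<lambda>x. Q \<phi> x - ?h x) \<le> \<kappa> * L2_norm M ?h"
      using step[OF h] by blast
    have "L2_norm M (\<lambda>x. Q (\<lambda>x. \<phi> x + \<psi> x) x - f x) = L2_norm M (\<lambda>x. Q \<phi> x - ?h x)"
      by (rule L2_norm_cong_AE)
        (use Qadd[OF \<phi>(1) \<psi>(1)] L2_measurable[OF L2_diff[OF Q[OF add[OF \<phi>(1) \<psi>(1)]] f]]
          L2_measurable[OF L2_diff[OF Q[OF \<phi>(1)] h]] in \<open>auto simp: algebra_simps\<close>)
    also have "\<dots> \<le> \<kappa> * (\<kappa> ^ n * L2_norm M f)"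
      using \<phi>(2) mult_left_mono[OF \<psi>(2) \<kappa>(1)] by (simp add: L2_norm_minus_commute[of M f])
    finally show ?case using add[OF \<phi>(1) \<psi>(1)] by (auto simp: mult.assoc)
  qed
  have "(\<lambda>n. \<kappa> ^ n * L2_norm M f) \<longlonglongrightarrow> 0 * L2_norm M f"
    using \<kappa> by (intro tendsto_intros LIMSEQ_power_zero) auto
  then have "eventually (\<lambda>n. \<kappa> ^ n * L2_norm M f < \<epsilon>) sequentially"
    using order_tendstoD(2) \<epsilon> by (metis mult_zero_left)
  then obtain n where "\<kappa> ^ n * L2_norm M f < \<epsilon>"
    using eventually_happens trivial_limit_sequentially by blast
  then show ?thesis using iter[of n] by force
qed

section \<open>Adjoint and closure of symmetric operators\<close>

lemma symmetric_operator_inner: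
  assumes "symmetric_operator M A" "(f, h) \<in> A" "(g, k) \<in> A"
  shows "L2_inner M g h = L2_inner M k f"
  using assms unfolding symmetric_operator_def op_adjoint_def by blast

lemma linear_operator_add:
  "linear_operator M A \<Longrightarrow> (f, h) \<in> A \<Longrightarrow> (f', h') \<in> A \<Longrightarrow> (\<lambda>x. f x + f' x, \<lambda>x. h x + h' x) \<in> A"
  unfolding linear_operator_def by blast

lemma linear_operator_scale:
  "linear_operator M A \<Longrightarrow> (f, h) \<in> A \<Longrightarrow> (\<lambda>x. c * f x, \<lambda>x. c * h x) \<in> A"
  unfolding linear_operator_def by blast

lemma linear_operator_diff:
  assumes "linear_operator M A" "(f, h) \<in> A" "(f', h') \<in> A"
  shows "(\<lambda>x. f x - f' x, \<lambda>x. h x - h' x) \<in> A"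
  using linear_operator_add[OF assms(1,2) linear_operator_scale[OF assms(1,3), of "-1"]] by simp

lemma linear_operator_cong:
  "linear_operator M A \<Longrightarrow> (f, h) \<in> A \<Longrightarrow> f' \<in> L2 M \<Longrightarrow> h' \<in> L2 M \<Longrightarrow>
    AE x in M. f' x = f x \<Longrightarrow> AE x in M. h' x = h x \<Longrightarrow> (f', h') \<in> A"
  unfolding linear_operator_def by blast

lemma linear_operator_unique:
  "linear_operator M A \<Longrightarrow> (f, h) \<in> A \<Longrightarrow> (f', h') \<in> A \<Longrightarrow>
    AE x in M. f x = f' x \<Longrightarrow> AE x in M. h x = h' x"
  unfolding linear_operator_def by blast

lemma L2_inner_tendsto_right:
  assumes g: "g \<in> L2 M" and f: "\<And>n. f n \<in> L2 M" "h \<in> L2 M"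
    and lim: "(\<lambda>n. L2_norm M (\<lambda>x. f n x - h x)) \<longlonglongrightarrow> 0"
  shows "(\<lambda>n. L2_inner M g (f n)) \<longlonglongrightarrow> L2_inner M g h"
proof -
  have "(\<lambda>n. L2_inner M g (f n) - L2_inner M g h) \<longlonglongrightarrow> 0"
  proof (rule Lim_null_comparison)
    show "\<forall>\<^sub>F n in sequentially. cmod (L2_inner M g (f n) - L2_inner M g h)
        \<le> L2_norm M g * L2_norm M (\<lambda>x. f n x - h x)"
      using L2_cauchy_schwarz[OF g L2_diff[OF f]] by (simp add: L2_inner_diff_right[OF g f])
    show "(\<lambda>n. L2_norm M g * L2_norm M (\<lambda>x. f n x - h x)) \<longlonglongrightarrow> 0"
      using tendsto_mult_left[OF lim, of "L2_norm M g"] by simp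
  qed
  then show ?thesis by (simp add: LIM_zero_iff)
qed

text \<open>For g in S, ||h||^2 equals the inner product of h with h - g, which is at most ||h|| ||h
  - g|| and hence arbitrarily small.\<close>

lemma L2_dense_orthogonal:
  assumes dense: "\<And>f \<epsilon>. f \<in> L2 M \<Longrightarrow> \<epsilon> > 0 \<Longrightarrow> \<exists>g\<in>S. L2_norm M (\<lambda>x. f x - g x) < \<epsilon>"
    and S: "S \<subseteq> L2 M" and h: "h \<in> L2 M" and orth: "\<And>g. g \<in> S \<Longrightarrow> L2_inner M h g = 0"
  shows "AE x in M. h x = 0"
proof -
  have "(L2_norm M h)\<^sup>2 \<le> 0 + \<epsilon>" if \<epsilon>: "\<epsilon> > 0" for \<epsilon>
  proof -
    define \<delta> where "\<delta> = \<epsilon> / (L2_norm M h + 1)"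
    have \<delta>: "\<delta> > 0" using \<epsilon> by (auto simp: \<delta>_def intro!: divide_pos_pos add_nonneg_pos)
    obtain g where g: "g \<in> S" "L2_norm M (\<lambda>x. h x - g x) < \<delta>" using dense[OF h \<delta>] by blast
    have gL: "g \<in> L2 M" using g(1) S by blast
    have "of_real ((L2_norm M h)\<^sup>2) = L2_inner M h (\<lambda>x. h x - g x)"
      using orth[OF g(1)] by (simp add: L2_inner_diff_right[OF h h gL] L2_inner_self)
    then have "(L2_norm M h)\<^sup>2 = cmod (L2_inner M h (\<lambda>x. h x - g x))"
      by (metis abs_of_nonneg norm_of_real zero_le_power2)
    also have "\<dots> \<le> L2_norm M h * L2_norm M (\<lambda>x. h x - g x)"
      by (rule L2_cauchy_schwarz[OF h L2_diff[OF h gL]])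
    also have "\<dots> \<le> (L2_norm M h + 1) * \<delta>" using g(2) by (intro mult_mono) auto
    also have "\<dots> = \<epsilon>"
    proof -
      have "L2_norm M h + 1 \<noteq> 0" using L2_norm_nonneg[of M h] by linarith
      then show ?thesis by (simp add: \<delta>_def)
    qed
    finally show ?thesis by simp
  qed
  then have "(L2_norm M h)\<^sup>2 \<le> 0" by (rule field_le_epsilon)
  then show ?thesis using L2_norm_eq_0_iff[OF h] by simp
qed

text \<open>Density of the domain is what makes the adjoint single-valued: two values at the same
  function differ by something orthogonal to \<open>Domain A\<close>. The other clauses pass through
  the defining identity.\<close>

lemma linear_operator_adjoint:
  assumes A: "A \<subseteq> L2 M \<times> L2 M" and dense: "densely_defined M A"
  shows "linear_operator M (op_adjoint M A)"
  unfolding linear_operator_def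
proof (intro conjI)
  show "op_adjoint M A \<subseteq> L2 M \<times> L2 M" by (auto simp: op_adjoint_def)
  have inner_cong: "L2_inner M f' g = L2_inner M f g"
    if "AE x in M. f' x = f x" "f' \<in> L2 M" "f \<in> L2 M" "g \<in> L2 M" for f f' g
    unfolding L2_inner_def
    by (rule integral_cong_AE)
       (use that L2_measurable[of _ M] in \<open>auto intro!: borel_measurable_times borel_measurable_cnj\<close>)
  show "\<forall>(f, h)\<in>op_adjoint M A. \<forall>f'\<in>L2 M. \<forall>h'\<in>L2 M.
      (AE x in M. f' x = f x) \<longrightarrow> (AE x in M. h' x = h x) \<longrightarrow> (f', h') \<in> op_adjoint M A"
  proof (clarify)
    fix f h f' h' assume *: "(f, h) \<in> op_adjoint M A" "f' \<in> L2 M" "h' \<in> L2 M"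
      "AE x in M. f' x = f x" "AE x in M. h' x = h x"
    have L: "f \<in> L2 M" "h \<in> L2 M" using *(1) by (auto simp: op_adjoint_def)
    have "L2_inner M f' q = L2_inner M h' p" if pq: "(p, q) \<in> A" for p q
    proof -
      have pqL: "p \<in> L2 M" "q \<in> L2 M" using A pq by auto
      have "L2_inner M f q = L2_inner M h p" using *(1) pq by (auto simp: op_adjoint_def)
      then show ?thesis
        using inner_cong[OF *(4,2) L(1) pqL(2)] inner_cong[OF *(5,3) L(2) pqL(1)] by simp
    qed
    then show "(f', h') \<in> op_adjoint M A" using * by (auto simp: op_adjoint_def)
  qed
  show "(\<lambda>x. 0, \<lambda>x. 0) \<in> op_adjoint M A" by (auto simp: op_adjoint_def L2_inner_def)
  show "\<forall>(f, h)\<in>op_adjoint M A. \<forall>(f', h')\<in>op_adjoint M A.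
      (\<lambda>x. f x + f' x, \<lambda>x. h x + h' x) \<in> op_adjoint M A"
  proof (clarify)
    fix f h f' h' assume *: "(f, h) \<in> op_adjoint M A" "(f', h') \<in> op_adjoint M A"
    have "L2_inner M (\<lambda>x. f x + f' x) q = L2_inner M (\<lambda>x. h x + h' x) p" if "(p, q) \<in> A" for p q
    proof -
      have pqL: "p \<in> L2 M" "q \<in> L2 M" using A that by auto
      have "L2_inner M f q = L2_inner M h p" "L2_inner M f' q = L2_inner M h' p"
        using * that by (auto simp: op_adjoint_def)
      then show ?thesis
        using * pqL by (simp add: L2_inner_add_left op_adjoint_def)
    qed
    then show "(\<lambda>x. f x + f' x, \<lambda>x. h x + h' x) \<in> op_adjoint M A"
      using * by (auto simp: op_adjoint_def L2_add)
  qed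
  show "\<forall>c. \<forall>(f, h)\<in>op_adjoint M A. (\<lambda>x. c * f x, \<lambda>x. c * h x) \<in> op_adjoint M A"
    by (auto simp: op_adjoint_def L2_scale L2_inner_scale_left)
  have "AE x in M. h x = h' x"
    if *: "(f, h) \<in> op_adjoint M A" "(f', h') \<in> op_adjoint M A"
      and eq: "AE x in M. f x = f' x" for f h f' h'
  proof -
    have L: "f \<in> L2 M" "h \<in> L2 M" "f' \<in> L2 M" "h' \<in> L2 M" using * by (auto simp: op_adjoint_def)
    have "L2_inner M (\<lambda>x. h x - h' x) p = 0" if "p \<in> Domain A" for p
    proof -
      obtain q where pq: "(p, q) \<in> A" using \<open>p \<in> Domain A\<close> by blast
      then have pqL: "p \<in> L2 M" "q \<in> L2 M" using A by auto
      have "L2_inner M h p = L2_inner M f q" "L2_inner M h' p = L2_inner M f' q"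
        using * pq by (auto simp: op_adjoint_def)
      then show ?thesis using inner_cong[OF eq L(1,3) pqL(2)] L pqL by (simp add: L2_inner_diff_left)
    qed
    then have "AE x in M. h x - h' x = 0"
      using dense A L
      by (intro L2_dense_orthogonal[where S="Domain A"]) (auto simp: densely_defined_def L2_diff)
    then show ?thesis by simp
  qed
  then show "\<forall>(f, h)\<in>op_adjoint M A. \<forall>(f', h')\<in>op_adjoint M A.
      (AE x in M. f x = f' x) \<longrightarrow> (AE x in M. h x = h' x)"
    by blast
qed

lemma op_closure_L2: "(f, h) \<in> op_closure M A \<Longrightarrow> f \<in> L2 M \<and> h \<in> L2 M"
  by (auto simp: op_closure_def)

lemma subset_op_closure:
  assumes "A \<subseteq> L2 M \<times> L2 M" shows "A \<subseteq> op_closure M A"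
proof (rule subrelI)
  fix f h assume "(f, h) \<in> A"
  with assms show "(f, h) \<in> op_closure M A"
    unfolding op_closure_def
    by (intro CollectI case_prodI conjI exI[of _ "\<lambda>n. f"] exI[of _ "\<lambda>n. h"]) auto
qed

text \<open>Both sides of the identity are continuous along the approximating graph elements, so an
  identity tested on A extends to the closure.\<close>

lemma op_closure_inner:
  assumes A: "A \<subseteq> L2 M \<times> L2 M" and fh: "(f, h) \<in> op_closure M A"
    and g: "g \<in> L2 M" "k \<in> L2 M" and eq: "\<And>p q. (p, q) \<in> A \<Longrightarrow> L2_inner M g q = L2_inner M k p"
  shows "L2_inner M g h = L2_inner M k f"
proof -
  obtain p q where pq: "\<And>n. (p n, q n) \<in> A" and lim: "(\<lambda>n. L2_norm M (\<lambda>x. p n x - f x)) \<longlonglongrightarrow> 0"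
      "(\<lambda>n. L2_norm M (\<lambda>x. q n x - h x)) \<longlonglongrightarrow> 0" and L: "f \<in> L2 M" "h \<in> L2 M"
    using fh by (auto simp: op_closure_def)
  have pqL: "p n \<in> L2 M" "q n \<in> L2 M" for n using A pq[of n] by auto
  have "(\<lambda>n. L2_inner M g (q n)) \<longlonglongrightarrow> L2_inner M g h"
    by (rule L2_inner_tendsto_right[OF g(1) pqL(2) L(2) lim(2)])
  moreover have "(\<lambda>n. L2_inner M g (q n)) = (\<lambda>n. L2_inner M k (p n))" using eq[OF pq] by auto
  moreover have "(\<lambda>n. L2_inner M k (p n)) \<longlonglongrightarrow> L2_inner M k f"
    by (rule L2_inner_tendsto_right[OF g(2) pqL(1) L(1) lim(1)])
  ultimately show ?thesis using LIMSEQ_unique by metis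
qed

lemma op_closure_subset_adjoint:
  assumes "symmetric_operator M A" shows "op_closure M A \<subseteq> op_adjoint M A"
proof clarify
  fix f h assume fh: "(f, h) \<in> op_closure M A"
  have A: "A \<subseteq> L2 M \<times> L2 M" using assms by (auto simp: symmetric_operator_def linear_operator_def)
  have "L2_inner M f q = L2_inner M h p" if "(p, q) \<in> A" for p q
  proof -
    have "L2_inner M p h = L2_inner M q f"
      by (rule op_closure_inner[OF A fh])
         (use that A assms in \<open>auto intro: symmetric_operator_inner\<close>)
    then show ?thesis by (metis L2_inner_cnj)
  qed
  then show "(f, h) \<in> op_adjoint M A" using op_closure_L2[OF fh] by (auto simp: op_adjoint_def)
qed

lemma op_closure_inner_sym:
  assumes "symmetric_operator M A" "(f, h) \<in> op_closure M A" "(g, k) \<in> op_closure M A"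
  shows "L2_inner M g h = L2_inner M k f"
proof (rule op_closure_inner[OF _ assms(2)])
  show "A \<subseteq> L2 M \<times> L2 M" using assms(1) by (auto simp: symmetric_operator_def linear_operator_def)
  show "g \<in> L2 M" "k \<in> L2 M" using op_closure_L2[OF assms(3)] by auto
  show "L2_inner M g q = L2_inner M k p" if "(p, q) \<in> A" for p q
    using op_closure_subset_adjoint[OF assms(1)] assms(3) that by (auto simp: op_adjoint_def)
qed

text \<open>Symmetry makes the inner product of p and q real. The imaginary part of the inner
  product of p with q - z p is then -(Im z) ||p||^2, and Cauchy-Schwarz bounds it.\<close>

lemma shift_lower_bound:
  assumes L: "p \<in> L2 M" "q \<in> L2 M" and sym: "L2_inner M p q = L2_inner M q p"
  shows "\<bar>Im z\<bar> * L2_norm M p \<le> L2_norm M (\<lambda>x. q x - z * p x)"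
proof (cases "L2_norm M p = 0")
  case False
  then have pos: "L2_norm M p > 0" using L2_norm_nonneg[of M p] by linarith
  have "Im (L2_inner M p q) = 0" using sym L2_inner_cnj[of M q p] by (simp add: complex_eq_iff)
  moreover have "L2_inner M p (\<lambda>x. q x - z * p x) = L2_inner M p q - z * of_real ((L2_norm M p)\<^sup>2)"
    by (simp add: L2_inner_diff_right L2_scale L L2_inner_scale_right L2_inner_self)
  ultimately have "Im (L2_inner M p (\<lambda>x. q x - z * p x)) = - Im z * (L2_norm M p)\<^sup>2"
    by (simp flip: of_real_power)
  then have "\<bar>Im z\<bar> * (L2_norm M p)\<^sup>2 = \<bar>Im (L2_inner M p (\<lambda>x. q x - z * p x))\<bar>"
    by (simp add: abs_mult)
  also have "\<dots> \<le> cmod (L2_inner M p (\<lambda>x. q x - z * p x))" by (rule abs_Im_le_cmod)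
  also have "\<dots> \<le> L2_norm M p * L2_norm M (\<lambda>x. q x - z * p x)"
    by (rule L2_cauchy_schwarz) (auto intro!: L L2_diff L2_scale)
  finally have "L2_norm M p * (\<bar>Im z\<bar> * L2_norm M p) \<le> L2_norm M p * L2_norm M (\<lambda>x. q x - z * p x)"
    by (simp add: power2_eq_square ac_simps)
  then show ?thesis using pos by simp
qed simp

definition dense_shift :: "'a measure \<Rightarrow> 'a graph \<Rightarrow> complex \<Rightarrow> bool" where
  "dense_shift M A z \<longleftrightarrow>
     (\<forall>f\<in>L2 M. \<forall>\<epsilon>>0. \<exists>(p, q)\<in>A. L2_norm M (\<lambda>x. q x - z * p x - f x) < \<epsilon>)"

lemma dense_shift_sequence:
  assumes "dense_shift M A z" "f \<in> L2 M"
  obtains p q where "\<And>n::nat. (p n, q n) \<in> A"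
    "\<And>n. L2_norm M (\<lambda>x. q n x - z * p n x - f x) < inverse (real (Suc n))"
proof -
  have "\<exists>p q. (p, q) \<in> A \<and> L2_norm M (\<lambda>x. q x - z * p x - f x) < inverse (real (Suc n))" for n
  proof -
    have "inverse (real (Suc n)) > 0" by simp
    then have "\<exists>(p, q)\<in>A. L2_norm M (\<lambda>x. q x - z * p x - f x) < inverse (real (Suc n))"
      using assms unfolding dense_shift_def by blast
    then show ?thesis by blast
  qed
  then show ?thesis using that by metis
qed

text \<open>For (g, k) in the adjoint, density at z gives (p n, q n) in A with q n - z p n close to
  k - z g. The remainder r n = g - p n solves the shifted adjoint equation with small right-hand
  side e n; density at \<open>cnj z\<close> yields ||r n|| \<le> ||e n|| / |Im z|. So the pairs
  converge to (g, k) in the graph norm, with the limit known beforehand.\<close>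

lemma adjoint_subset_closure:
  assumes sym: "symmetric_operator M A" and z: "Im z \<noteq> 0"
    and dense: "dense_shift M A z" "dense_shift M A (cnj z)"
  shows "op_adjoint M A \<subseteq> op_closure M A"
proof clarify
  fix g k assume gk: "(g, k) \<in> op_adjoint M A"
  have A: "A \<subseteq> L2 M \<times> L2 M" using sym by (auto simp: symmetric_operator_def linear_operator_def)
  have L: "g \<in> L2 M" "k \<in> L2 M" using gk by (auto simp: op_adjoint_def)
  let ?F = "\<lambda>x. k x - z * g x"
  have FL: "?F \<in> L2 M" by (intro L2_diff L2_scale L)
  obtain p q where pqA: "\<And>n. (p n, q n) \<in> A"
      and pq: "\<And>n. L2_norm M (\<lambda>x. q n x - z * p n x - ?F x) < inverse (real (Suc n))"
    using dense_shift_sequence[OF dense(1) FL] by blast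
  have pqL: "p n \<in> L2 M" "q n \<in> L2 M" for n using A pqA[of n] by auto
  define e where "e n x = ?F x - (q n x - z * p n x)" for n x
  have eL: "e n \<in> L2 M" for n unfolding e_def by (intro L2_diff L2_scale L pqL)
  have en: "L2_norm M (e n) < inverse (real (Suc n))" for n
    using pq[of n] unfolding e_def by (subst L2_norm_minus_commute) simp
  have e0: "(\<lambda>n. L2_norm M (e n)) \<longlonglongrightarrow> 0"
    by (rule tendsto_sandwich[OF _ _ tendsto_const LIMSEQ_inverse_real_of_nat])
       (use en in \<open>auto intro!: always_eventually less_imp_le\<close>)
  define r where "r n x = g x - p n x" for n x
  have rL: "r n \<in> L2 M" for n unfolding r_def by (intro L2_diff L pqL)
  have rb: "L2_norm M (r n) \<le> L2_norm M (e n) / \<bar>Im z\<bar>" for n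
  proof -
    let ?R = "L2_norm M (r n)" and ?E = "L2_norm M (e n)"
    \<comment> \<open>\<open>r n\<close> need not lie in the domain of A, so the lower bound cannot
      be applied to it. By duality it is tested against vectors (A - cnj z) \<phi> within \<delta>
      of \<open>r n\<close>, and the lower bound is applied to \<phi>; afterwards \<delta> tends to
      0.\<close>
    have key: "?R\<^sup>2 \<le> ?E * ((?R + \<delta>) / \<bar>Im z\<bar>) + ?R * \<delta>" if \<delta>: "\<delta> > 0" for \<delta>
    proof -
      obtain \<phi> \<omega> where \<phi>: "(\<phi>, \<omega>) \<in> A" "L2_norm M (\<lambda>x. \<omega> x - cnj z * \<phi> x - r n x) < \<delta>"
        using dense(2) rL[of n] \<delta> unfolding dense_shift_def by blast
      have \<phi>L: "\<phi> \<in> L2 M" "\<omega> \<in> L2 M" using A \<phi>(1) by auto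
      let ?y = "\<lambda>x. \<omega> x - cnj z * \<phi> x"
      have yL: "?y \<in> L2 M" by (intro L2_diff L2_scale \<phi>L)
      have 1: "L2_inner M (r n) ?y = L2_inner M (e n) \<phi>"
      proof -
        have "L2_inner M g \<omega> = L2_inner M k \<phi>" using gk \<phi>(1) by (auto simp: op_adjoint_def)
        moreover have "L2_inner M (p n) \<omega> = L2_inner M (q n) \<phi>"
          by (rule symmetric_operator_inner[OF sym \<phi>(1) pqA])
        moreover have "L2_inner M (r n) ?y
            = L2_inner M g \<omega> - cnj z * L2_inner M g \<phi> - (L2_inner M (p n) \<omega> - cnj z * L2_inner M (p n) \<phi>)"
          unfolding r_def
          by (simp add: L2_inner_diff_left L2_inner_diff_right L2_inner_scale_right L2_diff L2_scale L pqL \<phi>L)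
        moreover have "L2_inner M (e n) \<phi>
            = L2_inner M k \<phi> - cnj z * L2_inner M g \<phi> - (L2_inner M (q n) \<phi> - cnj z * L2_inner M (p n) \<phi>)"
          unfolding e_def
          by (simp add: L2_inner_diff_left L2_inner_scale_left L2_diff L2_scale L pqL \<phi>L)
        ultimately show ?thesis by simp
      qed
      have "\<bar>Im (cnj z)\<bar> * L2_norm M \<phi> \<le> L2_norm M ?y"
        by (rule shift_lower_bound[OF \<phi>L]) (rule symmetric_operator_inner[OF sym \<phi>(1) \<phi>(1)])
      moreover have "L2_norm M ?y \<le> ?R + \<delta>" using L2_norm_diff_le[OF yL rL[of n]] \<phi>(2) by linarith
      ultimately have \<phi>n: "L2_norm M \<phi> \<le> (?R + \<delta>) / \<bar>Im z\<bar>"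
        using z by (simp add: field_simps)
      have "L2_inner M (r n) (r n) = L2_inner M (e n) \<phi> - L2_inner M (r n) (\<lambda>x. ?y x - r n x)"
        by (simp add: L2_inner_diff_right[OF rL yL rL] 1)
      then have "?R\<^sup>2 = cmod (L2_inner M (e n) \<phi> - L2_inner M (r n) (\<lambda>x. ?y x - r n x))"
        unfolding L2_inner_self by (metis abs_of_nonneg norm_of_real zero_le_power2)
      also have "\<dots> \<le> cmod (L2_inner M (e n) \<phi>) + cmod (L2_inner M (r n) (\<lambda>x. ?y x - r n x))"
        by (rule norm_triangle_ineq4)
      also have "\<dots> \<le> ?E * L2_norm M \<phi> + ?R * L2_norm M (\<lambda>x. ?y x - r n x)"
        by (intro add_mono L2_cauchy_schwarz eL rL \<phi>L L2_diff yL)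
      also have "\<dots> \<le> ?E * ((?R + \<delta>) / \<bar>Im z\<bar>) + ?R * \<delta>"
        using \<phi>(2) by (intro add_mono mult_left_mono \<phi>n) auto
      finally show ?thesis .
    qed
    have "((\<lambda>\<delta>. ?E * ((?R + \<delta>) / \<bar>Im z\<bar>) + ?R * \<delta>) \<longlongrightarrow> ?E * ((?R + 0) / \<bar>Im z\<bar>) + ?R * 0) (at_right 0)"
      by (intro tendsto_intros) (use z in auto)
    then have "?R\<^sup>2 \<le> ?E * ((?R + 0) / \<bar>Im z\<bar>) + ?R * 0"
      by (rule tendsto_lowerbound) (use key in \<open>auto intro!: eventually_mono[OF eventually_at_right_less]\<close>)
    then have le: "?R * ?R \<le> ?R * (?E / \<bar>Im z\<bar>)" by (simp add: power2_eq_square ac_simps)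
    show ?thesis
    proof (cases "?R = 0")
      case True then show ?thesis by simp
    next
      case False
      then have "?R > 0" using L2_norm_nonneg[of M "r n"] by linarith
      with le show ?thesis by (simp del: times_divide_eq_right)
    qed
  qed
  have r0: "(\<lambda>n. L2_norm M (r n)) \<longlonglongrightarrow> 0"
  proof (rule tendsto_sandwich[OF _ _ tendsto_const])
    show "(\<lambda>n. L2_norm M (e n) / \<bar>Im z\<bar>) \<longlonglongrightarrow> 0"
      using tendsto_divide[OF e0 tendsto_const[of "\<bar>Im z\<bar>"]] z by simp
  qed (use rb in auto)
  have "(\<lambda>n. L2_norm M (\<lambda>x. q n x - k x)) \<longlonglongrightarrow> 0"
  proof (rule tendsto_sandwich[OF _ _ tendsto_const])
    have "L2_norm M (\<lambda>x. q n x - k x) \<le> L2_norm M (e n) + cmod z * L2_norm M (r n)" for n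
    proof -
      have "(\<lambda>x. k x - q n x) = (\<lambda>x. e n x + z * r n x)" by (auto simp: e_def r_def algebra_simps)
      then show ?thesis
        using L2_norm_triangle[OF eL[of n] L2_scale[OF rL[of n], of z]]
        by (simp add: L2_norm_scale L2_norm_minus_commute[of M "q n" k])
    qed
    then show "\<forall>\<^sub>F n in sequentially. L2_norm M (\<lambda>x. q n x - k x) \<le> L2_norm M (e n) + cmod z * L2_norm M (r n)"
      by simp
    show "(\<lambda>n. L2_norm M (e n) + cmod z * L2_norm M (r n)) \<longlonglongrightarrow> 0"
      using tendsto_add[OF e0 tendsto_mult_left[OF r0, of "cmod z"]] by simp
  qed auto
  moreover have "(\<lambda>n. L2_norm M (\<lambda>x. p n x - g x)) \<longlonglongrightarrow> 0"
    using r0 unfolding r_def by (simp add: L2_norm_minus_commute[of M g])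
  ultimately show "(g, k) \<in> op_closure M A"
    using pqA L by (auto simp: op_closure_def)
qed

text \<open>The two inclusions make the closure equal to the adjoint, from which it inherits
  single-valuedness. The adjoint of the closure is caught between the closure and the adjoint of
  A.\<close>

lemma essentially_self_adjointI:
  assumes sym: "symmetric_operator M A" and z: "Im z \<noteq> 0"
    and dense: "dense_shift M A z" "dense_shift M A (cnj z)"
  shows "essentially_self_adjoint M A"
proof -
  have A: "A \<subseteq> L2 M \<times> L2 M" and dA: "densely_defined M A"
    using sym by (auto simp: symmetric_operator_def linear_operator_def)
  have eq: "op_closure M A = op_adjoint M A"
    using op_closure_subset_adjoint[OF sym] adjoint_subset_closure[OF assms] by blast
  have lin: "linear_operator M (op_closure M A)"
    unfolding eq by (rule linear_operator_adjoint[OF A dA])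
  have "densely_defined M (op_closure M A)"
    using dA subset_op_closure[OF A] unfolding densely_defined_def by (meson Domain_mono subsetD)
  moreover have "op_closure M A \<subseteq> op_adjoint M (op_closure M A)"
  proof clarify
    fix f h assume "(f, h) \<in> op_closure M A"
    then show "(f, h) \<in> op_adjoint M (op_closure M A)"
      using op_closure_inner_sym[OF sym] op_closure_L2[of f h M A] by (auto simp: op_adjoint_def)
  qed
  moreover have "op_adjoint M (op_closure M A) \<subseteq> op_adjoint M A"
    using subset_op_closure[OF A] by (auto simp: op_adjoint_def)
  ultimately show ?thesis
    using sym lin eq unfolding essentially_self_adjoint_def self_adjoint_def by blast
qed

text \<open>Injectivity and the bound 1 / |Im z| come from the lower bound. For surjectivity,
  approximate solutions p n of (A - z) p = f are Cauchy by the same bound, and here completeness of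
  the space supplies the limit.\<close>

lemma nonreal_in_resolvent_set:
  assumes sym: "symmetric_operator M A" and lin: "linear_operator M (op_closure M A)"
    and z: "Im z \<noteq> 0" and dense: "dense_shift M A z"
  shows "z \<in> resolvent_set M (op_closure M A)"
proof -
  let ?B = "op_closure M A" and ?R = "(op_shift M (op_closure M A) z)\<inverse>"
  have A: "A \<subseteq> L2 M \<times> L2 M" using sym by (auto simp: symmetric_operator_def linear_operator_def)
  have RD: "(k, f) \<in> ?R \<longleftrightarrow> k \<in> L2 M \<and> (\<exists>h. (f, h) \<in> ?B \<and> (AE x in M. k x = h x - z * f x))" for k f
    by (auto simp: op_shift_def)
  have Rcan: "\<exists>h. (f, h) \<in> ?B \<and> h = (\<lambda>x. k x + z * f x)" if kf: "(k, f) \<in> ?R" for k f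
  proof -
    obtain h where h: "k \<in> L2 M" "(f, h) \<in> ?B" "AE x in M. k x = h x - z * f x" using iffD1[OF RD kf] by blast
    have "(f, \<lambda>x. k x + z * f x) \<in> ?B"
      by (rule linear_operator_cong[OF lin h(2)])
         (use h op_closure_L2[OF h(2)] in \<open>auto intro: L2_add L2_scale\<close>)
    then show ?thesis by blast
  qed
  have RI: "(k, f) \<in> ?R" if "(f, \<lambda>x. k x + z * f x) \<in> ?B" "k \<in> L2 M" for k f
    by (rule iffD2[OF RD]) (use that in \<open>auto intro!: exI[of _ "\<lambda>x. k x + z * f x"]\<close>)
  \<comment> \<open>\<open>op_shift\<close> fixes its value only up to null sets; choosing the
    representative k + z f removes the existential quantifier.\<close>
  have RB: "(k, f) \<in> ?R \<longleftrightarrow> k \<in> L2 M \<and> (f, \<lambda>x. k x + z * f x) \<in> ?B" for k f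
    using Rcan[of k f] RI[of f k] RD[of k f] by blast
  have est: "\<bar>Im z\<bar> * L2_norm M f \<le> L2_norm M k" if "(k, f) \<in> ?R" for k f
  proof -
    have *: "(f, \<lambda>x. k x + z * f x) \<in> ?B" using iffD1[OF RB that] by blast
    show ?thesis
      using shift_lower_bound[of f M "\<lambda>x. k x + z * f x" z] op_closure_L2[OF *]
        op_closure_inner_sym[OF sym * *] by simp
  qed
  have linR: "linear_operator M ?R"
    unfolding linear_operator_def
  proof (intro conjI)
    show "?R \<subseteq> L2 M \<times> L2 M"
    proof (rule subrelI)
      fix k f assume "(k, f) \<in> ?R"
      then have "k \<in> L2 M \<and> (f, \<lambda>x. k x + z * f x) \<in> ?B" by (rule iffD1[OF RB])
      then show "(k, f) \<in> L2 M \<times> L2 M" using op_closure_L2 by blast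
    qed
    show "\<forall>(f, h)\<in>?R. \<forall>f'\<in>L2 M. \<forall>h'\<in>L2 M.
        (AE x in M. f' x = f x) \<longrightarrow> (AE x in M. h' x = h x) \<longrightarrow> (f', h') \<in> ?R"
    proof (clarify, goal_cases)
      case (1 k f k' f')
      have B: "(f, \<lambda>x. k x + z * f x) \<in> ?B" using iffD1[OF RB converseI[OF 1(1)]] by blast
      have "AE x in M. k' x + z * f' x = k x + z * f x" using 1(4,5) by eventually_elim simp
      then have "(f', \<lambda>x. k' x + z * f' x) \<in> ?B"
        using linear_operator_cong[OF lin B] 1 by (auto intro: L2_add L2_scale)
      then show ?case by (intro converseD[OF RI] 1(2))
    qed
    have "(\<lambda>x. 0, \<lambda>x. 0) \<in> ?B" using lin by (auto simp: linear_operator_def)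
    then show "(\<lambda>x. 0, \<lambda>x. 0) \<in> ?R" by (intro RI) auto
    show "\<forall>(f, h)\<in>?R. \<forall>(f', h')\<in>?R. (\<lambda>x. f x + f' x, \<lambda>x. h x + h' x) \<in> ?R"
    proof (clarify, goal_cases)
      case (1 k f k' f')
      have B: "(f, \<lambda>x. k x + z * f x) \<in> ?B" "(f', \<lambda>x. k' x + z * f' x) \<in> ?B" and L: "k \<in> L2 M" "k' \<in> L2 M"
        using iffD1[OF RB converseI[OF 1(1)]] iffD1[OF RB converseI[OF 1(2)]] by blast+
      show ?case
        using linear_operator_add[OF lin B] by (intro converseD[OF RI] L2_add L) (simp add: algebra_simps)
    qed
    show "\<forall>c. \<forall>(f, h)\<in>?R. (\<lambda>x. c * f x, \<lambda>x. c * h x) \<in> ?R"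
    proof (clarify, goal_cases)
      case (1 c k f)
      have B: "(f, \<lambda>x. k x + z * f x) \<in> ?B" and L: "k \<in> L2 M"
        using iffD1[OF RB converseI[OF 1(1)]] by blast+
      show ?case
        using linear_operator_scale[OF lin B, of c] by (intro converseD[OF RI] L2_scale L) (simp add: algebra_simps)
    qed
    have "AE x in M. f x = f' x"
      if kf: "(k, f) \<in> ?R" "(k', f') \<in> ?R" and eq: "AE x in M. k x = k' x" for k f k' f'
    proof -
      have B: "(f, \<lambda>x. k x + z * f x) \<in> ?B" "(f', \<lambda>x. k' x + z * f' x) \<in> ?B" and L: "k \<in> L2 M" "k' \<in> L2 M"
        using iffD1[OF RB kf(1)] iffD1[OF RB kf(2)] by blast+
      have fL: "(\<lambda>x. f x - f' x) \<in> L2 M" using B op_closure_L2 L2_diff by blast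
      have "(\<lambda>x. k x - k' x, \<lambda>x. f x - f' x) \<in> ?R"
        using linear_operator_diff[OF lin B] by (intro RI L2_diff L) (simp add: algebra_simps)
      then have "\<bar>Im z\<bar> * L2_norm M (\<lambda>x. f x - f' x) \<le> L2_norm M (\<lambda>x. k x - k' x)" by (rule est)
      moreover have "L2_norm M (\<lambda>x. k x - k' x) = 0"
        using eq by (subst L2_norm_eq_0_iff[OF L2_diff[OF L]]) simp
      ultimately have "L2_norm M (\<lambda>x. f x - f' x) = 0"
        using z L2_norm_nonneg[of M "\<lambda>x. f x - f' x"] by (simp add: mult_le_0_iff)
      then show ?thesis using L2_norm_eq_0_iff[OF fL] by simp
    qed
    then show "\<forall>(f, h)\<in>?R. \<forall>(f', h')\<in>?R. (AE x in M. f x = f' x) \<longrightarrow> (AE x in M. h x = h' x)"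
      by blast
  qed
  have "f \<in> Domain ?R" if f: "f \<in> L2 M" for f
  proof -
    obtain p q where pqA: "\<And>n. (p n, q n) \<in> A"
        and pq: "\<And>n. L2_norm M (\<lambda>x. q n x - z * p n x - f x) < inverse (real (Suc n))"
      using dense_shift_sequence[OF dense f] by blast
    have pqL: "p n \<in> L2 M" "q n \<in> L2 M" for n using A pqA[of n] by auto
    define y where "y n x = q n x - z * p n x" for n x
    have yL: "y n \<in> L2 M" for n unfolding y_def by (intro L2_diff L2_scale pqL)
    have yn: "L2_norm M (\<lambda>x. y n x - f x) < inverse (real (Suc n))" for n
      using pq[of n] unfolding y_def by simp
    have y0: "(\<lambda>n. L2_norm M (\<lambda>x. y n x - f x)) \<longlonglongrightarrow> 0"
      by (rule tendsto_sandwich[OF _ _ tendsto_const LIMSEQ_inverse_real_of_nat])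
         (use yn in \<open>auto intro!: always_eventually less_imp_le\<close>)
    \<comment> \<open>Differences of the pairs lie in A again, so the lower bound turns the Cauchy
      property of \<open>y\<close> into that of \<open>p\<close>.\<close>
    have "\<exists>g\<in>L2 M. (\<lambda>n. L2_norm M (\<lambda>x. p n x - g x)) \<longlonglongrightarrow> 0"
    proof (rule L2_complete[OF pqL(1)])
      fix e :: real assume e: "e > 0"
      then obtain N where N: "\<And>n. n \<ge> N \<Longrightarrow> L2_norm M (\<lambda>x. y n x - f x) < e * \<bar>Im z\<bar> / 2"
        using order_tendstoD(2)[OF y0, of "e * \<bar>Im z\<bar> / 2"] z by (auto simp: eventually_sequentially)
      show "\<exists>N. \<forall>m\<ge>N. \<forall>n\<ge>N. L2_norm M (\<lambda>x. p m x - p n x) < e"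
      proof (intro exI allI impI)
        fix m n assume mn: "m \<ge> N" "n \<ge> N"
        have dA: "(\<lambda>x. p m x - p n x, \<lambda>x. q m x - q n x) \<in> A"
          by (rule linear_operator_diff[of M, OF _ pqA pqA]) (use sym in \<open>simp add: symmetric_operator_def\<close>)
        have "\<bar>Im z\<bar> * L2_norm M (\<lambda>x. p m x - p n x)
            \<le> L2_norm M (\<lambda>x. (q m x - q n x) - z * (p m x - p n x))"
          by (rule shift_lower_bound) (auto intro!: L2_diff pqL symmetric_operator_inner[OF sym dA dA])
        also have "\<dots> = L2_norm M (\<lambda>x. y m x - y n x)" by (simp add: y_def algebra_simps)
        also have "\<dots> \<le> L2_norm M (\<lambda>x. y m x - f x) + L2_norm M (\<lambda>x. f x - y n x)"
          by (rule L2_norm_triangle3[OF yL f yL])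
        also have "\<dots> < e * \<bar>Im z\<bar>" using N[OF mn(1)] N[OF mn(2)] by (simp add: L2_norm_minus_commute[of M f])
        finally show "L2_norm M (\<lambda>x. p m x - p n x) < e" using z by simp
      qed
    qed
    then obtain g where g: "g \<in> L2 M" "(\<lambda>n. L2_norm M (\<lambda>x. p n x - g x)) \<longlonglongrightarrow> 0" by blast
    have "(\<lambda>n. L2_norm M (\<lambda>x. q n x - (f x + z * g x))) \<longlonglongrightarrow> 0"
    proof (rule tendsto_sandwich[OF _ _ tendsto_const])
      have "L2_norm M (\<lambda>x. q n x - (f x + z * g x)) \<le> L2_norm M (\<lambda>x. y n x - f x) + cmod z * L2_norm M (\<lambda>x. p n x - g x)" for n
      proof -
        have "(\<lambda>x. q n x - (f x + z * g x)) = (\<lambda>x. (y n x - f x) + z * (p n x - g x))"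
          by (auto simp: y_def algebra_simps)
        then show ?thesis
          using L2_norm_triangle[OF L2_diff[OF yL f] L2_scale[OF L2_diff[OF pqL(1) g(1)], of z]]
          by (simp add: L2_norm_scale)
      qed
      then show "\<forall>\<^sub>F n in sequentially. L2_norm M (\<lambda>x. q n x - (f x + z * g x))
          \<le> L2_norm M (\<lambda>x. y n x - f x) + cmod z * L2_norm M (\<lambda>x. p n x - g x)" by simp
      show "(\<lambda>n. L2_norm M (\<lambda>x. y n x - f x) + cmod z * L2_norm M (\<lambda>x. p n x - g x)) \<longlonglongrightarrow> 0"
        using tendsto_add[OF y0 tendsto_mult_left[OF g(2), of "cmod z"]] by simp
    qed auto
    then have "(g, \<lambda>x. f x + z * g x) \<in> ?B"
      using pqA g f by (auto simp: op_closure_def intro: L2_add L2_scale)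
    then have "(f, g) \<in> ?R" by (rule RI) (rule f)
    then show ?thesis by blast
  qed
  moreover have "Domain ?R \<subseteq> L2 M" using iffD1[OF RB] by blast
  moreover have "L2_norm M h \<le> 1 / \<bar>Im z\<bar> * L2_norm M f" if "(f, h) \<in> ?R" for f h
    using est[OF that] z by (simp add: field_simps)
  ultimately show ?thesis
    using linR unfolding resolvent_set_def everywhere_bounded_def by blast
qed

text \<open>A bounded inverse with constant C would force ||p|| \<le> C ||(A - z) p||, contradicting
  the approximation with \<epsilon> = 1 / (|C| + 1). The strict inequality in the hypothesis also
  excludes p of norm 0.\<close>

lemma approximate_eigenvalue_in_spectrum:
  assumes A: "A \<subseteq> L2 M \<times> L2 M"
    and weyl: "\<And>\<epsilon>. \<epsilon> > 0 \<Longrightarrow> \<exists>(p, q)\<in>A. L2_norm M (\<lambda>x. q x - z * p x) < \<epsilon> * L2_norm M p"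
  shows "z \<in> op_spectrum M (op_closure M A)"
proof (rule ccontr)
  assume "z \<notin> op_spectrum M (op_closure M A)"
  then have "everywhere_bounded M ((op_shift M (op_closure M A) z)\<inverse>)"
    by (simp add: op_spectrum_def resolvent_set_def)
  then obtain C where C: "\<And>k f. (f, k) \<in> op_shift M (op_closure M A) z \<Longrightarrow> L2_norm M f \<le> C * L2_norm M k"
    unfolding everywhere_bounded_def by blast
  obtain p q where pq: "(p, q) \<in> A"
      "L2_norm M (\<lambda>x. q x - z * p x) < 1 / (\<bar>C\<bar> + 1) * L2_norm M p"
  proof -
    have "\<exists>(p, q)\<in>A. L2_norm M (\<lambda>x. q x - z * p x) < 1 / (\<bar>C\<bar> + 1) * L2_norm M p"
      by (rule weyl) (simp add: add_nonneg_pos)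
    then show ?thesis using that by blast
  qed
  have L: "p \<in> L2 M" "q \<in> L2 M" using pq A by auto
  have "(p, \<lambda>x. q x - z * p x) \<in> op_shift M (op_closure M A) z"
    using pq(1) subset_op_closure[OF A] L by (auto simp: op_shift_def intro!: L2_diff L2_scale)
  then have "L2_norm M p \<le> C * L2_norm M (\<lambda>x. q x - z * p x)" by (rule C)
  also have "\<dots> \<le> (\<bar>C\<bar> + 1) * L2_norm M (\<lambda>x. q x - z * p x)" by (rule mult_right_mono) auto
  also have "\<dots> < (\<bar>C\<bar> + 1) * (1 / (\<bar>C\<bar> + 1) * L2_norm M p)"
    using pq(2) by (intro mult_strict_left_mono) auto
  also have "\<dots> = L2_norm M p"
  proof -
    have "\<bar>C\<bar> + 1 > 0" by simp
    then show ?thesis by (simp add: field_simps)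
  qed
  finally show False by simp
qed

section \<open>Test functions\<close>

definition dv :: "(real \<Rightarrow> complex) \<Rightarrow> real \<Rightarrow> complex" where
  "dv f x = vector_derivative f (at x)"

text \<open>\<open>Ck n\<close> asks for n-fold differentiability without continuity of the last
  derivative. Quantified over all n this is smoothness, and the weaker stages keep the inductions
  short.\<close>

primrec Ck :: "nat \<Rightarrow> (real \<Rightarrow> complex) \<Rightarrow> bool" where
  "Ck 0 f = True"
| "Ck (Suc n) f = ((\<forall>x. f differentiable (at x)) \<and> Ck n (dv f))"

definition smooth :: "(real \<Rightarrow> complex) \<Rightarrow> bool" where
  "smooth f \<longleftrightarrow> (\<forall>n. Ck n f)"

lemma dv_eqI: "(\<And>x. (f has_vector_derivative f' x) (at x)) \<Longrightarrow> dv f = f'"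
  by (auto simp: dv_def vector_derivative_at)

lemma CkI:
  assumes "\<And>x. (f has_vector_derivative f' x) (at x)" "Ck n f'"
  shows "Ck (Suc n) f"
  using assms by (auto simp: dv_eqI[OF assms(1)] intro: differentiableI_vector)

lemma Ck_SucD:
  assumes "Ck (Suc n) f"
  shows "(f has_vector_derivative dv f x) (at x)" "Ck n (dv f)"
  using assms by (auto simp: dv_def vector_derivative_works[symmetric])

lemma Ck_Suc_imp: "Ck (Suc n) f \<Longrightarrow> Ck n f"
  by (induction n arbitrary: f) auto

lemma Ck_const: "Ck n (\<lambda>x. c)"
proof (induction n arbitrary: c)
  case (Suc n)
  show ?case by (rule CkI[where f'="\<lambda>x. 0"]) (auto intro: Suc)
qed simp

lemma Ck_add: "Ck n f \<Longrightarrow> Ck n g \<Longrightarrow> Ck n (\<lambda>x. f x + g x)"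
proof (induction n arbitrary: f g)
  case (Suc n)
  show ?case
    by (rule CkI[where f'="\<lambda>x. dv f x + dv g x"])
       (intro has_vector_derivative_add Ck_SucD[OF Suc.prems(1)] Ck_SucD[OF Suc.prems(2)] Suc.IH)+
qed simp

lemma Ck_mult: "Ck n f \<Longrightarrow> Ck n g \<Longrightarrow> Ck n (\<lambda>x. f x * g x)"
proof (induction n arbitrary: f g)
  case (Suc n)
  show ?case
    by (rule CkI[where f'="\<lambda>x. f x * dv g x + dv f x * g x"])
       (intro has_vector_derivative_mult Ck_SucD[OF Suc.prems(1)] Ck_SucD[OF Suc.prems(2)] Suc.IH Ck_add
          Ck_Suc_imp[OF Suc.prems(1)] Ck_Suc_imp[OF Suc.prems(2)])+
qed simp

lemma has_vector_derivative_inverse_complex: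
  fixes f :: "real \<Rightarrow> complex"
  assumes "(f has_vector_derivative f') (at x)" "f x \<noteq> 0"
  shows "((\<lambda>x. inverse (f x)) has_vector_derivative - (f' * (inverse (f x) * inverse (f x)))) (at x)"
proof -
  have "(inverse has_field_derivative - (inverse (f x) * 1 * inverse (f x))) (at (f x))"
    by (rule DERIV_inverse'[OF DERIV_ident assms(2)])
  from field_vector_diff_chain_at[OF assms(1) this] show ?thesis
    by (simp add: o_def)
qed

lemma Ck_inverse: "(\<And>x. f x \<noteq> 0) \<Longrightarrow> Ck n f \<Longrightarrow> Ck n (\<lambda>x. inverse (f x))"
proof (induction n arbitrary: f)
  case (Suc n)
  have I: "Ck n (\<lambda>x. inverse (f x))" by (rule Suc.IH[OF Suc.prems(1) Ck_Suc_imp[OF Suc.prems(2)]])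
  show ?case
  proof (rule CkI[where f'="\<lambda>x. - (dv f x * (inverse (f x) * inverse (f x)))"])
    show "((\<lambda>x. inverse (f x)) has_vector_derivative - (dv f x * (inverse (f x) * inverse (f x)))) (at x)" for x
      by (rule has_vector_derivative_inverse_complex[OF Ck_SucD(1)[OF Suc.prems(2)] Suc.prems(1)])
    have "Ck n (\<lambda>x. (-1) * (dv f x * (inverse (f x) * inverse (f x))))"
      by (intro Ck_mult Ck_const I Ck_SucD[OF Suc.prems(2)])
    then show "Ck n (\<lambda>x. - (dv f x * (inverse (f x) * inverse (f x))))" by simp
  qed
qed simp

lemma has_vector_derivative_affine:
  fixes f :: "real \<Rightarrow> complex"
  assumes "(f has_vector_derivative f') (at (a * x + b))"
  shows "((\<lambda>x. f (a * x + b)) has_vector_derivative of_real a * f') (at x)"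
proof -
  have "((\<lambda>x. a * x + b) has_vector_derivative a) (at x)"
    by (auto intro!: derivative_eq_intros simp: has_real_derivative_iff_has_vector_derivative[symmetric])
  from vector_diff_chain_at[OF this assms] show ?thesis by (simp add: o_def scaleR_conv_of_real)
qed

lemma Ck_affine: "Ck n f \<Longrightarrow> Ck n (\<lambda>x. f (a * x + b))"
proof (induction n arbitrary: f)
  case (Suc n)
  show ?case
    by (rule CkI[where f'="\<lambda>x. of_real a * dv f (a * x + b)"])
       (intro has_vector_derivative_affine Ck_SucD[OF Suc.prems] Ck_mult Ck_const Suc.IH)+
qed simp

lemma smoothI:
  assumes "\<And>x. (f has_vector_derivative f' x) (at x)" "smooth f'"
  shows "smooth f"
  unfolding smooth_def
proof
  fix n show "Ck n f"
    by (cases n) (use CkI[OF assms(1)] assms(2) in \<open>auto simp: smooth_def\<close>)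
qed

lemma smooth_deriv:
  assumes "smooth f" shows "(f has_vector_derivative dv f x) (at x)" "smooth (dv f)"
  using Ck_SucD[of _ f] assms unfolding smooth_def by blast+

lemma smooth_const: "smooth (\<lambda>x. c)" by (simp add: smooth_def Ck_const)
lemma smooth_add: "smooth f \<Longrightarrow> smooth g \<Longrightarrow> smooth (\<lambda>x. f x + g x)" by (simp add: smooth_def Ck_add)
lemma smooth_mult: "smooth f \<Longrightarrow> smooth g \<Longrightarrow> smooth (\<lambda>x. f x * g x)" by (simp add: smooth_def Ck_mult)
lemma smooth_inverse: "(\<And>x. f x \<noteq> 0) \<Longrightarrow> smooth f \<Longrightarrow> smooth (\<lambda>x. inverse (f x))"
  by (simp add: smooth_def Ck_inverse)
lemma smooth_affine: "smooth f \<Longrightarrow> smooth (\<lambda>x. f (a * x + b))" by (simp add: smooth_def Ck_affine)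

lemma smooth_of_real_ident: "smooth (\<lambda>x. of_real x)"
proof (rule smoothI)
  show "((\<lambda>x. complex_of_real x) has_vector_derivative 1) (at x)" for x
    using has_vector_derivative_of_real[OF DERIV_ident[of "at x"]] by simp
qed (rule smooth_const)

lemma smooth_power: "smooth f \<Longrightarrow> smooth (\<lambda>x. f x ^ n)"
  by (induction n) (auto intro: smooth_const smooth_mult)

text \<open>Bootstrapping: if f is n times differentiable, so is f' = p f, hence f is n + 1 times
  differentiable. This gives smoothness of exponentials of phases without a chain rule of higher
  order.\<close>

lemma smooth_of_linear_ode1:
  assumes f: "\<And>x. (f has_vector_derivative p x * f x) (at x)" and p: "smooth p"
  shows "smooth f"
  unfolding smooth_def
proof
  fix n show "Ck n f"
  proof (induction n)
    case (Suc n)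
    show ?case by (rule CkI[OF f]) (use p Suc in \<open>auto simp: smooth_def intro: Ck_mult\<close>)
  qed simp
qed

lemma smooth_of_linear_ode2:
  assumes f: "\<And>x. (f has_vector_derivative f' x) (at x)"
    and f': "\<And>x. (f' has_vector_derivative c * f x + h x) (at x)" and h: "smooth h"
  shows "smooth f"
proof -
  have "Ck n f \<and> Ck n f'" for n
  proof (induction n)
    case (Suc n)
    have "Ck (Suc n) f'"
      by (rule CkI[OF f']) (use h Suc in \<open>auto simp: smooth_def intro!: Ck_mult Ck_add Ck_const\<close>)
    moreover have "Ck (Suc n) f" by (rule CkI[OF f]) (use Suc in auto)
    ultimately show ?case by blast
  qed simp
  then show ?thesis by (simp add: smooth_def)
qed

lemma smooth_continuous: "smooth f \<Longrightarrow> continuous_on S f"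
  using smooth_deriv(1)[of f] has_vector_derivative_continuous
  by (meson continuous_at_imp_continuous_on)

lemma dv_add: "smooth f \<Longrightarrow> smooth g \<Longrightarrow> dv (\<lambda>x. f x + g x) = (\<lambda>x. dv f x + dv g x)"
  by (rule dv_eqI) (intro has_vector_derivative_add smooth_deriv)

lemma dv_mult: "smooth f \<Longrightarrow> smooth g \<Longrightarrow> dv (\<lambda>x. f x * g x) = (\<lambda>x. f x * dv g x + dv f x * g x)"
  by (rule dv_eqI) (intro has_vector_derivative_mult smooth_deriv)

lemma dv_affine: "smooth f \<Longrightarrow> dv (\<lambda>x. f (a * x + b)) = (\<lambda>x. of_real a * dv f (a * x + b))"
  by (rule dv_eqI) (intro has_vector_derivative_affine smooth_deriv)

section \<open>Smooth steps and cutoff functions\<close>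

definition flat :: "real poly \<Rightarrow> real \<Rightarrow> real" where
  "flat p x = (if x > 0 then poly p (1 / x) * exp (- (1 / x)) else 0)"

lemma poly_mult_exp_tendsto_0: "((\<lambda>y::real. poly p y * exp (- y)) \<longlongrightarrow> 0) at_top"
proof -
  have "((\<lambda>y::real. \<Sum>i\<le>degree p. coeff p i * (y ^ i / exp y)) \<longlongrightarrow> (\<Sum>i\<le>degree p. coeff p i * 0)) at_top"
    by (intro tendsto_sum tendsto_mult_left tendsto_power_div_exp_0)
  moreover have "(\<lambda>y. poly p y * exp (- y)) = (\<lambda>y. \<Sum>i\<le>degree p. coeff p i * (y ^ i / exp y))"
    by (simp add: poly_altdef sum_distrib_right exp_minus divide_inverse mult.assoc)
  ultimately show ?thesis by simp
qed

text \<open>The polynomial parameter of \<open>flat\<close> makes the family closed under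
  differentiation: P(y) exp(-y) at y = 1/x has x-derivative y^2 (P(y) - P'(y)) exp(-y). At 0 the
  right difference quotient is y P(y) exp(-y) with y tending to infinity.\<close>

lemma flat_deriv: "(flat p has_real_derivative flat (monom 1 2 * (p - pderiv p)) x) (at x)"
proof -
  consider "x > 0" | "x < 0" | "x = 0" by linarith
  then show ?thesis
  proof cases
    case 1
    have "((\<lambda>x. poly p (1 / x) * exp (- (1 / x))) has_real_derivative
        (1/x)^2 * (poly p (1/x) - poly (pderiv p) (1/x)) * exp (- (1/x))) (at x)"
      using 1 by (auto intro!: derivative_eq_intros DERIV_chain'[OF _ poly_DERIV]
          simp: field_simps power2_eq_square)
    then have "((\<lambda>x. poly p (1 / x) * exp (- (1 / x))) has_real_derivative
        flat (monom 1 2 * (p - pderiv p)) x) (at x)"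
      using 1 by (simp add: flat_def poly_monom)
    then show ?thesis
      by (rule has_field_derivative_transform_within_open[where S="{0<..}"]) (use 1 in \<open>auto simp: flat_def\<close>)
  next
    case 2
    have "((\<lambda>x. 0) has_real_derivative flat (monom 1 2 * (p - pderiv p)) x) (at x)"
      using 2 by (simp add: flat_def)
    then show ?thesis
      by (rule has_field_derivative_transform_within_open[where S="{..<0}"]) (use 2 in \<open>auto simp: flat_def\<close>)
  next
    case 3
    have "((\<lambda>h. (flat p (0 + h) - flat p 0) / h) \<longlongrightarrow> 0) (at 0)"
    proof (rule filterlim_split_at)
      show "((\<lambda>h. (flat p (0 + h) - flat p 0) / h) \<longlongrightarrow> 0) (at_left 0)"
        by (rule Lim_transform_eventually[OF tendsto_const])
           (auto simp: flat_def eventually_at_filter)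
      have "((\<lambda>h. poly (monom 1 1 * p) (inverse h) * exp (- (inverse h))) \<longlongrightarrow> 0) (at_right (0::real))"
        by (rule filterlim_compose[OF poly_mult_exp_tendsto_0 filterlim_inverse_at_top_right])
      then show "((\<lambda>h. (flat p (0 + h) - flat p 0) / h) \<longlongrightarrow> 0) (at_right 0)"
        by (rule Lim_transform_eventually)
           (auto simp: flat_def eventually_at_filter poly_monom field_simps)
    qed
    then show ?thesis using 3 by (simp add: has_field_derivative_iff flat_def)
  qed
qed

lemma smooth_flat: "smooth (\<lambda>x. of_real (flat p x))"
proof -
  have "Ck n (\<lambda>x. of_real (flat p x))" for n
  proof (induction n arbitrary: p)
    case (Suc n)
    show ?case
      by (rule CkI[OF has_vector_derivative_of_real[OF flat_deriv] Suc])
  qed simp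
  then show ?thesis by (simp add: smooth_def)
qed

definition smooth_step :: "real \<Rightarrow> real" where
  "smooth_step x = flat 1 x / (flat 1 x + flat 1 (1 - x))"

lemma flat_1_nonneg: "flat 1 x \<ge> 0" "x > 0 \<Longrightarrow> flat 1 x > 0" "x \<le> 0 \<Longrightarrow> flat 1 x = 0"
  by (auto simp: flat_def)

text \<open>At least one of x and 1 - x is positive.\<close>

lemma smooth_step_denom: "flat 1 x + flat 1 (1 - x) > 0"
proof (cases "x > 0")
  case True
  then show ?thesis using flat_1_nonneg(2)[of x] flat_1_nonneg(1)[of "1 - x"] by linarith
next
  case False
  then show ?thesis using flat_1_nonneg(1)[of x] flat_1_nonneg(2)[of "1 - x"] by linarith
qed

lemma smooth_smooth_step: "smooth (\<lambda>x. of_real (smooth_step x))"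
proof -
  have a: "smooth (\<lambda>x. of_real (flat 1 x) + of_real (flat 1 ((-1) * x + 1)))"
    by (intro smooth_add smooth_flat smooth_affine[OF smooth_flat])
  have "smooth (\<lambda>x. of_real (flat 1 x) * inverse (of_real (flat 1 x) + of_real (flat 1 ((-1) * x + 1))))"
  proof (intro smooth_mult smooth_flat smooth_inverse a)
    show "complex_of_real (flat 1 x) + of_real (flat 1 ((-1) * x + 1)) \<noteq> 0" for x
      using smooth_step_denom[of x] by (simp flip: of_real_add)
  qed
  moreover have "(\<lambda>x. complex_of_real (flat 1 x) * inverse (of_real (flat 1 x) + of_real (flat 1 ((-1) * x + 1))))
     = (\<lambda>x. of_real (smooth_step x))"
    by (auto simp: smooth_step_def divide_inverse)
  ultimately show ?thesis by simp
qed

lemma smooth_step_range: "0 \<le> smooth_step x" "smooth_step x \<le> 1"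
  using smooth_step_denom[of x] flat_1_nonneg(1)[of x] flat_1_nonneg(1)[of "1 - x"]
  by (auto simp: smooth_step_def)

lemma smooth_step_0: "x \<le> 0 \<Longrightarrow> smooth_step x = 0"
  by (simp add: smooth_step_def flat_1_nonneg)

lemma smooth_step_1: "x \<ge> 1 \<Longrightarrow> smooth_step x = 1"
  using flat_1_nonneg(2)[of x] by (simp add: smooth_step_def flat_1_nonneg(3))

definition cutoff :: "real \<Rightarrow> complex" where
  "cutoff x = of_real (smooth_step (2 + x) * smooth_step (2 - x))"

definition test_fun :: "(real \<Rightarrow> complex) \<Rightarrow> bool" where
  "test_fun f \<longleftrightarrow> smooth f \<and> (\<exists>R. \<forall>x. \<bar>x\<bar> > R \<longrightarrow> f x = 0)"

lemma cutoff_eq_1: "\<bar>x\<bar> \<le> 1 \<Longrightarrow> cutoff x = 1"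
  by (simp add: cutoff_def smooth_step_1 abs_le_iff)

lemma cutoff_eq_0: "\<bar>x\<bar> \<ge> 2 \<Longrightarrow> cutoff x = 0"
  by (cases "x \<ge> 2") (auto simp: cutoff_def smooth_step_0)

lemma cutoff_norm: "cmod (cutoff x) \<le> 1"
  using smooth_step_range by (simp add: cutoff_def norm_mult mult_le_one del: of_real_mult)

lemma smooth_cutoff: "smooth cutoff"
proof -
  have "smooth (\<lambda>x. of_real (smooth_step (1 * x + 2)) * of_real (smooth_step ((-1) * x + 2)))"
    by (intro smooth_mult smooth_affine[OF smooth_smooth_step])
  moreover have "(\<lambda>x. complex_of_real (smooth_step (1 * x + 2)) * of_real (smooth_step ((-1) * x + 2))) = cutoff"
    by (auto simp: cutoff_def add.commute)
  ultimately show ?thesis by simp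
qed

lemma test_fun_cutoff: "test_fun cutoff"
  using smooth_cutoff cutoff_eq_0 unfolding test_fun_def by (metis less_imp_le)

lemma test_fun_smooth: "test_fun f \<Longrightarrow> smooth f"
  by (simp add: test_fun_def)

lemma test_fun_support: "test_fun f \<Longrightarrow> \<exists>R\<ge>B. \<forall>x. \<bar>x\<bar> > R \<longrightarrow> f x = 0"
proof -
  assume "test_fun f"
  then obtain R where "\<forall>x. \<bar>x\<bar> > R \<longrightarrow> f x = 0" by (auto simp: test_fun_def)
  then show ?thesis by (intro exI[of _ "max R B"]) auto
qed

lemma test_fun_mult: "test_fun f \<Longrightarrow> smooth g \<Longrightarrow> test_fun (\<lambda>x. f x * g x)"
  unfolding test_fun_def by (auto intro!: smooth_mult)

lemma test_fun_scale: "test_fun f \<Longrightarrow> test_fun (\<lambda>x. c * f x)"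
  unfolding test_fun_def by (auto intro!: smooth_mult smooth_const)

lemma test_fun_zero: "test_fun (\<lambda>x. 0)"
  unfolding test_fun_def by (auto intro: smooth_const)

lemma test_fun_affine: "test_fun f \<Longrightarrow> a \<noteq> 0 \<Longrightarrow> test_fun (\<lambda>x. f (a * x + b))"
proof -
  assume f: "test_fun f" and a: "a \<noteq> 0"
  obtain R where R: "\<forall>x. \<bar>x\<bar> > R \<longrightarrow> f x = 0" using f by (auto simp: test_fun_def)
  have "f (a * x + b) = 0" if "\<bar>x\<bar> > (R + \<bar>b\<bar>) / \<bar>a\<bar>" for x
  proof -
    have "\<bar>a * x\<bar> > R + \<bar>b\<bar>" using that a by (simp add: abs_mult field_simps)
    then have "\<bar>a * x + b\<bar> > R" by linarith
    then show ?thesis using R by blast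
  qed
  then show ?thesis using f unfolding test_fun_def by (auto intro!: smooth_affine)
qed

lemma dv_locally_zero:
  assumes "open S" "x \<in> S" "\<And>y. y \<in> S \<Longrightarrow> f y = c"
  shows "dv f x = 0"
proof -
  have "(f has_vector_derivative 0) (at x)"
    by (rule has_vector_derivative_transform_within_open[OF has_vector_derivative_const[of c] assms(1,2)])
       (use assms(3) in auto)
  then show ?thesis by (simp add: dv_def vector_derivative_at)
qed

lemma test_fun_dv: "test_fun f \<Longrightarrow> test_fun (dv f)"
proof -
  assume f: "test_fun f"
  obtain R where R: "\<forall>x. \<bar>x\<bar> > R \<longrightarrow> f x = 0" using f by (auto simp: test_fun_def)
  have "dv f x = 0" if "\<bar>x\<bar> > R" for x
    by (rule dv_locally_zero[of "{y. \<bar>y\<bar> > R}" _ _ 0])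
       (use that R in \<open>auto intro!: open_Collect_less continuous_intros\<close>)
  then show ?thesis using f unfolding test_fun_def by (auto intro!: smooth_deriv)
qed

lemma test_fun_bounded: "test_fun f \<Longrightarrow> \<exists>K\<ge>0. \<forall>x. cmod (f x) \<le> K"
proof -
  assume f: "test_fun f"
  obtain R where R: "\<forall>x. \<bar>x\<bar> > R \<longrightarrow> f x = 0" using f by (auto simp: test_fun_def)
  have "bounded (f ` {-R..R})"
    by (intro compact_imp_bounded compact_continuous_image smooth_continuous test_fun_smooth f) auto
  then obtain K where K: "\<forall>x\<in>{-R..R}. cmod (f x) \<le> K" by (auto simp: bounded_iff)
  have "cmod (f x) \<le> max K 0" for x
  proof (cases "\<bar>x\<bar> > R")
    case False
    then have "x \<in> {-R..R}" by auto
    then show ?thesis using K by (auto simp: le_max_iff_disj)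
  qed (use R in auto)
  then show ?thesis by (intro exI[of _ "max K 0"]) auto
qed

section \<open>Finite sums of tensor products of test functions\<close>

inductive_set tensor_span :: "(real \<times> real \<Rightarrow> complex) set" where
  tensor: "test_fun f \<Longrightarrow> test_fun q \<Longrightarrow> (\<lambda>x. f (fst x) * q (snd x)) \<in> tensor_span"
| add: "\<phi> \<in> tensor_span \<Longrightarrow> \<psi> \<in> tensor_span \<Longrightarrow> (\<lambda>x. \<phi> x + \<psi> x) \<in> tensor_span"

lemma partial_s_eqI:
  "(\<And>s u. ((\<lambda>t. \<psi> (t, u)) has_vector_derivative \<psi>' (s, u)) (at s)) \<Longrightarrow> partial_s \<psi> = \<psi>'"
  by (auto simp: partial_s_def vector_derivative_at)

lemma partial_u_eqI:
  "(\<And>s u. ((\<lambda>t. \<psi> (s, t)) has_vector_derivative \<psi>' (s, u)) (at u)) \<Longrightarrow> partial_u \<psi> = \<psi>'"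
  by (auto simp: partial_u_def vector_derivative_at)

lemma tensor_deriv_s:
  assumes "test_fun f"
  shows "((\<lambda>t. f (fst (t, u)) * q (snd (t, u))) has_vector_derivative dv f (fst (s, u)) * q (snd (s, u))) (at s)"
  using has_vector_derivative_mult_left[OF smooth_deriv(1)[OF test_fun_smooth[OF assms], of s], of "q u"]
  by simp

lemma tensor_deriv_u:
  assumes "test_fun q"
  shows "((\<lambda>t. f (fst (s, t)) * q (snd (s, t))) has_vector_derivative f (fst (s, u)) * dv q (snd (s, u))) (at u)"
  using has_vector_derivative_mult_right[OF smooth_deriv(1)[OF test_fun_smooth[OF assms], of u], of "f s"]
  by simp

text \<open>The induction produces some derivative inside the span; uniqueness of derivatives then
  identifies it with \<open>partial_s \<psi>\<close>. Multiples need no rule of their own in the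
  span, since a constant can be put into a factor.\<close>

lemma tensor_span_partial_s:
  assumes "\<psi> \<in> tensor_span"
  shows "((\<lambda>t. \<psi> (t, u)) has_vector_derivative partial_s \<psi> (s, u)) (at s)" "partial_s \<psi> \<in> tensor_span"
proof -
  have "\<exists>\<psi>'\<in>tensor_span. \<forall>s u. ((\<lambda>t. \<psi> (t, u)) has_vector_derivative \<psi>' (s, u)) (at s)"
    using assms
  proof induction
    case (tensor f q)
    show ?case
      by (rule bexI[OF _ tensor_span.tensor[OF test_fun_dv[OF tensor(1)] tensor(2)]])
         (intro allI tensor_deriv_s tensor)
  next
    case (add \<phi> \<psi>)
    then obtain \<phi>' \<psi>' where "\<phi>' \<in> tensor_span" "\<psi>' \<in> tensor_span"
      "\<forall>s u. ((\<lambda>t. \<phi> (t, u)) has_vector_derivative \<phi>' (s, u)) (at s)"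
      "\<forall>s u. ((\<lambda>t. \<psi> (t, u)) has_vector_derivative \<psi>' (s, u)) (at s)" by blast
    then show ?case
      by (intro bexI[of _ "\<lambda>x. \<phi>' x + \<psi>' x"]) (auto intro!: has_vector_derivative_add tensor_span.add)
  qed
  then obtain \<psi>' where *: "\<psi>' \<in> tensor_span" "\<And>s u. ((\<lambda>t. \<psi> (t, u)) has_vector_derivative \<psi>' (s, u)) (at s)"
    by blast
  from partial_s_eqI[OF *(2)] * show "((\<lambda>t. \<psi> (t, u)) has_vector_derivative partial_s \<psi> (s, u)) (at s)"
    "partial_s \<psi> \<in> tensor_span" by auto
qed

lemma tensor_span_partial_u:
  assumes "\<psi> \<in> tensor_span"
  shows "((\<lambda>t. \<psi> (s, t)) has_vector_derivative partial_u \<psi> (s, u)) (at u)" "partial_u \<psi> \<in> tensor_span"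
proof -
  have "\<exists>\<psi>'\<in>tensor_span. \<forall>s u. ((\<lambda>t. \<psi> (s, t)) has_vector_derivative \<psi>' (s, u)) (at u)"
    using assms
  proof induction
    case (tensor f q)
    show ?case
      by (rule bexI[OF _ tensor_span.tensor[OF tensor(1) test_fun_dv[OF tensor(2)]]])
         (intro allI tensor_deriv_u tensor)
  next
    case (add \<phi> \<psi>)
    then obtain \<phi>' \<psi>' where "\<phi>' \<in> tensor_span" "\<psi>' \<in> tensor_span"
      "\<forall>s u. ((\<lambda>t. \<phi> (s, t)) has_vector_derivative \<phi>' (s, u)) (at u)"
      "\<forall>s u. ((\<lambda>t. \<psi> (s, t)) has_vector_derivative \<psi>' (s, u)) (at u)" by blast
    then show ?case
      by (intro bexI[of _ "\<lambda>x. \<phi>' x + \<psi>' x"]) (auto intro!: has_vector_derivative_add tensor_span.add)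
  qed
  then obtain \<psi>' where *: "\<psi>' \<in> tensor_span" "\<And>s u. ((\<lambda>t. \<psi> (s, t)) has_vector_derivative \<psi>' (s, u)) (at u)"
    by blast
  from partial_u_eqI[OF *(2)] * show "((\<lambda>t. \<psi> (s, t)) has_vector_derivative partial_u \<psi> (s, u)) (at u)"
    "partial_u \<psi> \<in> tensor_span" by auto
qed

lemma tensor_partial:
  assumes "test_fun f" "test_fun q"
  shows "partial_s (\<lambda>x. f (fst x) * q (snd x)) = (\<lambda>x. dv f (fst x) * q (snd x))"
    "partial_u (\<lambda>x. f (fst x) * q (snd x)) = (\<lambda>x. f (fst x) * dv q (snd x))"
  by (rule partial_s_eqI tensor_deriv_s partial_u_eqI tensor_deriv_u assms)+

lemma tensor_span_partial_add:
  assumes "\<phi> \<in> tensor_span" "\<psi> \<in> tensor_span"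
  shows "partial_s (\<lambda>x. \<phi> x + \<psi> x) = (\<lambda>x. partial_s \<phi> x + partial_s \<psi> x)"
    "partial_u (\<lambda>x. \<phi> x + \<psi> x) = (\<lambda>x. partial_u \<phi> x + partial_u \<psi> x)"
  by (rule partial_s_eqI partial_u_eqI has_vector_derivative_add tensor_span_partial_s(1)
      tensor_span_partial_u(1) assms)+

text \<open>On a product the two partial derivatives act on different factors.\<close>

lemma tensor_span_partial_commute:
  assumes "\<psi> \<in> tensor_span" shows "partial_s (partial_u \<psi>) = partial_u (partial_s \<psi>)"
  using assms
proof induction
  case (tensor f q)
  then show ?case by (simp add: tensor_partial test_fun_dv)
next
  case (add \<phi> \<psi>)
  then show ?case
    by (simp add: tensor_span_partial_add tensor_span_partial_u(2) tensor_span_partial_s(2))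
qed

lemma tensor_span_support_bound:
  assumes "\<psi> \<in> tensor_span"
  shows "\<exists>R\<ge>0. \<exists>K\<ge>0. (\<forall>s u. \<bar>s\<bar> > R \<or> \<bar>u\<bar> > R \<longrightarrow> \<psi> (s, u) = 0) \<and> (\<forall>x. cmod (\<psi> x) \<le> K)"
  using assms
proof induction
  case (tensor f q)
  obtain R where R: "R \<ge> 0" "\<forall>x. \<bar>x\<bar> > R \<longrightarrow> f x = 0" using test_fun_support[OF tensor(1)] by blast
  obtain S where S: "S \<ge> R" "\<forall>x. \<bar>x\<bar> > S \<longrightarrow> q x = 0" using test_fun_support[OF tensor(2)] by blast
  obtain K where K: "K \<ge> 0" "\<forall>x. cmod (f x) \<le> K" using test_fun_bounded[OF tensor(1)] by blast
  obtain L where L: "L \<ge> 0" "\<forall>x. cmod (q x) \<le> L" using test_fun_bounded[OF tensor(2)] by blast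
  show ?case
    by (rule exI[of _ S], rule conjI, use R S in simp, rule exI[of _ "K * L"])
       (use R S K L in \<open>auto simp: norm_mult intro!: mult_mono\<close>)
next
  case (add \<phi> \<psi>)
  then obtain R K R' K' where *: "R \<ge> 0" "K \<ge> 0" "R' \<ge> 0" "K' \<ge> 0"
    "\<forall>s u. \<bar>s\<bar> > R \<or> \<bar>u\<bar> > R \<longrightarrow> \<phi> (s, u) = 0" "\<forall>x. cmod (\<phi> x) \<le> K"
    "\<forall>s u. \<bar>s\<bar> > R' \<or> \<bar>u\<bar> > R' \<longrightarrow> \<psi> (s, u) = 0" "\<forall>x. cmod (\<psi> x) \<le> K'" by blast
  have "cmod (\<phi> x + \<psi> x) \<le> K + K'" for x using *(6,8) norm_triangle_le add_mono by metis
  then show ?case using *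
    by (intro exI[of _ "max R R'"] conjI exI[of _ "K + K'"]) auto
qed

lemma tensor_span_differentiable: "\<psi> \<in> tensor_span \<Longrightarrow> \<psi> differentiable_on UNIV"
proof (induction rule: tensor_span.induct)
  case (tensor f q)
  have d: "(g \<circ> p) differentiable (at x)" if "test_fun g" "p differentiable (at x)"
    for g :: "real \<Rightarrow> complex" and p and x :: "real \<times> real"
    by (rule differentiable_chain_at[OF that(2)])
       (rule differentiableI_vector[OF smooth_deriv(1)[OF test_fun_smooth[OF that(1)]]])
  have "fst differentiable (at x)" "snd differentiable (at x)" for x :: "real \<times> real"
    by (auto simp: differentiable_def intro: bounded_linear_imp_has_derivative bounded_linear_fst bounded_linear_snd)
  then show ?case
    using d[OF tensor(1), of fst] d[OF tensor(2), of snd]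
    by (auto simp: differentiable_on_def o_def intro!: differentiable_mult differentiable_at_withinI)
next
  case (add \<phi> \<psi>)
  then show ?case by (intro differentiable_on_add)
qed

lemma tensor_span_iterated_partials: "\<psi> \<in> tensor_span \<Longrightarrow> (partial_s ^^ m) ((partial_u ^^ n) \<psi>) \<in> tensor_span"
proof (induction m)
  case 0
  then show ?case by (induction n) (auto intro: tensor_span_partial_u)
qed (auto intro: tensor_span_partial_s)

lemma tensor_span_schwartz: "\<psi> \<in> tensor_span \<Longrightarrow> \<psi> \<in> schwartz"
  unfolding schwartz_def
proof (intro CollectI conjI allI)
  assume \<psi>: "\<psi> \<in> tensor_span"
  fix m n show "(partial_s ^^ m) ((partial_u ^^ n) \<psi>) differentiable_on UNIV"
    by (intro tensor_span_differentiable tensor_span_iterated_partials \<psi>)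
next
  assume \<psi>: "\<psi> \<in> tensor_span"
  fix j k m n
  obtain R K where R: "R \<ge> 0" "K \<ge> 0" "\<forall>s u. \<bar>s\<bar> > R \<or> \<bar>u\<bar> > R \<longrightarrow> (partial_s ^^ m) ((partial_u ^^ n) \<psi>) (s, u) = 0"
    "\<forall>x. cmod ((partial_s ^^ m) ((partial_u ^^ n) \<psi>) x) \<le> K"
    using tensor_span_support_bound[OF tensor_span_iterated_partials[OF \<psi>]] by blast
  have "\<bar>s\<bar> ^ j * \<bar>u\<bar> ^ k * cmod ((partial_s ^^ m) ((partial_u ^^ n) \<psi>) (s, u)) \<le> R ^ j * R ^ k * K" for s u
  proof (cases "\<bar>s\<bar> > R \<or> \<bar>u\<bar> > R")
    case True
    then have "(partial_s ^^ m) ((partial_u ^^ n) \<psi>) (s, u) = 0" using R(3) by blast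
    then show ?thesis using R by simp
  next
    case False
    then show ?thesis using R by (intro mult_mono power_mono) auto
  qed
  then show "\<exists>C. \<forall>s u. \<bar>s\<bar> ^ j * \<bar>u\<bar> ^ k * cmod ((partial_s ^^ m) ((partial_u ^^ n) \<psi>) (s, u)) \<le> C" by blast
qed

text \<open>The multiplier is absorbed into the first factor of each product, whose compact support
  is preserved; \<open>h\<close> may thus grow arbitrarily.\<close>

lemma tensor_span_mult_s:
  assumes "\<psi> \<in> tensor_span" "smooth h"
  shows "(\<lambda>x. h (fst x) * \<psi> x) \<in> tensor_span"
  using assms(1)
proof induction
  case (tensor f q)
  have "(\<lambda>x. (f (fst x) * h (fst x)) * q (snd x)) \<in> tensor_span"
    by (rule tensor_span.tensor[OF test_fun_mult[OF tensor(1) assms(2)] tensor(2)])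
  then show ?case by (simp add: ac_simps)
next
  case (add \<phi> \<psi>)
  then show ?case using tensor_span.add[OF add.IH] by (simp add: distrib_left)
qed

lemma tensor_span_zero: "(\<lambda>x. 0) \<in> tensor_span"
  using tensor_span.tensor[OF test_fun_zero test_fun_zero] by simp

section \<open>Integration over the strip\<close>

lemma strip_sets [simp, measurable]: "strip d \<in> sets borel"
  unfolding strip_def by (intro borel_open open_Times) auto

lemma space_strip_measure [simp]: "space (strip_measure d) = strip d"
  by (simp add: strip_measure_def space_restrict_space)

lemma mem_strip [simp]: "(s, u) \<in> strip d \<longleftrightarrow> 0 < u \<and> u < d"
  by (simp add: strip_def)

lemma strip_measurableI: "f \<in> borel_measurable borel \<Longrightarrow> f \<in> borel_measurable (strip_measure d)"
  by (simp add: strip_measure_def measurable_restrict_space1)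

lemma strip_measurable_continuous:
  fixes f :: "real \<times> real \<Rightarrow> 'b::topological_space"
  shows "continuous_on UNIV f \<Longrightarrow> f \<in> borel_measurable (strip_measure d)"
  by (intro strip_measurableI borel_measurable_continuous_onI)

lemma integrable_strip_iff:
  fixes f :: "real \<times> real \<Rightarrow> 'b::{banach, second_countable_topology}"
  shows "integrable (strip_measure d) f \<longleftrightarrow> integrable lborel (\<lambda>x. indicator (strip d) x *\<^sub>R f x)"
  unfolding strip_measure_def by (rule integrable_restrict_space) simp

lemma integral_strip_eq:
  fixes f :: "real \<times> real \<Rightarrow> 'b::{banach, second_countable_topology}"
  shows "integral\<^sup>L (strip_measure d) f = integral\<^sup>L lborel (\<lambda>x. indicator (strip d) x *\<^sub>R f x)"
  unfolding strip_measure_def by (rule integral_restrict_space) simp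

lemma AE_stripI: "(\<And>s u. 0 < u \<Longrightarrow> u < d \<Longrightarrow> P (s, u)) \<Longrightarrow> AE x in strip_measure d. P x"
  by (rule AE_I2) (auto simp: strip_def)

section \<open>Integrability from decay along the strip\<close>

lemma one_plus_sq_pos: "1 + (s::real)\<^sup>2 > 0"
  by (simp add: add_pos_nonneg)

lemma integrable_arctan_deriv: "integrable lborel (\<lambda>x::real. 1 / (1 + x\<^sup>2))"
proof -
  have "set_integrable lborel (einterval (-\<infinity>) \<infinity>) (\<lambda>x::real. 1 / (1 + x\<^sup>2))"
  proof (rule interval_integral_FTC_nonneg(1)[where F=arctan and A="- (pi/2)" and B="pi/2"])
    show "DERIV arctan x :> 1 / (1 + x\<^sup>2)" for x
      using DERIV_arctan[of x] by (simp add: divide_inverse)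
    show "isCont (\<lambda>x::real. 1 / (1 + x\<^sup>2)) x" for x
      using one_plus_sq_pos[of x] by (intro continuous_intros) simp
  qed (auto simp: ereal_tendsto_simps tendsto_arctan_at_top tendsto_arctan_at_bot)
  then show ?thesis by (simp add: set_integrable_def)
qed

text \<open>The strip has finite width, so decay in s alone gives integrability. This function is
  the universal majorant below.\<close>

lemma integrable_strip_decay: "integrable (strip_measure d) (\<lambda>x. 1 / (1 + (fst x)\<^sup>2))"
proof -
  have "integrable (lborel \<Otimes>\<^sub>M lborel) (\<lambda>x::real \<times> real. indicator {0<..<d} (snd x) * (1 / (1 + (fst x)\<^sup>2)))"
  proof (rule lborel_pair.Fubini_integrable)
    show "(\<lambda>x::real \<times> real. indicator {0<..<d} (snd x) * (1 / (1 + (fst x)\<^sup>2))) \<in> borel_measurable (lborel \<Otimes>\<^sub>M lborel)"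
      by measurable
    have "(LINT y|lborel. norm (indicator {0<..<d} (snd (x, y)) * (1 / (1 + (fst (x::real, y::real))\<^sup>2))))
        = measure lborel {0<..<d} * (1 / (1 + x\<^sup>2))" for x
      by (simp add: abs_mult)
    then show "integrable lborel (\<lambda>x. LINT y|lborel. norm (indicator {0<..<d} (snd (x, y)) * (1 / (1 + (fst (x::real, y::real))\<^sup>2))))"
      by (simp only: integrable_mult_right[OF integrable_arctan_deriv])
    show "AE x in lborel. integrable lborel (\<lambda>y. indicator {0<..<d} (snd (x, y)) * (1 / (1 + (fst (x::real, y::real))\<^sup>2)))"
    proof (rule AE_I2)
      fix x :: real
      have "integrable lborel (\<lambda>y::real. indicator {0<..<d} y :: real)"
        using emeasure_bounded_finite[of "{0<..<d}"] by (intro integrable_real_indicator) auto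
      from integrable_mult_left[OF this, of "1 / (1 + x\<^sup>2)"]
      show "integrable lborel (\<lambda>y. indicator {0<..<d} (snd (x, y)) * (1 / (1 + (fst (x, y))\<^sup>2)) :: real)"
        by (simp only: fst_conv snd_conv)
    qed
  qed
  moreover have "indicator (strip d) x = (indicator {0<..<d} (snd x) :: real)" for x :: "real \<times> real"
    by (cases x) (auto simp: strip_def indicator_def)
  ultimately show ?thesis by (simp add: integrable_strip_iff lborel_prod)
qed

text \<open>This class lies in L1 as well as in L2 and is closed under sums, products and bounded
  multipliers, so the integrals arising in integration by parts exist without separate arguments. It
  constrains the function only inside the strip.\<close>

definition decaying :: "real \<Rightarrow> (real \<times> real \<Rightarrow> complex) \<Rightarrow> bool" where
  "decaying d h \<longleftrightarrow> h \<in> borel_measurable (strip_measure d) \<and>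
     (\<exists>K. \<forall>s u. 0 < u \<longrightarrow> u < d \<longrightarrow> cmod (h (s, u)) \<le> K / (1 + s\<^sup>2))"

lemma decayingI:
  assumes "h \<in> borel_measurable (strip_measure d)"
    "\<And>s u. 0 < u \<Longrightarrow> u < d \<Longrightarrow> cmod (h (s, u)) \<le> K / (1 + s\<^sup>2)"
  shows "decaying d h"
  using assms unfolding decaying_def by blast

lemma decaying_bound:
  assumes "decaying d h"
  obtains K where "K \<ge> 0" "\<And>s u. 0 < u \<Longrightarrow> u < d \<Longrightarrow> cmod (h (s, u)) \<le> K / (1 + s\<^sup>2)"
proof -
  obtain K where K: "\<And>s u. 0 < u \<Longrightarrow> u < d \<Longrightarrow> cmod (h (s, u)) \<le> K / (1 + s\<^sup>2)"
    using assms unfolding decaying_def by blast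
  have "cmod (h (s, u)) \<le> max K 0 / (1 + s\<^sup>2)" if "0 < u" "u < d" for s u
    by (rule order_trans[OF K[OF that]], rule divide_right_mono) (use one_plus_sq_pos[of s] in auto)
  then show ?thesis using that[of "max K 0"] by auto
qed

lemma decaying_measurable: "decaying d h \<Longrightarrow> h \<in> borel_measurable (strip_measure d)"
  by (simp add: decaying_def)

lemma decaying_add: "decaying d f \<Longrightarrow> decaying d g \<Longrightarrow> decaying d (\<lambda>x. f x + g x)"
proof -
  assume f: "decaying d f" and g: "decaying d g"
  obtain K where K: "K \<ge> 0" "\<And>s u. 0 < u \<Longrightarrow> u < d \<Longrightarrow> cmod (f (s, u)) \<le> K / (1 + s\<^sup>2)"
    using decaying_bound[OF f] by blast
  obtain L where L: "L \<ge> 0" "\<And>s u. 0 < u \<Longrightarrow> u < d \<Longrightarrow> cmod (g (s, u)) \<le> L / (1 + s\<^sup>2)"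
    using decaying_bound[OF g] by blast
  show ?thesis
  proof (rule decayingI)
    show "(\<lambda>x. f x + g x) \<in> borel_measurable (strip_measure d)"
      using f g by (intro borel_measurable_add decaying_measurable)
    show "cmod (f (s, u) + g (s, u)) \<le> (K + L) / (1 + s\<^sup>2)" if "0 < u" "u < d" for s u
      using norm_triangle_le[OF add_mono[OF K(2)[OF that] L(2)[OF that]]]
      by (simp add: add_divide_distrib)
  qed
qed

lemma decaying_mult_bounded:
  assumes f: "decaying d f" and g: "g \<in> borel_measurable (strip_measure d)"
    "\<And>s u. 0 < u \<Longrightarrow> u < d \<Longrightarrow> cmod (g (s, u)) \<le> B"
  shows "decaying d (\<lambda>x. g x * f x)"
proof -
  obtain K where K: "K \<ge> 0" "\<And>s u. 0 < u \<Longrightarrow> u < d \<Longrightarrow> cmod (f (s, u)) \<le> K / (1 + s\<^sup>2)"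
    using decaying_bound[OF f] by blast
  show ?thesis
  proof (rule decayingI)
    show "(\<lambda>x. g x * f x) \<in> borel_measurable (strip_measure d)"
      by (intro borel_measurable_times g(1) decaying_measurable[OF f])
    show "cmod (g (s, u) * f (s, u)) \<le> (\<bar>B\<bar> * K) / (1 + s\<^sup>2)" if "0 < u" "u < d" for s u
      using mult_mono[OF order_trans[OF g(2)[OF that] abs_ge_self] K(2)[OF that, of s]]
      by (simp add: norm_mult)
  qed
qed

lemma decaying_scale: "decaying d f \<Longrightarrow> decaying d (\<lambda>x. c * f x)"
  by (rule decaying_mult_bounded[where B="cmod c" and g="\<lambda>_. c"]) auto

lemma decaying_minus: "decaying d f \<Longrightarrow> decaying d (\<lambda>x. - f x)"
  using decaying_scale[of d f "-1"] by simp

lemma decaying_diff: "decaying d f \<Longrightarrow> decaying d g \<Longrightarrow> decaying d (\<lambda>x. f x - g x)"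
  using decaying_add[OF _ decaying_minus, of d f g] by simp

lemma decaying_cnj: "decaying d f \<Longrightarrow> decaying d (\<lambda>x. cnj (f x))"
  by (auto simp: decaying_def)

lemma decaying_bounded: "decaying d f \<Longrightarrow> \<exists>B. \<forall>s u. 0 < u \<longrightarrow> u < d \<longrightarrow> cmod (f (s, u)) \<le> B"
proof -
  assume f: "decaying d f"
  obtain K where K: "K \<ge> 0" "\<And>s u. 0 < u \<Longrightarrow> u < d \<Longrightarrow> cmod (f (s, u)) \<le> K / (1 + s\<^sup>2)"
    using decaying_bound[OF f] by blast
  have "cmod (f (s, u)) \<le> K" if "0 < u" "u < d" for s u
  proof -
    have "K / (1 + s\<^sup>2) \<le> K / 1" by (rule divide_left_mono) (use K one_plus_sq_pos[of s] in auto)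
    then show ?thesis using K(2)[OF that, of s] by simp
  qed
  then show ?thesis by blast
qed

lemma decaying_mult: "decaying d f \<Longrightarrow> decaying d g \<Longrightarrow> decaying d (\<lambda>x. f x * g x)"
  using decaying_bounded[of d f] decaying_mult_bounded[of d g f] decaying_measurable[of d f] by blast

lemma decaying_integrable:
  assumes "decaying d f" shows "integrable (strip_measure d) f"
proof -
  obtain K where K: "K \<ge> 0" "\<And>s u. 0 < u \<Longrightarrow> u < d \<Longrightarrow> cmod (f (s, u)) \<le> K / (1 + s\<^sup>2)"
    using decaying_bound[OF assms] by blast
  show ?thesis
  proof (rule Bochner_Integration.integrable_bound)
    show "integrable (strip_measure d) (\<lambda>x. K * (1 / (1 + (fst x)\<^sup>2)))"
      by (intro integrable_mult_right integrable_strip_decay)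
    show "f \<in> borel_measurable (strip_measure d)" by (rule decaying_measurable[OF assms])
    show "AE x in strip_measure d. norm (f x) \<le> norm (K * (1 / (1 + (fst x)\<^sup>2)))"
      by (rule AE_stripI) (use K one_plus_sq_pos in \<open>auto simp: abs_of_pos\<close>)
  qed
qed

lemma decaying_L2: "decaying d f \<Longrightarrow> f \<in> L2 (strip_measure d)"
proof -
  assume f: "decaying d f"
  have "integrable (strip_measure d) (\<lambda>x. cnj (f x) * f x)"
    by (intro decaying_integrable decaying_mult decaying_cnj f)
  then have "integrable (strip_measure d) (\<lambda>x. Re (cnj (f x) * f x))" by (rule integrable_Re)
  moreover have "Re (cnj (f x) * f x) = (cmod (f x))\<^sup>2" for x
    by (simp add: cmod_def power2_eq_square)
  ultimately show ?thesis using decaying_measurable[OF f] by (simp add: L2_def)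
qed

section \<open>Integration by parts\<close>

lemma decaying_tendsto_0:
  assumes "decaying d f" "0 < u" "u < d" "filterlim (\<lambda>s. norm s) at_top F"
  shows "((\<lambda>s. f (s, u)) \<longlongrightarrow> 0) F"
proof -
  obtain K where K: "K \<ge> 0" "\<And>s u. 0 < u \<Longrightarrow> u < d \<Longrightarrow> cmod (f (s, u)) \<le> K / (1 + s\<^sup>2)"
    using decaying_bound[OF assms(1)] by blast
  have "filterlim (\<lambda>s::real. (norm s)\<^sup>2) at_top F"
    by (rule filterlim_pow_at_top[OF _ assms(4)]) simp
  then have "filterlim (\<lambda>s::real. 1 + (norm s)\<^sup>2) at_top F"
    by (rule filterlim_tendsto_add_at_top[OF tendsto_const])
  then have "((\<lambda>s. K / (1 + (norm s)\<^sup>2)) \<longlongrightarrow> 0) F"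
    by (intro real_tendsto_divide_at_top[OF tendsto_const])
  then show ?thesis
    by (rule Lim_null_comparison[rotated]) (use K assms(2,3) in auto)
qed

lemma norm_at_top_real: "filterlim (\<lambda>s::real. norm s) at_top at_top" "filterlim (\<lambda>s::real. norm s) at_top at_bot"
  using filterlim_abs_real filterlim_at_infinity_imp_norm_at_top[OF filterlim_mono[OF filterlim_ident _ order_refl]]
  by (auto simp: filterlim_at_bot_mirror)

text \<open>Fubini reduces the claim to the fundamental theorem on horizontal lines, where the decay
  kills the boundary terms. Derivatives are required for 0 < u < d only, because the metric
  coefficient may be singular elsewhere.\<close>

lemma integral_partial_s_zero:
  assumes f': "decaying d f'" and f: "decaying d f"
    and deriv: "\<And>s u. 0 < u \<Longrightarrow> u < d \<Longrightarrow> ((\<lambda>t. f (t, u)) has_vector_derivative f' (s, u)) (at s)"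
    and cont: "\<And>s u. 0 < u \<Longrightarrow> u < d \<Longrightarrow> isCont (\<lambda>t. f' (t, u)) s"
  shows "(LINT x|strip_measure d. f' x) = 0"
proof -
  let ?h = "\<lambda>s u. indicator (strip d) (s, u) *\<^sub>R f' (s, u)"
  have eq: "case_prod ?h = (\<lambda>x. indicator (strip d) x *\<^sub>R f' x)" by auto
  have int: "integrable (lborel \<Otimes>\<^sub>M lborel) (case_prod ?h)"
    unfolding eq using decaying_integrable[OF f'] by (simp add: integrable_strip_iff lborel_prod)
  \<comment> \<open>Integrability is a premise because Fubini provides it for almost every u
    only.\<close>
  have zero: "(LINT s|lborel. ?h s u) = 0" if i: "integrable lborel (\<lambda>s. ?h s u)" for u
  proof (cases "0 < u \<and> u < d")
    case True
    then have h: "?h s u = f' (s, u)" for s by simp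
    have "(LBINT s=-\<infinity>..\<infinity>. f' (s, u)) = 0 - 0"
    proof (rule interval_integral_FTC_integrable[where F="\<lambda>s. f (s, u)"])
      show "set_integrable lborel (einterval (-\<infinity>) \<infinity>) (\<lambda>s. f' (s, u))"
        using i unfolding h by (simp add: set_integrable_def)
      show "(((\<lambda>s. f (s, u)) \<circ> real_of_ereal) \<longlongrightarrow> 0) (at_right (-\<infinity>))"
        "(((\<lambda>s. f (s, u)) \<circ> real_of_ereal) \<longlongrightarrow> 0) (at_left \<infinity>)"
        unfolding ereal_tendsto_simps
        by (rule decaying_tendsto_0[OF f] norm_at_top_real True[THEN conjunct1] True[THEN conjunct2])+
    qed (use True deriv cont in auto)
    then show ?thesis
      unfolding h by (simp add: interval_lebesgue_integral_def set_lebesgue_integral_def)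
  qed (auto simp: indicator_def)
  have "(LINT x|strip_measure d. f' x) = integral\<^sup>L (lborel \<Otimes>\<^sub>M lborel) (case_prod ?h)"
    by (simp add: integral_strip_eq eq lborel_prod)
  also have "\<dots> = (LINT u|lborel. LINT s|lborel. ?h s u)"
    by (rule lborel_pair.integral_snd[OF int, symmetric])
  also have "\<dots> = 0"
  proof (rule integral_eq_zero_AE)
    show "AE u in lborel. (LINT s|lborel. ?h s u) = 0"
      using lborel_pair.AE_integrable_snd[OF int] by eventually_elim (rule zero)
  qed
  finally show ?thesis .
qed

text \<open>Here the boundary terms sit at u = 0 and u = d, so the derivative is needed on a
  neighbourhood of the closed interval; functions given on the whole plane provide it.\<close>

lemma integral_partial_u_zero:
  assumes d: "d > 0" and f': "decaying d f'"
    and deriv: "\<And>s u. ((\<lambda>t. f (s, t)) has_vector_derivative f' (s, u)) (at u)"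
    and cont: "\<And>s. continuous_on UNIV (\<lambda>t. f' (s, t))"
    and bc: "\<And>s. f (s, 0) = 0" "\<And>s. f (s, d) = 0"
  shows "(LINT x|strip_measure d. f' x) = 0"
proof -
  let ?h = "\<lambda>s u. indicator (strip d) (s, u) *\<^sub>R f' (s, u)"
  have eq: "case_prod ?h = (\<lambda>x. indicator (strip d) x *\<^sub>R f' x)" by auto
  have int: "integrable (lborel \<Otimes>\<^sub>M lborel) (case_prod ?h)"
    unfolding eq using decaying_integrable[OF f'] by (simp add: integrable_strip_iff lborel_prod)
  have zero: "(LINT u|lborel. ?h s u) = 0" for s
  proof -
    have "(LBINT u=0..d. f' (s, u)) = f (s, d) - f (s, 0)"
      by (rule interval_integral_FTC_finite[where a=0, simplified zero_ereal_def[symmetric]])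
         (auto intro: continuous_on_subset[OF cont] has_vector_derivative_at_within[OF deriv])
    then have "(LBINT u=0..d. f' (s, u)) = 0" by (simp add: bc)
    moreover have "(\<lambda>u. ?h s u) = (\<lambda>u. indicator {0<..<d} u *\<^sub>R f' (s, u))" by (auto simp: indicator_def)
    ultimately show ?thesis
      using d by (simp add: interval_lebesgue_integral_def set_lebesgue_integral_def zero_ereal_def)
  qed
  have "(LINT x|strip_measure d. f' x) = integral\<^sup>L (lborel \<Otimes>\<^sub>M lborel) (case_prod ?h)"
    by (simp add: integral_strip_eq eq lborel_prod)
  also have "\<dots> = (LINT s|lborel. LINT u|lborel. ?h s u)"
    using lborel_pair.integral_fst[OF int] by simp
  finally show ?thesis by (simp add: zero)
qed

lemma has_vector_derivative_cnj:
  "(f has_vector_derivative f') F \<Longrightarrow> ((\<lambda>x. cnj (f x)) has_vector_derivative cnj f') F"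
  by (rule bounded_linear.has_vector_derivative[OF bounded_linear_cnj])

lemma integration_by_parts_s:
  assumes dec: "decaying d p" "decaying d p'" "decaying d q" "decaying d q'"
    and deriv: "\<And>s u. 0 < u \<Longrightarrow> u < d \<Longrightarrow> ((\<lambda>t. p (t, u)) has_vector_derivative p' (s, u)) (at s)"
      "\<And>s u. 0 < u \<Longrightarrow> u < d \<Longrightarrow> ((\<lambda>t. q (t, u)) has_vector_derivative q' (s, u)) (at s)"
    and cont: "\<And>s u. 0 < u \<Longrightarrow> u < d \<Longrightarrow> isCont (\<lambda>t. p' (t, u)) s"
      "\<And>s u. 0 < u \<Longrightarrow> u < d \<Longrightarrow> isCont (\<lambda>t. q' (t, u)) s"
  shows "L2_inner (strip_measure d) p q' = - L2_inner (strip_measure d) p' q"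
proof -
  have "(LINT x|strip_measure d. cnj (p x) * q' x + cnj (p' x) * q x) = 0"
  proof (rule integral_partial_s_zero[where f="\<lambda>x. cnj (p x) * q x"])
    show "decaying d (\<lambda>x. cnj (p x) * q' x + cnj (p' x) * q x)" "decaying d (\<lambda>x. cnj (p x) * q x)"
      by (intro decaying_add decaying_mult decaying_cnj dec)+
    fix s u :: real assume u: "0 < u" "u < d"
    show "((\<lambda>t. cnj (p (t, u)) * q (t, u)) has_vector_derivative
        cnj (p (s, u)) * q' (s, u) + cnj (p' (s, u)) * q (s, u)) (at s)"
      by (intro has_vector_derivative_mult has_vector_derivative_cnj deriv u)
    have "isCont (\<lambda>t. p (t, u)) s" "isCont (\<lambda>t. q (t, u)) s"
      by (rule has_vector_derivative_continuous, rule deriv[OF u])+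
    then show "isCont (\<lambda>t. cnj (p (t, u)) * q' (t, u) + cnj (p' (t, u)) * q (t, u)) s"
      by (intro continuous_intros cont u)
  qed
  moreover have "integrable (strip_measure d) (\<lambda>x. cnj (p x) * q' x)"
    "integrable (strip_measure d) (\<lambda>x. cnj (p' x) * q x)"
    by (intro decaying_integrable decaying_mult decaying_cnj dec)+
  ultimately show ?thesis by (simp add: L2_inner_def eq_neg_iff_add_eq_0)
qed

lemma integration_by_parts_u:
  assumes d: "d > 0" and dec: "decaying d p" "decaying d p'" "decaying d q" "decaying d q'"
    and deriv: "\<And>s u. ((\<lambda>t. p (s, t)) has_vector_derivative p' (s, u)) (at u)"
      "\<And>s u. ((\<lambda>t. q (s, t)) has_vector_derivative q' (s, u)) (at u)"
    and cont: "\<And>s. continuous_on UNIV (\<lambda>t. p' (s, t))" "\<And>s. continuous_on UNIV (\<lambda>t. q' (s, t))"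
    and bc: "\<And>s. p (s, 0) = 0" "\<And>s. p (s, d) = 0"
  shows "L2_inner (strip_measure d) p q' = - L2_inner (strip_measure d) p' q"
proof -
  have "(LINT x|strip_measure d. cnj (p x) * q' x + cnj (p' x) * q x) = 0"
  proof (rule integral_partial_u_zero[OF d, where f="\<lambda>x. cnj (p x) * q x"])
    show "decaying d (\<lambda>x. cnj (p x) * q' x + cnj (p' x) * q x)"
      by (intro decaying_add decaying_mult decaying_cnj dec)+
    fix s u :: real
    show "((\<lambda>t. cnj (p (s, t)) * q (s, t)) has_vector_derivative
        cnj (p (s, u)) * q' (s, u) + cnj (p' (s, u)) * q (s, u)) (at u)"
      by (intro has_vector_derivative_mult has_vector_derivative_cnj deriv)
    have "continuous_on UNIV (\<lambda>t. p (s, t))" "continuous_on UNIV (\<lambda>t. q (s, t))"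
      by (rule continuous_at_imp_continuous_on, rule ballI, rule has_vector_derivative_continuous, rule deriv)+
    then show "continuous_on UNIV (\<lambda>t. cnj (p (s, t)) * q' (s, t) + cnj (p' (s, t)) * q (s, t))"
      by (intro continuous_intros cont)
  qed (use bc in auto)
  moreover have "integrable (strip_measure d) (\<lambda>x. cnj (p x) * q' x)"
    "integrable (strip_measure d) (\<lambda>x. cnj (p' x) * q x)"
    by (intro decaying_integrable decaying_mult decaying_cnj dec)+
  ultimately show ?thesis by (simp add: L2_inner_def eq_neg_iff_add_eq_0)
qed

section \<open>Schwartz functions\<close>

text \<open>The weight of order s^4 leaves room for a factor growing like 1 + s^2: the product still
  decays like 1 / (1 + s^2).\<close>

definition rapid :: "(real \<times> real \<Rightarrow> complex) \<Rightarrow> bool" where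
  "rapid f \<longleftrightarrow> continuous_on UNIV f \<and> (\<exists>K. \<forall>s u. (1 + s\<^sup>2)\<^sup>2 * cmod (f (s, u)) \<le> K)"

lemma rapid_decaying_weighted:
  assumes f: "rapid f" and w: "w \<in> borel_measurable (strip_measure d)"
    "\<And>s u. 0 < u \<Longrightarrow> u < d \<Longrightarrow> cmod (w (s, u)) \<le> B * (1 + s\<^sup>2)"
  shows "decaying d (\<lambda>x. w x * f x)"
proof -
  obtain K where K: "\<And>s u. (1 + s\<^sup>2)\<^sup>2 * cmod (f (s, u)) \<le> K" using f by (auto simp: rapid_def)
  show ?thesis
  proof (rule decayingI)
    show "(\<lambda>x. w x * f x) \<in> borel_measurable (strip_measure d)"
      using f by (intro borel_measurable_times w strip_measurable_continuous) (simp add: rapid_def)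
    fix s u :: real assume u: "0 < u" "u < d"
    have "cmod (w (s, u)) \<le> \<bar>B\<bar> * (1 + s\<^sup>2)"
      by (rule order_trans[OF w(2)[OF u]], rule mult_right_mono) (use one_plus_sq_pos[of s] in auto)
    then have "cmod (w (s, u)) * ((1 + s\<^sup>2) * cmod (f (s, u))) \<le> (\<bar>B\<bar> * (1 + s\<^sup>2)) * ((1 + s\<^sup>2) * cmod (f (s, u)))"
      by (rule mult_right_mono) (use one_plus_sq_pos[of s] in auto)
    also have "\<dots> = \<bar>B\<bar> * ((1 + s\<^sup>2)\<^sup>2 * cmod (f (s, u)))" by (simp add: power2_eq_square)
    also have "\<dots> \<le> \<bar>B\<bar> * K" by (rule mult_left_mono[OF K]) simp
    finally show "cmod (w (s, u) * f (s, u)) \<le> (\<bar>B\<bar> * K) / (1 + s\<^sup>2)"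
      using one_plus_sq_pos[of s] by (simp add: norm_mult field_simps)
  qed
qed

lemma rapid_decaying: "rapid f \<Longrightarrow> decaying d f"
  using rapid_decaying_weighted[of f "\<lambda>_. 1" d 1] by simp

text \<open>What integration by parts of a second-order expression uses, shared by the Schwartz
  functions and the tensor products.\<close>

definition nice :: "(real \<times> real \<Rightarrow> complex) \<Rightarrow> bool" where
  "nice \<psi> \<longleftrightarrow>
     rapid \<psi> \<and> rapid (partial_s \<psi>) \<and> rapid (partial_s (partial_s \<psi>)) \<and>
     rapid (partial_u \<psi>) \<and> rapid (partial_u (partial_u \<psi>)) \<and>
     (\<forall>s u. ((\<lambda>t. \<psi> (t, u)) has_vector_derivative partial_s \<psi> (s, u)) (at s)) \<and>
     (\<forall>s u. ((\<lambda>t. partial_s \<psi> (t, u)) has_vector_derivative partial_s (partial_s \<psi>) (s, u)) (at s)) \<and>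
     (\<forall>s u. ((\<lambda>t. \<psi> (s, t)) has_vector_derivative partial_u \<psi> (s, u)) (at u)) \<and>
     (\<forall>s u. ((\<lambda>t. partial_u \<psi> (s, t)) has_vector_derivative partial_u (partial_u \<psi>) (s, u)) (at u))"

lemma differentiable_partial_s:
  assumes "f differentiable_on UNIV"
  shows "((\<lambda>t. f (t, u)) has_vector_derivative partial_s f (s, u)) (at s)"
proof -
  have f: "f differentiable (at (s, u))" using assms by (simp add: differentiable_on_def)
  have "((\<lambda>t. (t, u)) has_vector_derivative (1, 0)) (at s)"
    by (auto intro!: derivative_eq_intros)
  then have "(\<lambda>t. (t, u)) differentiable (at s)" by (rule differentiableI_vector)
  from differentiable_chain_at[OF this f] have "(\<lambda>t. f (t, u)) differentiable (at s)" by (simp add: o_def)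
  then show ?thesis by (simp add: partial_s_def vector_derivative_works[symmetric])
qed

lemma differentiable_partial_u:
  assumes "f differentiable_on UNIV"
  shows "((\<lambda>t. f (s, t)) has_vector_derivative partial_u f (s, u)) (at u)"
proof -
  have f: "f differentiable (at (s, u))" using assms by (simp add: differentiable_on_def)
  have "((\<lambda>t. (s, t)) has_vector_derivative (0, 1)) (at u)"
    by (auto intro!: derivative_eq_intros)
  then have "(\<lambda>t. (s, t)) differentiable (at u)" by (rule differentiableI_vector)
  from differentiable_chain_at[OF this f] have "(\<lambda>t. f (s, t)) differentiable (at u)" by (simp add: o_def)
  then show ?thesis by (simp add: partial_u_def vector_derivative_works[symmetric])
qed

lemma schwartz_nice:
  assumes "\<psi> \<in> schwartz" shows "nice \<psi>"
proof -
  have diff: "(partial_s ^^ m) ((partial_u ^^ n) \<psi>) differentiable_on UNIV" for m n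
    using assms by (simp add: schwartz_def)
  have rap: "rapid ((partial_s ^^ m) ((partial_u ^^ n) \<psi>))" for m n
  proof -
    let ?f = "(partial_s ^^ m) ((partial_u ^^ n) \<psi>)"
    have B: "\<exists>C. \<forall>s u. \<bar>s\<bar> ^ j * \<bar>u\<bar> ^ k * cmod (?f (s, u)) \<le> C" for j k
      using assms unfolding schwartz_def by blast
    \<comment> \<open>Expanding (1 + s^2)^2 = 1 + 2 s^2 + s^4 calls for the Schwartz bounds with
      exponents 0, 2 and 4.\<close>
    obtain C0 where C0: "\<And>s u. \<bar>s\<bar> ^ 0 * \<bar>u\<bar> ^ 0 * cmod (?f (s, u)) \<le> C0" using B by blast
    obtain C2 where C2: "\<And>s u. \<bar>s\<bar> ^ 2 * \<bar>u\<bar> ^ 0 * cmod (?f (s, u)) \<le> C2" using B by blast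
    obtain C4 where C4: "\<And>s u. \<bar>s\<bar> ^ 4 * \<bar>u\<bar> ^ 0 * cmod (?f (s, u)) \<le> C4" using B by blast
    have "(1 + s\<^sup>2)\<^sup>2 * cmod (?f (s, u)) \<le> C0 + 2 * C2 + C4" for s u
    proof -
      have "(1 + s\<^sup>2)\<^sup>2 = 1 + 2 * \<bar>s\<bar> ^ 2 + \<bar>s\<bar> ^ 4" by (simp add: power2_eq_square power4_eq_xxxx algebra_simps)
      then have "(1 + s\<^sup>2)\<^sup>2 * cmod (?f (s, u)) = cmod (?f (s, u)) + 2 * (\<bar>s\<bar> ^ 2 * cmod (?f (s, u))) + \<bar>s\<bar> ^ 4 * cmod (?f (s, u))"
        by (simp only: distrib_right mult_1 mult.assoc)
      then show ?thesis using C0[of s u] C2[of s u] C4[of s u] by simp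
    qed
    then show ?thesis
      unfolding rapid_def using differentiable_imp_continuous_on[OF diff] by blast
  qed
  show ?thesis
    unfolding nice_def
    using rap[of 0 0] rap[of 1 0] rap[of 2 0] rap[of 0 1] rap[of 0 2]
      differentiable_partial_s[OF diff[of 0 0]] differentiable_partial_s[OF diff[of 1 0]]
      differentiable_partial_u[OF diff[of 0 0]] differentiable_partial_u[OF diff[of 0 1]]
    by (simp add: numeral_2_eq_2)
qed

section \<open>Schroedinger operators in the strip\<close>

text \<open>For h the s-derivative of g this is -\<partial>_s g \<partial>_s - \<partial>_u^2 + V
  with the divergence form multiplied out, so that additivity and commutators with functions of s
  become algebra.\<close>

definition sop :: "(real \<times> real \<Rightarrow> real) \<Rightarrow> (real \<times> real \<Rightarrow> real) \<Rightarrow> (real \<times> real \<Rightarrow> real) \<Rightarrow>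
    (real \<times> real \<Rightarrow> complex) \<Rightarrow> real \<times> real \<Rightarrow> complex" where
  "sop g h V \<psi> x = - (of_real (g x) * partial_s (partial_s \<psi>) x + of_real (h x) * partial_s \<psi> x)
     - partial_u (partial_u \<psi>) x + of_real (V x) * \<psi> x"

text \<open>A subspace of the Schwartz domain on which all ranges below are shown to be dense;
  density on the larger domain follows. It is stable under multiplication by smooth functions of s,
  which the cutoff argument relies on.\<close>

definition dirichlet_tensors :: "real \<Rightarrow> (real \<times> real \<Rightarrow> complex) set" where
  "dirichlet_tensors d = {\<psi> \<in> tensor_span. \<forall>s. \<psi> (s, 0) = 0 \<and> \<psi> (s, d) = 0}"

lemma dirichlet_tensors_zero: "(\<lambda>x. 0) \<in> dirichlet_tensors d"
  by (simp add: dirichlet_tensors_def tensor_span_zero)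

lemma dirichlet_tensors_add:
  "\<phi> \<in> dirichlet_tensors d \<Longrightarrow> \<psi> \<in> dirichlet_tensors d \<Longrightarrow> (\<lambda>x. \<phi> x + \<psi> x) \<in> dirichlet_tensors d"
  by (simp add: dirichlet_tensors_def tensor_span.add)

lemma dirichlet_tensors_mult_s:
  "\<psi> \<in> dirichlet_tensors d \<Longrightarrow> smooth c \<Longrightarrow> (\<lambda>x. c (fst x) * \<psi> x) \<in> dirichlet_tensors d"
  by (simp add: dirichlet_tensors_def tensor_span_mult_s)

lemma dirichlet_tensors_subset: "dirichlet_tensors d \<subseteq> dirichlet_schwartz d"
  by (auto simp: dirichlet_tensors_def dirichlet_schwartz_def tensor_span_schwartz)

lemma tensor_span_nice: "\<psi> \<in> tensor_span \<Longrightarrow> nice \<psi>"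
  by (intro schwartz_nice tensor_span_schwartz)

lemma tensor_span_rapid: "\<psi> \<in> tensor_span \<Longrightarrow> rapid \<psi>"
  using tensor_span_nice unfolding nice_def by blast

lemma tensor_span_decaying: "\<psi> \<in> tensor_span \<Longrightarrow> decaying d \<psi>"
  by (intro rapid_decaying tensor_span_rapid)

lemma tensor_span_L2: "\<psi> \<in> tensor_span \<Longrightarrow> \<psi> \<in> L2 (strip_measure d)"
  by (intro decaying_L2 tensor_span_decaying)

lemma sop_add:
  assumes "\<phi> \<in> tensor_span" "\<psi> \<in> tensor_span"
  shows "sop g h V (\<lambda>x. \<phi> x + \<psi> x) x = sop g h V \<phi> x + sop g h V \<psi> x"
  using assms
  by (simp add: sop_def tensor_span_partial_add tensor_span_partial_s(2) tensor_span_partial_u(2) algebra_simps)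

lemma partial_mult_s:
  assumes "\<psi> \<in> tensor_span" "smooth c"
  shows "partial_s (\<lambda>x. c (fst x) * \<psi> x) = (\<lambda>x. c (fst x) * partial_s \<psi> x + dv c (fst x) * \<psi> x)"
    "partial_u (\<lambda>x. c (fst x) * \<psi> x) = (\<lambda>x. c (fst x) * partial_u \<psi> x)"
proof -
  show "partial_s (\<lambda>x. c (fst x) * \<psi> x) = (\<lambda>x. c (fst x) * partial_s \<psi> x + dv c (fst x) * \<psi> x)"
  proof (rule partial_s_eqI)
    show "((\<lambda>t. c (fst (t, u)) * \<psi> (t, u)) has_vector_derivative
        c (fst (s, u)) * partial_s \<psi> (s, u) + dv c (fst (s, u)) * \<psi> (s, u)) (at s)" for s u
      using has_vector_derivative_mult[OF smooth_deriv(1)[OF assms(2)] tensor_span_partial_s(1)[OF assms(1)]]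
      by simp
  qed
  show "partial_u (\<lambda>x. c (fst x) * \<psi> x) = (\<lambda>x. c (fst x) * partial_u \<psi> x)"
  proof (rule partial_u_eqI)
    show "((\<lambda>t. c (fst (s, t)) * \<psi> (s, t)) has_vector_derivative
        c (fst (s, u)) * partial_u \<psi> (s, u)) (at u)" for s u
      using has_vector_derivative_mult_right[OF tensor_span_partial_u(1)[OF assms(1)], of "c s"] by simp
  qed
qed

text \<open>The terms with derivatives of \<open>c\<close> are the commutator of the operator with a
  cutoff function of s; the potential does not contribute to it.\<close>

lemma sop_mult_s:
  assumes "\<psi> \<in> tensor_span" "smooth c"
  shows "sop g h V (\<lambda>x. c (fst x) * \<psi> x) x = c (fst x) * sop g h V \<psi> x
    - of_real (g x) * (2 * dv c (fst x) * partial_s \<psi> x + dv (dv c) (fst x) * \<psi> x)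
    - of_real (h x) * (dv c (fst x) * \<psi> x)"
proof -
  have "partial_s (partial_s (\<lambda>x. c (fst x) * \<psi> x)) x
      = c (fst x) * partial_s (partial_s \<psi>) x + dv c (fst x) * partial_s \<psi> x
        + (dv c (fst x) * partial_s \<psi> x + dv (dv c) (fst x) * \<psi> x)"
    unfolding partial_mult_s(1)[OF assms]
    by (subst tensor_span_partial_add)
       (auto intro!: tensor_span_mult_s tensor_span_partial_s(2) smooth_deriv(2) assms
         simp: partial_mult_s[OF tensor_span_partial_s(2)[OF assms(1)] assms(2)]
           partial_mult_s[OF assms(1) smooth_deriv(2)[OF assms(2)]])
  moreover have "partial_u (partial_u (\<lambda>x. c (fst x) * \<psi> x)) x = c (fst x) * partial_u (partial_u \<psi>) x"
    unfolding partial_mult_s(2)[OF assms]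
    by (subst partial_mult_s(2)[OF tensor_span_partial_u(2)[OF assms(1)] assms(2)]) simp
  ultimately show ?thesis
    unfolding sop_def partial_mult_s(1)[OF assms] by (simp add: algebra_simps)
qed

section \<open>The quadratic form and symmetry\<close>

lemma isCont_section:
  fixes f :: "real \<times> real \<Rightarrow> complex"
  assumes "rapid f" shows "isCont (\<lambda>t. f (t, u)) s" "continuous_on UNIV (\<lambda>t. f (s, t))"
proof -
  have c: "continuous_on UNIV f" using assms by (simp add: rapid_def)
  have "continuous_on UNIV (\<lambda>t. f (t, u))"
    by (rule continuous_on_compose2[OF c]) (auto intro!: continuous_intros)
  then show "isCont (\<lambda>t. f (t, u)) s" by (simp add: continuous_on_eq_continuous_at)
  show "continuous_on UNIV (\<lambda>t. f (s, t))"
    by (rule continuous_on_compose2[OF c]) (auto intro!: continuous_intros)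
qed

lemma L2_inner_real_mult:
  "L2_inner M f (\<lambda>x. complex_of_real (w x) * k x) = L2_inner M (\<lambda>x. complex_of_real (w x) * f x) k"
  by (simp add: L2_inner_def mult.left_commute mult.assoc)

text \<open>Uniform ellipticity with \<open>h\<close> the s-derivative of \<open>g\<close>. All
  bounds are confined to 0 < u < d, where the curvature condition keeps the metric
  nondegenerate.\<close>

locale strip_coefficients =
  fixes d :: real and g h :: "real \<times> real \<Rightarrow> real" and g\<^sub>0 G B\<^sub>h :: real
  assumes d_pos: "d > 0" and g0_pos: "g\<^sub>0 > 0"
    and g_measurable: "g \<in> borel_measurable (strip_measure d)"
    and h_measurable: "h \<in> borel_measurable (strip_measure d)"
    and g_lower: "\<And>s u. 0 < u \<Longrightarrow> u < d \<Longrightarrow> g\<^sub>0 \<le> g (s, u)"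
    and g_upper: "\<And>s u. 0 < u \<Longrightarrow> u < d \<Longrightarrow> g (s, u) \<le> G"
    and h_bound: "\<And>s u. 0 < u \<Longrightarrow> u < d \<Longrightarrow> \<bar>h (s, u)\<bar> \<le> B\<^sub>h"
    and g_deriv: "\<And>s u. 0 < u \<Longrightarrow> u < d \<Longrightarrow> ((\<lambda>t. g (t, u)) has_real_derivative h (s, u)) (at s)"
    and h_cont: "\<And>s u. 0 < u \<Longrightarrow> u < d \<Longrightarrow> isCont (\<lambda>t. h (t, u)) s"
begin

abbreviation "M \<equiv> strip_measure d"

lemma g0_le_G: "g\<^sub>0 \<le> G"
  using g_lower[of "d/2" 0] g_upper[of "d/2" 0] d_pos by linarith

lemma G_pos: "G > 0" using g0_le_G g0_pos by linarith

lemma Bh_nonneg: "B\<^sub>h \<ge> 0"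
  using h_bound[of "d/2" 0] d_pos by linarith

lemma g_complex_measurable: "(\<lambda>x. complex_of_real (g x)) \<in> borel_measurable M"
  using g_measurable by measurable

lemma h_complex_measurable: "(\<lambda>x. complex_of_real (h x)) \<in> borel_measurable M"
  using h_measurable by measurable

lemma g_mult_decaying:
  assumes "decaying d f" shows "decaying d (\<lambda>x. of_real (g x) * f x)"
proof (rule decaying_mult_bounded[where B=G, OF assms])
  show "cmod (complex_of_real (g (s, u))) \<le> G" if "0 < u" "u < d" for s u
    using g_lower[OF that, of s] g_upper[OF that, of s] g0_pos by simp
qed (rule g_complex_measurable)

lemma h_mult_decaying: "decaying d f \<Longrightarrow> decaying d (\<lambda>x. of_real (h x) * f x)"
  by (rule decaying_mult_bounded[where B=B\<^sub>h]) (use h_complex_measurable h_bound in auto)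

text \<open>Quadratic growth is the most that the weight in \<open>rapid\<close> can
  compensate.\<close>

definition admissible :: "(real \<times> real \<Rightarrow> real) \<Rightarrow> bool" where
  "admissible V \<longleftrightarrow> V \<in> borel_measurable M \<and>
     (\<exists>B. \<forall>s u. 0 < u \<longrightarrow> u < d \<longrightarrow> \<bar>V (s, u)\<bar> \<le> B * (1 + s\<^sup>2))"

lemma admissible_mult_decaying:
  assumes "admissible V" "rapid f" shows "decaying d (\<lambda>x. of_real (V x) * f x)"
proof -
  obtain B where B: "\<And>s u. 0 < u \<Longrightarrow> u < d \<Longrightarrow> \<bar>V (s, u)\<bar> \<le> B * (1 + s\<^sup>2)"
    using assms(1) unfolding admissible_def by blast
  have [measurable]: "V \<in> borel_measurable M" using assms(1) by (simp add: admissible_def)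
  show ?thesis
    by (rule rapid_decaying_weighted[OF assms(2), where B=B]) (use B in auto)
qed

lemma sop_decaying:
  assumes "nice \<psi>" "admissible V" shows "decaying d (sop g h V \<psi>)"
proof -
  have "decaying d (\<lambda>x. - (of_real (g x) * partial_s (partial_s \<psi>) x + of_real (h x) * partial_s \<psi> x)
     - partial_u (partial_u \<psi>) x + of_real (V x) * \<psi> x)"
    using assms(1) unfolding nice_def
    by (intro decaying_add decaying_diff decaying_minus g_mult_decaying h_mult_decaying
        admissible_mult_decaying[OF assms(2)] rapid_decaying) auto
  then show ?thesis by (simp add: sop_def[abs_def])
qed

lemma sop_L2: "nice \<psi> \<Longrightarrow> admissible V \<Longrightarrow> sop g h V \<psi> \<in> L2 M"
  by (intro decaying_L2 sop_decaying)

text \<open>One integration by parts in each variable. The boundary terms at u = 0 and u = d carry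
  the factor \<open>cnj \<phi>\<close>, so the Dirichlet condition on the first argument removes
  them.\<close>

lemma sop_form:
  assumes \<phi>: "nice \<phi>" and \<psi>: "nice \<psi>" and V: "admissible V"
    and bc: "\<And>s. \<phi> (s, 0) = 0" "\<And>s. \<phi> (s, d) = 0"
  shows "L2_inner M \<phi> (sop g h V \<psi>) = L2_inner M (partial_s \<phi>) (\<lambda>x. of_real (g x) * partial_s \<psi> x)
    + L2_inner M (partial_u \<phi>) (partial_u \<psi>) + L2_inner M \<phi> (\<lambda>x. of_real (V x) * \<psi> x)"
proof -
  note dec = rapid_decaying[where d=d]
  have r: "rapid \<phi>" "rapid (partial_s \<phi>)" "rapid (partial_u \<phi>)" "rapid \<psi>" "rapid (partial_s \<psi>)"
    "rapid (partial_s (partial_s \<psi>))" "rapid (partial_u \<psi>)" "rapid (partial_u (partial_u \<psi>))"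
    using \<phi> \<psi> by (auto simp: nice_def)
  let ?q = "\<lambda>x. of_real (g x) * partial_s \<psi> x"
  let ?q' = "\<lambda>x. of_real (g x) * partial_s (partial_s \<psi>) x + of_real (h x) * partial_s \<psi> x"
  have q'dec: "decaying d ?q'"
    by (intro decaying_add g_mult_decaying h_mult_decaying dec r)
  have s: "L2_inner M \<phi> ?q' = - L2_inner M (partial_s \<phi>) ?q"
  proof (rule integration_by_parts_s)
    show "decaying d ?q" by (intro g_mult_decaying dec r)
    fix s u :: real assume u: "0 < u" "u < d"
    show "((\<lambda>t. \<phi> (t, u)) has_vector_derivative partial_s \<phi> (s, u)) (at s)"
      using \<phi> by (simp add: nice_def)
    have "((\<lambda>t. complex_of_real (g (t, u))) has_vector_derivative of_real (h (s, u))) (at s)"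
      by (rule has_vector_derivative_of_real[OF g_deriv[OF u]])
    moreover have "((\<lambda>t. partial_s \<psi> (t, u)) has_vector_derivative partial_s (partial_s \<psi>) (s, u)) (at s)"
      using \<psi> by (simp add: nice_def)
    ultimately show "((\<lambda>t. of_real (g (t, u)) * partial_s \<psi> (t, u)) has_vector_derivative
        of_real (g (s, u)) * partial_s (partial_s \<psi>) (s, u) + of_real (h (s, u)) * partial_s \<psi> (s, u)) (at s)"
      by (rule has_vector_derivative_mult)
    show "isCont (\<lambda>t. partial_s \<phi> (t, u)) s" by (rule isCont_section[OF r(2)])
    have "isCont (\<lambda>t. g (t, u)) s" by (rule DERIV_isCont[OF g_deriv[OF u]])
    then show "isCont (\<lambda>t. of_real (g (t, u)) * partial_s (partial_s \<psi>) (t, u) + of_real (h (t, u)) * partial_s \<psi> (t, u)) s"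
      by (intro continuous_intros isCont_section r h_cont u)
  qed (intro dec r q'dec)+
  have u: "L2_inner M \<phi> (partial_u (partial_u \<psi>)) = - L2_inner M (partial_u \<phi>) (partial_u \<psi>)"
    by (rule integration_by_parts_u[OF d_pos])
       (use \<phi> \<psi> bc in \<open>auto simp: nice_def intro: dec r isCont_section\<close>)
  have L: "\<phi> \<in> L2 M" "?q' \<in> L2 M" "partial_u (partial_u \<psi>) \<in> L2 M" "(\<lambda>x. of_real (V x) * \<psi> x) \<in> L2 M"
    by (intro decaying_L2 dec r q'dec admissible_mult_decaying[OF V])+
  have eq: "sop g h V \<psi> = (\<lambda>x. ((-1) * ?q' x - partial_u (partial_u \<psi>) x) + of_real (V x) * \<psi> x)"
    by (auto simp: sop_def)
  have "L2_inner M \<phi> (sop g h V \<psi>) = (-1) * L2_inner M \<phi> ?q' - L2_inner M \<phi> (partial_u (partial_u \<psi>))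
      + L2_inner M \<phi> (\<lambda>x. of_real (V x) * \<psi> x)"
    unfolding eq
    by (simp only: L2_inner_add_right[OF L(1) L2_diff[OF L2_scale[OF L(2)] L(3)] L(4)]
        L2_inner_diff_right[OF L(1) L2_scale[OF L(2)] L(3)] L2_inner_scale_right)
  then show ?thesis by (simp add: s u)
qed

text \<open>The right-hand side of the form identity is Hermitian, since g and V are real.\<close>

lemma sop_symmetric:
  assumes \<phi>: "nice \<phi>" and \<psi>: "nice \<psi>" and V: "admissible V"
    and bc: "\<And>s. \<phi> (s, 0) = 0" "\<And>s. \<phi> (s, d) = 0" "\<And>s. \<psi> (s, 0) = 0" "\<And>s. \<psi> (s, d) = 0"
  shows "L2_inner M \<phi> (sop g h V \<psi>) = L2_inner M (sop g h V \<phi>) \<psi>"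
proof -
  have swap: "cnj (L2_inner M f (\<lambda>x. complex_of_real (w x) * k x)) = L2_inner M k (\<lambda>x. complex_of_real (w x) * f x)"
    for f k w unfolding L2_inner_real_mult[of M f w k] by (rule L2_inner_cnj[symmetric])
  show ?thesis
    unfolding L2_inner_cnj[of M "sop g h V \<phi>" \<psi>] sop_form[OF \<psi> \<phi> V bc(3,4)] sop_form[OF \<phi> \<psi> V bc(1,2)]
    by (simp add: swap L2_inner_cnj[of M "partial_u \<phi>" "partial_u \<psi>"])
qed

lemma dirichlet_tensorsD:
  assumes "\<psi> \<in> dirichlet_tensors d"
  shows "\<psi> \<in> tensor_span" "nice \<psi>" "\<psi> (s, 0) = 0" "\<psi> (s, d) = 0" "\<psi> \<in> L2 M"
  using assms tensor_span_nice tensor_span_L2 by (auto simp: dirichlet_tensors_def)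

lemma sop_shift_lower_bound:
  assumes "\<psi> \<in> dirichlet_tensors d" "admissible V"
  shows "\<bar>Im z\<bar> * L2_norm M \<psi> \<le> L2_norm M (\<lambda>x. sop g h V \<psi> x - z * \<psi> x)"
  by (rule shift_lower_bound)
     (use assms dirichlet_tensorsD[OF assms(1)] in \<open>auto intro!: sop_L2 sop_symmetric\<close>)

lemma admissible_bounded:
  assumes "V \<in> borel_measurable M" "\<And>s u. 0 < u \<Longrightarrow> u < d \<Longrightarrow> \<bar>V (s, u)\<bar> \<le> B"
  shows "admissible V"
proof -
  have "\<bar>V (s, u)\<bar> \<le> \<bar>B\<bar> * (1 + s\<^sup>2)" if "0 < u" "u < d" for s u
  proof -
    have "\<bar>B\<bar> * 1 \<le> \<bar>B\<bar> * (1 + s\<^sup>2)" by (rule mult_left_mono) auto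
    then show ?thesis using assms(2)[OF that, of s] by linarith
  qed
  then show ?thesis using assms(1) unfolding admissible_def by blast
qed

end

section \<open>A priori bounds for constant coefficients\<close>

lemma strip_coefficients_const: "d > 0 \<Longrightarrow> C > 0 \<Longrightarrow> strip_coefficients d (\<lambda>_. C) (\<lambda>_. 0) C C 0"
  by unfold_locales auto

text \<open>Interpolation: ||\<partial>_s \<psi>||^2 is minus the inner product of \<psi> with
  \<partial>_s^2 \<psi>. It makes a first-order term small relative to the second-order one.\<close>

lemma L2_norm_partial_s_sq:
  assumes "\<psi> \<in> tensor_span"
  shows "(L2_norm (strip_measure d) (partial_s \<psi>))\<^sup>2
    \<le> L2_norm (strip_measure d) \<psi> * L2_norm (strip_measure d) (partial_s (partial_s \<psi>))"
proof -
  let ?M = "strip_measure d"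
  have t: "\<psi> \<in> tensor_span" "partial_s \<psi> \<in> tensor_span" "partial_s (partial_s \<psi>) \<in> tensor_span"
    using assms tensor_span_partial_s(2) by blast+
  have c: "isCont (\<lambda>t. f (t, u)) s" if "f \<in> tensor_span" for f s u
    using has_vector_derivative_continuous[OF tensor_span_partial_s(1)[OF that]] .
  have "L2_inner ?M \<psi> (partial_s (partial_s \<psi>)) = - L2_inner ?M (partial_s \<psi>) (partial_s \<psi>)"
    by (rule integration_by_parts_s)
       (intro tensor_span_decaying t tensor_span_partial_s(1) c)+
  then have "cmod (of_real ((L2_norm ?M (partial_s \<psi>))\<^sup>2)) = cmod (L2_inner ?M \<psi> (partial_s (partial_s \<psi>)))"
    by (simp only: L2_inner_self norm_minus_cancel)
  also have "\<dots> \<le> L2_norm ?M \<psi> * L2_norm ?M (partial_s (partial_s \<psi>))"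
    by (intro L2_cauchy_schwarz tensor_span_L2 t)
  finally show ?thesis by (simp del: of_real_power)
qed

text \<open>Moving one s-derivative and one u-derivative across turns the inner product into
  ||\<partial>_u \<partial>_s \<psi>||^2. The second step is allowed because \<partial>_s \<psi>
  inherits the Dirichlet condition. Mixed third derivatives occur on the way, which is harmless in
  the tensor span.\<close>

lemma Re_L2_inner_second_partials:
  assumes d: "d > 0" and \<psi>: "\<psi> \<in> dirichlet_tensors d"
  shows "0 \<le> Re (L2_inner (strip_measure d) (partial_s (partial_s \<psi>)) (partial_u (partial_u \<psi>)))"
proof -
  let ?M = "strip_measure d"
  have t: "\<psi> \<in> tensor_span" using \<psi> by (simp add: dirichlet_tensors_def)
  note ts = tensor_span_partial_s(2) and tu = tensor_span_partial_u(2)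
  have c: "isCont (\<lambda>t. f (t, u)) s" if "f \<in> tensor_span" for f s u
    using has_vector_derivative_continuous[OF tensor_span_partial_s(1)[OF that]] .
  have c': "continuous_on UNIV (\<lambda>t. f (s, t))" if "f \<in> tensor_span" for f s
    by (intro continuous_at_imp_continuous_on ballI has_vector_derivative_continuous[OF tensor_span_partial_u(1)[OF that]])
  have 1: "L2_inner ?M (partial_u (partial_u \<psi>)) (partial_s (partial_s \<psi>))
      = - L2_inner ?M (partial_s (partial_u (partial_u \<psi>))) (partial_s \<psi>)"
    by (rule integration_by_parts_s)
       (intro tensor_span_decaying t tensor_span_partial_s(1) c ts tu)+
  have 2: "partial_s (partial_u (partial_u \<psi>)) = partial_u (partial_u (partial_s \<psi>))"
    using t by (simp add: tensor_span_partial_commute tu)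
  have bc: "partial_s \<psi> (s, 0) = 0" "partial_s \<psi> (s, d) = 0" for s
    using \<psi> by (simp_all add: dirichlet_tensors_def partial_s_def)
  have 3: "L2_inner ?M (partial_s \<psi>) (partial_u (partial_u (partial_s \<psi>)))
      = - L2_inner ?M (partial_u (partial_s \<psi>)) (partial_u (partial_s \<psi>))"
    by (rule integration_by_parts_u[OF d])
       (intro tensor_span_decaying t tensor_span_partial_u(1) c' ts tu bc)+
  have "L2_inner ?M (partial_s (partial_s \<psi>)) (partial_u (partial_u \<psi>))
      = cnj (L2_inner ?M (partial_u (partial_u \<psi>)) (partial_s (partial_s \<psi>)))"
    by (rule L2_inner_cnj)
  also have "\<dots> = - L2_inner ?M (partial_s \<psi>) (partial_u (partial_u (partial_s \<psi>)))"
    unfolding 1 2 by (simp add: L2_inner_cnj[of ?M "partial_s \<psi>"])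
  also have "\<dots> = of_real ((L2_norm ?M (partial_u (partial_s \<psi>)))\<^sup>2)" unfolding 3 L2_inner_self by simp
  finally show ?thesis by (simp del: of_real_power)
qed

text \<open>Two uses of ||a + b||^2. Between the two second-order terms the cross term is
  nonnegative by the preceding lemma. Between S \<psi> and z \<psi> it vanishes, since z is
  imaginary and S symmetric, so P^2 = ||S \<psi>||^2 + |z|^2 ||\<psi>||^2.\<close>

lemma constant_coefficient_bounds:
  assumes d: "d > 0" and C: "C > 0" and \<psi>: "\<psi> \<in> dirichlet_tensors d" and \<kappa>: "Re z = 0"
  defines "P \<equiv> L2_norm (strip_measure d) (\<lambda>x. sop (\<lambda>_. C) (\<lambda>_. 0) (\<lambda>_. 0) \<psi> x - z * \<psi> x)"
  shows "C * L2_norm (strip_measure d) (partial_s (partial_s \<psi>)) \<le> P"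
    "cmod z * L2_norm (strip_measure d) \<psi> \<le> P"
proof -
  let ?M = "strip_measure d" and ?S = "sop (\<lambda>_. C) (\<lambda>_. 0) (\<lambda>_. 0) \<psi>"
  interpret c: strip_coefficients d "\<lambda>_. C" "\<lambda>_. 0" C C 0 by (rule strip_coefficients_const[OF d C])
  have t: "\<psi> \<in> tensor_span" "partial_s (partial_s \<psi>) \<in> tensor_span" "partial_u (partial_u \<psi>) \<in> tensor_span"
    by (intro tensor_span_partial_s(2) tensor_span_partial_u(2) c.dirichlet_tensorsD(1)[OF \<psi>])+
  have adm: "c.admissible (\<lambda>_. 0)" by (rule c.admissible_bounded[where B=0]) auto
  have SL: "?S \<in> L2 ?M" by (rule c.sop_L2[OF c.dirichlet_tensorsD(2)[OF \<psi>] adm])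
  have \<psi>L: "\<psi> \<in> L2 ?M" by (rule tensor_span_L2[OF t(1)])
  let ?a = "\<lambda>x. of_real (- C) * partial_s (partial_s \<psi>) x" and ?b = "\<lambda>x. (-1) * partial_u (partial_u \<psi>) x"
  have aL: "?a \<in> L2 ?M" "?b \<in> L2 ?M" by (intro L2_scale tensor_span_L2 t)+
  have S: "?S = (\<lambda>x. ?a x + ?b x)" by (auto simp: sop_def)
  have "(C * L2_norm ?M (partial_s (partial_s \<psi>)))\<^sup>2 = (L2_norm ?M ?a)\<^sup>2"
    using C by (simp only: L2_norm_scale norm_of_real) simp
  also have "\<dots> \<le> (L2_norm ?M ?S)\<^sup>2"
  proof -
    have "L2_inner ?M ?a ?b = of_real C * L2_inner ?M (partial_s (partial_s \<psi>)) (partial_u (partial_u \<psi>))"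
      by (simp only: L2_inner_scale_left L2_inner_scale_right) simp
    then have "Re (L2_inner ?M ?a ?b) \<ge> 0"
      using C Re_L2_inner_second_partials[OF d \<psi>] by simp
    then show ?thesis unfolding S L2_norm_add_sq[OF aL] using zero_le_power2[of "L2_norm ?M ?b"] by linarith
  qed
  also have 1: "(L2_norm ?M ?S)\<^sup>2 + (cmod z * L2_norm ?M \<psi>)\<^sup>2 = P\<^sup>2"
  proof -
    have "Im (L2_inner ?M \<psi> ?S) = 0"
    proof -
      have "L2_inner ?M \<psi> ?S = L2_inner ?M ?S \<psi>"
        by (rule c.sop_symmetric) (use c.dirichlet_tensorsD[OF \<psi>] adm in auto)
      then show ?thesis using L2_inner_cnj[of ?M ?S \<psi>] by (simp add: complex_eq_iff)
    qed
    then have "Re (L2_inner ?M ?S (\<lambda>x. - z * \<psi> x)) = 0"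
      unfolding L2_inner_scale_right using \<kappa> by (simp add: L2_inner_cnj[of ?M ?S \<psi>])
    then show ?thesis
      using L2_norm_add_sq[OF SL L2_scale[OF \<psi>L, of "- z"]]
      unfolding P_def L2_norm_scale by (simp add: power_mult_distrib)
  qed
  finally have 2: "(C * L2_norm ?M (partial_s (partial_s \<psi>)))\<^sup>2 \<le> P\<^sup>2"
    using 1 by (smt (verit) zero_le_power2)
  have P0: "P \<ge> 0" by (simp add: P_def)
  show "C * L2_norm ?M (partial_s (partial_s \<psi>)) \<le> P" by (rule power2_le_imp_le[OF 2 P0])
  have "(cmod z * L2_norm ?M \<psi>)\<^sup>2 \<le> P\<^sup>2" using 1 by (smt (verit) zero_le_power2)
  then show "cmod z * L2_norm ?M \<psi> \<le> P" by (rule power2_le_imp_le[OF _ P0])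
qed

section \<open>Totality of the transverse sine modes\<close>

definition closed_L2_subspace :: "'a measure \<Rightarrow> ('a \<Rightarrow> complex) set \<Rightarrow> bool" where
  "closed_L2_subspace M S \<longleftrightarrow> S \<subseteq> L2 M \<and> (\<lambda>x. 0) \<in> S \<and>
     (\<forall>f\<in>S. \<forall>g\<in>S. (\<lambda>x. f x + g x) \<in> S) \<and> (\<forall>c. \<forall>f\<in>S. (\<lambda>x. c * f x) \<in> S) \<and>
     (\<forall>f\<in>L2 M. (\<forall>\<epsilon>>0. \<exists>g\<in>S. L2_norm M (\<lambda>x. g x - f x) < \<epsilon>) \<longrightarrow> f \<in> S)"

lemma closed_L2_subspace_add: "closed_L2_subspace M S \<Longrightarrow> f \<in> S \<Longrightarrow> g \<in> S \<Longrightarrow> (\<lambda>x. f x + g x) \<in> S"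
  by (simp add: closed_L2_subspace_def)

lemma closed_L2_subspace_scale: "closed_L2_subspace M S \<Longrightarrow> f \<in> S \<Longrightarrow> (\<lambda>x. c * f x) \<in> S"
  by (simp add: closed_L2_subspace_def)

lemma closed_L2_subspace_zero: "closed_L2_subspace M S \<Longrightarrow> (\<lambda>x. 0) \<in> S"
  by (simp add: closed_L2_subspace_def)

lemma closed_L2_subspace_diff:
  assumes "closed_L2_subspace M S" "f \<in> S" "g \<in> S" shows "(\<lambda>x. f x - g x) \<in> S"
  using closed_L2_subspace_add[OF assms(1,2) closed_L2_subspace_scale[OF assms(1,3), of "-1"]] by simp

lemma closed_L2_subspace_sum:
  "closed_L2_subspace M S \<Longrightarrow> (\<And>i. i \<in> I \<Longrightarrow> f i \<in> S) \<Longrightarrow> (\<lambda>x. \<Sum>i\<in>I. f i x) \<in> S"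
  by (induction I rule: infinite_finite_induct)
     (auto intro: closed_L2_subspace_add closed_L2_subspace_zero)

text \<open>The form in which closedness is used: each enlargement of the subspace below is a
  dominated pointwise limit.\<close>

lemma closed_L2_subspace_dominated:
  assumes S: "closed_L2_subspace M S" and w: "w \<in> L2 M" and f: "\<And>n::nat. f n \<in> S"
    and g: "g \<in> borel_measurable M" and dom: "\<And>n. AE x in M. cmod (f n x) \<le> cmod (w x)"
    and lim: "AE x in M. (\<lambda>n. f n x) \<longlonglongrightarrow> g x"
  shows "g \<in> S"
proof -
  have fL: "f n \<in> L2 M" for n using S f[of n] by (auto simp: closed_L2_subspace_def)
  have gL: "g \<in> L2 M" and *: "(\<lambda>n. L2_norm M (\<lambda>x. f n x - g x)) \<longlonglongrightarrow> 0"
    by (rule L2_dominated_convergence[OF w g L2_measurable[OF fL] dom lim])+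
  have "\<exists>h\<in>S. L2_norm M (\<lambda>x. h x - g x) < \<epsilon>" if "\<epsilon> > 0" for \<epsilon>
  proof -
    have "\<forall>\<^sub>F n in sequentially. L2_norm M (\<lambda>x. f n x - g x) < \<epsilon>"
      by (rule order_tendstoD(2)[OF *]) (rule that)
    then obtain n where "L2_norm M (\<lambda>x. f n x - g x) < \<epsilon>"
      using eventually_happens trivial_limit_sequentially by blast
    then show ?thesis using f by blast
  qed
  then show ?thesis using S gL by (simp add: closed_L2_subspace_def)
qed

lemma decaying_bounded_support:
  assumes "f \<in> borel_measurable (strip_measure d)" "\<And>x. cmod (f x) \<le> B" "\<And>s u. \<bar>s\<bar> > R \<Longrightarrow> f (s, u) = 0"
  shows "decaying d f"
proof (rule decayingI[OF assms(1)])
  fix s u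
  have B: "B \<ge> 0" using assms(2)[of undefined] norm_ge_zero order_trans by blast
  show "cmod (f (s, u)) \<le> (B * (1 + R\<^sup>2)) / (1 + s\<^sup>2)"
  proof (cases "\<bar>s\<bar> > R")
    case True
    then show ?thesis using assms(3)[OF True, of u] B one_plus_sq_pos[of s] one_plus_sq_pos[of R] by simp
  next
    case False
    then have "s\<^sup>2 \<le> R\<^sup>2" by (metis abs_ge_zero linorder_not_less power2_abs power_mono)
    then have "cmod (f (s, u)) * (1 + s\<^sup>2) \<le> B * (1 + R\<^sup>2)"
      using assms(2)[of "(s, u)"] B by (intro mult_mono) auto
    then show ?thesis using one_plus_sq_pos[of s] by (simp add: field_simps)
  qed
qed

text \<open>Inside the interval the functions are exp(-1 / (n (s - a))) exp(-1 / (n (b - s))) with n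
  replaced by n + 1. They stay below the indicator, so the indicator itself is the dominating
  function.\<close>

lemma approx_indicator_smooth:
  fixes a b :: real
  defines "h \<equiv> \<lambda>n::nat. \<lambda>s. complex_of_real (flat 1 (real (Suc n) * s + (- real (Suc n) * a)) * flat 1 ((- real (Suc n)) * s + real (Suc n) * b))"
  shows "test_fun (h n)" "cmod (h n s) \<le> indicator {a<..<b} s" "(\<lambda>n. h n s) \<longlonglongrightarrow> indicator {a<..<b} s"
proof -
  have e1: "real (Suc n) * s + (- real (Suc n) * a) = real (Suc n) * (s - a)" for n s
    by (simp add: algebra_simps)
  have e2: "(- real (Suc n)) * s + real (Suc n) * b = real (Suc n) * (b - s)" for n s
    by (simp add: algebra_simps)
  have le: "flat 1 x \<le> 1" for x by (auto simp: flat_def)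
  have 0: "h n s = 0" if "s \<notin> {a<..<b}" for n s
  proof -
    have "real (Suc n) * (s - a) \<le> 0 \<or> real (Suc n) * (b - s) \<le> 0"
      using that by (auto simp: mult_le_0_iff)
    then show ?thesis unfolding h_def e1 e2 using flat_1_nonneg(3) by auto
  qed
  have "smooth (h n)"
    unfolding h_def of_real_mult[of "flat _ _"] by (intro smooth_mult smooth_affine[OF smooth_flat])
  moreover have "h n s = 0" if "\<bar>s\<bar> > max \<bar>a\<bar> \<bar>b\<bar>" for s
    by (rule 0) (use that in auto)
  ultimately show "test_fun (h n)" unfolding test_fun_def by blast
  show "cmod (h n s) \<le> indicator {a<..<b} s"
  proof (cases "s \<in> {a<..<b}")
    case True
    have "cmod (h n s) = flat 1 (real (Suc n) * (s - a)) * flat 1 (real (Suc n) * (b - s))"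
      unfolding h_def e1 e2 norm_of_real by (simp add: abs_mult flat_1_nonneg(1))
    also have "\<dots> \<le> 1" by (intro mult_le_one le flat_1_nonneg(1))
    finally show ?thesis using True by simp
  qed (use 0 in auto)
  show "(\<lambda>n. h n s) \<longlonglongrightarrow> indicator {a<..<b} s"
  proof (cases "s \<in> {a<..<b}")
    case True
    have lim: "(\<lambda>n. flat 1 (real (Suc n) * c)) \<longlonglongrightarrow> 1" if c: "c > 0" for c
    proof -
      have "(\<lambda>n. exp (- (inverse (real (Suc n)) * inverse c))) \<longlonglongrightarrow> exp (- (0 * inverse c))"
        by (intro tendsto_intros LIMSEQ_inverse_real_of_nat)
      moreover have "flat 1 (real (Suc n) * c) = exp (- (inverse (real (Suc n)) * inverse c))" for n
        using c by (simp add: flat_def divide_inverse del: of_nat_Suc)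
      ultimately show ?thesis by simp
    qed
    have "(\<lambda>n. complex_of_real (flat 1 (real (Suc n) * (s - a)) * flat 1 (real (Suc n) * (b - s)))) \<longlonglongrightarrow> of_real (1 * 1)"
      by (intro tendsto_of_real tendsto_mult lim) (use True in auto)
    then show ?thesis using True unfolding h_def e1 e2 by simp
  qed (use 0 in auto)
qed

text \<open>Tents of slope n truncated at height 1.\<close>

lemma approx_indicator_continuous:
  fixes c e :: real
  defines "v \<equiv> \<lambda>n::nat. \<lambda>u. min 1 (real n * max 0 (min (u - c) (e - u)))"
  shows "continuous_on UNIV (v n)" "\<bar>v n u\<bar> \<le> 1" "(\<lambda>n. v n u) \<longlonglongrightarrow> indicator {c<..<e} u"
proof -
  show "continuous_on UNIV (v n)" unfolding v_def by (intro continuous_intros)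
  have "0 \<le> v n u" unfolding v_def by simp
  then show "\<bar>v n u\<bar> \<le> 1" unfolding v_def by simp
  show "(\<lambda>n. v n u) \<longlonglongrightarrow> indicator {c<..<e} u"
  proof (cases "u \<in> {c<..<e}")
    case True
    define m where "m = min (u - c) (e - u)"
    have m: "m > 0" using True by (auto simp: m_def)
    obtain N :: nat where N: "real N * m > 1" using reals_Archimedean3[OF m] by blast
    have "v n u = 1" if "n \<ge> N" for n
    proof -
      have "real n * m \<ge> real N * m" using that m by (intro mult_right_mono) auto
      then have "real n * m > 1" using N by linarith
      then show ?thesis using m unfolding v_def m_def[symmetric] by simp
    qed
    then have "\<forall>\<^sub>F n in sequentially. v n u = 1" by (auto simp: eventually_sequentially)
    then have "(\<lambda>n. v n u) \<longlonglongrightarrow> 1" by (rule tendsto_eventually)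
    then show ?thesis using True by simp
  next
    case False
    then have "max 0 (min (u - c) (e - u)) = 0" by auto
    then have "v n u = 0" for n by (simp add: v_def)
    then show ?thesis using False by simp
  qed
qed

text \<open>No Fourier series is summed. Products of cosines with sin(k u) give all polynomials in
  cos(k u) times sin(k u); Weierstrass approximation gives all continuous functions times sin(k u),
  then indicators of rectangles and of Borel sets. As sin(k u) > 0 inside the strip, an arbitrary f
  is reached through f / sin(k u).\<close>

theorem sine_modes_total:
  assumes d: "d > 0" and S: "closed_L2_subspace (strip_measure d) S"
    and modes: "\<And>h n. test_fun h \<Longrightarrow> (\<lambda>x. h (fst x) * of_real (sin (real n * (pi / d) * snd x))) \<in> S"
  shows "S = L2 (strip_measure d)"
proof -
  let ?M = "strip_measure d"
  define k where "k = pi / d"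
  have k: "k > 0" using d by (simp add: k_def)
  note add = closed_L2_subspace_add[OF S] and scale = closed_L2_subspace_scale[OF S]
    and dominated = closed_L2_subspace_dominated[OF S] and diff = closed_L2_subspace_diff[OF S]
    and sum = closed_L2_subspace_sum[OF S]
  \<comment> \<open>The identity 2 cos t sin(n t) = sin((n + 1) t) + sin((n - 1) t) trades a cosine
    for neighbouring modes, so n must be arbitrary in the induction; n = 0 is the zero function and
    treated apart.\<close>
  have "(\<lambda>x. h (fst x) * of_real (cos (k * snd x) ^ j * sin (real n * k * snd x))) \<in> S"
    if h: "test_fun h" for h j n
  proof (induction j arbitrary: n)
    case 0
    then show ?case using modes[OF h, of n] by (simp add: k_def)
  next
    case (Suc j)
    show ?case
    proof (cases n)
      case 0
      then show ?thesis using closed_L2_subspace_zero[OF S] by simp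
    next
      case (Suc m)
      have trig: "cos t * sin (real (Suc m) * t) = (1/2) * (sin (real (Suc (Suc m)) * t) + sin (real m * t))" for t
        using sin_times_cos[of "real (Suc m) * t" t] by (simp add: algebra_simps)
      have "(\<lambda>x. (1/2) * (h (fst x) * of_real (cos (k * snd x) ^ j * sin (real (Suc (Suc m)) * k * snd x))
           + h (fst x) * of_real (cos (k * snd x) ^ j * sin (real m * k * snd x)))) \<in> S"
        by (intro scale add Suc.IH)
      moreover have "(1/2) * (h (fst x) * of_real (cos (k * snd x) ^ j * sin (real (Suc (Suc m)) * k * snd x))
           + h (fst x) * of_real (cos (k * snd x) ^ j * sin (real m * k * snd x)))
         = h (fst x) * of_real (cos (k * snd x) ^ Suc j * sin (real n * k * snd x))" for x :: "real \<times> real"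
      proof -
        have "cos (k * snd x) ^ Suc j * sin (real n * k * snd x)
            = cos (k * snd x) ^ j * (cos (k * snd x) * sin (real (Suc m) * (k * snd x)))"
          by (simp add: Suc mult.assoc)
        also have "\<dots> = (1/2) * (cos (k * snd x) ^ j * sin (real (Suc (Suc m)) * k * snd x)
            + cos (k * snd x) ^ j * sin (real m * k * snd x))"
          unfolding trig by (simp add: algebra_simps)
        finally show ?thesis by (simp only: of_real_mult of_real_add) (simp add: algebra_simps)
      qed
      ultimately show ?thesis by simp
    qed
  qed
  note modes' = this
  have cos_modes: "(\<lambda>x. h (fst x) * of_real (cos (k * snd x) ^ j * sin (k * snd x))) \<in> S"
    if h: "test_fun h" for h j
    using modes'[OF h, of j 1] by (simp only: of_nat_1 mult_1)
  have polys: "(\<lambda>x. h (fst x) * of_real ((\<Sum>i\<le>n. a i * cos (k * snd x) ^ i) * sin (k * snd x))) \<in> S"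
    if h: "test_fun h" for h a and n :: nat
  proof -
    have "(\<lambda>x. \<Sum>i\<le>n. of_real (a i) * (h (fst x) * of_real (cos (k * snd x) ^ i * sin (k * snd x)))) \<in> S"
      by (intro sum scale cos_modes[OF h])
    moreover have "(\<Sum>i\<le>n. of_real (a i) * (h (fst x) * of_real (cos (k * snd x) ^ i * sin (k * snd x))))
        = h (fst x) * of_real ((\<Sum>i\<le>n. a i * cos (k * snd x) ^ i) * sin (k * snd x))" for x :: "real \<times> real"
      by (simp add: sum_distrib_left sum_distrib_right ac_simps)
    ultimately show ?thesis by simp
  qed
  have smooth_cont: "(\<lambda>x. h (fst x) * complex_of_real (v (snd x) * sin (k * snd x))) \<in> S"
    if h: "test_fun h" and v: "continuous_on UNIV v" for h v
  proof -
    obtain R where R: "\<And>s. \<bar>s\<bar> > R \<Longrightarrow> h s = 0" using h by (auto simp: test_fun_def)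
    obtain K where K: "K \<ge> 0" "\<And>s. cmod (h s) \<le> K" using test_fun_bounded[OF h] by blast
    have ch: "continuous_on UNIV h" by (rule smooth_continuous[OF test_fun_smooth[OF h]])
    have "\<exists>g. real_polynomial_function g \<and> (\<forall>x\<in>{-1..1}. \<bar>v (arccos x / k) - g x\<bar> < 1 / real (Suc n))" for n
    \<comment> \<open>On [0, pi] the cosine is inverted by \<open>arccos\<close>, so a continuous
      function of u is a continuous function of cos(k u) on [-1, 1], where polynomials are
      dense.\<close>
    proof -
      have "continuous_on {-1..1} (\<lambda>x. v (arccos x / k))"
        by (rule continuous_on_compose2[OF v]) (use k in \<open>auto intro!: continuous_intros\<close>)
      then show ?thesis
        using Stone_Weierstrass_real_polynomial_function[of "{-1..1::real}" "\<lambda>x. v (arccos x / k)" "1 / real (Suc n)"]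
        by (metis compact_Icc of_nat_0_less_iff zero_less_Suc zero_less_divide_1_iff)
    qed
    then obtain g where g: "\<And>n. real_polynomial_function (g n)"
        "\<And>n x. x \<in> {-1..1} \<Longrightarrow> \<bar>v (arccos x / k) - g n x\<bar> < 1 / real (Suc n)" by metis
    have gv: "\<bar>v u - g n (cos (k * u))\<bar> < 1 / real (Suc n)" if "0 < u" "u < d" for u n
    proof -
      have "0 \<le> k * u" "k * u \<le> pi" using that k d by (auto simp: k_def field_simps)
      then have "arccos (cos (k * u)) = k * u" by (rule arccos_cos)
      then show ?thesis using g(2)[of "cos (k * u)" n] k by simp
    qed
    have "bounded (v ` {0..d})"
      by (intro compact_imp_bounded compact_continuous_image continuous_on_subset[OF v]) auto
    then obtain B where "\<forall>u\<in>{0..d}. \<bar>v u\<bar> \<le> B" by (auto simp: bounded_iff)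
    then have B: "\<And>u. u \<in> {0..d} \<Longrightarrow> \<bar>v u\<bar> \<le> B" by blast
    show ?thesis
    proof (rule dominated[where f="\<lambda>n x. h (fst x) * of_real (g n (cos (k * snd x)) * sin (k * snd x))"
        and w="\<lambda>x. of_real (B + 1) * h (fst x)"])
      have "decaying d (\<lambda>x. h (fst x))"
        by (rule decaying_bounded_support[of _ _ K R])
           (use K R in \<open>auto intro!: strip_measurable_continuous continuous_on_compose2[OF ch] continuous_intros\<close>)
      then show "(\<lambda>x. of_real (B + 1) * h (fst x)) \<in> L2 ?M" by (intro L2_scale decaying_L2)
      show "(\<lambda>x. h (fst x) * of_real (g n (cos (k * snd x)) * sin (k * snd x))) \<in> S" for n
      proof -
        obtain a m where "g n = (\<lambda>x. \<Sum>i\<le>m. a i * x ^ i)"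
          using g(1)[of n] by (auto simp: real_polynomial_function_iff_sum)
        then show ?thesis using polys[OF h, where n=m and a=a] by simp
      qed
      show "(\<lambda>x. h (fst x) * complex_of_real (v (snd x) * sin (k * snd x))) \<in> borel_measurable ?M"
        by (intro strip_measurable_continuous continuous_intros continuous_on_compose2[OF ch]
            continuous_on_compose2[OF v]) auto
      show "AE x in ?M. cmod (h (fst x) * of_real (g n (cos (k * snd x)) * sin (k * snd x)))
          \<le> cmod (of_real (B + 1) * h (fst x))" for n
      proof (rule AE_stripI)
        fix s u assume u: "0 < u" "u < d"
        have "1 / real (Suc n) \<le> 1" by simp
        then have 1: "\<bar>g n (cos (k * u))\<bar> \<le> B + 1"
        proof -
          have "\<bar>v u\<bar> \<le> B" by (rule B) (use u in auto)
          then show ?thesis using gv[OF u, of n] \<open>1 / real (Suc n) \<le> 1\<close> by linarith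
        qed
        have "\<bar>g n (cos (k * u))\<bar> * \<bar>sin (k * u)\<bar> \<le> (B + 1) * 1"
          by (rule mult_mono[OF 1]) (use 1 in auto)
        then have "cmod (h s) * (\<bar>g n (cos (k * u))\<bar> * \<bar>sin (k * u)\<bar>) \<le> cmod (h s) * \<bar>B + 1\<bar>"
          by (intro mult_left_mono) auto
        then show "cmod (h (fst (s, u)) * of_real (g n (cos (k * snd (s, u))) * sin (k * snd (s, u))))
            \<le> cmod (of_real (B + 1) * h (fst (s, u)))"
          unfolding norm_mult norm_of_real by (simp add: abs_mult mult.commute)
      qed
      show "AE x in ?M. (\<lambda>n. h (fst x) * of_real (g n (cos (k * snd x)) * sin (k * snd x)))
          \<longlonglongrightarrow> h (fst x) * complex_of_real (v (snd x) * sin (k * snd x))"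
      proof (rule AE_stripI)
        fix s u assume u: "0 < u" "u < d"
        have "(\<lambda>n. g n (cos (k * u))) \<longlonglongrightarrow> v u"
        proof (rule LIMSEQ_I)
          fix e :: real assume "e > 0"
          then obtain N where N: "1 / real (Suc N) < e" using nat_approx_posE by blast
          have "norm (g n (cos (k * u)) - v u) < e" if "n \<ge> N" for n
          proof -
            have "1 / real (Suc n) \<le> 1 / real (Suc N)" using that by (simp add: frac_le)
            then show ?thesis using gv[OF u, of n] N by (simp add: abs_minus_commute)
          qed
          then show "\<exists>N. \<forall>n\<ge>N. norm (g n (cos (k * u)) - v u) < e" by blast
        qed
        then show "(\<lambda>n. h (fst (s, u)) * of_real (g n (cos (k * snd (s, u))) * sin (k * snd (s, u))))
          \<longlonglongrightarrow> h (fst (s, u)) * of_real (v (snd (s, u)) * sin (k * snd (s, u)))"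
          by (intro tendsto_intros) simp
      qed
    qed
  qed
  have ind_L2: "(\<lambda>x. complex_of_real C * indicator {a<..<b} (fst x)) \<in> L2 ?M" for a b C :: real
  proof (intro L2_scale decaying_L2 decaying_bounded_support[of _ _ 1 "max \<bar>a\<bar> \<bar>b\<bar>"])
    show "(\<lambda>x. indicator {a<..<b} (fst x)) \<in> borel_measurable ?M"
      by (rule strip_measurableI, unfold borel_prod[symmetric]) measurable
  qed (auto simp: indicator_def)
  have ind_cont: "(\<lambda>x. indicator {a<..<b} (fst x) * complex_of_real (v (snd x) * sin (k * snd x))) \<in> S"
    if v: "continuous_on UNIV v" for a b v
  proof -
    have "bounded (v ` {0..d})"
      by (intro compact_imp_bounded compact_continuous_image continuous_on_subset[OF v]) auto
    then obtain B where "\<forall>u\<in>{0..d}. \<bar>v u\<bar> \<le> B" by (auto simp: bounded_iff)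
    then have B: "\<And>u. u \<in> {0..d} \<Longrightarrow> \<bar>v u\<bar> \<le> B" by blast
    obtain h :: "nat \<Rightarrow> real \<Rightarrow> complex" where h: "\<And>n. test_fun (h n)"
        "\<And>n s. cmod (h n s) \<le> indicator {a<..<b} s" "\<And>s. (\<lambda>n. h n s) \<longlonglongrightarrow> indicator {a<..<b} s"
      by (rule that[OF approx_indicator_smooth[where a=a and b=b]])
    show ?thesis
    proof (rule dominated[where w="\<lambda>x. complex_of_real B * indicator {a<..<b} (fst x)", OF _ smooth_cont[OF h(1) v]])
      show "(\<lambda>x. complex_of_real B * indicator {a<..<b} (fst x)) \<in> L2 ?M" by (rule ind_L2)
      show "(\<lambda>x. indicator {a<..<b} (fst x) * complex_of_real (v (snd x) * sin (k * snd x))) \<in> borel_measurable ?M"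
      proof (rule borel_measurable_times)
        show "(\<lambda>x. indicator {a<..<b} (fst x) :: complex) \<in> borel_measurable ?M"
          by (rule strip_measurableI, unfold borel_prod[symmetric]) measurable
        show "(\<lambda>x. complex_of_real (v (snd x) * sin (k * snd x))) \<in> borel_measurable ?M"
          by (intro strip_measurable_continuous continuous_intros continuous_on_compose2[OF v]) auto
      qed
      show "AE x in ?M. cmod (h n (fst x) * complex_of_real (v (snd x) * sin (k * snd x))) \<le> cmod (complex_of_real B * indicator {a<..<b} (fst x))" for n
      proof (rule AE_stripI)
        fix s u assume u: "0 < u" "u < d"
        have "\<bar>v u\<bar> * \<bar>sin (k * u)\<bar> \<le> B * 1" by (rule mult_mono) (use B[of u] u in auto)
        then have "cmod (h n s) * (\<bar>v u\<bar> * \<bar>sin (k * u)\<bar>) \<le> indicator {a<..<b} s * \<bar>B\<bar>"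
          by (intro mult_mono h(2)) auto
        then show "cmod (h n (fst (s, u)) * of_real (v (snd (s, u)) * sin (k * snd (s, u))))
            \<le> cmod (complex_of_real B * indicator {a<..<b} (fst (s, u)))"
          unfolding norm_mult norm_of_real by (auto simp: abs_mult indicator_def)
      qed
      show "AE x in ?M. (\<lambda>n. h n (fst x) * complex_of_real (v (snd x) * sin (k * snd x)))
          \<longlonglongrightarrow> indicator {a<..<b} (fst x) * complex_of_real (v (snd x) * sin (k * snd x))"
        by (intro AE_I2 tendsto_intros h(3))
    qed
  qed
  have rect: "(\<lambda>x. indicator {a<..<b} (fst x) * complex_of_real (indicator {c<..<e} (snd x) * sin (k * snd x))) \<in> S"
    for a b c e
  proof -
    obtain v :: "nat \<Rightarrow> real \<Rightarrow> real" where v: "\<And>n. continuous_on UNIV (v n)"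
        "\<And>n u. \<bar>v n u\<bar> \<le> 1" "\<And>u. (\<lambda>n. v n u) \<longlonglongrightarrow> indicator {c<..<e} u"
      by (rule that[OF approx_indicator_continuous[where c=c and e=e]])
    show ?thesis
    proof (rule dominated[where w="\<lambda>x. complex_of_real 1 * indicator {a<..<b} (fst x)", OF _ ind_cont[OF v(1)]])
      show "(\<lambda>x. complex_of_real 1 * indicator {a<..<b} (fst x)) \<in> L2 ?M" by (rule ind_L2)
      show "(\<lambda>x. indicator {a<..<b} (fst x) * complex_of_real (indicator {c<..<e} (snd x) * sin (k * snd x))) \<in> borel_measurable ?M"
        by (rule strip_measurableI, unfold borel_prod[symmetric]) measurable
      show "AE x in ?M. cmod (indicator {a<..<b} (fst x) * complex_of_real (v n (snd x) * sin (k * snd x))) \<le> cmod (complex_of_real 1 * indicator {a<..<b} (fst x))" for n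
      proof (rule AE_stripI)
        fix s u
        have "\<bar>v n u\<bar> * \<bar>sin (k * u)\<bar> \<le> 1 * 1" by (rule mult_mono) (use v(2) in auto)
        then show "cmod (indicator {a<..<b} (fst (s, u)) * of_real (v n (snd (s, u)) * sin (k * snd (s, u))))
            \<le> cmod (complex_of_real 1 * indicator {a<..<b} (fst (s, u)))"
          unfolding norm_mult norm_of_real by (auto simp: abs_mult indicator_def)
      qed
      show "AE x in ?M. (\<lambda>n. indicator {a<..<b} (fst x) * complex_of_real (v n (snd x) * sin (k * snd x)))
          \<longlonglongrightarrow> indicator {a<..<b} (fst x) * complex_of_real (indicator {c<..<e} (snd x) * sin (k * snd x))"
        by (intro AE_I2 tendsto_intros v(3))
    qed
  qed
  \<comment> \<open>The bounded window |s| < n makes \<open>J n B\<close> square integrable for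
    every Borel set; the sine stays as a factor because membership in S has been obtained only with
    it.\<close>
  define J where "J n B x = indicator {- real n<..<real n} (fst x) * (indicator B x * complex_of_real (sin (k * snd x)))"
    for n :: nat and B :: "(real \<times> real) set" and x :: "real \<times> real"
  have J_measurable: "J n B \<in> borel_measurable ?M" if B: "B \<in> sets borel" for n B
  proof -
    have "(\<lambda>x. indicator {- real n<..<real n} (fst x) :: complex) \<in> borel_measurable ?M"
      by (rule strip_measurableI, unfold borel_prod[symmetric]) measurable
    moreover have "(\<lambda>x. indicator B x :: complex) \<in> borel_measurable ?M"
      by (intro strip_measurableI borel_measurable_indicator B)
    moreover have "(\<lambda>x. complex_of_real (sin (k * snd x))) \<in> borel_measurable ?M"
      by (rule strip_measurable_continuous) (intro continuous_intros)
    ultimately show ?thesis unfolding J_def[abs_def] by (intro borel_measurable_times)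
  qed
  have borel_sets: "J n B \<in> S" if B: "B \<in> sets borel" for n B
  proof -
    have box: "box (a, c) (b, e) = {a<..<b} \<times> {c<..<e}" for a b c e :: real
      by (force simp: box_def Basis_prod_def)
    have JU: "J n UNIV \<in> S"
      using ind_cont[of "\<lambda>_. 1" "- real n" "real n"] by (simp add: J_def[abs_def])
    \<comment> \<open>Boxes form an intersection-stable generator of the Borel sets. Complements are
      taken relative to the window through \<open>J n UNIV\<close>, disjoint unions by dominated
      convergence.\<close>
    have "Int_stable (range (\<lambda>(a, b). box a b :: (real \<times> real) set))"
      by (auto simp: Int_stable_def box_Int_box)
    moreover have "range (\<lambda>(a, b). box a b :: (real \<times> real) set) \<subseteq> Pow UNIV" by simp
    moreover have "B \<in> sigma_sets UNIV (range (\<lambda>(a, b). box a b))"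
      using B by (subst (asm) borel_eq_box) simp
    ultimately show ?thesis
    proof (induction rule: sigma_sets_induct_disjoint)
      case (basic A)
      then obtain p q :: "real \<times> real" where "A = box p q" by auto
      then obtain a c b e where A: "A = {a<..<b} \<times> {c<..<e}" by (metis box surj_pair)
      have "J n A = (\<lambda>x. indicator {max a (- real n)<..<min b (real n)} (fst x) * complex_of_real (indicator {c<..<e} (snd x) * sin (k * snd x)))"
        by (auto simp: J_def A indicator_def fun_eq_iff)
      then show ?case using rect by simp
    next
      case empty
      then show ?case using closed_L2_subspace_zero[OF S] by (simp add: J_def[abs_def])
    next
      case (compl A)
      have "J n (UNIV - A) = (\<lambda>x. J n UNIV x - J n A x)"
        by (auto simp: J_def indicator_def fun_eq_iff)
      then show ?case using diff[OF JU compl.IH] by simp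
    next
      case (union A)
      show ?case
      proof (rule dominated[where f="\<lambda>m x. \<Sum>i<m. J n (A i) x" and w="\<lambda>x. complex_of_real 1 * indicator {- real n<..<real n} (fst x)"])
        have sumeq: "(\<Sum>i<m. J n (A i) x) = J n (\<Union>i<m. A i) x" for m x
        proof -
          have "disjoint_family_on A {..<m}" using union(1) by (auto simp: disjoint_family_on_def)
          then have "indicator (\<Union>i<m. A i) x = (\<Sum>i<m. indicator (A i) x :: complex)"
            by (intro indicator_UN_disjoint) auto
          then show ?thesis by (simp only: J_def sum_distrib_left sum_distrib_right)
        qed
        show "(\<lambda>x. \<Sum>i<m. J n (A i) x) \<in> S" for m by (intro sum union.IH)
        have Am: "A i \<in> sets borel" for i using union(2) by (subst borel_eq_box) auto
        show "J n (\<Union> (range A)) \<in> borel_measurable ?M"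
          by (rule J_measurable) (use Am in auto)
        show "AE x in ?M. cmod (\<Sum>i<m. J n (A i) x) \<le> cmod (complex_of_real 1 * indicator {- real n<..<real n} (fst x))" for m
          unfolding sumeq by (rule AE_I2) (auto simp: J_def indicator_def norm_mult)
        show "AE x in ?M. (\<lambda>m. \<Sum>i<m. J n (A i) x) \<longlonglongrightarrow> J n (\<Union> (range A)) x"
          unfolding sumeq unfolding J_def by (intro AE_I2 tendsto_intros LIMSEQ_indicator_UN)
      qed (rule ind_L2)
    qed
  qed
  have "f \<in> S" if f: "f \<in> L2 ?M" for f
  proof -
    have fm[measurable]: "f \<in> borel_measurable ?M" using f by (rule L2_measurable)
    have spos: "sin (k * u) > 0" if "0 < u" "u < d" for u
      by (rule sin_gt_zero) (use that k d in \<open>auto simp: k_def field_simps\<close>)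
    have sm: "(\<lambda>x. complex_of_real (sin (k * snd x))) \<in> borel_measurable ?M"
      by (rule strip_measurable_continuous) (intro continuous_intros)
    \<comment> \<open>Simple functions approximate the quotient with modulus at most twice its own;
      multiplying the sine back leaves the majorant 2 |f|.\<close>
    have "(\<lambda>x. f x / complex_of_real (sin (k * snd x))) \<in> borel_measurable ?M"
      by (intro borel_measurable_divide fm sm)
    from borel_measurable_implies_sequence_metric[OF this, of 0, unfolded space_strip_measure]
    obtain F where
      F: "\<And>i. simple_function ?M (F i)"
        "\<And>x. x \<in> strip d \<Longrightarrow> (\<lambda>i. F i x) \<longlonglongrightarrow> f x / complex_of_real (sin (k * snd x))"
        "\<And>i x. x \<in> strip d \<Longrightarrow> cmod (F i x) \<le> 2 * cmod (f x / complex_of_real (sin (k * snd x)))"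
      unfolding dist_norm diff_zero by metis
    \<comment> \<open>A finite combination of functions \<open>J i B\<close> over the level sets of
      \<open>F i\<close>; the window grows along with the approximation.\<close>
    define f' where "f' i x = (\<Sum>y\<in>F i ` strip d. y * J i (F i -` {y} \<inter> strip d) x)" for i x
    have f'eq: "f' i x = indicator {- real i<..<real i} (fst x) * (F i x * complex_of_real (sin (k * snd x)))"
      if x: "x \<in> strip d" for i x
    proof -
      have fin: "finite (F i ` strip d)" using simple_functionD(1)[OF F(1)[of i]] by simp
      have "f' i x = (\<Sum>y\<in>F i ` strip d. if y = F i x then y * (indicator {- real i<..<real i} (fst x) * complex_of_real (sin (k * snd x))) else 0)"
        unfolding f'_def J_def by (rule sum.cong) (use x in \<open>auto simp: indicator_def\<close>)
      also have "\<dots> = F i x * (indicator {- real i<..<real i} (fst x) * complex_of_real (sin (k * snd x)))"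
        using fin x by (simp add: sum.delta)
      finally show ?thesis by simp
    qed
    show "f \<in> S"
    proof (rule dominated[where f=f' and w="\<lambda>x. 2 * f x"])
      show "f' i \<in> S" for i
        unfolding f'_def
      proof (intro sum scale borel_sets)
        fix y
        have "F i -` {y} \<inter> space ?M \<in> sets ?M" by (rule simple_functionD(2)[OF F(1)])
        then show "F i -` {y} \<inter> strip d \<in> sets borel"
          by (simp add: strip_measure_def sets_restrict_space_iff)
      qed
      show "AE x in ?M. cmod (f' i x) \<le> cmod (2 * f x)" for i
      proof (rule AE_I2)
        fix x assume "x \<in> space ?M"
        then have x: "x \<in> strip d" by simp
        then have sp: "sin (k * snd x) > 0" using spos[of "snd x"] by (cases x) auto
        have "cmod (f' i x) \<le> cmod (F i x) * sin (k * snd x)"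
          unfolding f'eq[OF x] norm_mult norm_of_real using sp by (auto simp: indicator_def)
        also have "\<dots> \<le> 2 * cmod (f x / complex_of_real (sin (k * snd x))) * sin (k * snd x)"
          using F(3)[OF x, of i] sp by (intro mult_right_mono) auto
        also have "\<dots> = cmod (2 * f x)" using sp by (simp add: norm_divide norm_mult)
        finally show "cmod (f' i x) \<le> cmod (2 * f x)" .
      qed
      show "AE x in ?M. (\<lambda>i. f' i x) \<longlonglongrightarrow> f x"
      proof (rule AE_I2)
        fix x assume "x \<in> space ?M"
        then have x: "x \<in> strip d" by simp
        then have sp: "sin (k * snd x) > 0" using spos[of "snd x"] by (cases x) auto
        have "(\<lambda>i. F i x * complex_of_real (sin (k * snd x))) \<longlonglongrightarrow>
            f x / complex_of_real (sin (k * snd x)) * complex_of_real (sin (k * snd x))"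
          by (intro tendsto_intros F(2)[OF x])
        then have lim: "(\<lambda>i. F i x * complex_of_real (sin (k * snd x))) \<longlonglongrightarrow> f x" using sp by simp
        obtain N :: nat where N: "real N > \<bar>fst x\<bar>" using reals_Archimedean2 by blast
        have "\<forall>\<^sub>F i in sequentially. F i x * complex_of_real (sin (k * snd x)) = f' i x"
          unfolding eventually_sequentially
        proof (intro exI allI impI)
          fix i assume "i \<ge> N"
          then have "real i > \<bar>fst x\<bar>" using N by linarith
          then show "F i x * complex_of_real (sin (k * snd x)) = f' i x"
            unfolding f'eq[OF x] by (auto simp: indicator_def)
        qed
        then show "(\<lambda>i. f' i x) \<longlonglongrightarrow> f x" by (rule Lim_transform_eventually[OF lim])
      qed
    qed (use L2_scale[OF f] fm in auto)
  qed
  then show ?thesis using S by (auto simp: closed_L2_subspace_def)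
qed

section \<open>The constant coefficient resolvent\<close>

lemma LBINT_has_vector_derivative:
  fixes f :: "real \<Rightarrow> 'a::euclidean_space" and c x :: real
  assumes "continuous_on UNIV f"
  shows "((\<lambda>u. LBINT y=c..u. f y) has_vector_derivative f x) (at x)"
proof -
  have "((\<lambda>u. LBINT y=c..u. f y) has_vector_derivative f x) (at x within {min c x - 1..max c x + 1})"
    by (rule interval_integral_FTC2) (auto intro: continuous_on_subset[OF assms])
  moreover have "at x within {min c x - 1..max c x + 1} = at x"
    by (rule at_within_Icc_at) auto
  ultimately show ?thesis by simp
qed

text \<open>Starting the integral at -R makes the primitive vanish on the left; on the right it is
  constant, hence it is bounded everywhere.\<close>

lemma primitive_of_compact_support:
  fixes h :: "real \<Rightarrow> complex"
  assumes h: "continuous_on UNIV h" and supp: "\<And>s. \<bar>s\<bar> \<ge> R \<Longrightarrow> h s = 0" and R: "R \<ge> 0"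
  shows "\<exists>A K. (\<forall>s. (A has_vector_derivative h s) (at s)) \<and> (\<forall>s\<le>-R. A s = 0) \<and> (\<forall>s. cmod (A s) \<le> K)"
proof -
  define A where "A s = (LBINT t=-R..s. h t)" for s :: real
  have A': "(A has_vector_derivative h s) (at s)" for s
    unfolding A_def by (rule LBINT_has_vector_derivative[OF h])
  have A0: "A (-R) = 0" unfolding A_def by (rule interval_integral_endpoints_same)
  have const: "\<exists>c. \<forall>s\<in>T. A s = c" if T: "convex T" "\<And>s. s \<in> T \<Longrightarrow> \<bar>s\<bar> \<ge> R" for T
  proof (rule has_derivative_zero_constant[OF T(1)])
    fix s assume s: "s \<in> T"
    have "(A has_vector_derivative 0) (at s within T)"
      using has_vector_derivative_at_within[OF A'[of s]] supp[OF T(2)[OF s]] by simp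
    then show "(A has_derivative (\<lambda>h. 0)) (at s within T)" by (simp add: has_vector_derivative_def)
  qed
  obtain c where c: "\<And>s. s \<le> -R \<Longrightarrow> A s = c" using const[of "{..-R}"] R by auto
  obtain c' where c': "\<And>s. s \<ge> R \<Longrightarrow> A s = c'" using const[of "{R..}"] R by auto
  have z: "A s = 0" if "s \<le> -R" for s using c[OF that] c[of "-R"] A0 by simp
  have "continuous_on {-R..R} A"
    by (intro continuous_at_imp_continuous_on ballI has_vector_derivative_continuous[OF A'])
  then have "bounded (A ` {-R..R})" by (intro compact_imp_bounded compact_continuous_image) auto
  then obtain K where "\<forall>s\<in>{-R..R}. cmod (A s) \<le> K" by (auto simp: bounded_iff)
  then have K: "\<And>s. s \<in> {-R..R} \<Longrightarrow> cmod (A s) \<le> K" by blast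
  have "cmod (A s) \<le> max K 0" for s
  proof -
    consider "s \<le> -R" | "s \<in> {-R..R}" | "s \<ge> R" by fastforce
    then show ?thesis
    proof cases
      case 1 then show ?thesis using z by simp
    next
      case 2 then show ?thesis using K by (simp add: le_max_iff_disj)
    next
      case 3 then show ?thesis using c'[OF 3] c'[of R] K[of R] R by (simp add: le_max_iff_disj)
    qed
  qed
  then show ?thesis using A' z by blast
qed

lemma has_vector_derivative_exp_linear:
  "((\<lambda>s. exp (c * complex_of_real s)) has_vector_derivative c * exp (c * of_real s)) (at s)"
proof -
  have "((\<lambda>z. exp (c * z)) has_field_derivative exp (c * of_real s) * c) (at (of_real s))"
    by (auto intro!: derivative_eq_intros)
  from has_vector_derivative_real_field[OF this] show ?thesis by (simp add: mult.commute)
qed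

text \<open>Variation of constants: p(s) = exp(-\<mu> s) A(s) with A a primitive of exp(\<mu> t)
  h(t). Left of the support A vanishes, right of it A is bounded and the exponential decays.\<close>

lemma decaying_primitive:
  assumes h: "test_fun h" and \<mu>: "Re \<mu> > 0"
  shows "\<exists>p K. (\<forall>s. (p has_vector_derivative h s - \<mu> * p s) (at s)) \<and> (\<forall>s. cmod (p s) \<le> K * exp (- Re \<mu> * \<bar>s\<bar>))"
proof -
  obtain R0 where R0: "R0 \<ge> 0" "\<forall>s. \<bar>s\<bar> > R0 \<longrightarrow> h s = 0" using test_fun_support[OF h] by blast
  define R where "R = R0 + 1"
  have R: "R \<ge> 0" "\<And>s. \<bar>s\<bar> \<ge> R \<Longrightarrow> h s = 0" using R0 by (auto simp: R_def)
  have "continuous_on UNIV (\<lambda>s. exp (\<mu> * of_real s) * h s)"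
    by (intro continuous_intros smooth_continuous test_fun_smooth h)
  then obtain A K where A: "\<And>s. (A has_vector_derivative exp (\<mu> * of_real s) * h s) (at s)"
      "\<And>s. s \<le> -R \<Longrightarrow> A s = 0" "\<And>s. cmod (A s) \<le> K"
    using primitive_of_compact_support[of "\<lambda>s. exp (\<mu> * of_real s) * h s" R] R by auto
  have K: "K \<ge> 0" using A(3)[of 0] norm_ge_zero order_trans by blast
  define p where "p s = exp (- \<mu> * of_real s) * A s" for s
  have "(p has_vector_derivative h s - \<mu> * p s) (at s)" for s
  proof -
    have "(p has_vector_derivative exp (- \<mu> * of_real s) * (exp (\<mu> * of_real s) * h s)
        + (- \<mu> * exp (- \<mu> * of_real s)) * A s) (at s)"
      unfolding p_def by (intro has_vector_derivative_mult has_vector_derivative_exp_linear A)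
    moreover have "exp (- \<mu> * of_real s) * exp (\<mu> * of_real s) = 1" by (simp flip: exp_add)
    then have "exp (- \<mu> * of_real s) * (exp (\<mu> * of_real s) * h s) = h s"
      by (simp only: mult.assoc[symmetric] mult_1)
    then have "exp (- \<mu> * of_real s) * (exp (\<mu> * of_real s) * h s) + (- \<mu> * exp (- \<mu> * of_real s)) * A s
        = h s - \<mu> * p s" by (simp add: p_def)
    ultimately show ?thesis by (simp only:)
  qed
  \<comment> \<open>For s > -R one has |s| - s \<le> 2 R; the constant exp(2 Re \<mu> R) pays for
    replacing s by |s| in the exponent.\<close>
  moreover have "cmod (p s) \<le> K * exp (2 * Re \<mu> * R) * exp (- Re \<mu> * \<bar>s\<bar>)" for s
  proof (cases "s \<le> -R")
    case True
    then show ?thesis using K A(2) by (simp add: p_def)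
  next
    case False
    have "cmod (p s) = exp (- Re \<mu> * s) * cmod (A s)" by (simp add: p_def norm_mult)
    also have "\<dots> \<le> exp (2 * Re \<mu> * R - Re \<mu> * \<bar>s\<bar>) * K"
    proof (rule mult_mono)
      have "\<bar>s\<bar> - s \<le> 2 * R" using False R(1) by linarith
      then have "Re \<mu> * (\<bar>s\<bar> - s) \<le> Re \<mu> * (2 * R)" using \<mu> by (intro mult_left_mono) auto
      then show "exp (- Re \<mu> * s) \<le> exp (2 * Re \<mu> * R - Re \<mu> * \<bar>s\<bar>)" by (simp add: algebra_simps)
    qed (use A(3) in auto)
    also have "\<dots> = K * exp (2 * Re \<mu> * R) * exp (- Re \<mu> * \<bar>s\<bar>)"
      by (simp add: exp_add[symmetric] mult.assoc)
    finally show ?thesis .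
  qed
  ultimately show ?thesis by blast
qed

text \<open>The solution is the convolution of \<open>h\<close> with the Green function \<open>exp (- \<mu> \<bar>s\<bar>) / (2 \<mu>)\<close>,
  split into its two one-sided parts.\<close>

lemma helmholtz_solution:
  assumes h: "test_fun h" and \<mu>: "Re \<mu> > 0"
  shows "\<exists>f K. smooth f \<and> (\<forall>s. dv (dv f) s = \<mu>\<^sup>2 * f s - h s) \<and>
    (\<forall>s. cmod (f s) \<le> K * exp (- Re \<mu> * \<bar>s\<bar>)) \<and> (\<forall>s. cmod (dv f s) \<le> K * exp (- Re \<mu> * \<bar>s\<bar>))"
proof -
  have \<mu>0: "\<mu> \<noteq> 0" using \<mu> by auto
  obtain p K where p: "\<And>s. (p has_vector_derivative h s - \<mu> * p s) (at s)"
      "\<And>s. cmod (p s) \<le> K * exp (- Re \<mu> * \<bar>s\<bar>)" using decaying_primitive[OF h \<mu>] by blast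
  have "test_fun (\<lambda>s. h ((-1) * s + 0))" by (rule test_fun_affine[OF h]) simp
  then obtain r L where r: "\<And>s. (r has_vector_derivative h (- s) - \<mu> * r s) (at s)"
      "\<And>s. cmod (r s) \<le> L * exp (- Re \<mu> * \<bar>s\<bar>)" using decaying_primitive[OF _ \<mu>, of "\<lambda>s. h (- s)"] by auto
  \<comment> \<open>The part coming from the right is the reflection of the part from the left for
    the reflected right-hand side.\<close>
  define q where "q s = r (- s)" for s
  have q: "(q has_vector_derivative - (h s - \<mu> * q s)) (at s)" "cmod (q s) \<le> L * exp (- Re \<mu> * \<bar>s\<bar>)" for s
  proof -
    have "((\<lambda>s. r ((-1) * s + 0)) has_vector_derivative of_real (-1) * (h (- (- s)) - \<mu> * r (- s))) (at s)"
      by (rule has_vector_derivative_affine) (use r(1)[of "-s"] in simp)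
    then show "(q has_vector_derivative - (h s - \<mu> * q s)) (at s)" by (simp add: q_def[abs_def])
    show "cmod (q s) \<le> L * exp (- Re \<mu> * \<bar>s\<bar>)" using r(2)[of "-s"] by (simp add: q_def)
  qed
  \<comment> \<open>The contributions of h to p' and q' cancel in f' and add up in f'', which
    produces the inhomogeneity -h.\<close>
  define f where "f s = inverse (2 * \<mu>) * (p s + q s)" for s
  define f' where "f' s = (1/2) * (q s - p s)" for s
  have f: "(f has_vector_derivative f' s) (at s)" for s
  proof -
    have "(f has_vector_derivative inverse (2 * \<mu>) * ((h s - \<mu> * p s) + - (h s - \<mu> * q s))) (at s)"
      unfolding f_def by (intro has_vector_derivative_mult_right has_vector_derivative_add p q)
    moreover have "inverse (2 * \<mu>) * ((h s - \<mu> * p s) + - (h s - \<mu> * q s)) = f' s"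
      using \<mu>0 by (simp add: f'_def field_simps)
    ultimately show ?thesis by simp
  qed
  have f': "(f' has_vector_derivative \<mu>\<^sup>2 * f s + (-1) * h s) (at s)" for s
  proof -
    have "(f' has_vector_derivative (1/2) * (- (h s - \<mu> * q s) - (h s - \<mu> * p s))) (at s)"
      unfolding f'_def by (intro has_vector_derivative_mult_right has_vector_derivative_diff p q)
    moreover have "(1/2) * (- (h s - \<mu> * q s) - (h s - \<mu> * p s)) = \<mu>\<^sup>2 * f s + (-1) * h s"
      using \<mu>0 by (simp add: f_def field_simps power2_eq_square)
    ultimately show ?thesis by (simp only:)
  qed
  have sm: "smooth f"
    by (rule smooth_of_linear_ode2[OF f f']) (intro smooth_mult smooth_const test_fun_smooth h)
  have d1: "dv f = f'" by (rule dv_eqI[OF f])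
  have d2: "dv f' = (\<lambda>s. \<mu>\<^sup>2 * f s + (-1) * h s)" by (rule dv_eqI[OF f'])
  have pq: "cmod (p s) + cmod (q s) \<le> (K + L) * exp (- Re \<mu> * \<bar>s\<bar>)" for s
    using p(2)[of s] q(2)[of s] by (simp add: algebra_simps)
  define c where "c = max (cmod (inverse (2 * \<mu>))) (1/2)"
  have c: "c \<ge> 0" by (simp add: c_def)
  have "cmod (f s) \<le> c * (cmod (p s) + cmod (q s))" for s
    unfolding f_def norm_mult by (intro mult_mono norm_triangle_ineq c) (auto simp: c_def)
  moreover have "cmod (f' s) \<le> c * (cmod (p s) + cmod (q s))" for s
    unfolding f'_def norm_mult
    by (intro mult_mono order_trans[OF norm_triangle_ineq4] c) (auto simp: c_def)
  ultimately have "cmod (f s) \<le> (c * (K + L)) * exp (- Re \<mu> * \<bar>s\<bar>)"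
      "cmod (dv f s) \<le> (c * (K + L)) * exp (- Re \<mu> * \<bar>s\<bar>)" for s
    unfolding d1 using mult_left_mono[OF pq[of s] c] by (auto simp: mult.assoc intro: order_trans)
  then show ?thesis using sm d1 d2 by (intro exI[of _ f] exI[of _ "c * (K + L)"]) auto
qed

text \<open>From exp(x) \<ge> 1 + x^2 / 2 for x \<ge> 0; exponential decay in s thus places a
  function in the class \<open>decaying\<close>.\<close>

lemma exp_decay_le:
  fixes \<rho> s :: real
  assumes "\<rho> > 0" shows "exp (- \<rho> * \<bar>s\<bar>) \<le> (1 + 2 / \<rho>\<^sup>2) / (1 + s\<^sup>2)"
proof -
  have "1 + \<rho> * \<bar>s\<bar> + (\<rho> * \<bar>s\<bar>)\<^sup>2 / 2 \<le> exp (\<rho> * \<bar>s\<bar>)"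
    by (rule exp_lower_Taylor_quadratic) (use assms in simp)
  then have 1: "1 + \<rho>\<^sup>2 * s\<^sup>2 / 2 \<le> exp (\<rho> * \<bar>s\<bar>)"
  proof -
    assume a: "1 + \<rho> * \<bar>s\<bar> + (\<rho> * \<bar>s\<bar>)\<^sup>2 / 2 \<le> exp (\<rho> * \<bar>s\<bar>)"
    have "0 \<le> \<rho> * \<bar>s\<bar>" using assms by (intro mult_nonneg_nonneg) auto
    then show ?thesis using a unfolding power_mult_distrib power2_abs by linarith
  qed
  have "1 + s\<^sup>2 \<le> (1 + 2 / \<rho>\<^sup>2) * (1 + \<rho>\<^sup>2 * s\<^sup>2 / 2)"
    using assms by (simp add: field_simps)
  also have "\<dots> \<le> (1 + 2 / \<rho>\<^sup>2) * exp (\<rho> * \<bar>s\<bar>)"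
    by (rule mult_left_mono[OF 1]) (simp add: add_nonneg_nonneg)
  finally have "1 / exp (\<rho> * \<bar>s\<bar>) \<le> (1 + 2 / \<rho>\<^sup>2) / (1 + s\<^sup>2)"
    using one_plus_sq_pos[of s] by (simp add: pos_divide_le_eq pos_le_divide_eq mult.commute)
  moreover have "exp (- \<rho> * \<bar>s\<bar>) = 1 / exp (\<rho> * \<bar>s\<bar>)" by (simp add: exp_minus inverse_eq_divide)
  ultimately show ?thesis by simp
qed

section \<open>Transverse modes and their extension to the plane\<close>

lemma smooth_sin: "smooth (\<lambda>u. of_real (sin (k * u)))"
proof (rule smooth_of_linear_ode2[where c="of_real (- (k\<^sup>2))" and h="\<lambda>_. 0"])
  show "((\<lambda>u. complex_of_real (sin (k * u))) has_vector_derivative of_real (k * cos (k * u))) (at u)" for u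
    by (rule has_vector_derivative_of_real) (auto intro!: derivative_eq_intros)
  show "((\<lambda>u. complex_of_real (k * cos (k * u))) has_vector_derivative
      of_real (- (k\<^sup>2)) * of_real (sin (k * u)) + 0) (at u)" for u
  proof -
    have "((\<lambda>u. complex_of_real (k * cos (k * u))) has_vector_derivative of_real (- (k\<^sup>2) * sin (k * u))) (at u)"
      by (rule has_vector_derivative_of_real) (auto intro!: derivative_eq_intros simp: power2_eq_square)
    then show ?thesis by (simp only: of_real_mult add_0_right)
  qed
qed (rule smooth_const)

lemma dv_cong_open:
  assumes "open U" "\<And>u. u \<in> U \<Longrightarrow> q u = r u" "u \<in> U" shows "dv q u = dv r u"
proof -
  have "(q has_vector_derivative c) (at u) \<longleftrightarrow> (r has_vector_derivative c) (at u)" for c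
    using has_vector_derivative_transform_within_open[OF _ assms(1,3)] assms(2) by metis
  then show ?thesis by (simp add: dv_def vector_derivative_def)
qed

text \<open>The factors of the tensor span need compact support in u, which a sine lacks. The cutoff
  in u / d is 1 on [0, d], so values at both ends survive, and derivatives agree inside the open
  interval.\<close>

lemma strip_test_extension:
  assumes d: "d > 0" and r: "smooth r"
  shows "\<exists>q. test_fun q \<and> q 0 = r 0 \<and> q d = r d \<and>
    (\<forall>u. 0 < u \<longrightarrow> u < d \<longrightarrow> q u = r u \<and> dv (dv q) u = dv (dv r) u)"
proof -
  define q where "q u = cutoff (inverse d * u + 0) * r u" for u
  have q: "test_fun q"
    unfolding q_def by (intro test_fun_mult test_fun_affine test_fun_cutoff r) (use d in auto)
  have 1: "q u = r u" if "0 \<le> u" "u \<le> d" for u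
    using cutoff_eq_1[of "inverse d * u"] that d by (simp add: q_def field_simps)
  have 2: "dv q u = dv r u" if "u \<in> {0<..<d}" for u
    by (rule dv_cong_open[of "{0<..<d}"]) (use that 1 in auto)
  have "dv (dv q) u = dv (dv r) u" if "u \<in> {0<..<d}" for u
    by (rule dv_cong_open[of "{0<..<d}"]) (use that 2 in auto)
  then show ?thesis using q 1 d by (intro exI[of _ q]) auto
qed

lemma dv_dv_sin: "dv (dv (\<lambda>u. complex_of_real (sin (k * u)))) u = - (of_real (k\<^sup>2) * of_real (sin (k * u)))"
proof -
  have "dv (\<lambda>u. complex_of_real (sin (k * u))) = (\<lambda>u. of_real (k * cos (k * u)))"
    by (rule dv_eqI, rule has_vector_derivative_of_real) (auto intro!: derivative_eq_intros)
  moreover have "dv (\<lambda>u. complex_of_real (k * cos (k * u))) = (\<lambda>u. of_real (- (k * (sin (k * u) * k))))"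
    by (rule dv_eqI, rule has_vector_derivative_of_real) (auto intro!: derivative_eq_intros)
  ultimately show ?thesis by (simp add: power2_eq_square)
qed

lemma sop_tensor:
  assumes "test_fun f" "test_fun q"
  shows "sop g h V (\<lambda>x. f (fst x) * q (snd x)) x =
    - (of_real (g x) * (dv (dv f) (fst x) * q (snd x)) + of_real (h x) * (dv f (fst x) * q (snd x)))
    - f (fst x) * dv (dv q) (snd x) + of_real (V x) * (f (fst x) * q (snd x))"
  using assms by (simp add: sop_def tensor_partial test_fun_dv)

lemma cutoff_dv_bounds: "\<exists>K\<ge>0. (\<forall>x. cmod (dv cutoff x) \<le> K) \<and> (\<forall>x. cmod (dv (dv cutoff) x) \<le> K)"
proof -
  obtain K where K: "K \<ge> 0" "\<forall>x. cmod (dv cutoff x) \<le> K"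
    using test_fun_bounded[OF test_fun_dv[OF test_fun_cutoff]] by blast
  obtain L where L: "L \<ge> 0" "\<forall>x. cmod (dv (dv cutoff) x) \<le> L"
    using test_fun_bounded[OF test_fun_dv[OF test_fun_dv[OF test_fun_cutoff]]] by blast
  show ?thesis using K L by (intro exI[of _ "max K L"]) (auto simp: le_max_iff_disj)
qed

text \<open>The summand 0 brings the argument into the shape a x + b of the rules for affine
  substitution.\<close>

definition cutoff_at :: "real \<Rightarrow> real \<Rightarrow> complex" where
  "cutoff_at R s = cutoff (inverse R * s + 0)"

lemma cutoff_at:
  assumes R: "R > 0"
  shows "test_fun (cutoff_at R)" "smooth (cutoff_at R)" "cmod (cutoff_at R s) \<le> 1"
    "\<bar>s\<bar> \<le> R \<Longrightarrow> cutoff_at R s = 1" "\<bar>s\<bar> \<ge> 2 * R \<Longrightarrow> cutoff_at R s = 0"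
    "dv (cutoff_at R) s = of_real (inverse R) * dv cutoff (inverse R * s)"
    "dv (dv (cutoff_at R)) s = (of_real (inverse R))\<^sup>2 * dv (dv cutoff) (inverse R * s)"
proof -
  show t: "test_fun (cutoff_at R)"
    unfolding cutoff_at_def[abs_def] by (rule test_fun_affine[OF test_fun_cutoff]) (use R in simp)
  then show "smooth (cutoff_at R)" by (rule test_fun_smooth)
  show "cmod (cutoff_at R s) \<le> 1" by (simp add: cutoff_at_def cutoff_norm)
  show "\<bar>s\<bar> \<le> R \<Longrightarrow> cutoff_at R s = 1"
    using cutoff_eq_1[of "inverse R * s"] R by (simp add: cutoff_at_def abs_mult field_simps)
  show "\<bar>s\<bar> \<ge> 2 * R \<Longrightarrow> cutoff_at R s = 0"
    using cutoff_eq_0[of "inverse R * s"] R by (simp add: cutoff_at_def abs_mult field_simps)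
  have 1: "dv (cutoff_at R) = (\<lambda>s. of_real (inverse R) * dv cutoff (inverse R * s + 0))"
    unfolding cutoff_at_def[abs_def] by (rule dv_affine[OF smooth_cutoff])
  then show "dv (cutoff_at R) s = of_real (inverse R) * dv cutoff (inverse R * s)" by simp
  have "dv (\<lambda>s. of_real (inverse R) * dv cutoff (inverse R * s + 0))
      = (\<lambda>s. of_real (inverse R) * (of_real (inverse R) * dv (dv cutoff) (inverse R * s + 0)))"
    by (rule dv_eqI) (intro has_vector_derivative_mult_right has_vector_derivative_affine smooth_deriv(1) smooth_deriv(2) smooth_cutoff)
  then show "dv (dv (cutoff_at R)) s = (of_real (inverse R))\<^sup>2 * dv (dv cutoff) (inverse R * s)"
    unfolding 1 by (simp add: power2_eq_square)
qed

text \<open>Separation of variables leaves -C f'' + (k^2 - z) f = h. Its exponentially decaying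
  solution, cut off in s and multiplied by the extended sine, lies in the domain; the commutator
  error tends to 0 by dominated convergence as the cutoff moves out.\<close>

lemma range_closure_contains_modes:
  assumes d: "d > 0" and C: "C > 0" and z: "Im z \<noteq> 0" and h: "test_fun h" and \<epsilon>: "\<epsilon> > 0"
  shows "\<exists>\<psi>\<in>dirichlet_tensors d. L2_norm (strip_measure d)
    (\<lambda>x. sop (\<lambda>_. C) (\<lambda>_. 0) (\<lambda>_. 0) \<psi> x - z * \<psi> x
      - h (fst x) * of_real (sin (real n * (pi / d) * snd x))) < \<epsilon>"
proof -
  let ?M = "strip_measure d"
  define k where "k = real n * (pi / d)"
  define w where "w = (of_real (k\<^sup>2) - z) / of_real C"
  \<comment> \<open>\<open>csqrt\<close> has nonnegative real part, and the real part cannot vanish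
    since \<mu>^2 has nonzero imaginary part; so the Helmholtz solution applies.\<close>
  define \<mu> where "\<mu> = csqrt w"
  have \<mu>2: "\<mu>\<^sup>2 = w" by (simp add: \<mu>_def)
  have "Im w \<noteq> 0" using z C by (simp add: w_def)
  then have "Im (\<mu>\<^sup>2) \<noteq> 0" by (simp only: \<mu>2 not_False_eq_True)
  then have "Re \<mu> \<noteq> 0" by (auto simp: power2_eq_square)
  then have \<mu>: "Re \<mu> > 0" using Re_csqrt[of w] by (simp add: \<mu>_def)
  have "test_fun (\<lambda>s. inverse (of_real C) * h s)" by (rule test_fun_scale[OF h])
  then obtain f K where f: "smooth f" "\<And>s. dv (dv f) s = \<mu>\<^sup>2 * f s - inverse (of_real C) * h s"
      "\<And>s. cmod (f s) \<le> K * exp (- Re \<mu> * \<bar>s\<bar>)" "\<And>s. cmod (dv f s) \<le> K * exp (- Re \<mu> * \<bar>s\<bar>)"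
    using helmholtz_solution[OF _ \<mu>] by blast
  have ode: "- (of_real C * dv (dv f) s) + (of_real (k\<^sup>2) - z) * f s = h s" for s
    using C unfolding f(2) \<mu>2 w_def by (simp add: field_simps)
  have K: "K \<ge> 0" using order_trans[OF norm_ge_zero f(3)[of 0]] by simp
  obtain q where q: "test_fun q" "q 0 = of_real (sin (k * 0))" "q d = of_real (sin (k * d))"
      "\<And>u. 0 < u \<Longrightarrow> u < d \<Longrightarrow> q u = of_real (sin (k * u))"
      "\<And>u. 0 < u \<Longrightarrow> u < d \<Longrightarrow> dv (dv q) u = - (of_real (k\<^sup>2) * of_real (sin (k * u)))"
    using strip_test_extension[OF d smooth_sin[of k]] dv_dv_sin by auto
  have "k * d = real n * pi" using d by (simp add: k_def)
  then have qd: "q 0 = 0" "q d = 0" using q(2,3) by (simp_all add: sin_npi)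
  obtain K1 where K1: "K1 \<ge> 0" "\<And>x. cmod (dv cutoff x) \<le> K1" "\<And>x. cmod (dv (dv cutoff) x) \<le> K1"
    using cutoff_dv_bounds by blast
  define c where "c m = cutoff_at (real (Suc m))" for m
  note cut = cutoff_at[of "real (Suc _)", OF of_nat_0_less_iff[THEN iffD2, OF zero_less_Suc], folded c_def]
  have cb: "cmod (dv (c m) s) \<le> K1" "cmod (dv (dv (c m)) s) \<le> K1" for m s
  proof -
    have i: "inverse (real (Suc m)) \<le> 1" "inverse (real (Suc m)) \<ge> 0" by (auto simp: field_simps)
    have "inverse (real (Suc m)) * cmod (dv cutoff (inverse (real (Suc m)) * s)) \<le> 1 * K1"
      by (intro mult_mono K1 i) auto
    then show "cmod (dv (c m) s) \<le> K1" unfolding cut(6) norm_mult norm_of_real using i(2) by simp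
    have "(inverse (real (Suc m)))\<^sup>2 * cmod (dv (dv cutoff) (inverse (real (Suc m)) * s)) \<le> 1 * K1"
      by (intro mult_mono K1 power_le_one i) auto
    then show "cmod (dv (dv (c m)) s) \<le> K1" unfolding cut(7) norm_mult norm_power norm_of_real using i(2) by simp
  qed
  have cz: "dv (c m) s = 0" "dv (dv (c m)) s = 0" "c m s = 1" if "\<bar>s\<bar> < real (Suc m)" for m s
  proof -
    let ?U = "{s. \<bar>s\<bar> < real (Suc m)}"
    have U: "open ?U" by (intro open_Collect_less continuous_intros)
    have 1: "dv (c m) t = 0" if "t \<in> ?U" for t
      by (rule dv_locally_zero[OF U that, of _ 1]) (rule cut(4), simp)
    show "dv (c m) s = 0" using 1 that by simp
    show "dv (dv (c m)) s = 0" by (rule dv_locally_zero[OF U, of _ _ 0]) (use that 1 in auto)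
    show "c m s = 1" by (rule cut(4)) (use that in simp)
  qed
  \<comment> \<open>The longitudinal error: the tail of h removed by the cutoff, and the commutator.
    At each fixed s it vanishes as soon as m + 1 > |s|.\<close>
  define e where "e m s = (c m s - 1) * h s - of_real C * (2 * dv (c m) s * dv f s + dv (dv (c m)) s * f s)" for m s
  define \<psi> where "\<psi> m x = (c m (fst x) * f (fst x)) * q (snd x)" for m and x :: "real \<times> real"
  have \<psi>D: "\<psi> m \<in> dirichlet_tensors d" for m
    unfolding dirichlet_tensors_def \<psi>_def[abs_def]
    by (auto simp: qd intro!: tensor_span.tensor[OF test_fun_mult[OF cut(1) f(1)] q(1)])
  have err: "sop (\<lambda>_. C) (\<lambda>_. 0) (\<lambda>_. 0) (\<psi> m) (s, u) - z * \<psi> m (s, u)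
      - h s * of_real (sin (k * u)) = e m s * of_real (sin (k * u))" if u: "0 < u" "u < d" for m s u
  proof -
    have d1: "dv (\<lambda>s. c m s * f s) = (\<lambda>s. c m s * dv f s + dv (c m) s * f s)"
      by (rule dv_mult[OF cut(2) f(1)])
    have d2: "dv (dv (\<lambda>s. c m s * f s)) s = c m s * dv (dv f) s + dv (c m) s * dv f s + (dv (c m) s * dv f s + dv (dv (c m)) s * f s)"
      unfolding d1
      by (subst dv_add) (auto intro!: smooth_mult smooth_deriv(2) cut(2) f(1) simp: dv_mult smooth_deriv(2) cut(2) f(1))
    have "sop (\<lambda>_. C) (\<lambda>_. 0) (\<lambda>_. 0) (\<psi> m) (s, u) - z * \<psi> m (s, u) - h s * of_real (sin (k * u))
       = (- (of_real C * dv (dv (\<lambda>s. c m s * f s)) s) + (of_real (k\<^sup>2) - z) * (c m s * f s) - h s) * of_real (sin (k * u))"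
      unfolding \<psi>_def[abs_def] sop_tensor[OF test_fun_mult[OF cut(1) f(1)] q(1)]
      by (simp add: q(4)[OF u] q(5)[OF u] algebra_simps)
    also have "- (of_real C * dv (dv (\<lambda>s. c m s * f s)) s) + (of_real (k\<^sup>2) - z) * (c m s * f s) - h s
       = c m s * (- (of_real C * dv (dv f) s) + (of_real (k\<^sup>2) - z) * f s) - h s
         - of_real C * (2 * dv (c m) s * dv f s + dv (dv (c m)) s * f s)"
      unfolding d2 by (simp add: algebra_simps)
    also have "\<dots> = e m s" unfolding ode e_def by (simp add: algebra_simps)
    finally show ?thesis .
  qed
  obtain H where H: "H \<ge> 0" "\<And>s. cmod (h s) \<le> H" using test_fun_bounded[OF h] by blast
  obtain R where R: "\<And>s. \<bar>s\<bar> > R \<Longrightarrow> h s = 0" using h by (auto simp: test_fun_def)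
  define w1 where "w1 x = 2 * h (fst x)" for x :: "real \<times> real"
  define E where "E = 3 * (C * K1 * K)"
  define w2 where "w2 x = complex_of_real (E * exp (- Re \<mu> * \<bar>fst x\<bar>))" for x :: "real \<times> real"
  \<comment> \<open>A majorant independent of m: 2 |h| for the tail, and E = 3 C K1 K from the three
    commutator products, two with c' f' and one with c'' f.\<close>
  define wt where "wt x = complex_of_real (cmod (w1 x) + E * exp (- Re \<mu> * \<bar>fst x\<bar>))" for x :: "real \<times> real"
  have E: "E \<ge> 0" using C K K1 by (simp add: E_def)
  have ch: "continuous_on UNIV h" by (rule smooth_continuous[OF test_fun_smooth[OF h]])
  have hfst: "continuous_on UNIV (\<lambda>x::real \<times> real. h (fst x))"
    by (rule continuous_on_compose2[OF ch]) (auto intro!: continuous_intros)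
  have wtL: "wt \<in> L2 ?M"
  proof (rule decaying_L2)
    have 1: "decaying d (\<lambda>x. complex_of_real (cmod (w1 x)))"
      by (rule decaying_bounded_support[of _ _ "2 * H" R])
         (use H R in \<open>auto simp: w1_def norm_mult intro!: strip_measurable_continuous continuous_intros hfst\<close>)
    have 2: "decaying d w2"
    proof (rule decayingI[where K="E * (1 + 2 / (Re \<mu>)\<^sup>2)"])
      show "w2 \<in> borel_measurable ?M"
        unfolding w2_def[abs_def] by (intro strip_measurable_continuous continuous_intros)
      show "cmod (w2 (s, u)) \<le> E * (1 + 2 / (Re \<mu>)\<^sup>2) / (1 + s\<^sup>2)" for s u
        using mult_left_mono[OF exp_decay_le[OF \<mu>, of s] E] E unfolding w2_def norm_of_real
        by (simp add: abs_mult)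
    qed
    show "decaying d wt" using decaying_add[OF 1 2] by (simp add: wt_def[abs_def] w2_def)
  qed
  have em: "(\<lambda>x. e m (fst x) * complex_of_real (sin (k * snd x))) \<in> borel_measurable ?M" for m
  proof -
    have "continuous_on UNIV (e m)"
      unfolding e_def[abs_def] by (intro continuous_intros smooth_continuous cut(2) f(1) smooth_deriv(2) ch)
    then have "continuous_on UNIV (\<lambda>x::real \<times> real. e m (fst x))"
      by (rule continuous_on_compose2) (auto intro!: continuous_intros)
    then show ?thesis by (intro strip_measurable_continuous continuous_intros)
  qed
  have edom: "cmod (e m s * complex_of_real (sin (k * u))) \<le> cmod (wt (s, u))" for m s u
  proof -
    have a: "cmod ((c m s - 1) * h s) \<le> 2 * cmod (h s)"
      unfolding norm_mult
      by (rule mult_right_mono) (use norm_triangle_ineq4[of "c m s" 1] cut(3)[of m s] in auto)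
    have b: "cmod (dv (c m) s * dv f s) \<le> K1 * (K * exp (- Re \<mu> * \<bar>s\<bar>))"
      unfolding norm_mult by (intro mult_mono cb f K1) auto
    have b': "cmod (dv (dv (c m)) s * f s) \<le> K1 * (K * exp (- Re \<mu> * \<bar>s\<bar>))"
      unfolding norm_mult by (intro mult_mono cb f K1) auto
    have "cmod (2 * dv (c m) s * dv f s + dv (dv (c m)) s * f s)
        \<le> cmod (2 * dv (c m) s * dv f s) + cmod (dv (dv (c m)) s * f s)" by (rule norm_triangle_ineq)
    also have "\<dots> \<le> 3 * (K1 * (K * exp (- Re \<mu> * \<bar>s\<bar>)))"
      using b b' by (simp add: norm_mult mult.assoc)
    finally have "C * cmod (2 * dv (c m) s * dv f s + dv (dv (c m)) s * f s) \<le> C * (3 * (K1 * (K * exp (- Re \<mu> * \<bar>s\<bar>))))"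
      using C by (intro mult_left_mono) auto
    then have bb: "cmod (of_real C * (2 * dv (c m) s * dv f s + dv (dv (c m)) s * f s)) \<le> E * exp (- Re \<mu> * \<bar>s\<bar>)"
      using C by (simp only: norm_mult[of "of_real C"] norm_of_real) (simp add: E_def mult.assoc)
    have "cmod (e m s) \<le> 2 * cmod (h s) + E * exp (- Re \<mu> * \<bar>s\<bar>)"
      unfolding e_def using norm_triangle_ineq4 a bb by (smt (verit))
    then have "cmod (e m s) * \<bar>sin (k * u)\<bar> \<le> (2 * cmod (h s) + E * exp (- Re \<mu> * \<bar>s\<bar>)) * 1"
      using E by (intro mult_mono) auto
    also have "\<dots> = cmod (wt (s, u))" unfolding wt_def norm_of_real using E by (simp add: w1_def norm_mult)
    finally show ?thesis by (simp add: norm_mult)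
  qed
  have elim: "(\<lambda>m. e m s * complex_of_real (sin (k * u))) \<longlonglongrightarrow> 0" for s u
  proof -
    obtain N :: nat where N: "real N > \<bar>s\<bar>" using reals_Archimedean2 by blast
    have "e m s * complex_of_real (sin (k * u)) = 0" if "m \<ge> N" for m
      using cz[of s m] N that by (simp add: e_def)
    then have "\<forall>\<^sub>F m in sequentially. e m s * complex_of_real (sin (k * u)) = 0"
      by (auto simp: eventually_sequentially)
    then show ?thesis by (rule tendsto_eventually)
  qed
  have "(\<lambda>m. L2_norm ?M (\<lambda>x. e m (fst x) * complex_of_real (sin (k * snd x)) - 0)) \<longlonglongrightarrow> 0"
    by (rule L2_dominated_convergence(3)[OF wtL]) (use em edom elim in auto)
  then have "\<forall>\<^sub>F m in sequentially. L2_norm ?M (\<lambda>x. e m (fst x) * complex_of_real (sin (k * snd x)) - 0) < \<epsilon>"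
    by (rule order_tendstoD(2)) (rule \<epsilon>)
  then obtain m where m: "L2_norm ?M (\<lambda>x. e m (fst x) * complex_of_real (sin (k * snd x))) < \<epsilon>"
    using eventually_happens trivial_limit_sequentially by fastforce
  have "L2_norm ?M (\<lambda>x. sop (\<lambda>_. C) (\<lambda>_. 0) (\<lambda>_. 0) (\<psi> m) x - z * \<psi> m x - h (fst x) * of_real (sin (k * snd x)))
      = L2_norm ?M (\<lambda>x. e m (fst x) * complex_of_real (sin (k * snd x)))"
    unfolding L2_norm_def
    by (intro arg_cong[where f=sqrt] Bochner_Integration.integral_cong refl) (auto simp: err strip_def)
  then show ?thesis using m \<psi>D[of m] unfolding k_def by (intro bexI[of _ "\<psi> m"]) auto
qed

text \<open>Together with the totality of the sine modes this reduces density of a range to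
  approximating single modes.\<close>

lemma closed_L2_subspace_range:
  assumes zero: "(\<lambda>x. 0) \<in> D"
    and add: "\<And>\<phi> \<psi>. \<phi> \<in> D \<Longrightarrow> \<psi> \<in> D \<Longrightarrow> (\<lambda>x. \<phi> x + \<psi> x) \<in> D"
    and scale: "\<And>a \<psi>. \<psi> \<in> D \<Longrightarrow> (\<lambda>x. a * \<psi> x) \<in> D"
    and PL: "\<And>\<psi>. \<psi> \<in> D \<Longrightarrow> P \<psi> \<in> L2 M"
    and Padd: "\<And>\<phi> \<psi> x. \<phi> \<in> D \<Longrightarrow> \<psi> \<in> D \<Longrightarrow> P (\<lambda>x. \<phi> x + \<psi> x) x = P \<phi> x + P \<psi> x"
    and Pscale: "\<And>a \<psi> x. \<psi> \<in> D \<Longrightarrow> P (\<lambda>x. a * \<psi> x) x = a * P \<psi> x"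
  shows "closed_L2_subspace M {v \<in> L2 M. \<forall>\<epsilon>>0. \<exists>\<psi>\<in>D. L2_norm M (\<lambda>x. P \<psi> x - v x) < \<epsilon>}"
proof -
  define S where "S = {v \<in> L2 M. \<forall>\<epsilon>>0. \<exists>\<psi>\<in>D. L2_norm M (\<lambda>x. P \<psi> x - v x) < \<epsilon>}"
  have "closed_L2_subspace M S"
    unfolding closed_L2_subspace_def
  proof (intro conjI ballI allI impI)
    show "S \<subseteq> L2 M" by (auto simp: S_def)
    have P0: "P (\<lambda>x. 0) x = 0" for x using Pscale[OF zero, of 0 x] by simp
    have z0: "L2_norm M (\<lambda>x. P (\<lambda>x. 0) x - 0) < \<epsilon>" if "\<epsilon> > 0" for \<epsilon>
      using that by (simp add: P0)
    show zS: "(\<lambda>x. 0) \<in> S" unfolding S_def using z0 zero by fastforce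
    fix v assume v: "v \<in> S"
    then have vL: "v \<in> L2 M" by (simp add: S_def)
    show "(\<lambda>x. v x + w x) \<in> S" if w: "w \<in> S" for w
    proof -
      have wL: "w \<in> L2 M" using w by (simp add: S_def)
      have "\<exists>\<psi>\<in>D. L2_norm M (\<lambda>x. P \<psi> x - (v x + w x)) < \<epsilon>" if \<epsilon>: "\<epsilon> > 0" for \<epsilon>
      proof -
        have "\<epsilon> / 2 > 0" using \<epsilon> by simp
        then obtain \<psi> \<phi> where \<psi>: "\<psi> \<in> D" "L2_norm M (\<lambda>x. P \<psi> x - v x) < \<epsilon> / 2"
          and \<phi>: "\<phi> \<in> D" "L2_norm M (\<lambda>x. P \<phi> x - w x) < \<epsilon> / 2"
          using v w unfolding S_def by blast
        have "(\<lambda>x. P (\<lambda>x. \<psi> x + \<phi> x) x - (v x + w x)) = (\<lambda>x. (P \<psi> x - v x) + (P \<phi> x - w x))"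
          by (auto simp: Padd[OF \<psi>(1) \<phi>(1)])
        then have "L2_norm M (\<lambda>x. P (\<lambda>x. \<psi> x + \<phi> x) x - (v x + w x)) < \<epsilon>"
          using L2_norm_triangle[OF L2_diff[OF PL[OF \<psi>(1)] vL] L2_diff[OF PL[OF \<phi>(1)] wL]] \<psi>(2) \<phi>(2) by simp
        then show ?thesis using add[OF \<psi>(1) \<phi>(1)] by blast
      qed
      then show ?thesis using vL wL by (simp add: S_def L2_add)
    qed
    show "(\<lambda>x. a * v x) \<in> S" for a
    proof (cases "a = 0")
      case True
      then show ?thesis using zS by simp
    next
      case False
      have "\<exists>\<psi>\<in>D. L2_norm M (\<lambda>x. P \<psi> x - a * v x) < \<epsilon>" if \<epsilon>: "\<epsilon> > 0" for \<epsilon>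
      proof -
        have "\<epsilon> / cmod a > 0" using \<epsilon> False by simp
        then obtain \<psi> where \<psi>: "\<psi> \<in> D" "L2_norm M (\<lambda>x. P \<psi> x - v x) < \<epsilon> / cmod a"
          using v unfolding S_def by blast
        have "L2_norm M (\<lambda>x. P (\<lambda>x. a * \<psi> x) x - a * v x) = L2_norm M (\<lambda>x. a * (P \<psi> x - v x))"
          by (simp add: Pscale[OF \<psi>(1)] algebra_simps)
        also have "\<dots> < \<epsilon>" unfolding L2_norm_scale using \<psi>(2) False by (simp add: field_simps)
        finally show ?thesis using scale[OF \<psi>(1)] by blast
      qed
      then show ?thesis using vL by (simp add: S_def L2_scale)
    qed
  next
    fix v assume vL: "v \<in> L2 M" and v: "\<forall>\<epsilon>>0. \<exists>g\<in>S. L2_norm M (\<lambda>x. g x - v x) < \<epsilon>"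
    have "\<exists>\<psi>\<in>D. L2_norm M (\<lambda>x. P \<psi> x - v x) < \<epsilon>" if \<epsilon>: "\<epsilon> > 0" for \<epsilon>
    proof -
      have \<epsilon>2: "\<epsilon> / 2 > 0" using \<epsilon> by simp
      then obtain w where w: "w \<in> S" "L2_norm M (\<lambda>x. w x - v x) < \<epsilon> / 2" using v by blast
      then obtain \<psi> where \<psi>: "\<psi> \<in> D" "L2_norm M (\<lambda>x. P \<psi> x - w x) < \<epsilon> / 2"
        using \<epsilon>2 unfolding S_def by blast
      have "L2_norm M (\<lambda>x. P \<psi> x - v x) < \<epsilon>"
        using L2_norm_triangle3[OF PL[OF \<psi>(1)] _ vL, of w] w \<psi>(2) by (simp add: S_def)
      then show ?thesis using \<psi>(1) by blast
    qed
    then show "v \<in> S" using vL by (simp add: S_def)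
  qed
  then show ?thesis by (simp only: S_def)
qed

lemma dirichlet_tensors_scale: "\<psi> \<in> dirichlet_tensors d \<Longrightarrow> (\<lambda>x. a * \<psi> x) \<in> dirichlet_tensors d"
  using dirichlet_tensors_mult_s[OF _ smooth_const[of a]] by simp

lemma test_mode_L2:
  assumes h: "test_fun h"
  shows "(\<lambda>x. h (fst x) * complex_of_real (sin (k * snd x))) \<in> L2 (strip_measure d)"
proof -
  have ch: "continuous_on UNIV h" by (rule smooth_continuous[OF test_fun_smooth[OF h]])
  obtain H where H: "H \<ge> 0" "\<And>s. cmod (h s) \<le> H" using test_fun_bounded[OF h] by blast
  obtain R where R: "\<And>s. \<bar>s\<bar> > R \<Longrightarrow> h s = 0" using h by (auto simp: test_fun_def)
  have "decaying d (\<lambda>x. h (fst x) * complex_of_real (sin (k * snd x)))"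
  proof (rule decaying_bounded_support[of _ _ H R])
    have "continuous_on UNIV (\<lambda>x::real \<times> real. h (fst x))"
      by (rule continuous_on_compose2[OF ch]) (auto intro!: continuous_intros)
    then show "(\<lambda>x. h (fst x) * complex_of_real (sin (k * snd x))) \<in> borel_measurable (strip_measure d)"
      by (intro strip_measurable_continuous continuous_intros)
    fix x :: "real \<times> real"
    have "cmod (h (fst x)) * \<bar>sin (k * snd x)\<bar> \<le> H * 1" by (intro mult_mono H) auto
    then show "cmod (h (fst x) * complex_of_real (sin (k * snd x))) \<le> H"
      unfolding norm_mult norm_of_real by simp
  qed (use R in auto)
  then show ?thesis by (rule decaying_L2)
qed

theorem constant_coefficient_dense_range:
  assumes d: "d > 0" and C: "C > 0" and z: "Im z \<noteq> 0" and f: "f \<in> L2 (strip_measure d)" and \<epsilon>: "\<epsilon> > 0"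
  shows "\<exists>\<psi>\<in>dirichlet_tensors d. L2_norm (strip_measure d)
    (\<lambda>x. sop (\<lambda>_. C) (\<lambda>_. 0) (\<lambda>_. 0) \<psi> x - z * \<psi> x - f x) < \<epsilon>"
proof -
  let ?M = "strip_measure d"
  define P where "P \<psi> x = sop (\<lambda>_. C) (\<lambda>_. 0) (\<lambda>_. 0) \<psi> x - z * \<psi> x" for \<psi> x
  interpret c: strip_coefficients d "\<lambda>_. C" "\<lambda>_. 0" C C 0 by (rule strip_coefficients_const[OF d C])
  have adm: "c.admissible (\<lambda>_. 0)" by (rule c.admissible_bounded[where B=0]) auto
  define S where "S = {v \<in> L2 ?M. \<forall>\<epsilon>>0. \<exists>\<psi>\<in>dirichlet_tensors d. L2_norm ?M (\<lambda>x. P \<psi> x - v x) < \<epsilon>}"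
  have "closed_L2_subspace ?M S"
    unfolding S_def
  proof (rule closed_L2_subspace_range[OF dirichlet_tensors_zero dirichlet_tensors_add dirichlet_tensors_scale])
    fix \<psi> assume \<psi>: "\<psi> \<in> dirichlet_tensors d"
    show "P \<psi> \<in> L2 ?M"
      unfolding P_def[abs_def] using c.dirichlet_tensorsD[OF \<psi>] by (intro L2_diff L2_scale c.sop_L2 adm)
    show "P (\<lambda>x. \<phi> x + \<psi> x) x = P \<phi> x + P \<psi> x" if "\<phi> \<in> dirichlet_tensors d" for \<phi> x
      using c.dirichlet_tensorsD(1)[OF \<psi>] c.dirichlet_tensorsD(1)[OF that]
      by (simp add: P_def sop_add algebra_simps)
    show "P (\<lambda>x. a * \<psi> x) x = a * P \<psi> x" for a x
      using sop_mult_s[OF c.dirichlet_tensorsD(1)[OF \<psi>] smooth_const[of a], of "\<lambda>_. C" "\<lambda>_. 0" "\<lambda>_. 0" x]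
      by (simp add: P_def dv_eqI[of "\<lambda>_. _" "\<lambda>_. 0"] algebra_simps)
  qed
  moreover have "(\<lambda>x. h (fst x) * of_real (sin (real n * (pi / d) * snd x))) \<in> S" if h: "test_fun h" for h n
    using test_mode_L2[OF h, of "real n * (pi / d)"] range_closure_contains_modes[OF d C z h, of _ n]
    unfolding S_def P_def by blast
  ultimately have "S = L2 ?M" by (intro sine_modes_total[OF d])
  then have "f \<in> S" using f by simp
  then show ?thesis using \<epsilon> unfolding S_def P_def by blast
qed

text \<open>The same reduction with the identity in place of the operator: a sine mode coincides in
  the strip with its extension.\<close>

theorem dirichlet_tensors_dense:
  assumes d: "d > 0" and f: "f \<in> L2 (strip_measure d)" and \<epsilon>: "\<epsilon> > 0"
  shows "\<exists>\<psi>\<in>dirichlet_tensors d. L2_norm (strip_measure d) (\<lambda>x. \<psi> x - f x) < \<epsilon>"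
proof -
  let ?M = "strip_measure d"
  define S where "S = {v \<in> L2 ?M. \<forall>\<epsilon>>0. \<exists>\<psi>\<in>dirichlet_tensors d. L2_norm ?M (\<lambda>x. \<psi> x - v x) < \<epsilon>}"
  have "closed_L2_subspace ?M S"
    unfolding S_def
    by (rule closed_L2_subspace_range[where P="\<lambda>\<psi>. \<psi>", OF dirichlet_tensors_zero dirichlet_tensors_add dirichlet_tensors_scale])
       (auto simp: dirichlet_tensors_def tensor_span_L2)
  moreover have "(\<lambda>x. h (fst x) * of_real (sin (real n * (pi / d) * snd x))) \<in> S" if h: "test_fun h" for h n
  proof -
    define k where "k = real n * (pi / d)"
    have kd: "k * d = real n * pi" using d by (simp add: k_def)
    obtain q where q: "test_fun q" "q 0 = of_real (sin (k * 0))" "q d = of_real (sin (k * d))"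
        "\<And>u. 0 < u \<Longrightarrow> u < d \<Longrightarrow> q u = of_real (sin (k * u))"
      using strip_test_extension[OF d smooth_sin[of k]] by auto
    have D: "(\<lambda>x. h (fst x) * q (snd x)) \<in> dirichlet_tensors d"
      unfolding dirichlet_tensors_def using q(2,3) kd by (auto simp: sin_npi intro!: tensor_span.tensor h q(1))
    have "L2_norm ?M (\<lambda>x. h (fst x) * q (snd x) - h (fst x) * of_real (sin (k * snd x))) = L2_norm ?M (\<lambda>x. 0)"
      unfolding L2_norm_def
      by (intro arg_cong[where f=sqrt] Bochner_Integration.integral_cong refl) (auto simp: q(4) strip_def)
    then show ?thesis
      using D test_mode_L2[OF h, of k d] unfolding S_def k_def[symmetric] by force
  qed
  ultimately have "S = L2 ?M" by (intro sine_modes_total[OF d])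
  then have "f \<in> S" using f by simp
  then show ?thesis using \<epsilon> unfolding S_def by blast
qed

section \<open>Variable coefficients and growing potentials\<close>

lemma L2_mult_bounded:
  assumes f: "f \<in> L2 M" and w: "w \<in> borel_measurable M" "AE x in M. cmod (w x) \<le> B" and B: "B \<ge> 0"
  shows "(\<lambda>x. w x * f x) \<in> L2 M" "L2_norm M (\<lambda>x. w x * f x) \<le> B * L2_norm M f"
proof -
  have [measurable]: "f \<in> borel_measurable M" by (rule L2_measurable[OF f])
  note [measurable] = w(1)
  have m: "(\<lambda>x. w x * f x) \<in> borel_measurable M" by measurable
  have le: "AE x in M. cmod (w x * f x) \<le> cmod (of_real B * f x)"
    using w(2) by eventually_elim (use B in \<open>auto simp: norm_mult intro: mult_right_mono\<close>)
  show "(\<lambda>x. w x * f x) \<in> L2 M" by (rule L2_dominated[OF L2_scale[OF f] m le])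
  have "L2_norm M (\<lambda>x. w x * f x) \<le> L2_norm M (\<lambda>x. of_real B * f x)"
    by (rule L2_norm_mono[OF L2_scale[OF f] m le])
  then show "L2_norm M (\<lambda>x. w x * f x) \<le> B * L2_norm M f" using B by (simp add: L2_norm_scale)
qed

context strip_coefficients
begin

text \<open>With \<open>G\<close> an upper bound of \<open>g\<close>, the difference to the operator with constant coefficient
  \<open>G\<close> has relative bound \<open>(G - g\<^sub>0) / G < 1\<close>, as in the Kato-Rellich theorem.\<close>

lemma dense_range_bounded_potential:
  assumes V: "V \<in> borel_measurable M" "\<And>s u. 0 < u \<Longrightarrow> u < d \<Longrightarrow> \<bar>V (s, u)\<bar> \<le> B"
    and z: "Im z \<noteq> 0" and f: "f \<in> L2 M" and \<epsilon>: "\<epsilon> > 0"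
  shows "\<exists>\<psi>\<in>dirichlet_tensors d. L2_norm M (\<lambda>x. sop g h V \<psi> x - z * \<psi> x - f x) < \<epsilon>"
proof -
  have B: "B \<ge> 0" using V(2)[of "d/2" 0] d_pos by linarith
  \<comment> \<open>Relative bound at the point i k: the second-order difference contributes (G -
    g0) / G with g0 the lower bound of g, the first-order term the geometric mean of 1 / k and 1 / G
    by interpolation, the potential B / k. The last two vanish as k grows.\<close>
  define \<theta> where "\<theta> k = (G - g\<^sub>0) / G + B\<^sub>h * sqrt (1 / (k * G)) + B / k" for k
  have "((\<lambda>k. (G - g\<^sub>0) / G + B\<^sub>h * sqrt (inverse k * inverse G) + B * inverse k) \<longlongrightarrow>
      (G - g\<^sub>0) / G + B\<^sub>h * sqrt (0 * inverse G) + B * 0) at_top"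
    by (intro tendsto_intros tendsto_inverse_0_at_top filterlim_ident)
  then have "(\<theta> \<longlongrightarrow> (G - g\<^sub>0) / G) at_top"
    by (simp add: \<theta>_def[abs_def] divide_inverse)
  moreover have "(G - g\<^sub>0) / G < 1" using g0_pos G_pos by simp
  ultimately have "\<forall>\<^sub>F k in at_top. \<theta> k < 1" by (rule order_tendstoD(2))
  moreover have "\<forall>\<^sub>F k in at_top. (k::real) > 0" by (rule eventually_gt_at_top)
  \<comment> \<open>This is equivalent to |z - z1| < k for z1 = \<plusminus> i k on the side of
    z.\<close>
  moreover have "\<forall>\<^sub>F k in at_top. k > (cmod z)\<^sup>2 / (2 * \<bar>Im z\<bar>)" by (rule eventually_gt_at_top)
  ultimately have "\<forall>\<^sub>F k in at_top. \<theta> k < 1 \<and> k > 0 \<and> k > (cmod z)\<^sup>2 / (2 * \<bar>Im z\<bar>)"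
    by eventually_elim simp
  then obtain k where k: "\<theta> k < 1" "k > 0" "k > (cmod z)\<^sup>2 / (2 * \<bar>Im z\<bar>)"
    using eventually_happens trivial_limit_at_top_linorder by blast
  \<comment> \<open>Purely imaginary, as the constant coefficient bounds require, and in the same
    half plane as z.\<close>
  define z1 where "z1 = Complex 0 (sgn (Im z) * k)"
  have z1: "Re z1 = 0" "Im z1 \<noteq> 0" "cmod z1 = k" "\<bar>Im z1\<bar> = k"
    using z k(2) by (auto simp: z1_def cmod_def abs_mult sgn_if)
  have dist: "cmod (z - z1) < k"
  proof -
    have "(cmod z)\<^sup>2 < 2 * k * \<bar>Im z\<bar>" using k(3) z by (simp add: field_simps)
    moreover have "(cmod (z - z1))\<^sup>2 = (cmod z)\<^sup>2 - 2 * k * \<bar>Im z\<bar> + k\<^sup>2"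
    proof -
      have "(Im z - sgn (Im z) * k)\<^sup>2 = (Im z)\<^sup>2 - 2 * k * \<bar>Im z\<bar> + k\<^sup>2"
        using z by (cases "Im z > 0") (auto simp: power2_eq_square algebra_simps)
      then show ?thesis by (simp add: cmod_power2 z1_def)
    qed
    ultimately have "(cmod (z - z1))\<^sup>2 < k\<^sup>2" by linarith
    then show ?thesis by (rule power2_less_imp_less) (use k in simp)
  qed
  have adm: "admissible V" by (rule admissible_bounded[OF V])
  interpret c: strip_coefficients d "\<lambda>_. G" "\<lambda>_. 0" G G 0 by (rule strip_coefficients_const[OF d_pos G_pos])
  have adm0: "c.admissible (\<lambda>_. 0)" by (rule c.admissible_bounded[where B=0]) auto
  note D = dirichlet_tensorsD
  have SL: "(\<lambda>x. sop g h V \<psi> x - w * \<psi> x) \<in> L2 M" if "\<psi> \<in> dirichlet_tensors d" for \<psi> w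
    by (intro L2_diff L2_scale sop_L2 adm D(2)[OF that] D(5)[OF that])
  have SL0: "(\<lambda>x. sop (\<lambda>_. G) (\<lambda>_. 0) (\<lambda>_. 0) \<psi> x - w * \<psi> x) \<in> L2 M" if "\<psi> \<in> dirichlet_tensors d" for \<psi> w
    by (intro L2_diff L2_scale c.sop_L2 adm0 D(2)[OF that] D(5)[OF that])
  have Sadd: "sop g h V (\<lambda>x. \<phi> x + \<psi> x) x - w * (\<phi> x + \<psi> x)
      = (sop g h V \<phi> x - w * \<phi> x) + (sop g h V \<psi> x - w * \<psi> x)"
    if "\<phi> \<in> dirichlet_tensors d" "\<psi> \<in> dirichlet_tensors d" for \<phi> \<psi> w x
    using sop_add[OF D(1)[OF that(1)] D(1)[OF that(2)]] by (simp add: algebra_simps)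
  have bound: "L2_norm M (\<lambda>x. (sop g h V \<psi> x - z1 * \<psi> x) - (sop (\<lambda>_. G) (\<lambda>_. 0) (\<lambda>_. 0) \<psi> x - z1 * \<psi> x))
      \<le> \<theta> k * L2_norm M (\<lambda>x. sop (\<lambda>_. G) (\<lambda>_. 0) (\<lambda>_. 0) \<psi> x - z1 * \<psi> x)"
    if \<psi>: "\<psi> \<in> dirichlet_tensors d" for \<psi>
  proof -
    define N where "N = L2_norm M (\<lambda>x. sop (\<lambda>_. G) (\<lambda>_. 0) (\<lambda>_. 0) \<psi> x - z1 * \<psi> x)"
    have N: "N \<ge> 0" by (simp add: N_def)
    have t: "\<psi> \<in> tensor_span" "partial_s \<psi> \<in> tensor_span" "partial_s (partial_s \<psi>) \<in> tensor_span"
      by (intro tensor_span_partial_s(2) D(1)[OF \<psi>])+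
    have b1: "L2_norm M (partial_s (partial_s \<psi>)) \<le> N / G"
      using constant_coefficient_bounds(1)[OF d_pos G_pos \<psi> z1(1)] G_pos
      unfolding N_def by (simp add: pos_le_divide_eq mult.commute)
    have b2: "L2_norm M \<psi> \<le> N / k"
      using constant_coefficient_bounds(2)[OF d_pos G_pos \<psi> z1(1)] k(2)
      unfolding N_def z1(3) by (simp add: pos_le_divide_eq mult.commute)
    have "(L2_norm M (partial_s \<psi>))\<^sup>2 \<le> (N / k) * (N / G)"
      using L2_norm_partial_s_sq[OF t(1), of d] mult_mono[OF b2 b1] N k(2) by simp
    also have "\<dots> = (sqrt (1 / (k * G)) * N)\<^sup>2"
    proof -
      have "(sqrt (1 / (k * G)))\<^sup>2 = 1 / (k * G)" using k(2) G_pos by (intro real_sqrt_pow2) simp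
      then show ?thesis unfolding power_mult_distrib by (simp add: power2_eq_square)
    qed
    finally have b3: "L2_norm M (partial_s \<psi>) \<le> sqrt (1 / (k * G)) * N"
      by (rule power2_le_imp_le) (use N k(2) G_pos in simp)
    have gm: "(\<lambda>x. complex_of_real (G - g x)) \<in> borel_measurable M" using g_measurable by measurable
    have hm: "(\<lambda>x. complex_of_real (- h x)) \<in> borel_measurable M" using h_measurable by measurable
    have Vm: "(\<lambda>x. complex_of_real (V x)) \<in> borel_measurable M" using V(1) by measurable
    have ga: "AE x in M. cmod (complex_of_real (G - g x)) \<le> G - g\<^sub>0"
    proof (rule AE_stripI)
      fix s u assume "0 < u" "u < d"
      then show "cmod (complex_of_real (G - g (s, u))) \<le> G - g\<^sub>0"
        unfolding norm_of_real using g_lower[of u s] g_upper[of u s] by linarith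
    qed
    have ha: "AE x in M. cmod (complex_of_real (- h x)) \<le> B\<^sub>h"
      by (rule AE_stripI) (use h_bound in auto)
    have Va: "AE x in M. cmod (complex_of_real (V x)) \<le> B"
      by (rule AE_stripI) (use V(2) in auto)
    have Gg: "G - g\<^sub>0 \<ge> 0" using g0_le_G by simp
    let ?a = "\<lambda>x. complex_of_real (G - g x) * partial_s (partial_s \<psi>) x"
    let ?b = "\<lambda>x. complex_of_real (- h x) * partial_s \<psi> x"
    let ?c = "\<lambda>x. complex_of_real (V x) * \<psi> x"
    note la = L2_mult_bounded[OF tensor_span_L2[OF t(3)] gm ga Gg]
    note lb = L2_mult_bounded[OF tensor_span_L2[OF t(2)] hm ha Bh_nonneg]
    note lc = L2_mult_bounded[OF tensor_span_L2[OF t(1)] Vm Va B]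
    have "(\<lambda>x. (sop g h V \<psi> x - z1 * \<psi> x) - (sop (\<lambda>_. G) (\<lambda>_. 0) (\<lambda>_. 0) \<psi> x - z1 * \<psi> x))
        = (\<lambda>x. (?a x + ?b x) + ?c x)"
      by (auto simp: sop_def algebra_simps)
    then have "L2_norm M (\<lambda>x. (sop g h V \<psi> x - z1 * \<psi> x) - (sop (\<lambda>_. G) (\<lambda>_. 0) (\<lambda>_. 0) \<psi> x - z1 * \<psi> x))
        \<le> L2_norm M ?a + L2_norm M ?b + L2_norm M ?c"
      using L2_norm_triangle[OF L2_add[OF la(1) lb(1)] lc(1)] L2_norm_triangle[OF la(1) lb(1)] by simp
    also have "\<dots> \<le> (G - g\<^sub>0) * (N / G) + B\<^sub>h * (sqrt (1 / (k * G)) * N) + B * (N / k)"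
      by (intro add_mono order_trans[OF la(2)] order_trans[OF lb(2)] order_trans[OF lc(2)]
          mult_left_mono b1 b2 b3 Gg Bh_nonneg B)
    also have "\<dots> = \<theta> k * N" by (simp add: \<theta>_def algebra_simps)
    finally show ?thesis by (simp add: N_def)
  qed
  have \<theta>0: "\<theta> k \<ge> 0"
    using g0_le_G G_pos Bh_nonneg B k(2) by (auto simp: \<theta>_def intro!: add_nonneg_nonneg)
  \<comment> \<open>First perturbation: from the coefficient G to g, h and V at the point
    z1.\<close>
  have dense1: "\<exists>\<psi>\<in>dirichlet_tensors d. L2_norm M (\<lambda>x. sop g h V \<psi> x - z1 * \<psi> x - f x) < \<epsilon>"
    if f: "f \<in> L2 M" and \<epsilon>: "\<epsilon> > 0" for f \<epsilon>
    by (rule dense_range_perturb[where D="dirichlet_tensors d"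
          and P="\<lambda>\<psi> x. sop (\<lambda>_. G) (\<lambda>_. 0) (\<lambda>_. 0) \<psi> x - z1 * \<psi> x"
          and Q="\<lambda>\<psi> x. sop g h V \<psi> x - z1 * \<psi> x",
          OF dirichlet_tensors_zero dirichlet_tensors_add SL0 SL _ bound \<theta>0 k(1) _ f \<epsilon>])
       (auto simp: Sadd intro: constant_coefficient_dense_range[OF d_pos G_pos z1(2)])
  \<comment> \<open>Second perturbation: from z1 to z. The lower bound 1 / k on the resolvent scale
    makes the ratio |z - z1| / k less than 1.\<close>
  show ?thesis
  proof (rule dense_range_perturb[where D="dirichlet_tensors d" and \<theta>="cmod (z - z1) / k"
          and P="\<lambda>\<psi> x. sop g h V \<psi> x - z1 * \<psi> x" and Q="\<lambda>\<psi> x. sop g h V \<psi> x - z * \<psi> x",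
          OF dirichlet_tensors_zero dirichlet_tensors_add SL SL _ _ _ _ dense1 f \<epsilon>])
    fix \<psi> assume \<psi>: "\<psi> \<in> dirichlet_tensors d"
    have "(\<lambda>x. (sop g h V \<psi> x - z * \<psi> x) - (sop g h V \<psi> x - z1 * \<psi> x)) = (\<lambda>x. (z1 - z) * \<psi> x)"
      by (auto simp: algebra_simps)
    then have "L2_norm M (\<lambda>x. (sop g h V \<psi> x - z * \<psi> x) - (sop g h V \<psi> x - z1 * \<psi> x)) = cmod (z - z1) * L2_norm M \<psi>"
      by (simp add: L2_norm_scale norm_minus_commute)
    also have "L2_norm M \<psi> \<le> L2_norm M (\<lambda>x. sop g h V \<psi> x - z1 * \<psi> x) / k"
      using sop_shift_lower_bound[OF \<psi> adm, of z1] k(2) unfolding z1(4) by (simp add: field_simps)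
    finally show "L2_norm M (\<lambda>x. (sop g h V \<psi> x - z * \<psi> x) - (sop g h V \<psi> x - z1 * \<psi> x))
        \<le> cmod (z - z1) / k * L2_norm M (\<lambda>x. sop g h V \<psi> x - z1 * \<psi> x)"
      by (simp add: mult_left_mono)
  qed (use dist k(2) in \<open>auto simp: Sadd\<close>)
qed

text \<open>The real part of the quadratic form at \<psi> contains the weighted norm of \<partial>_s
  \<psi>; the nonnegative term from \<partial>_u is dropped. The bound depends on the potential only
  through its supremum, which makes growth with the cutoff radius visible.\<close>

lemma partial_s_form_bound:
  assumes V: "V \<in> borel_measurable M" "\<And>s u. 0 < u \<Longrightarrow> u < d \<Longrightarrow> \<bar>V (s, u)\<bar> \<le> B"
    and \<psi>: "\<psi> \<in> dirichlet_tensors d"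
  shows "g\<^sub>0 * (L2_norm M (partial_s \<psi>))\<^sup>2
    \<le> L2_norm M \<psi> * L2_norm M (\<lambda>x. sop g h V \<psi> x - z * \<psi> x) + (cmod z + B) * (L2_norm M \<psi>)\<^sup>2"
proof -
  have B: "B \<ge> 0" using V(2)[of "d/2" 0] d_pos by linarith
  note D = dirichlet_tensorsD[OF \<psi>]
  have adm: "admissible V" by (rule admissible_bounded[OF V])
  let ?T = "\<lambda>x. sop g h V \<psi> x - z * \<psi> x" and ?p = "partial_s \<psi>"
  have TL: "?T \<in> L2 M" by (intro L2_diff L2_scale sop_L2 adm D)
  have pL: "?p \<in> L2 M" by (intro tensor_span_L2 tensor_span_partial_s(2) D(1))
  have Vm: "(\<lambda>x. complex_of_real (V x)) \<in> borel_measurable M" using V(1) by measurable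
  have Va: "AE x in M. cmod (complex_of_real (V x)) \<le> B"
    by (rule AE_stripI) (use V(2) in auto)
  note lc = L2_mult_bounded[OF D(5) Vm Va B]
  have gpL: "(\<lambda>x. of_real (g x) * ?p x) \<in> L2 M"
    by (intro decaying_L2 g_mult_decaying tensor_span_decaying tensor_span_partial_s(2) D(1))
  have low: "g\<^sub>0 * (L2_norm M ?p)\<^sup>2 \<le> Re (L2_inner M ?p (\<lambda>x. of_real (g x) * ?p x))"
  proof -
    have i: "integrable M (\<lambda>x. cnj (?p x) * (of_real (g x) * ?p x))"
      by (rule L2_inner_integrable[OF pL gpL])
    have eq: "Re (cnj (?p x) * (of_real (g x) * ?p x)) = g x * (cmod (?p x))\<^sup>2" for x
    proof -
      have "cnj (?p x) * (of_real (g x) * ?p x) = of_real (g x) * (?p x * cnj (?p x))" by (simp add: ac_simps)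
      also have "\<dots> = of_real (g x * (cmod (?p x))\<^sup>2)" by (simp only: complex_norm_square[symmetric] of_real_mult of_real_power)
      finally show ?thesis by (simp only: Re_complex_of_real)
    qed
    have "g\<^sub>0 * (L2_norm M ?p)\<^sup>2 = (LINT x|M. g\<^sub>0 * (cmod (?p x))\<^sup>2)"
      by (simp add: L2_norm_sq)
    also have "\<dots> \<le> (LINT x|M. Re (cnj (?p x) * (of_real (g x) * ?p x)))"
    proof (rule integral_mono_AE)
      show "integrable M (\<lambda>x. g\<^sub>0 * (cmod (?p x))\<^sup>2)" using L2_integrable_sq[OF pL] by simp
      show "integrable M (\<lambda>x. Re (cnj (?p x) * (of_real (g x) * ?p x)))" by (rule integrable_Re[OF i])
      show "AE x in M. g\<^sub>0 * (cmod (?p x))\<^sup>2 \<le> Re (cnj (?p x) * (of_real (g x) * ?p x))"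
        unfolding eq by (rule AE_stripI) (auto intro!: mult_right_mono g_lower)
    qed
    also have "\<dots> = Re (L2_inner M ?p (\<lambda>x. of_real (g x) * ?p x))"
      unfolding L2_inner_def by (rule integral_Re[OF i])
    finally show ?thesis .
  qed
  have "L2_inner M \<psi> (sop g h V \<psi>) = L2_inner M \<psi> ?T + z * L2_inner M \<psi> \<psi>"
    using L2_inner_add_right[OF D(5) TL L2_scale[OF D(5), of z]] by (simp add: L2_inner_scale_right)
  then have "L2_inner M ?p (\<lambda>x. of_real (g x) * ?p x) + L2_inner M (partial_u \<psi>) (partial_u \<psi>)
      = L2_inner M \<psi> ?T + z * L2_inner M \<psi> \<psi> - L2_inner M \<psi> (\<lambda>x. of_real (V x) * \<psi> x)"
    using sop_form[OF D(2) D(2) adm D(3) D(4)] by (simp add: algebra_simps)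
  then have eq: "Re (L2_inner M ?p (\<lambda>x. of_real (g x) * ?p x)) + (L2_norm M (partial_u \<psi>))\<^sup>2
      = Re (L2_inner M \<psi> ?T + z * L2_inner M \<psi> \<psi> - L2_inner M \<psi> (\<lambda>x. of_real (V x) * \<psi> x))"
    by (metis L2_inner_self Re_complex_of_real plus_complex.sel(1))
  have "Re (L2_inner M \<psi> ?T + z * L2_inner M \<psi> \<psi> - L2_inner M \<psi> (\<lambda>x. of_real (V x) * \<psi> x))
      \<le> cmod (L2_inner M \<psi> ?T + z * L2_inner M \<psi> \<psi> - L2_inner M \<psi> (\<lambda>x. of_real (V x) * \<psi> x))"
    by (rule complex_Re_le_cmod)
  also have "\<dots> \<le> cmod (L2_inner M \<psi> ?T) + cmod (z * L2_inner M \<psi> \<psi>) + cmod (L2_inner M \<psi> (\<lambda>x. of_real (V x) * \<psi> x))"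
    by (rule order_trans[OF norm_triangle_ineq4 add_mono[OF norm_triangle_ineq order_refl]])
  also have "\<dots> \<le> L2_norm M \<psi> * L2_norm M ?T + cmod z * (L2_norm M \<psi> * L2_norm M \<psi>) + L2_norm M \<psi> * (B * L2_norm M \<psi>)"
    unfolding norm_mult
    by (intro add_mono mult_left_mono L2_cauchy_schwarz order_trans[OF L2_cauchy_schwarz[OF D(5) lc(1)]] D(5) TL lc(2)) auto
  also have "\<dots> = L2_norm M \<psi> * L2_norm M ?T + (cmod z + B) * (L2_norm M \<psi>)\<^sup>2"
    by (simp add: power2_eq_square algebra_simps)
  finally show ?thesis using low eq zero_le_power2[of "L2_norm M (partial_u \<psi>)"] by linarith
qed

text \<open>Cutting a linearly growing potential off at distance \<open>2 R\<close> makes the commutator with the cutoff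
  function of size \<open>\<parallel>\<partial>\<^sub>s \<psi>\<parallel> / R\<close>, while the form bound gives only \<open>\<parallel>\<partial>\<^sub>s \<psi>\<parallel> = O(\<surd>R)\<close>.\<close>

theorem dense_range_linear_potential:
  assumes V: "V \<in> borel_measurable M" "\<And>s u. 0 < u \<Longrightarrow> u < d \<Longrightarrow> \<bar>V (s, u)\<bar> \<le> B * (1 + \<bar>s\<bar>)"
    and z: "Im z \<noteq> 0" and f: "f \<in> L2 M" and \<epsilon>: "\<epsilon> > 0"
  shows "\<exists>\<psi>\<in>dirichlet_tensors d. L2_norm M (\<lambda>x. sop g h V \<psi> x - z * \<psi> x - f x) < \<epsilon>"
proof -
  have B: "B \<ge> 0" using V(2)[of "d/2" 0] d_pos by simp
  define R where "R n = real (Suc n)" for n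
  have R: "R n \<ge> 1" "R n > 0" for n by (auto simp: R_def)
  \<comment> \<open>Cut at 2 R, where the cutoff function of radius R ends: multiplied by that
    function, the truncated and the full potential agree.\<close>
  define VR where "VR n x = V x * indicator {-(2 * R n)..2 * R n} (fst x)" for n and x :: "real \<times> real"
  have VRm: "VR n \<in> borel_measurable M" for n
  proof -
    have "(\<lambda>x. indicator {-(2 * R n)..2 * R n} (fst x) :: real) \<in> borel_measurable M"
      by (rule strip_measurableI, unfold borel_prod[symmetric]) measurable
    with V(1) show ?thesis unfolding VR_def[abs_def] by (intro borel_measurable_times)
  qed
  have VRb: "\<bar>VR n (s, u)\<bar> \<le> B * (1 + 2 * R n)" if u: "0 < u" "u < d" for n s u
  proof (cases "\<bar>s\<bar> \<le> 2 * R n")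
    case True
    have "\<bar>VR n (s, u)\<bar> \<le> \<bar>V (s, u)\<bar>" by (simp add: VR_def indicator_def)
    also have "\<dots> \<le> B * (1 + \<bar>s\<bar>)" by (rule V(2)[OF u])
    also have "\<dots> \<le> B * (1 + 2 * R n)" using True B by (intro mult_left_mono) auto
    finally show ?thesis .
  next
    case False
    then show ?thesis using B R(2)[of n] by (auto simp: VR_def indicator_def)
  qed
  \<comment> \<open>One half for solving the truncated problem, one half for the errors of the
    cutoff.\<close>
  define \<delta> where "\<delta> = \<epsilon> / 2"
  have \<delta>: "\<delta> > 0" using \<epsilon> by (simp add: \<delta>_def)
  have "\<exists>\<psi>. \<psi> \<in> dirichlet_tensors d \<and> L2_norm M (\<lambda>x. sop g h (VR n) \<psi> x - z * \<psi> x - f x) < \<delta>" for n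
    using dense_range_bounded_potential[OF VRm VRb z f \<delta>, of n] by blast
  then obtain \<psi> where \<psi>: "\<And>n. \<psi> n \<in> dirichlet_tensors d"
      "\<And>n. L2_norm M (\<lambda>x. sop g h (VR n) (\<psi> n) x - z * \<psi> n x - f x) < \<delta>" by metis
  note D = dirichlet_tensorsD[OF \<psi>(1)]
  have admR: "admissible (VR n)" for n by (rule admissible_bounded[OF VRm VRb])
  define T where "T n x = sop g h (VR n) (\<psi> n) x - z * \<psi> n x" for n x
  have TL: "T n \<in> L2 M" for n unfolding T_def by (intro L2_diff L2_scale sop_L2 admR D)
  define m where "m = L2_norm M f + \<delta>"
  have m: "m \<ge> 0" using \<delta> by (simp add: m_def add_nonneg_pos less_imp_le)
  have Tm: "L2_norm M (T n) \<le> m" for n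
    using L2_norm_diff_le[OF TL f, of n] \<psi>(2)[of n] unfolding m_def T_def by linarith
  define m' where "m' = m / \<bar>Im z\<bar>"
  have m': "m' \<ge> 0" using m by (simp add: m'_def)
  have \<psi>m: "L2_norm M (\<psi> n) \<le> m'" for n
  proof -
    have "\<bar>Im z\<bar> * L2_norm M (\<psi> n) \<le> m"
      using sop_shift_lower_bound[OF \<psi>(1)[of n] admR[of n], of z] Tm[of n] unfolding T_def by linarith
    then show ?thesis using z by (simp add: m'_def field_simps)
  qed
  \<comment> \<open>Since R \<ge> 1, all terms of the form bound are at most a constant times R; 3 B
    comes from 1 + 2 R \<le> 3 R.\<close>
  define A where "A = (m' * m + (cmod z + 3 * B) * m'\<^sup>2) / g\<^sub>0"
  have A: "A \<ge> 0" unfolding A_def using m m' B g0_pos by (intro divide_nonneg_pos add_nonneg_nonneg mult_nonneg_nonneg) auto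
  have pA: "L2_norm M (partial_s (\<psi> n)) \<le> sqrt (A * R n)" for n
  proof -
    have "g\<^sub>0 * (L2_norm M (partial_s (\<psi> n)))\<^sup>2
        \<le> L2_norm M (\<psi> n) * L2_norm M (T n) + (cmod z + B * (1 + 2 * R n)) * (L2_norm M (\<psi> n))\<^sup>2"
      using partial_s_form_bound[OF VRm VRb \<psi>(1), of n n z] unfolding T_def by simp
    also have "\<dots> \<le> m' * m + (cmod z + B * (1 + 2 * R n)) * m'\<^sup>2"
      using B R(2)[of n] m m' by (intro add_mono mult_mono \<psi>m Tm power_mono) auto
    also have "\<dots> \<le> R n * (m' * m) + (R n * (cmod z + 3 * B)) * m'\<^sup>2"
    proof (intro add_mono mult_right_mono)
      show "m' * m \<le> R n * (m' * m)" using mult_right_mono[OF R(1)[of n], of "m' * m"] m m' by simp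
      have "cmod z \<le> R n * cmod z" "B \<le> R n * B"
        using mult_right_mono[OF R(1)[of n], of "cmod z"] mult_right_mono[OF R(1)[of n], of B] B by simp_all
      then show "cmod z + B * (1 + 2 * R n) \<le> R n * (cmod z + 3 * B)" by (simp add: algebra_simps)
    qed simp
    also have "\<dots> = g\<^sub>0 * (A * R n)" using g0_pos by (simp add: A_def field_simps)
    finally have "(L2_norm M (partial_s (\<psi> n)))\<^sup>2 \<le> A * R n" using g0_pos by simp
    then show ?thesis by (rule real_le_rsqrt)
  qed
  obtain K where K: "K \<ge> 0" "\<And>x. cmod (dv cutoff x) \<le> K" "\<And>x. cmod (dv (dv cutoff) x) \<le> K"
    using cutoff_dv_bounds by blast
  define c where "c n = cutoff_at (R n)" for n
  note cut = cutoff_at[OF R(2), folded c_def]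
  have c1: "cmod (dv (c n) s) \<le> K / R n" for n s
  proof -
    have "cmod (dv (c n) s) = inverse (R n) * cmod (dv cutoff (inverse (R n) * s))"
      unfolding cut(6) norm_mult norm_of_real using R(2)[of n] by simp
    also have "\<dots> \<le> inverse (R n) * K" using R(2)[of n] by (intro mult_left_mono K) simp
    finally show ?thesis by (simp add: divide_inverse mult.commute)
  qed
  have c2: "cmod (dv (dv (c n)) s) \<le> K / R n" for n s
  proof -
    have "cmod (dv (dv (c n)) s) = inverse (R n) * (inverse (R n) * cmod (dv (dv cutoff) (inverse (R n) * s)))"
      unfolding cut(7) norm_mult norm_power norm_of_real using R(2)[of n] by (simp add: power2_eq_square)
    also have "\<dots> \<le> inverse (R n) * (1 * K)"
      using R[of n] by (intro mult_left_mono mult_mono K) (auto simp: field_simps)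
    finally show ?thesis by (simp add: divide_inverse mult.commute)
  qed
  define \<phi> where "\<phi> n x = c n (fst x) * \<psi> n x" for n x
  have \<phi>D: "\<phi> n \<in> dirichlet_tensors d" for n
    unfolding \<phi>_def by (rule dirichlet_tensors_mult_s[OF \<psi>(1) cut(2)])
  have cm: "(\<lambda>x. r (fst x)) \<in> borel_measurable M" if "smooth r" for r
    by (rule strip_measurable_continuous)
       (rule continuous_on_compose2[OF smooth_continuous[OF that, of UNIV]], auto intro!: continuous_intros)
  \<comment> \<open>The four errors: residual of the truncated problem, tail of f, and the parts of
    the commutator acting on \<partial>_s \<psi> and on \<psi>.\<close>
  define E1 where "E1 n x = c n (fst x) * (T n x - f x)" for n x
  define E2 where "E2 n x = (c n (fst x) - 1) * f x" for n x
  define E3 where "E3 n x = (- of_real (g x) * (2 * dv (c n) (fst x))) * partial_s (\<psi> n) x" for n x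
  define E4 where "E4 n x = (- of_real (g x) * dv (dv (c n)) (fst x) - of_real (h x) * dv (c n) (fst x)) * \<psi> n x" for n x
  have VV: "c n (fst x) * (of_real (VR n x) * \<psi> n x) = c n (fst x) * (of_real (V x) * \<psi> n x)" for n x
    using cut(5)[of n "fst x"] by (cases "\<bar>fst x\<bar> \<ge> 2 * R n") (auto simp: VR_def indicator_def)
  have decomp: "sop g h V (\<phi> n) x - z * \<phi> n x - f x = (E1 n x + E2 n x) + (E3 n x + E4 n x)" for n x
  proof -
    have "c n (fst x) * sop g h V (\<psi> n) x = c n (fst x) * sop g h (VR n) (\<psi> n) x"
      unfolding sop_def distrib_left VV ..
    then show ?thesis
      unfolding \<phi>_def[abs_def] sop_mult_s[OF D(1) cut(2)] E1_def E2_def E3_def E4_def T_def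
      by (simp add: algebra_simps)
  qed
  have E1: "E1 n \<in> L2 M" "L2_norm M (E1 n) \<le> \<delta>" for n
  proof -
    have "AE x in M. cmod (c n (fst x)) \<le> 1" by (rule AE_I2) (rule cut(3))
    note l = L2_mult_bounded[OF L2_diff[OF TL[of n] f] cm[OF cut(2)] this zero_le_one]
    show "E1 n \<in> L2 M" unfolding E1_def by (rule l(1))
    show "L2_norm M (E1 n) \<le> \<delta>" using l(2) \<psi>(2)[of n] unfolding E1_def T_def by linarith
  qed
  have fm: "f \<in> borel_measurable M" by (rule L2_measurable[OF f])
  have E2: "E2 n \<in> L2 M" "(\<lambda>n. L2_norm M (\<lambda>x. E2 n x - 0)) \<longlonglongrightarrow> 0" for n
  proof -
    have wL: "(\<lambda>x. 2 * f x) \<in> L2 M" by (rule L2_scale[OF f])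
    have e2m: "E2 n \<in> borel_measurable M" for n
      unfolding E2_def[abs_def] by (intro borel_measurable_times borel_measurable_diff cm cut(2) borel_measurable_const fm)
    have dom: "AE x in M. cmod (E2 n x) \<le> cmod (2 * f x)" for n
    proof (rule AE_I2)
      fix x :: "real \<times> real"
      have "cmod (c n (fst x) - 1) \<le> 2" using norm_triangle_ineq4[of "c n (fst x)" 1] cut(3)[of n "fst x"] by simp
      then show "cmod (E2 n x) \<le> cmod (2 * f x)" by (simp add: E2_def norm_mult mult_right_mono)
    qed
    have lim: "AE x in M. (\<lambda>n. E2 n x) \<longlonglongrightarrow> 0"
    proof (rule AE_I2)
      fix x :: "real \<times> real"
      obtain N :: nat where N: "real N > \<bar>fst x\<bar>" using reals_Archimedean2 by blast
      have "E2 n x = 0" if "n \<ge> N" for n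
        using cut(4)[of "fst x" n] N that by (simp add: E2_def R_def)
      then have "\<forall>\<^sub>F n in sequentially. E2 n x = 0" by (auto simp: eventually_sequentially)
      then show "(\<lambda>n. E2 n x) \<longlonglongrightarrow> 0" by (rule tendsto_eventually)
    qed
    show "E2 n \<in> L2 M" by (rule L2_dominated[OF wL e2m dom])
    show "(\<lambda>n. L2_norm M (\<lambda>x. E2 n x - 0)) \<longlonglongrightarrow> 0"
      by (rule L2_dominated_convergence(3)[OF wL _ e2m dom lim]) simp
  qed
  have gb: "cmod (complex_of_real (g (s, u))) \<le> G" if "0 < u" "u < d" for s u
    using g_lower[OF that, of s] g_upper[OF that, of s] g0_pos by simp
  have E3: "E3 n \<in> L2 M" "L2_norm M (E3 n) \<le> (2 * G * K / R n) * sqrt (A * R n)" for n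
  proof -
    have wm: "(\<lambda>x. - of_real (g x) * (2 * dv (c n) (fst x))) \<in> borel_measurable M"
      by (intro borel_measurable_times borel_measurable_uminus g_complex_measurable borel_measurable_const
          cm smooth_deriv(2) cut(2))
    have wb: "AE x in M. cmod (- of_real (g x) * (2 * dv (c n) (fst x))) \<le> 2 * G * K / R n"
    proof (rule AE_stripI)
      fix s u assume u: "0 < u" "u < d"
      have "cmod (complex_of_real (g (s, u))) * (2 * cmod (dv (c n) s)) \<le> G * (2 * (K / R n))"
        by (intro mult_mono gb[OF u] mult_left_mono c1) (use G_pos in auto)
      then show "cmod (- of_real (g (s, u)) * (2 * dv (c n) (fst (s, u)))) \<le> 2 * G * K / R n"
        by (simp add: norm_mult ac_simps)
    qed
    have nn: "2 * G * K / R n \<ge> 0" using G_pos K(1) R(2)[of n] by simp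
    note l = L2_mult_bounded[OF tensor_span_L2[OF tensor_span_partial_s(2)[OF D(1)]] wm wb nn]
    show "E3 n \<in> L2 M" unfolding E3_def by (rule l(1))
    show "L2_norm M (E3 n) \<le> (2 * G * K / R n) * sqrt (A * R n)"
      unfolding E3_def by (rule order_trans[OF l(2) mult_left_mono[OF pA nn]])
  qed
  have E4: "E4 n \<in> L2 M" "L2_norm M (E4 n) \<le> ((G + B\<^sub>h) * K / R n) * m'" for n
  proof -
    have wm: "(\<lambda>x. - of_real (g x) * dv (dv (c n)) (fst x) - of_real (h x) * dv (c n) (fst x)) \<in> borel_measurable M"
      by (intro borel_measurable_times borel_measurable_diff borel_measurable_uminus g_complex_measurable
          h_complex_measurable borel_measurable_const cm smooth_deriv(2) cut(2))
    have wb: "AE x in M. cmod (- of_real (g x) * dv (dv (c n)) (fst x) - of_real (h x) * dv (c n) (fst x)) \<le> (G + B\<^sub>h) * K / R n"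
    proof (rule AE_stripI)
      fix s u assume u: "0 < u" "u < d"
      have "cmod (- of_real (g (s, u)) * dv (dv (c n)) s - of_real (h (s, u)) * dv (c n) s)
          \<le> cmod (- of_real (g (s, u)) * dv (dv (c n)) s) + cmod (of_real (h (s, u)) * dv (c n) s)"
        by (rule norm_triangle_ineq4)
      also have "\<dots> \<le> G * (K / R n) + B\<^sub>h * (K / R n)"
        unfolding norm_mult norm_minus_cancel
        by (intro add_mono mult_mono gb[OF u] c1 c2) (use G_pos Bh_nonneg h_bound[OF u] in auto)
      finally show "cmod (- of_real (g (s, u)) * dv (dv (c n)) (fst (s, u)) - of_real (h (s, u)) * dv (c n) (fst (s, u)))
          \<le> (G + B\<^sub>h) * K / R n" by (simp add: algebra_simps add_divide_distrib)
    qed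
    have nn: "(G + B\<^sub>h) * K / R n \<ge> 0" using G_pos Bh_nonneg K(1) R(2)[of n] by simp
    note l = L2_mult_bounded[OF D(5) wm wb nn]
    show "E4 n \<in> L2 M" unfolding E4_def by (rule l(1))
    show "L2_norm M (E4 n) \<le> ((G + B\<^sub>h) * K / R n) * m'"
      unfolding E4_def by (rule order_trans[OF l(2) mult_left_mono[OF \<psi>m nn]])
  qed
  \<comment> \<open>The tail of f tends to 0 by dominated convergence; the commutator parts are
    O(R^(-1/2)) and O(R^(-1)).\<close>
  define e where "e n = L2_norm M (\<lambda>x. E2 n x - 0) + ((2 * G * K / R n) * sqrt (A * R n) + ((G + B\<^sub>h) * K / R n) * m')" for n
  have iR: "(\<lambda>n. inverse (R n)) \<longlonglongrightarrow> 0" unfolding R_def by (rule LIMSEQ_inverse_real_of_nat)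
  have "(\<lambda>n. 2 * G * K * sqrt (A * inverse (R n))) \<longlonglongrightarrow> 2 * G * K * sqrt (A * 0)"
    by (intro tendsto_intros iR)
  moreover have "2 * G * K * sqrt (A * inverse (R n)) = (2 * G * K / R n) * sqrt (A * R n)" for n
  proof -
    have "A * inverse (R n) = (A * R n) / (R n)\<^sup>2" using R(2)[of n] by (simp add: field_simps power2_eq_square)
    then show ?thesis using R(2)[of n] by (simp add: real_sqrt_divide)
  qed
  ultimately have "(\<lambda>n. (2 * G * K / R n) * sqrt (A * R n)) \<longlonglongrightarrow> 0" by simp
  moreover have "(\<lambda>n. (G + B\<^sub>h) * K * inverse (R n) * m') \<longlonglongrightarrow> (G + B\<^sub>h) * K * 0 * m'"
    by (intro tendsto_intros iR)
  then have "(\<lambda>n. ((G + B\<^sub>h) * K / R n) * m') \<longlonglongrightarrow> 0" by (simp add: divide_inverse)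
  ultimately have "e \<longlonglongrightarrow> 0 + (0 + 0)" unfolding e_def by (intro tendsto_add E2(2))
  then have "e \<longlonglongrightarrow> 0" by simp
  then have "\<forall>\<^sub>F n in sequentially. e n < \<delta>" by (rule order_tendstoD(2)) (rule \<delta>)
  then obtain n where n: "e n < \<delta>" using eventually_happens trivial_limit_sequentially by blast
  have "L2_norm M (\<lambda>x. sop g h V (\<phi> n) x - z * \<phi> n x - f x)
      \<le> (L2_norm M (E1 n) + L2_norm M (E2 n)) + (L2_norm M (E3 n) + L2_norm M (E4 n))"
    unfolding decomp
    by (rule order_trans[OF L2_norm_triangle[OF L2_add[OF E1(1) E2(1)] L2_add[OF E3(1) E4(1)]]
          add_mono[OF L2_norm_triangle[OF E1(1) E2(1)] L2_norm_triangle[OF E3(1) E4(1)]]])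
  also have "\<dots> \<le> \<delta> + e n" using E1(2)[of n] E3(2)[of n] E4(2)[of n] by (simp add: e_def)
  also have "\<dots> < \<epsilon>" using n by (simp add: \<delta>_def)
  finally show ?thesis using \<phi>D by blast
qed

end

section \<open>The Stark operator\<close>

lemma schwartz_iterated_differentiable:
  "\<psi> \<in> schwartz \<Longrightarrow> (partial_s ^^ m) ((partial_u ^^ n) \<psi>) differentiable_on UNIV"
  by (simp add: schwartz_def)

lemma schwartz_partials_add:
  assumes "\<phi> \<in> schwartz" "\<psi> \<in> schwartz"
  shows "(partial_s ^^ m) ((partial_u ^^ n) (\<lambda>x. \<phi> x + \<psi> x))
    = (\<lambda>x. (partial_s ^^ m) ((partial_u ^^ n) \<phi>) x + (partial_s ^^ m) ((partial_u ^^ n) \<psi>) x)"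
proof (induction m)
  case 0
  show ?case
  proof (induction n)
    case (Suc n)
    have "partial_u (\<lambda>x. (partial_u ^^ n) \<phi> x + (partial_u ^^ n) \<psi> x)
        = (\<lambda>x. partial_u ((partial_u ^^ n) \<phi>) x + partial_u ((partial_u ^^ n) \<psi>) x)"
      using schwartz_iterated_differentiable[OF assms(1), of 0 n] schwartz_iterated_differentiable[OF assms(2), of 0 n]
      by (intro partial_u_eqI has_vector_derivative_add differentiable_partial_u) auto
    then show ?case using Suc by simp
  qed simp
next
  case (Suc m)
  have "partial_s (\<lambda>x. (partial_s ^^ m) ((partial_u ^^ n) \<phi>) x + (partial_s ^^ m) ((partial_u ^^ n) \<psi>) x)
      = (\<lambda>x. partial_s ((partial_s ^^ m) ((partial_u ^^ n) \<phi>)) x + partial_s ((partial_s ^^ m) ((partial_u ^^ n) \<psi>)) x)"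
    by (intro partial_s_eqI has_vector_derivative_add differentiable_partial_s schwartz_iterated_differentiable assms)
  then show ?case using Suc by simp
qed

lemma schwartz_partials_scale:
  assumes "\<psi> \<in> schwartz"
  shows "(partial_s ^^ m) ((partial_u ^^ n) (\<lambda>x. c * \<psi> x)) = (\<lambda>x. c * (partial_s ^^ m) ((partial_u ^^ n) \<psi>) x)"
proof (induction m)
  case 0
  show ?case
  proof (induction n)
    case (Suc n)
    have "partial_u (\<lambda>x. c * (partial_u ^^ n) \<psi> x) = (\<lambda>x. c * partial_u ((partial_u ^^ n) \<psi>) x)"
      using schwartz_iterated_differentiable[OF assms(1), of 0 n]
      by (intro partial_u_eqI has_vector_derivative_mult_right differentiable_partial_u) auto
    then show ?case using Suc by simp
  qed simp
next
  case (Suc m)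
  have "partial_s (\<lambda>x. c * (partial_s ^^ m) ((partial_u ^^ n) \<psi>) x)
      = (\<lambda>x. c * partial_s ((partial_s ^^ m) ((partial_u ^^ n) \<psi>)) x)"
    by (intro partial_s_eqI has_vector_derivative_mult_right differentiable_partial_s schwartz_iterated_differentiable assms)
  then show ?case using Suc by simp
qed

lemma schwartz_add:
  assumes \<phi>: "\<phi> \<in> schwartz" and \<psi>: "\<psi> \<in> schwartz"
  shows "(\<lambda>x. \<phi> x + \<psi> x) \<in> schwartz"
  unfolding schwartz_def mem_Collect_eq schwartz_partials_add[OF \<phi> \<psi>]
proof (intro conjI allI)
  fix m n
  show "(\<lambda>x. (partial_s ^^ m) ((partial_u ^^ n) \<phi>) x + (partial_s ^^ m) ((partial_u ^^ n) \<psi>) x) differentiable_on UNIV"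
    by (intro differentiable_on_add schwartz_iterated_differentiable \<phi> \<psi>)
  fix j k
  obtain C where C: "\<And>s u. \<bar>s\<bar> ^ j * \<bar>u\<bar> ^ k * cmod ((partial_s ^^ m) ((partial_u ^^ n) \<phi>) (s, u)) \<le> C"
    using \<phi> unfolding schwartz_def by blast
  obtain C' where C': "\<And>s u. \<bar>s\<bar> ^ j * \<bar>u\<bar> ^ k * cmod ((partial_s ^^ m) ((partial_u ^^ n) \<psi>) (s, u)) \<le> C'"
    using \<psi> unfolding schwartz_def by blast
  have "\<bar>s\<bar> ^ j * \<bar>u\<bar> ^ k * cmod ((partial_s ^^ m) ((partial_u ^^ n) \<phi>) (s, u) + (partial_s ^^ m) ((partial_u ^^ n) \<psi>) (s, u)) \<le> C + C'" for s u
  proof -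
    have "\<bar>s\<bar> ^ j * \<bar>u\<bar> ^ k * cmod ((partial_s ^^ m) ((partial_u ^^ n) \<phi>) (s, u) + (partial_s ^^ m) ((partial_u ^^ n) \<psi>) (s, u))
        \<le> \<bar>s\<bar> ^ j * \<bar>u\<bar> ^ k * (cmod ((partial_s ^^ m) ((partial_u ^^ n) \<phi>) (s, u)) + cmod ((partial_s ^^ m) ((partial_u ^^ n) \<psi>) (s, u)))"
      by (intro mult_left_mono norm_triangle_ineq) simp
    then show ?thesis using C[of s u] C'[of s u] unfolding distrib_left by linarith
  qed
  then show "\<exists>C. \<forall>s u. \<bar>s\<bar> ^ j * \<bar>u\<bar> ^ k * cmod ((partial_s ^^ m) ((partial_u ^^ n) \<phi>) (s, u) + (partial_s ^^ m) ((partial_u ^^ n) \<psi>) (s, u)) \<le> C"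
    by blast
qed

lemma schwartz_scale:
  assumes \<psi>: "\<psi> \<in> schwartz" shows "(\<lambda>x. c * \<psi> x) \<in> schwartz"
  unfolding schwartz_def mem_Collect_eq schwartz_partials_scale[OF \<psi>]
proof (intro conjI allI)
  fix m n
  show "(\<lambda>x. c * (partial_s ^^ m) ((partial_u ^^ n) \<psi>) x) differentiable_on UNIV"
    by (intro differentiable_on_mult differentiable_on_const schwartz_iterated_differentiable \<psi>)
  fix j k
  obtain C where C: "\<And>s u. \<bar>s\<bar> ^ j * \<bar>u\<bar> ^ k * cmod ((partial_s ^^ m) ((partial_u ^^ n) \<psi>) (s, u)) \<le> C"
    using \<psi> unfolding schwartz_def by blast
  have "\<bar>s\<bar> ^ j * \<bar>u\<bar> ^ k * cmod (c * (partial_s ^^ m) ((partial_u ^^ n) \<psi>) (s, u)) \<le> cmod c * C" for s u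
    using mult_left_mono[OF C[of s u], of "cmod c"] by (simp add: norm_mult ac_simps)
  then show "\<exists>C. \<forall>s u. \<bar>s\<bar> ^ j * \<bar>u\<bar> ^ k * cmod (c * (partial_s ^^ m) ((partial_u ^^ n) \<psi>) (s, u)) \<le> C" by blast
qed

lemma dirichlet_schwartz_add:
  "\<phi> \<in> dirichlet_schwartz d \<Longrightarrow> \<psi> \<in> dirichlet_schwartz d \<Longrightarrow> (\<lambda>x. \<phi> x + \<psi> x) \<in> dirichlet_schwartz d"
  by (simp add: dirichlet_schwartz_def schwartz_add)

lemma dirichlet_schwartz_scale:
  "\<psi> \<in> dirichlet_schwartz d \<Longrightarrow> (\<lambda>x. c * \<psi> x) \<in> dirichlet_schwartz d"
  by (simp add: dirichlet_schwartz_def schwartz_scale)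

lemma sop_schwartz_add:
  assumes "\<phi> \<in> schwartz" "\<psi> \<in> schwartz"
  shows "sop g h V (\<lambda>x. \<phi> x + \<psi> x) x = sop g h V \<phi> x + sop g h V \<psi> x"
  using schwartz_partials_add[OF assms, of 2 0] schwartz_partials_add[OF assms, of 1 0]
    schwartz_partials_add[OF assms, of 0 2]
  by (simp add: sop_def numeral_2_eq_2 algebra_simps)

lemma sop_schwartz_scale:
  assumes "\<psi> \<in> schwartz"
  shows "sop g h V (\<lambda>x. c * \<psi> x) x = c * sop g h V \<psi> x"
  using schwartz_partials_scale[OF assms, of 2 0] schwartz_partials_scale[OF assms, of 1 0]
    schwartz_partials_scale[OF assms, of 0 2]
  by (simp add: sop_def numeral_2_eq_2 algebra_simps)

lemma graph_onI:
  "f \<in> borel_measurable N \<Longrightarrow> k \<in> borel_measurable N \<Longrightarrow> \<psi> \<in> D \<Longrightarrow> AE x in N. f x = \<psi> x \<Longrightarrow>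
    AE x in N. k x = T \<psi> x \<Longrightarrow> (f, k) \<in> graph_on N D T"
  unfolding graph_on_def by blast

section \<open>The operator on the Schwartz domain\<close>

context strip_coefficients
begin

lemma dirichlet_schwartzD:
  assumes "\<psi> \<in> dirichlet_schwartz d"
  shows "\<psi> \<in> schwartz" "nice \<psi>" "\<psi> (s, 0) = 0" "\<psi> (s, d) = 0" "\<psi> \<in> L2 M"
proof -
  show "\<psi> \<in> schwartz" "nice \<psi>" "\<psi> (s, 0) = 0" "\<psi> (s, d) = 0"
    using assms schwartz_nice by (auto simp: dirichlet_schwartz_def)
  then show "\<psi> \<in> L2 M" by (intro decaying_L2 rapid_decaying) (simp add: nice_def)
qed

definition op :: "(real \<times> real \<Rightarrow> real) \<Rightarrow> (real \<times> real) graph" where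
  "op V = graph_on M (dirichlet_schwartz d) (sop g h V)"

context
  fixes V :: "real \<times> real \<Rightarrow> real"
  assumes adm: "admissible V"
begin

lemma op_I: "\<psi> \<in> dirichlet_schwartz d \<Longrightarrow> (\<psi>, sop g h V \<psi>) \<in> op V"
  unfolding op_def graph_on_def
  using L2_measurable[OF dirichlet_schwartzD(5)] L2_measurable[OF sop_L2[OF dirichlet_schwartzD(2) adm]]
  by (intro CollectI case_prodI conjI) auto

lemma op_E:
  assumes "(f, k) \<in> op V"
  obtains \<psi> where "\<psi> \<in> dirichlet_schwartz d" "AE x in M. f x = \<psi> x" "AE x in M. k x = sop g h V \<psi> x"
    "f \<in> L2 M" "k \<in> L2 M"
proof -
  obtain \<psi> where \<psi>: "f \<in> borel_measurable M" "k \<in> borel_measurable M" "\<psi> \<in> dirichlet_schwartz d"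
      "AE x in M. f x = \<psi> x" "AE x in M. k x = sop g h V \<psi> x"
    using assms unfolding op_def graph_on_def by blast
  have "f \<in> L2 M" by (rule L2_dominated[OF dirichlet_schwartzD(5)[OF \<psi>(3)] \<psi>(1)]) (use \<psi>(4) in auto)
  moreover have "k \<in> L2 M"
    by (rule L2_dominated[OF sop_L2[OF dirichlet_schwartzD(2)[OF \<psi>(3)] adm] \<psi>(2)]) (use \<psi>(5) in auto)
  ultimately show ?thesis using that \<psi> by blast
qed

lemma op_subset_L2: "op V \<subseteq> L2 M \<times> L2 M"
  by (auto elim: op_E)

lemma op_densely_defined: "densely_defined M (op V)"
  unfolding densely_defined_def
proof (intro ballI allI impI)
  fix f \<epsilon> assume "f \<in> L2 M" "(\<epsilon>::real) > 0"
  then obtain \<psi> where \<psi>: "\<psi> \<in> dirichlet_tensors d" "L2_norm M (\<lambda>x. \<psi> x - f x) < \<epsilon>"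
    using dirichlet_tensors_dense[OF d_pos] by blast
  then have "\<psi> \<in> Domain (op V)" using op_I dirichlet_tensors_subset by blast
  then show "\<exists>g\<in>Domain (op V). L2_norm M (\<lambda>x. f x - g x) < \<epsilon>"
    using \<psi>(2) by (auto simp: L2_norm_minus_commute[of M f])
qed

lemma op_subset_adjoint: "op V \<subseteq> op_adjoint M (op V)"
proof (rule subrelI)
  fix g' k assume gk: "(g', k) \<in> op V"
  obtain \<phi> where \<phi>: "\<phi> \<in> dirichlet_schwartz d" "AE x in M. g' x = \<phi> x" "AE x in M. k x = sop g h V \<phi> x"
    and L: "g' \<in> L2 M" "k \<in> L2 M" using op_E[OF gk] by metis
  have "L2_inner M g' q = L2_inner M k p" if pq: "(p, q) \<in> op V" for p q
  proof -
    obtain \<psi> where \<psi>: "\<psi> \<in> dirichlet_schwartz d" "AE x in M. p x = \<psi> x" "AE x in M. q x = sop g h V \<psi> x"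
      and pqL: "p \<in> L2 M" "q \<in> L2 M" using op_E[OF pq] by metis
    have cong: "L2_inner M a b = L2_inner M a' b'"
      if "AE x in M. a x = a' x" "AE x in M. b x = b' x" "a \<in> L2 M" "b \<in> L2 M" "a' \<in> L2 M" "b' \<in> L2 M"
      for a b a' b' :: "real \<times> real \<Rightarrow> complex"
      unfolding L2_inner_def
      by (rule integral_cong_AE)
         (use that L2_measurable[of _ M] in \<open>auto intro!: borel_measurable_times borel_measurable_cnj\<close>)
    note D\<phi> = dirichlet_schwartzD[OF \<phi>(1)] and D\<psi> = dirichlet_schwartzD[OF \<psi>(1)]
    have "L2_inner M g' q = L2_inner M \<phi> (sop g h V \<psi>)"
      by (rule cong[OF \<phi>(2) \<psi>(3) L(1) pqL(2) D\<phi>(5) sop_L2[OF D\<psi>(2) adm]])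
    also have "\<dots> = L2_inner M (sop g h V \<phi>) \<psi>"
      by (rule sop_symmetric[OF D\<phi>(2) D\<psi>(2) adm D\<phi>(3) D\<phi>(4) D\<psi>(3) D\<psi>(4)])
    also have "\<dots> = L2_inner M k p"
      by (rule cong[OF \<phi>(3) \<psi>(2) L(2) pqL(1) sop_L2[OF D\<phi>(2) adm] D\<psi>(5), symmetric])
    finally show ?thesis .
  qed
  then show "(g', k) \<in> op_adjoint M (op V)" using L by (auto simp: op_adjoint_def)
qed

lemma op_linear: "linear_operator M (op V)"
  unfolding linear_operator_def
proof (intro conjI)
  show "op V \<subseteq> L2 M \<times> L2 M" by (rule op_subset_L2)
  show "\<forall>(f, h)\<in>op V. \<forall>f'\<in>L2 M. \<forall>h'\<in>L2 M.
        (AE x in M. f' x = f x) \<longrightarrow> (AE x in M. h' x = h x) \<longrightarrow> (f', h') \<in> op V"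
  proof (clarify)
    fix f k f' k' assume *: "(f, k) \<in> op V" "f' \<in> L2 M" "k' \<in> L2 M"
      "AE x in M. f' x = f x" "AE x in M. k' x = k x"
    obtain \<psi> where \<psi>: "\<psi> \<in> dirichlet_schwartz d" "AE x in M. f x = \<psi> x" "AE x in M. k x = sop g h V \<psi> x"
      using op_E[OF *(1)] by metis
    have "AE x in M. f' x = \<psi> x" using *(4) \<psi>(2) by eventually_elim simp
    moreover have "AE x in M. k' x = sop g h V \<psi> x" using *(5) \<psi>(3) by eventually_elim simp
    ultimately show "(f', k') \<in> op V"
      unfolding op_def by (rule graph_onI[OF L2_measurable[OF *(2)] L2_measurable[OF *(3)] \<psi>(1)])
  qed
  have z: "(\<lambda>x. 0) \<in> dirichlet_schwartz d" using dirichlet_tensors_zero dirichlet_tensors_subset by blast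
  have "sop g h V (\<lambda>x. 0) = (\<lambda>x. 0)"
    using sop_schwartz_scale[OF dirichlet_schwartzD(1)[OF z], of g h V 0] by auto
  then show "(\<lambda>x. 0, \<lambda>x. 0) \<in> op V" using op_I[OF z] by simp
  show "\<forall>(f, h)\<in>op V. \<forall>(f', h')\<in>op V. (\<lambda>x. f x + f' x, \<lambda>x. h x + h' x) \<in> op V"
  proof (clarify)
    fix f k f' k' assume *: "(f, k) \<in> op V" "(f', k') \<in> op V"
    obtain \<psi> where \<psi>: "\<psi> \<in> dirichlet_schwartz d" "AE x in M. f x = \<psi> x" "AE x in M. k x = sop g h V \<psi> x"
      and L: "f \<in> L2 M" "k \<in> L2 M" using op_E[OF *(1)] by metis
    obtain \<phi> where \<phi>: "\<phi> \<in> dirichlet_schwartz d" "AE x in M. f' x = \<phi> x" "AE x in M. k' x = sop g h V \<phi> x"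
      and L': "f' \<in> L2 M" "k' \<in> L2 M" using op_E[OF *(2)] by metis
    have "AE x in M. f x + f' x = \<psi> x + \<phi> x" using \<psi>(2) \<phi>(2) by eventually_elim simp
    moreover have "AE x in M. k x + k' x = sop g h V (\<lambda>x. \<psi> x + \<phi> x) x"
      using \<psi>(3) \<phi>(3)
      by eventually_elim (simp add: sop_schwartz_add dirichlet_schwartzD(1) \<psi>(1) \<phi>(1))
    ultimately show "(\<lambda>x. f x + f' x, \<lambda>x. k x + k' x) \<in> op V"
      unfolding op_def
      by (rule graph_onI[OF L2_measurable[OF L2_add[OF L(1) L'(1)]] L2_measurable[OF L2_add[OF L(2) L'(2)]]
            dirichlet_schwartz_add[OF \<psi>(1) \<phi>(1)]])
  qed
  show "\<forall>c. \<forall>(f, h)\<in>op V. (\<lambda>x. c * f x, \<lambda>x. c * h x) \<in> op V"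
  proof (clarify)
    fix c f k assume *: "(f, k) \<in> op V"
    obtain \<psi> where \<psi>: "\<psi> \<in> dirichlet_schwartz d" "AE x in M. f x = \<psi> x" "AE x in M. k x = sop g h V \<psi> x"
      and L: "f \<in> L2 M" "k \<in> L2 M" using op_E[OF *] by metis
    have "AE x in M. c * f x = c * \<psi> x" using \<psi>(2) by eventually_elim simp
    moreover have "AE x in M. c * k x = sop g h V (\<lambda>x. c * \<psi> x) x"
      using \<psi>(3) by eventually_elim (simp add: sop_schwartz_scale dirichlet_schwartzD(1) \<psi>(1))
    ultimately show "(\<lambda>x. c * f x, \<lambda>x. c * k x) \<in> op V"
      unfolding op_def
      by (rule graph_onI[OF L2_measurable[OF L2_scale[OF L(1)]] L2_measurable[OF L2_scale[OF L(2)]]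
            dirichlet_schwartz_scale[OF \<psi>(1)]])
  qed
  \<comment> \<open>Equality almost everywhere in the strip does not by itself compare derivatives.
    Instead the graph lies in its adjoint, and the adjoint of a densely defined operator is
    single-valued.\<close>
  have "AE x in M. k x = k' x"
    if "(f, k) \<in> op V" "(f', k') \<in> op V" "AE x in M. f x = f' x" for f k f' k'
    using linear_operator_unique[OF linear_operator_adjoint[OF op_subset_L2 op_densely_defined]] that
      op_subset_adjoint by blast
  then show "\<forall>(f, h)\<in>op V. \<forall>(f', h')\<in>op V. (AE x in M. f x = f' x) \<longrightarrow> (AE x in M. h x = h' x)"
    by blast
qed

lemma op_symmetric: "symmetric_operator M (op V)"
  using op_linear op_densely_defined op_subset_adjoint by (simp add: symmetric_operator_def)

end

lemma admissible_linear:
  assumes "V \<in> borel_measurable M" "\<And>s u. 0 < u \<Longrightarrow> u < d \<Longrightarrow> \<bar>V (s, u)\<bar> \<le> B * (1 + \<bar>s\<bar>)"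
  shows "admissible V"
proof -
  have B: "B \<ge> 0" using assms(2)[of "d/2" 0] d_pos by simp
  have "\<bar>V (s, u)\<bar> \<le> (2 * B) * (1 + s\<^sup>2)" if u: "0 < u" "u < d" for s u
  proof -
    have "\<bar>s\<bar> \<le> 1 + s\<^sup>2"
      using sum_squares_bound[of "\<bar>s\<bar>" 1] by (simp add: power2_eq_square)
    then have "1 + \<bar>s\<bar> \<le> 2 * (1 + s\<^sup>2)" using zero_le_power2[of s] unfolding distrib_left by linarith
    then have "B * (1 + \<bar>s\<bar>) \<le> B * (2 * (1 + s\<^sup>2))" using B by (rule mult_left_mono)
    also have "B * (2 * (1 + s\<^sup>2)) = (2 * B) * (1 + s\<^sup>2)" by simp
    finally show ?thesis using assms(2)[OF u, of s] by linarith
  qed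
  then show ?thesis using assms(1) unfolding admissible_def by blast
qed

lemma op_dense_shift:
  assumes "V \<in> borel_measurable M" "\<And>s u. 0 < u \<Longrightarrow> u < d \<Longrightarrow> \<bar>V (s, u)\<bar> \<le> B * (1 + \<bar>s\<bar>)" "Im z \<noteq> 0"
  shows "dense_shift M (op V) z"
  unfolding dense_shift_def
proof (intro ballI allI impI)
  fix f \<epsilon> assume "f \<in> L2 M" "(\<epsilon>::real) > 0"
  then obtain \<psi> where "\<psi> \<in> dirichlet_tensors d" "L2_norm M (\<lambda>x. sop g h V \<psi> x - z * \<psi> x - f x) < \<epsilon>"
    using dense_range_linear_potential[OF assms] by blast
  then show "\<exists>(p, q)\<in>op V. L2_norm M (\<lambda>x. q x - z * p x - f x) < \<epsilon>"
    using op_I[OF admissible_linear[OF assms(1,2)]] dirichlet_tensors_subset by blast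
qed

theorem op_essentially_self_adjoint:
  assumes "V \<in> borel_measurable M" "\<And>s u. 0 < u \<Longrightarrow> u < d \<Longrightarrow> \<bar>V (s, u)\<bar> \<le> B * (1 + \<bar>s\<bar>)"
  shows "essentially_self_adjoint M (op V)" "op_spectrum M (op_closure M (op V)) \<subseteq> \<real>"
proof -
  note sym = op_symmetric[OF admissible_linear[OF assms]]
  show esa: "essentially_self_adjoint M (op V)"
    by (rule essentially_self_adjointI[OF sym, of \<i>]) (auto intro: op_dense_shift[OF assms])
  have "z \<in> \<real>" if z: "z \<in> op_spectrum M (op_closure M (op V))" for z
  proof (rule ccontr)
    assume "z \<notin> \<real>"
    then have "Im z \<noteq> 0" by (simp add: complex_is_Real_iff)
    then have "z \<in> resolvent_set M (op_closure M (op V))"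
      using esa by (intro nonreal_in_resolvent_set sym op_dense_shift[OF assms])
        (auto simp: essentially_self_adjoint_def self_adjoint_def)
    then show False using z by (simp add: op_spectrum_def)
  qed
  then show "op_spectrum M (op_closure M (op V)) \<subseteq> \<real>" by blast
qed

end

section \<open>Metric and potential of the curved strip\<close>

lemma C1_deriv:
  fixes f :: "real \<Rightarrow> real"
  assumes "f C1_differentiable_on UNIV"
  shows "(f has_real_derivative deriv f s) (at s)" "continuous_on UNIV (deriv f)"
proof -
  obtain D where D: "\<And>x. (f has_vector_derivative D x) (at x)" "continuous_on UNIV D"
    using assms unfolding C1_differentiable_on_def by blast
  have r: "(f has_real_derivative D x) (at x)" for x
    using D(1)[of x] by (simp add: has_real_derivative_iff_has_vector_derivative)
  then have eq: "deriv f = D" by (auto intro: DERIV_imp_deriv)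
  show "(f has_real_derivative deriv f s) (at s)" "continuous_on UNIV (deriv f)"
    using r D(2) by (simp_all add: eq)
qed

lemma borel_measurable_continuous_fst:
  "(\<lambda>x::real \<times> real. f (fst x)) \<in> borel_measurable borel" if "continuous_on UNIV f" for f :: "real \<Rightarrow> real"
  by (rule borel_measurable_continuous_onI, rule continuous_on_compose2[OF that]) (auto intro!: continuous_intros)

lemma snd_borel: "(\<lambda>x::real \<times> real. snd x) \<in> borel_measurable borel"
  by (rule borel_measurable_continuous_onI) (auto intro!: continuous_intros)

lemma fst_borel: "(\<lambda>x::real \<times> real. fst x) \<in> borel_measurable borel"
  by (rule borel_measurable_continuous_onI) (auto intro!: continuous_intros)

locale stark =
  fixes d s\<^sub>0 \<eta> F :: real and \<gamma> :: "real \<Rightarrow> real"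
  assumes d_pos: "d > 0" and s0_pos: "s\<^sub>0 > 0"
    and supp: "closure {s. \<gamma> s \<noteq> 0} = {0..s\<^sub>0}"
    and h1: "\<gamma> C1_differentiable_on UNIV" "deriv \<gamma> C1_differentiable_on UNIV"
    and h2: "d * (SUP s. \<bar>\<gamma> s\<bar>) < 1"
    and h3: "\<bar>\<eta>\<bar> < pi / 2"
    and F_pos: "F > 0"
begin

lemmas \<gamma>_deriv = C1_deriv(1)[OF h1(1)] and \<gamma>'_cont = C1_deriv(2)[OF h1(1)]
  and \<gamma>'_deriv = C1_deriv(1)[OF h1(2)] and \<gamma>''_cont = C1_deriv(2)[OF h1(2)]

lemma \<gamma>_cont: "continuous_on UNIV \<gamma>"
  using \<gamma>_deriv DERIV_isCont continuous_at_imp_continuous_on by blast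

text \<open>The complement of the closed support is open, so the derivatives vanish there together
  with \<gamma>.\<close>

lemma outside_zero:
  assumes "s \<notin> {0..s\<^sub>0}" shows "\<gamma> s = 0" "deriv \<gamma> s = 0" "deriv (deriv \<gamma>) s = 0"
proof -
  have 0: "\<gamma> t = 0" if "t \<in> - {0..s\<^sub>0}" for t
    using that closure_subset[of "{s. \<gamma> s \<noteq> 0}"] unfolding supp by auto
  then show "\<gamma> s = 0" using assms by simp
  have o: "open (- {0..s\<^sub>0})" by auto
  have 1: "deriv \<gamma> t = 0" if t: "t \<in> - {0..s\<^sub>0}" for t
  proof -
    have "(\<gamma> has_real_derivative 0) (at t)"
      by (rule has_field_derivative_transform_within_open[OF DERIV_const[of 0] o t]) (use 0 in auto)
    then show ?thesis by (rule DERIV_imp_deriv)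
  qed
  then show "deriv \<gamma> s = 0" using assms by simp
  have "(deriv \<gamma> has_real_derivative 0) (at s)"
    by (rule has_field_derivative_transform_within_open[OF DERIV_const[of 0] o]) (use 1 assms in auto)
  then show "deriv (deriv \<gamma>) s = 0" by (rule DERIV_imp_deriv)
qed

lemma bounded_if_supported:
  fixes f :: "real \<Rightarrow> real"
  assumes "continuous_on UNIV f" "\<And>s. s \<notin> {0..s\<^sub>0} \<Longrightarrow> f s = 0"
  shows "\<exists>K\<ge>0. \<forall>s. \<bar>f s\<bar> \<le> K"
proof -
  have "bounded (f ` {0..s\<^sub>0})"
    by (intro compact_imp_bounded compact_continuous_image continuous_on_subset[OF assms(1)]) auto
  then obtain K where K: "\<forall>s\<in>{0..s\<^sub>0}. \<bar>f s\<bar> \<le> K" by (auto simp: bounded_iff)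
  have "\<bar>f s\<bar> \<le> max K 0" for s
    using K assms(2)[of s] by (cases "s \<in> {0..s\<^sub>0}") (auto simp: le_max_iff_disj)
  then show ?thesis by (intro exI[of _ "max K 0"]) auto
qed

definition \<delta> :: real where "\<delta> = d * (SUP s. \<bar>\<gamma> s\<bar>)"

lemma \<delta>_less: "\<delta> < 1" using h2 by (simp add: \<delta>_def)

lemma u\<gamma>_bound: "0 < u \<Longrightarrow> u < d \<Longrightarrow> \<bar>u * \<gamma> s\<bar> \<le> \<delta>"
proof -
  assume u: "0 < u" "u < d"
  obtain K where "\<forall>s. \<bar>\<gamma> s\<bar> \<le> K" using bounded_if_supported[OF \<gamma>_cont outside_zero(1)] by blast
  \<comment> \<open>A real supremum bounds its family only once boundedness is known; continuity and
    compact support provide it.\<close>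
  then have "bdd_above (range (\<lambda>s. \<bar>\<gamma> s\<bar>))" by (auto intro!: bdd_aboveI[of _ K])
  then have "\<bar>\<gamma> s\<bar> \<le> (SUP s. \<bar>\<gamma> s\<bar>)" by (intro cSUP_upper) auto
  then have "u * \<bar>\<gamma> s\<bar> \<le> d * (SUP s. \<bar>\<gamma> s\<bar>)" using u by (intro mult_mono) auto
  then show ?thesis using u by (simp add: \<delta>_def abs_mult)
qed

lemma metric_denominator: "0 < u \<Longrightarrow> u < d \<Longrightarrow> 1 - \<delta> \<le> 1 + u * \<gamma> s \<and> 1 + u * \<gamma> s \<le> 1 + \<delta> \<and> 0 < 1 + u * \<gamma> s"
  using u\<gamma>_bound[of u s] \<delta>_less by linarith

text \<open>The s-derivative of \<open>metric_g \<gamma>\<close>, in the role of \<open>h\<close> in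
  the expanded operator.\<close>

definition metric_h :: "real \<times> real \<Rightarrow> real" where
  "metric_h = (\<lambda>(s, u). - 2 * u * deriv \<gamma> s / (1 + u * \<gamma> s) ^ 3)"

lemma metric_deriv:
  assumes "0 < u" "u < d"
  shows "((\<lambda>t. metric_g \<gamma> (t, u)) has_real_derivative metric_h (s, u)) (at s)"
proof -
  have D: "1 + u * \<gamma> s \<noteq> 0" using metric_denominator[OF assms, of s] by simp
  have "((\<lambda>t. 1 / (1 + u * \<gamma> t)\<^sup>2) has_real_derivative
      - (2 * (1 + u * \<gamma> s) * (u * deriv \<gamma> s)) / ((1 + u * \<gamma> s)\<^sup>2 * (1 + u * \<gamma> s)\<^sup>2)) (at s)"
    using D by (auto intro!: derivative_eq_intros \<gamma>_deriv)
  moreover have "- (2 * (1 + u * \<gamma> s) * (u * deriv \<gamma> s)) / ((1 + u * \<gamma> s)\<^sup>2 * (1 + u * \<gamma> s)\<^sup>2) = metric_h (s, u)"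
    using D by (simp add: metric_h_def divide_simps power2_eq_square power3_eq_cube)
  ultimately show ?thesis by (simp add: metric_g_def)
qed

lemma \<delta>_nonneg: "\<delta> \<ge> 0"
  using u\<gamma>_bound[of "d/2" 0] d_pos by linarith

lemma inverse_power_bound:
  assumes "0 < u" "u < d" shows "1 / (1 + u * \<gamma> s) ^ n \<le> 1 / (1 - \<delta>) ^ n"
  using metric_denominator[OF assms, of s] \<delta>_less
  by (intro divide_left_mono power_mono mult_pos_pos zero_less_power) auto

lemma fraction_bound:
  assumes u: "0 < u" "u < d" and "\<bar>a\<bar> \<le> K"
  shows "\<bar>a / (1 + u * \<gamma> s) ^ n\<bar> \<le> K / (1 - \<delta>) ^ n"
proof -
  have "\<bar>a / (1 + u * \<gamma> s) ^ n\<bar> = \<bar>a\<bar> * (1 / (1 + u * \<gamma> s) ^ n)"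
    using metric_denominator[OF u, of s] by (simp add: abs_divide)
  also have "\<dots> \<le> K * (1 / (1 - \<delta>) ^ n)"
    using metric_denominator[OF u, of s] assms(3)
    by (intro mult_mono inverse_power_bound[OF u]) auto
  finally show ?thesis by simp
qed

text \<open>Condition (h2) gives 1 - \<delta> \<le> 1 + u \<gamma> \<le> 1 + \<delta> with \<delta>
  < 1; the ellipticity constants are the inverse squares of these bounds.\<close>

lemma strip_coefficients_metric:
  "\<exists>B. strip_coefficients d (metric_g \<gamma>) metric_h (1 / (1 + \<delta>)\<^sup>2) (1 / (1 - \<delta>)\<^sup>2) B"
proof -
  obtain K where K: "K \<ge> 0" "\<And>s. \<bar>deriv \<gamma> s\<bar> \<le> K"
    using bounded_if_supported[OF \<gamma>'_cont outside_zero(2)] by blast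
  have "strip_coefficients d (metric_g \<gamma>) metric_h (1 / (1 + \<delta>)\<^sup>2) (1 / (1 - \<delta>)\<^sup>2) (2 * d * K / (1 - \<delta>) ^ 3)"
  proof
    show "0 < 1 / (1 + \<delta>)\<^sup>2" using \<delta>_nonneg by (auto intro!: divide_pos_pos zero_less_power)
    note [measurable] = borel_measurable_continuous_fst[OF \<gamma>_cont] borel_measurable_continuous_fst[OF \<gamma>'_cont] snd_borel fst_borel
    show "metric_g \<gamma> \<in> borel_measurable (strip_measure d)"
      unfolding metric_g_def case_prod_beta by (intro strip_measurableI) measurable
    show "metric_h \<in> borel_measurable (strip_measure d)"
      unfolding metric_h_def case_prod_beta by (intro strip_measurableI) measurable
    fix s u :: real assume u: "0 < u" "u < d"
    show "1 / (1 + \<delta>)\<^sup>2 \<le> metric_g \<gamma> (s, u)"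
      unfolding metric_g_def split using metric_denominator[OF u, of s] \<delta>_nonneg
      by (intro divide_left_mono power_mono mult_pos_pos zero_less_power) auto
    show "metric_g \<gamma> (s, u) \<le> 1 / (1 - \<delta>)\<^sup>2"
      unfolding metric_g_def split by (rule inverse_power_bound[OF u])
    have "\<bar>- 2 * u * deriv \<gamma> s\<bar> \<le> 2 * d * K"
      using u K by (auto simp: abs_mult intro!: mult_mono)
    then show "\<bar>metric_h (s, u)\<bar> \<le> 2 * d * K / (1 - \<delta>) ^ 3"
      unfolding metric_h_def split by (rule fraction_bound[OF u])
    show "((\<lambda>t. metric_g \<gamma> (t, u)) has_real_derivative metric_h (s, u)) (at s)" by (rule metric_deriv[OF u])
    have "isCont \<gamma> s" "isCont (deriv \<gamma>) s"
      using \<gamma>_cont \<gamma>'_cont by (auto simp: continuous_on_eq_continuous_at)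
    then show "isCont (\<lambda>t. metric_h (t, u)) s"
      unfolding metric_h_def split using metric_denominator[OF u, of s]
      by (intro continuous_intros) auto
  qed (rule d_pos)
  then show ?thesis by blast
qed

lemma angle_deriv: "(angle \<gamma> has_real_derivative - \<gamma> s) (at s)"
proof -
  have "((\<lambda>s. LBINT t=0..s. \<gamma> t) has_vector_derivative \<gamma> s) (at s)"
    using LBINT_has_vector_derivative[OF \<gamma>_cont, of 0 s] by (simp add: zero_ereal_def)
  then have "((\<lambda>s. - (LBINT t=0..s. \<gamma> t)) has_vector_derivative - \<gamma> s) (at s)"
    by (rule has_vector_derivative_minus)
  then show ?thesis by (simp add: angle_def[abs_def] has_real_derivative_iff_has_vector_derivative)
qed

lemma angle_cont: "continuous_on UNIV (angle \<gamma>)"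
  using angle_deriv DERIV_isCont continuous_at_imp_continuous_on by blast

text \<open>The primitive in the middle branch of \<open>W\<close>; its continuity yields
  measurability and boundedness of that branch.\<close>

definition field_integral :: "real \<Rightarrow> real" where
  "field_integral s = (LBINT t=0..s. cos (\<eta> - angle \<gamma> t))"

lemma field_integral_cont: "continuous_on UNIV field_integral"
proof -
  have "continuous_on UNIV (\<lambda>t. cos (\<eta> - angle \<gamma> t))" by (intro continuous_intros angle_cont)
  from LBINT_has_vector_derivative[OF this, of 0]
  have "(field_integral has_vector_derivative cos (\<eta> - angle \<gamma> s)) (at s)" for s
    by (simp add: field_integral_def[abs_def] zero_ereal_def)
  then show ?thesis
    using has_vector_derivative_continuous continuous_at_imp_continuous_on by blast
qed

definition potential :: "real \<times> real \<Rightarrow> real" where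
  "potential x = W \<gamma> s\<^sub>0 \<eta> F x + V0 \<gamma> x"

lemma potential_measurable: "potential \<in> borel_measurable (strip_measure d)"
proof -
  note [measurable] = borel_measurable_continuous_fst[OF \<gamma>_cont] borel_measurable_continuous_fst[OF \<gamma>'_cont] borel_measurable_continuous_fst[OF \<gamma>''_cont]
    borel_measurable_continuous_fst[OF angle_cont] borel_measurable_continuous_fst[OF field_integral_cont] snd_borel fst_borel
  show ?thesis
    unfolding potential_def[abs_def] W_def V0_def field_integral_def[symmetric] case_prod_beta
    by (intro strip_measurableI) measurable
qed

text \<open>\<open>V0\<close> is bounded because its denominators are at least powers of 1 -
  \<delta> and its numerators have compact support in s; \<open>W\<close> is at most linear in |s|
  on each of its three branches.\<close>

lemma potential_bound: "\<exists>B. \<forall>s u. 0 < u \<longrightarrow> u < d \<longrightarrow> \<bar>potential (s, u)\<bar> \<le> B * (1 + \<bar>s\<bar>)"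
proof -
  obtain K where K: "K \<ge> 0" "\<And>s. \<bar>\<gamma> s\<bar> \<le> K"
    using bounded_if_supported[OF \<gamma>_cont outside_zero(1)] by blast
  obtain K1 where K1: "K1 \<ge> 0" "\<And>s. \<bar>deriv \<gamma> s\<bar> \<le> K1"
    using bounded_if_supported[OF \<gamma>'_cont outside_zero(2)] by blast
  obtain K2 where K2: "K2 \<ge> 0" "\<And>s. \<bar>deriv (deriv \<gamma>) s\<bar> \<le> K2"
    using bounded_if_supported[OF \<gamma>''_cont outside_zero(3)] by blast
  have "bounded (field_integral ` {0..s\<^sub>0})"
    by (intro compact_imp_bounded compact_continuous_image continuous_on_subset[OF field_integral_cont]) auto
  then obtain I where "\<forall>s\<in>{0..s\<^sub>0}. \<bar>field_integral s\<bar> \<le> I" by (auto simp: bounded_iff)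
  then have I: "\<And>s. 0 \<le> s \<Longrightarrow> s \<le> s\<^sub>0 \<Longrightarrow> \<bar>field_integral s\<bar> \<le> I" by auto
  have I0: "I \<ge> 0" using I[of 0] s0_pos by simp
  define Q where "Q = K\<^sup>2 / 4 / (1 - \<delta>)\<^sup>2 + d * K2 / 2 / (1 - \<delta>) ^ 3 + 5 / 4 * (d\<^sup>2 * K1\<^sup>2) / (1 - \<delta>) ^ 4"
  have V0: "\<bar>V0 \<gamma> (s, u)\<bar> \<le> Q" if u: "0 < u" "u < d" for s u
  proof -
    have a: "\<bar>(\<gamma> s)\<^sup>2 / 4\<bar> \<le> K\<^sup>2 / 4" using power_mono[OF K(2)[of s], of 2] by simp
    have b: "\<bar>u * deriv (deriv \<gamma>) s / 2\<bar> \<le> d * K2 / 2"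
      using mult_mono[of u d "\<bar>deriv (deriv \<gamma>) s\<bar>" K2] u K2 by (simp add: abs_mult)
    have c: "\<bar>5 / 4 * (u\<^sup>2 * (deriv \<gamma> s)\<^sup>2)\<bar> \<le> 5 / 4 * (d\<^sup>2 * K1\<^sup>2)"
    proof -
      have "(deriv \<gamma> s)\<^sup>2 \<le> K1\<^sup>2" using power_mono[OF K1(2)[of s], of 2] by simp
      moreover have "u\<^sup>2 \<le> d\<^sup>2" using u by (intro power_mono) auto
      ultimately have "u\<^sup>2 * (deriv \<gamma> s)\<^sup>2 \<le> d\<^sup>2 * K1\<^sup>2" by (intro mult_mono) auto
      then show ?thesis by (simp add: abs_mult)
    qed
    have "V0 \<gamma> (s, u) = - ((\<gamma> s)\<^sup>2 / 4 / (1 + u * \<gamma> s)\<^sup>2) + u * deriv (deriv \<gamma>) s / 2 / (1 + u * \<gamma> s) ^ 3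
        - 5 / 4 * (u\<^sup>2 * (deriv \<gamma> s)\<^sup>2) / (1 + u * \<gamma> s) ^ 4"
      by (simp add: V0_def)
    then show ?thesis
      using fraction_bound[OF u a, of s 2] fraction_bound[OF u b, of s 3] fraction_bound[OF u c, of s 4]
      unfolding Q_def by linarith
  qed
  have Q0: "Q \<ge> 0" using V0[of "d/2" 0] d_pos by linarith
  have W: "\<bar>W \<gamma> s\<^sub>0 \<eta> F (s, u)\<bar> \<le> F * (\<bar>s\<bar> + s\<^sub>0 + I + d)" if u: "0 < u" "u < d" for s u
  proof -
    have su: "\<bar>sin a * u\<bar> \<le> d" for a
      using mult_mono[OF abs_sin_le_one[of a], of u d] u by (simp add: abs_mult)
    have cs: "\<bar>cos a * t\<bar> \<le> \<bar>t\<bar>" for a t :: real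
      using mult_right_mono[OF abs_cos_le_one[of a], of "\<bar>t\<bar>"] by (simp add: abs_mult)
    have "\<exists>w. W \<gamma> s\<^sub>0 \<eta> F (s, u) = F * w \<and> \<bar>w\<bar> \<le> \<bar>s\<bar> + s\<^sub>0 + I + d"
    proof -
      consider "s < 0" | "0 \<le> s" "s \<le> s\<^sub>0" | "s > s\<^sub>0" by linarith
      then show ?thesis
      proof cases
        case 1
        have "\<bar>cos \<eta> * s + sin \<eta> * u\<bar> \<le> \<bar>s\<bar> + s\<^sub>0 + I + d" using cs[of \<eta> s] su[of \<eta>] s0_pos I0 by linarith
        then show ?thesis using 1 by (auto simp: W_def)
      next
        case 2
        have "\<bar>field_integral s + sin (\<eta> - angle \<gamma> s) * u\<bar> \<le> \<bar>s\<bar> + s\<^sub>0 + I + d"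
          using I[OF 2] su[of "\<eta> - angle \<gamma> s"] 2 s0_pos by linarith
        then show ?thesis using 2 by (auto simp: W_def field_integral_def)
      next
        case 3
        have "\<bar>cos (\<eta> - angle \<gamma> s\<^sub>0) * (s - s\<^sub>0) + field_integral s\<^sub>0 + sin (\<eta> - angle \<gamma> s\<^sub>0) * u\<bar> \<le> \<bar>s\<bar> + s\<^sub>0 + I + d"
          using I[of s\<^sub>0] cs[of "\<eta> - angle \<gamma> s\<^sub>0" "s - s\<^sub>0"] su[of "\<eta> - angle \<gamma> s\<^sub>0"] 3 s0_pos by linarith
        then show ?thesis using 3 s0_pos by (auto simp: W_def field_integral_def)
      qed
    qed
    then show ?thesis using F_pos by (auto simp: abs_mult)
  qed
  define B where "B = F * (1 + s\<^sub>0 + I + d) + Q"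
  have "\<bar>potential (s, u)\<bar> \<le> B * (1 + \<bar>s\<bar>)" if u: "0 < u" "u < d" for s u
  proof -
    have "\<bar>potential (s, u)\<bar> \<le> F * (\<bar>s\<bar> + s\<^sub>0 + I + d) + Q"
      unfolding potential_def using W[OF u, of s] V0[OF u, of s] by linarith
    also have "\<dots> \<le> F * ((1 + s\<^sub>0 + I + d) * (1 + \<bar>s\<bar>)) + Q * (1 + \<bar>s\<bar>)"
    proof (intro add_mono mult_left_mono)
      have "0 \<le> (s\<^sub>0 + I + d) * \<bar>s\<bar>" using s0_pos I0 d_pos by simp
      then show "\<bar>s\<bar> + s\<^sub>0 + I + d \<le> (1 + s\<^sub>0 + I + d) * (1 + \<bar>s\<bar>)" by (simp add: algebra_simps)
      show "Q \<le> Q * (1 + \<bar>s\<bar>)" using Q0 by (simp add: distrib_left)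
    qed (use F_pos in simp)
    also have "\<dots> = B * (1 + \<bar>s\<bar>)" by (simp add: B_def algebra_simps)
    finally show ?thesis .
  qed
  then show ?thesis by blast
qed

text \<open>The product rule for g \<partial>_s \<psi>. It is available inside the strip, where the
  metric is differentiable, and that suffices for graphs taken up to null sets of the strip.\<close>

lemma stark_expr_eq_sop:
  assumes \<psi>: "\<psi> \<in> dirichlet_schwartz d" and u: "0 < u" "u < d"
  shows "stark_expr \<gamma> s\<^sub>0 \<eta> F \<psi> (s, u) = sop (metric_g \<gamma>) metric_h potential \<psi> (s, u)"
proof -
  have n: "nice \<psi>" using \<psi> schwartz_nice by (simp add: dirichlet_schwartz_def)
  have "((\<lambda>t. complex_of_real (metric_g \<gamma> (t, u)) * partial_s \<psi> (t, u)) has_vector_derivative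
      of_real (metric_g \<gamma> (s, u)) * partial_s (partial_s \<psi>) (s, u) + of_real (metric_h (s, u)) * partial_s \<psi> (s, u)) (at s)"
    by (rule has_vector_derivative_mult[OF has_vector_derivative_of_real[OF metric_deriv[OF u]]])
       (use n in \<open>simp add: nice_def\<close>)
  then have "partial_s (\<lambda>y. complex_of_real (metric_g \<gamma> y) * partial_s \<psi> y) (s, u)
      = of_real (metric_g \<gamma> (s, u)) * partial_s (partial_s \<psi>) (s, u) + of_real (metric_h (s, u)) * partial_s \<psi> (s, u)"
    unfolding partial_s_def[of "\<lambda>y. complex_of_real (metric_g \<gamma> y) * partial_s \<psi> y"] split
    by (rule vector_derivative_at)
  then show ?thesis
    by (simp add: stark_expr_def H0_def T_s_def T_u_def sop_def potential_def algebra_simps)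
qed

lemma stark_operator_eq:
  "stark_operator d \<gamma> s\<^sub>0 \<eta> F = graph_on (strip_measure d) (dirichlet_schwartz d) (sop (metric_g \<gamma>) metric_h potential)"
proof -
  have "(AE x in strip_measure d. h x = stark_expr \<gamma> s\<^sub>0 \<eta> F \<psi> x)
      \<longleftrightarrow> (AE x in strip_measure d. h x = sop (metric_g \<gamma>) metric_h potential \<psi> x)"
    if \<psi>: "\<psi> \<in> dirichlet_schwartz d" for \<psi> h
  proof (rule AE_cong)
    fix x assume "x \<in> space (strip_measure d)"
    then show "(h x = stark_expr \<gamma> s\<^sub>0 \<eta> F \<psi> x) = (h x = sop (metric_g \<gamma>) metric_h potential \<psi> x)"
      using stark_expr_eq_sop[OF \<psi>] by (cases x) simp
  qed
  then show ?thesis unfolding stark_operator_def graph_on_def by (auto 0 3)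
qed

end

section \<open>Approximate eigenfunctions\<close>

text \<open>The exponential of i S solves a first-order linear equation, hence is smooth. In the
  second derivative of a exp(i S), the term (S')^2 a is the eikonal part, 2 i S' a' + i S'' a the
  transport part and a'' the remainder.\<close>

lemma phase_derivatives:
  fixes S S' S'' :: "real \<Rightarrow> real"
  assumes S: "\<And>x. (S has_real_derivative S' x) (at x)" and S': "\<And>x. (S' has_real_derivative S'' x) (at x)"
    and sm: "smooth (\<lambda>x. of_real (S' x))" and a: "smooth a"
  defines "e \<equiv> \<lambda>x. exp (\<i> * complex_of_real (S x))"
  shows "smooth e"
    "dv (dv (\<lambda>x. a x * e x)) x = (dv (dv a) x + 2 * \<i> * of_real (S' x) * dv a x
       + (\<i> * of_real (S'' x) - (of_real (S' x))\<^sup>2) * a x) * e x"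
proof -
  have e: "(e has_vector_derivative (\<i> * of_real (S' x)) * e x) (at x)" for x
  proof -
    have "((\<lambda>x. \<i> * complex_of_real (S x)) has_vector_derivative \<i> * of_real (S' x)) (at x)"
      by (intro has_vector_derivative_mult_right has_vector_derivative_of_real S)
    from field_vector_diff_chain_at[OF this DERIV_exp] show ?thesis
      by (simp add: e_def o_def)
  qed
  have ip: "smooth (\<lambda>x. \<i> * of_real (S' x))" by (intro smooth_mult smooth_const sm)
  show sme: "smooth e" by (rule smooth_of_linear_ode1[OF e ip])
  have d1: "dv (\<lambda>x. a x * e x) = (\<lambda>x. (dv a x + \<i> * of_real (S' x) * a x) * e x)"
  proof (rule dv_eqI)
    show "((\<lambda>x. a x * e x) has_vector_derivative (dv a x + \<i> * of_real (S' x) * a x) * e x) (at x)" for x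
      using has_vector_derivative_mult[OF smooth_deriv(1)[OF a] e] by (simp add: algebra_simps)
  qed
  have d2: "((\<lambda>x. dv a x + (\<i> * of_real (S' x)) * a x) has_vector_derivative
      dv (dv a) x + ((\<i> * of_real (S' x)) * dv a x + (\<i> * of_real (S'' x)) * a x)) (at x)" for x
    by (intro has_vector_derivative_add has_vector_derivative_mult smooth_deriv(1) smooth_deriv(2) a
        has_vector_derivative_mult_right has_vector_derivative_of_real S')
  have "(dv (\<lambda>x. a x * e x) has_vector_derivative
      (dv a x + (\<i> * of_real (S' x)) * a x) * ((\<i> * of_real (S' x)) * e x)
      + (dv (dv a) x + ((\<i> * of_real (S' x)) * dv a x + (\<i> * of_real (S'' x)) * a x)) * e x) (at x)"
    unfolding d1 by (rule has_vector_derivative_mult[OF d2 e])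
  then have "dv (dv (\<lambda>x. a x * e x)) x = (dv a x + (\<i> * of_real (S' x)) * a x) * ((\<i> * of_real (S' x)) * e x)
      + (dv (dv a) x + ((\<i> * of_real (S' x)) * dv a x + (\<i> * of_real (S'' x)) * a x)) * e x"
    unfolding dv_def[of "dv _"] by (rule vector_derivative_at)
  also have "\<dots> = (dv (dv a) x + 2 * \<i> * of_real (S' x) * dv a x
       + (\<i> * of_real (S'' x) - (of_real (S' x))\<^sup>2) * a x) * e x"
  proof -
    \<comment> \<open>A variable stands for the imaginary unit, so that the rearrangement is a plain
      ring identity and \<open>\<i> * \<i>\<close> is evaluated only at the end.\<close>
    have ring: "(y + I * w * v) * (I * w * E) + (z + (I * w * y + I * q * v)) * E
        = (z + 2 * I * w * y + (I * q + (I * I) * w\<^sup>2) * v) * E" for y w v E z q I :: complex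
      by (simp add: algebra_simps power2_eq_square)
    show ?thesis unfolding ring by simp
  qed
  finally show "dv (dv (\<lambda>x. a x * e x)) x = (dv (dv a) x + 2 * \<i> * of_real (S' x) * dv a x
       + (\<i> * of_real (S'' x) - (of_real (S' x))\<^sup>2) * a x) * e x" .
qed

text \<open>Sine and cosine of the phase are bootstrapped jointly, as each is the derivative of the
  other up to a smooth factor.\<close>

lemma smooth_sin_phase:
  fixes \<theta> \<theta>' :: "real \<Rightarrow> real"
  assumes \<theta>: "\<And>x. (\<theta> has_real_derivative \<theta>' x) (at x)" and sm: "smooth (\<lambda>x. of_real (\<theta>' x))"
  shows "smooth (\<lambda>x. of_real (sin (\<theta> x)))"
proof -
  have s: "((\<lambda>x. complex_of_real (sin (\<theta> x))) has_vector_derivative of_real (\<theta>' x) * of_real (cos (\<theta> x))) (at x)" for x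
    unfolding of_real_mult[symmetric]
    by (rule has_vector_derivative_of_real) (auto intro!: derivative_eq_intros \<theta>)
  have c: "((\<lambda>x. complex_of_real (cos (\<theta> x))) has_vector_derivative (-1) * (of_real (\<theta>' x) * of_real (sin (\<theta> x)))) (at x)" for x
    using has_vector_derivative_of_real[of "\<lambda>x. cos (\<theta> x)" "- (\<theta>' x * sin (\<theta> x))" "at x"]
    by (auto intro!: derivative_eq_intros \<theta>)
  have "Ck n (\<lambda>x. of_real (sin (\<theta> x))) \<and> Ck n (\<lambda>x. of_real (cos (\<theta> x)))" for n
  proof (induction n)
    case (Suc n)
    have T: "Ck n (\<lambda>x. of_real (\<theta>' x))" using sm by (simp add: smooth_def)
    have "Ck (Suc n) (\<lambda>x. of_real (sin (\<theta> x)))"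
      by (rule CkI[OF s]) (use Suc T in \<open>auto intro!: Ck_mult\<close>)
    moreover have "Ck (Suc n) (\<lambda>x. of_real (cos (\<theta> x)))"
      by (rule CkI[OF c]) (intro Ck_mult Ck_const T Suc[THEN conjunct1])
    ultimately show ?case by blast
  qed simp
  then show ?thesis by (simp add: smooth_def)
qed

text \<open>Used for the mass of quasimodes on boxes, with either an explicit antiderivative G or
  the integral from 0.\<close>

lemma strip_box_integral:
  fixes G v :: "real \<Rightarrow> real"
  assumes d: "d > 0" and ab: "a \<le> b"
    and G: "\<And>u. (G has_real_derivative v u) (at u)" and v: "continuous_on UNIV v"
  shows "integrable (strip_measure d) (\<lambda>x. indicator {a..b} (fst x) * v (snd x))"
    "(LINT x|strip_measure d. indicator {a..b} (fst x) * v (snd x)) = (b - a) * (G d - G 0)"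
proof -
  let ?M = "strip_measure d"
  have "bounded (v ` {0..d})"
    by (intro compact_imp_bounded compact_continuous_image continuous_on_subset[OF v]) auto
  then obtain B where "\<forall>u\<in>{0..d}. \<bar>v u\<bar> \<le> B" by (auto simp: bounded_iff)
  then have B: "\<And>u. 0 < u \<Longrightarrow> u < d \<Longrightarrow> \<bar>v u\<bar> \<le> B" by auto
  have "decaying d (\<lambda>x. complex_of_real (v (snd x)) * complex_of_real (indicator {a..b} (fst x)))"
  proof (rule decaying_mult_bounded[where B=B])
    show "decaying d (\<lambda>x. complex_of_real (indicator {a..b} (fst x)))"
    proof (rule decaying_bounded_support[of _ _ 1 "max \<bar>a\<bar> \<bar>b\<bar>"])
      show "(\<lambda>x. complex_of_real (indicator {a..b} (fst x))) \<in> borel_measurable ?M"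
        by (rule strip_measurableI, unfold borel_prod[symmetric]) measurable
    qed (auto simp: indicator_def)
    show "(\<lambda>x. complex_of_real (v (snd x))) \<in> borel_measurable ?M"
      by (intro strip_measurable_continuous continuous_intros continuous_on_compose2[OF v]) auto
  qed (use B in auto)
  from integrable_Re[OF decaying_integrable[OF this]]
  show int: "integrable ?M (\<lambda>x. indicator {a..b} (fst x) * v (snd x))"
    by (simp flip: of_real_mult add: mult.commute)
  let ?h = "\<lambda>s u. indicator (strip d) (s, u) *\<^sub>R (indicator {a..b} s * v u)"
  have eq: "case_prod ?h = (\<lambda>x. indicator (strip d) x *\<^sub>R (indicator {a..b} (fst x) * v (snd x)))" by auto
  have int': "integrable (lborel \<Otimes>\<^sub>M lborel) (case_prod ?h)"
    unfolding eq using int by (simp add: integrable_strip_iff lborel_prod)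
  have inner: "(LINT u|lborel. ?h s u) = (G d - G 0) * indicator {a..b} s" for s
  proof -
    have "(LBINT u=0..d. v u) = G d - G 0"
    proof (rule interval_integral_FTC_finite[where a=0, simplified zero_ereal_def[symmetric]])
      show "continuous_on {min 0 d..max 0 d} v" by (rule continuous_on_subset[OF v]) simp
      show "(G has_vector_derivative v x) (at x within {min 0 d..max 0 d})" for x
        using G[of x] by (auto simp: has_real_derivative_iff_has_vector_derivative intro: has_vector_derivative_at_within)
    qed
    then have *: "(LINT u|lborel. indicator {0<..<d} u *\<^sub>R v u) = G d - G 0"
      using d by (simp add: interval_lebesgue_integral_def set_lebesgue_integral_def zero_ereal_def)
    have "(\<lambda>u. ?h s u) = (\<lambda>u. indicator {a..b} s * (indicator {0<..<d} u *\<^sub>R v u))"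
      by (auto simp: indicator_def)
    then have "(LINT u|lborel. ?h s u) = indicator {a..b} s * (LINT u|lborel. indicator {0<..<d} u *\<^sub>R v u)"
      by (simp only: integral_mult_right_zero)
    then show ?thesis by (simp only: * mult.commute)
  qed
  have "(LINT x|?M. indicator {a..b} (fst x) * v (snd x)) = integral\<^sup>L (lborel \<Otimes>\<^sub>M lborel) (case_prod ?h)"
    unfolding integral_strip_eq eq lborel_prod ..
  also have "\<dots> = (LINT s|lborel. LINT u|lborel. ?h s u)"
    using lborel_pair.integral_fst[OF int'] by simp
  also have "\<dots> = (LINT s|lborel. (G d - G 0) * indicator {a..b} s)" by (simp only: inner)
  also have "\<dots> = (b - a) * (G d - G 0)" using ab by simp
  finally show "(LINT x|?M. indicator {a..b} (fst x) * v (snd x)) = (b - a) * (G d - G 0)" .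
qed

text \<open>WKB in the transverse direction: at high energy \<open>k\<^sup>2\<close> the linear potential \<open>c u\<close> is
  absorbed into the phase, and \<open>\<theta>\<close> still vanishes at \<open>0\<close> and is a multiple of \<open>\<pi>\<close> at \<open>d\<close>.\<close>

lemma transverse_quasimode:
  fixes c d :: real
  assumes d: "d > 0" and \<epsilon>: "\<epsilon> > 0"
  shows "\<exists>r::real \<Rightarrow> real. \<exists>E. smooth (\<lambda>u. of_real (r u)) \<and> r 0 = 0 \<and> r d = 0 \<and> (\<forall>u. \<bar>r u\<bar> \<le> 1) \<and>
    (\<forall>u. 0 < u \<longrightarrow> u < d \<longrightarrow> cmod (- dv (dv (\<lambda>u. of_real (r u))) u + of_real (c * u - E) * of_real (r u)) \<le> \<epsilon>) \<and>
    (\<forall>a b. a \<le> b \<longrightarrow> (b - a) * (d / 4) \<le> (LINT x|strip_measure d. indicator {a..b} (fst x) * (r (snd x))\<^sup>2))"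
proof -
  \<comment> \<open>This is (q d)^2 + 2 |q| for q = c / (4 k), the bound on the residual found
    below.\<close>
  have "((\<lambda>k. (c\<^sup>2 * d\<^sup>2 / 16) * (inverse k * inverse k) + (\<bar>c\<bar> / 2) * inverse k) \<longlongrightarrow>
      (c\<^sup>2 * d\<^sup>2 / 16) * (0 * 0) + (\<bar>c\<bar> / 2) * 0) at_top"
    by (intro tendsto_intros tendsto_inverse_0_at_top filterlim_ident)
  then have "\<forall>\<^sub>F k in at_top. (c\<^sup>2 * d\<^sup>2 / 16) * (inverse k * inverse k) + (\<bar>c\<bar> / 2) * inverse k < \<epsilon>"
    using \<epsilon> by (intro order_tendstoD(2)) auto
  moreover have "\<forall>\<^sub>F k in at_top. k > max 1 (\<bar>c\<bar> * d / 4)" by (rule eventually_gt_at_top)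
  ultimately have "\<forall>\<^sub>F k in at_top. (c\<^sup>2 * d\<^sup>2 / 16) * (inverse k * inverse k) + (\<bar>c\<bar> / 2) * inverse k < \<epsilon>
      \<and> k > max 1 (\<bar>c\<bar> * d / 4)" by eventually_elim simp
  then obtain k0 where k0: "\<And>k. k \<ge> k0 \<Longrightarrow> (c\<^sup>2 * d\<^sup>2 / 16) * (inverse k * inverse k) + (\<bar>c\<bar> / 2) * inverse k < \<epsilon>
      \<and> k > max 1 (\<bar>c\<bar> * d / 4)" by (auto simp: eventually_at_top_linorder)
  \<comment> \<open>The wave number must be a multiple of pi / d, so that the unperturbed phase k u
    already satisfies both boundary conditions.\<close>
  obtain m :: nat where m: "real m > k0 * d / pi" using reals_Archimedean2 by blast
  define k where "k = real m * pi / d"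
  have "k \<ge> k0" using m d by (simp add: k_def field_simps)
  from k0[OF this] have k: "(c\<^sup>2 * d\<^sup>2 / 16) * (inverse k * inverse k) + (\<bar>c\<bar> / 2) * inverse k < \<epsilon>"
    "k > 1" "\<bar>c\<bar> * d / 4 < k" by auto
  \<comment> \<open>Chosen so that the cross term 2 k q (d - 2 u) of the squared derivative of the
    phase is c (d / 2 - u), which cancels the deviation of c u from its mean. The profile u d - u^2
    leaves the phase unchanged at both ends.\<close>
  define q where "q = c / (4 * k)"
  define \<theta> where "\<theta> u = k * u + q * (u * d - u\<^sup>2)" for u
  define \<theta>' where "\<theta>' u = k + q * (d - 2 * u)" for u
  have \<theta>: "(\<theta> has_real_derivative \<theta>' u) (at u)" for u
    unfolding \<theta>_def[abs_def] \<theta>'_def by (auto intro!: derivative_eq_intros simp: algebra_simps)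
  have \<theta>': "(\<theta>' has_real_derivative - (2 * q)) (at u)" for u
    unfolding \<theta>'_def[abs_def] by (auto intro!: derivative_eq_intros)
  have sm: "smooth (\<lambda>u. of_real (\<theta>' u))"
  proof -
    have "smooth (\<lambda>u. of_real (k + q * d) + of_real (- (2 * q)) * of_real u)"
      by (intro smooth_add smooth_mult smooth_const smooth_of_real_ident)
    moreover have "complex_of_real (k + q * d) + of_real (- (2 * q)) * of_real u = of_real (\<theta>' u)" for u
      by (simp add: \<theta>'_def algebra_simps)
    ultimately show ?thesis by simp
  qed
  define r where "r u = sin (\<theta> u)" for u
  have rs: "smooth (\<lambda>u. of_real (r u))" unfolding r_def by (rule smooth_sin_phase[OF \<theta> sm])
  have r0: "r 0 = 0" by (simp add: r_def \<theta>_def)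
  have \<theta>d: "\<theta> d = real m * pi" using d by (simp add: \<theta>_def k_def power2_eq_square)
  have rd: "r d = 0" unfolding r_def \<theta>d by (rule sin_npi)
  \<comment> \<open>Kinetic energy plus the mean of c u over (0, d).\<close>
  define E where "E = k\<^sup>2 + c * d / 2"
  have dd: "dv (dv (\<lambda>u. of_real (r u))) u = of_real (- (2 * q) * cos (\<theta> u) - (\<theta>' u)\<^sup>2 * sin (\<theta> u))" for u
  proof -
    have 1: "dv (\<lambda>u. of_real (r u)) = (\<lambda>u. of_real (\<theta>' u * cos (\<theta> u)))"
      unfolding r_def by (rule dv_eqI, rule has_vector_derivative_of_real) (auto intro!: derivative_eq_intros \<theta>)
    have "dv (\<lambda>u. complex_of_real (\<theta>' u * cos (\<theta> u))) = (\<lambda>u. of_real (- (2 * q) * cos (\<theta> u) - (\<theta>' u)\<^sup>2 * sin (\<theta> u)))"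
      by (rule dv_eqI, rule has_vector_derivative_of_real)
         (auto intro!: derivative_eq_intros \<theta> \<theta>' simp: power2_eq_square)
    then show ?thesis unfolding 1 by simp
  qed
  have res: "cmod (- dv (dv (\<lambda>u. of_real (r u))) u + of_real (c * u - E) * of_real (r u)) \<le> \<epsilon>"
    if u: "0 < u" "u < d" for u
  proof -
    have qk: "4 * (q * k) = c" using k(2) by (simp add: q_def)
    have "- dv (dv (\<lambda>u. of_real (r u))) u + of_real (c * u - E) * of_real (r u)
        = of_real (((\<theta>' u)\<^sup>2 + c * u - E) * sin (\<theta> u) + 2 * q * cos (\<theta> u))"
      unfolding dd by (simp add: r_def algebra_simps)
    also have "(\<theta>' u)\<^sup>2 + c * u - E = (q * (d - 2 * u))\<^sup>2 + (2 * (q * k) * (d - 2 * u) + c * u - c * d / 2)"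
      unfolding \<theta>'_def E_def by (simp add: power2_eq_square algebra_simps)
    also have "2 * (q * k) * (d - 2 * u) + c * u - c * d / 2 = 0"
      unfolding qk[symmetric] by (simp add: algebra_simps)
    finally have "cmod (- dv (dv (\<lambda>u. of_real (r u))) u + of_real (c * u - E) * of_real (r u))
        = \<bar>(q * (d - 2 * u))\<^sup>2 * sin (\<theta> u) + 2 * q * cos (\<theta> u)\<bar>" by (simp only: norm_of_real add_0_right)
    also have "\<dots> \<le> (q * (d - 2 * u))\<^sup>2 * \<bar>sin (\<theta> u)\<bar> + 2 * \<bar>q\<bar> * \<bar>cos (\<theta> u)\<bar>"
      by (rule order_trans[OF abs_triangle_ineq]) (simp add: abs_mult)
    also have "\<dots> \<le> (q * d)\<^sup>2 * 1 + 2 * \<bar>q\<bar> * 1"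
    proof (intro add_mono mult_mono)
      have "\<bar>d - 2 * u\<bar> \<le> d" using u by linarith
      then have "\<bar>q * (d - 2 * u)\<bar> \<le> \<bar>q * d\<bar>" using d by (simp add: abs_mult mult_left_mono)
      then show "(q * (d - 2 * u))\<^sup>2 \<le> (q * d)\<^sup>2" by (rule abs_le_square_iff[THEN iffD1])
    qed auto
    also have "\<dots> = (c\<^sup>2 * d\<^sup>2 / 16) * (inverse k * inverse k) + (\<bar>c\<bar> / 2) * inverse k"
    proof -
      have eq: "(c / 4 * i * d)\<^sup>2 * 1 + 2 * (\<bar>c\<bar> / 4 * i) * 1 = (c\<^sup>2 * d\<^sup>2 / 16) * (i * i) + (\<bar>c\<bar> / 2) * i" for i
        by (simp add: power2_eq_square ac_simps)
      have q1: "q = c / 4 * inverse k" using k(2) unfolding q_def by (simp add: field_simps)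
      have q2: "\<bar>q\<bar> = \<bar>c\<bar> / 4 * inverse k" unfolding q1 abs_mult using k(2) by simp
      show ?thesis unfolding q2 unfolding q1 by (rule eq)
    qed
    finally show ?thesis using k(1) by linarith
  qed
  have low: "(b - a) * (d / 4) \<le> (LINT x|strip_measure d. indicator {a..b} (fst x) * (r (snd x))\<^sup>2)" if ab: "a \<le> b" for a b
  proof -
    have rc: "continuous_on UNIV (\<lambda>u. (r u)\<^sup>2)" "continuous_on UNIV (\<lambda>u. (r u)\<^sup>2 * \<theta>' u)"
      unfolding r_def \<theta>_def \<theta>'_def by (intro continuous_intros)+
    \<comment> \<open>sin^2 of the phase has no explicit antiderivative, but multiplied by the
      derivative of the phase it has. That derivative is at most 2 k on (0, d) and the phase at d is
      k d, whence the mass d / 4 per unit length.\<close>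
    have G: "((\<lambda>u. (\<theta> u - sin (\<theta> u) * cos (\<theta> u)) / 2) has_real_derivative (r u)\<^sup>2 * \<theta>' u) (at u)" for u
    proof -
      have "((\<lambda>u. (\<theta> u - sin (\<theta> u) * cos (\<theta> u)) / 2) has_real_derivative
          (\<theta>' u - (\<theta>' u * cos (\<theta> u) * cos (\<theta> u) - sin (\<theta> u) * (\<theta>' u * sin (\<theta> u)))) / 2) (at u)"
        by (auto intro!: derivative_eq_intros \<theta> simp: field_simps)
      moreover have "(\<theta>' u - (\<theta>' u * cos (\<theta> u) * cos (\<theta> u) - sin (\<theta> u) * (\<theta>' u * sin (\<theta> u)))) / 2 = (r u)\<^sup>2 * \<theta>' u"
      proof -
        have "\<theta>' u * cos (\<theta> u) * cos (\<theta> u) = \<theta>' u * (1 - (sin (\<theta> u))\<^sup>2)"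
          using cos_squared_eq[of "\<theta> u"] by (simp only: mult.assoc power2_eq_square)
        then show ?thesis by (simp add: r_def power2_eq_square algebra_simps)
      qed
      ultimately show ?thesis by simp
    qed
    have dr: "\<And>u. ((\<lambda>u::real. LBINT y=0..u. (r y)\<^sup>2) has_real_derivative (r u)\<^sup>2) (at u)"
      using LBINT_has_vector_derivative[OF rc(1), of 0]
      by (simp add: has_real_derivative_iff_has_vector_derivative zero_ereal_def)
    note i1 = strip_box_integral(1)[OF d ab dr rc(1)]
    note i2 = strip_box_integral[OF d ab G rc(2)]
    have "2 * k * ((b - a) * (d / 4)) = (b - a) * (\<theta> d / 2)" using d by (simp add: \<theta>d k_def)
    also have "\<dots> = (LINT x|strip_measure d. indicator {a..b} (fst x) * ((r (snd x))\<^sup>2 * \<theta>' (snd x)))"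
      unfolding i2(2) using rd r0 by (simp add: r_def \<theta>_def)
    also have "\<dots> \<le> (LINT x|strip_measure d. 2 * k * (indicator {a..b} (fst x) * (r (snd x))\<^sup>2))"
    proof (rule integral_mono_AE[OF i2(1)])
      show "integrable (strip_measure d) (\<lambda>x. 2 * k * (indicator {a..b} (fst x) * (r (snd x))\<^sup>2))"
        using i1 by simp
      show "AE x in strip_measure d. indicator {a..b} (fst x) * ((r (snd x))\<^sup>2 * \<theta>' (snd x))
          \<le> 2 * k * (indicator {a..b} (fst x) * (r (snd x))\<^sup>2)"
      proof (rule AE_stripI)
        fix s u assume u: "0 < u" "u < d"
        have "\<bar>q\<bar> * \<bar>d - 2 * u\<bar> \<le> \<bar>q\<bar> * d" using u by (intro mult_left_mono) auto
        \<comment> \<open>From |c| d / 4 < k and k > 1 one gets |c| d / 4 \<le> k^2, so the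
          correction to the slope of the phase is at most k.\<close>
        also have "\<bar>q\<bar> * d \<le> k"
        proof -
          have "k * 1 \<le> k * k" using k(2) by (intro mult_left_mono) auto
          then have "\<bar>c\<bar> * d / 4 \<le> k * k" using k(3) by linarith
          then show ?thesis using k(2) by (simp add: q_def abs_mult field_simps)
        qed
        finally have "q * (d - 2 * u) \<le> k" by (simp add: abs_mult[symmetric] abs_le_iff)
        then have "\<theta>' u \<le> 2 * k" by (simp add: \<theta>'_def)
        then have "(r u)\<^sup>2 * \<theta>' u \<le> (r u)\<^sup>2 * (2 * k)" by (rule mult_left_mono) simp
        then show "indicator {a..b} (fst (s, u)) * ((r (snd (s, u)))\<^sup>2 * \<theta>' (snd (s, u)))
          \<le> 2 * k * (indicator {a..b} (fst (s, u)) * (r (snd (s, u)))\<^sup>2)"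
          by (simp add: indicator_def mult.commute)
      qed
    qed
    finally have "2 * k * ((b - a) * (d / 4)) \<le> 2 * k * (LINT x|strip_measure d. indicator {a..b} (fst x) * (r (snd x))\<^sup>2)"
      by (simp only: integral_mult_right_zero)
    then show ?thesis by (rule mult_left_le_imp_le) (use k(2) in simp)
  qed
  show ?thesis using rs r0 rd res low by (intro exI[of _ r] exI[of _ E]) (auto simp: r_def)
qed

text \<open>WKB in the longitudinal direction around \<open>s = - L\<close>, where the squared momentum is
  \<open>p\<^sup>2 = b L + \<mu>\<close>. The square root in the phase is replaced by its second order Taylor polynomial, which is
  accurate on windows of width \<open>R\<close> with \<open>R\<^sup>3 = o(p\<^sup>4)\<close>; the cutoff error requires \<open>p = o(R)\<close>.
  Both hold for \<open>p = t\<^sup>5\<close>, \<open>R = t\<^sup>6\<close>.\<close>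

lemma longitudinal_quasimode:
  fixes b \<mu> :: real
  assumes b: "b > 0" and \<epsilon>: "\<epsilon> > 0"
  shows "\<exists>f L R. test_fun f \<and> R > 0 \<and> 2 * R < L \<and> (\<forall>s. cmod (f s) \<le> 1) \<and>
    (\<forall>s. \<bar>s + L\<bar> \<le> R \<longrightarrow> cmod (f s) = 1) \<and>
    (\<forall>s. \<bar>s + L\<bar> > 2 * R \<longrightarrow> f s = 0 \<and> dv f s = 0 \<and> dv (dv f) s = 0) \<and>
    (\<forall>s. cmod (- dv (dv f) s + of_real (b * s - \<mu>) * f s) \<le> \<epsilon>)"
proof -
  obtain K where K: "K \<ge> 0" "\<And>x. cmod (dv cutoff x) \<le> K" "\<And>x. cmod (dv (dv cutoff) x) \<le> K"
    using cutoff_dv_bounds by blast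
  \<comment> \<open>In order, the four errors in terms of t: second derivative of the cutoff K /
    R^2, transport across the cutoff 4 K p / R, uncompensated transport b / p, and eikonal error p^2
    X^3 with X = 2 b R / p^2.\<close>
  have lim: "((\<lambda>t. K * (inverse t)^12 + 4 * K * inverse t + b * (inverse t)^5 + 8 * b^3 * (inverse t)^2) \<longlongrightarrow>
      K * 0^12 + 4 * K * 0 + b * 0^5 + 8 * b^3 * 0^2) at_top"
    by (intro tendsto_intros tendsto_inverse_0_at_top filterlim_ident)
  then have e1: "\<forall>\<^sub>F t in at_top. K * (inverse t)^12 + 4 * K * inverse t + b * (inverse t)^5 + 8 * b^3 * (inverse t)^2 < \<epsilon>"
    using \<epsilon> by (intro order_tendstoD(2)) auto
  \<comment> \<open>Keeps the relative change of the squared momentum below 1 on the whole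
    window.\<close>
  have "((\<lambda>t. 2 * b * (inverse t)^4) \<longlongrightarrow> 2 * b * 0^4) at_top"
    by (intro tendsto_intros tendsto_inverse_0_at_top filterlim_ident)
  then have e2: "\<forall>\<^sub>F t in at_top. 2 * b * (inverse t)^4 < 1"
    by (intro order_tendstoD(2)) auto
  \<comment> \<open>After multiplication by t^10 = p^2 this says \<mu> + 2 b R < p^2, hence 2 R < L:
    the window lies in s < 0.\<close>
  have "((\<lambda>t. \<mu> * (inverse t)^10 + 2 * b * (inverse t)^4) \<longlongrightarrow> \<mu> * 0^10 + 2 * b * 0^4) at_top"
    by (intro tendsto_intros tendsto_inverse_0_at_top filterlim_ident)
  then have e3: "\<forall>\<^sub>F t in at_top. \<mu> * (inverse t)^10 + 2 * b * (inverse t)^4 < 1"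
    by (intro order_tendstoD(2)) auto
  have "\<forall>\<^sub>F t in at_top. K * (inverse t)^12 + 4 * K * inverse t + b * (inverse t)^5 + 8 * b^3 * (inverse t)^2 < \<epsilon>
      \<and> 2 * b * (inverse t)^4 < 1 \<and> \<mu> * (inverse t)^10 + 2 * b * (inverse t)^4 < 1 \<and> t > (0::real)"
    using e1 e2 e3 eventually_gt_at_top[of 0] by eventually_elim simp
  then obtain t :: real where t: "K * (inverse t)^12 + 4 * K * inverse t + b * (inverse t)^5 + 8 * b^3 * (inverse t)^2 < \<epsilon>"
      "2 * b * (inverse t)^4 < 1" "\<mu> * (inverse t)^10 + 2 * b * (inverse t)^4 < 1" "t > 0"
    using eventually_happens trivial_limit_at_top_linorder by blast
  define p R where "p = t^5" and "R = t^6"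
  have pR: "p > 0" "R > 0" using t(4) by (auto simp: p_def R_def)
  \<comment> \<open>The point s = -L is where the classical squared momentum \<mu> - b s equals
    p^2.\<close>
  define L where "L = (p\<^sup>2 - \<mu>) / b"
  have p2: "b * L + \<mu> = p\<^sup>2" using b by (simp add: L_def)
  have p2t: "p\<^sup>2 = t^10" by (simp add: p_def flip: power_mult)
  have it: "inverse t ^ n * t ^ n = 1" for n using t(4) by (simp add: power_inverse)
  have RL: "2 * R < L"
  proof -
    have "(\<mu> * (inverse t)^10 + 2 * b * (inverse t)^4) * t^10 < 1 * t^10"
      using t(3,4) by (intro mult_strict_right_mono) auto
    moreover have "(\<mu> * (inverse t)^10 + 2 * b * (inverse t)^4) * t^10 = \<mu> * (inverse t ^ 10 * t ^ 10) + 2 * b * ((inverse t ^ 4 * t^4) * t^6)"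
      by (simp add: algebra_simps flip: power_add)
    ultimately have "\<mu> + 2 * b * R < p\<^sup>2" by (simp add: it p2t R_def)
    then show ?thesis using b by (simp add: L_def field_simps)
  qed
  \<comment> \<open>The squared momentum is p^2 (1 - x). The derivative S' below is p times the
    Taylor polynomial 1 - x / 2 - x^2 / 8 of the square root of 1 - x, so S is a polynomial in
    s.\<close>
  define x where "x s = b * (s + L) / p\<^sup>2" for s
  define S where "S s = p * ((s + L) - b / p\<^sup>2 * (s + L)\<^sup>2 / 4 - (b / p\<^sup>2)\<^sup>2 * (s + L)^3 / 24)" for s
  define S' where "S' s = p * (1 - x s / 2 - (x s)\<^sup>2 / 8)" for s
  define S'' where "S'' s = p * (- (b / p\<^sup>2) / 2 - x s * (b / p\<^sup>2) / 4)" for s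
  have dx: "(x has_real_derivative b / p\<^sup>2) (at s)" for s
  proof -
    have "((\<lambda>s. c * (s + L)) has_real_derivative c) (at s)" for c
      by (auto intro!: derivative_eq_intros)
    from this[of "b / p\<^sup>2"] have "((\<lambda>s. b / p\<^sup>2 * (s + L)) has_real_derivative b / p\<^sup>2) (at s)" .
    then show ?thesis by (simp add: x_def[abs_def])
  qed
  have dS: "(S has_real_derivative S' s) (at s)" for s
  proof -
    have "((\<lambda>s. p * ((s + L) - c * (s + L)\<^sup>2 / 4 - c\<^sup>2 * (s + L)^3 / 24)) has_real_derivative
        p * (1 - c * (2 * (s + L)) / 4 - c\<^sup>2 * (3 * (s + L)\<^sup>2) / 24)) (at s)" for c
      by (auto intro!: derivative_eq_intros)
    from this[of "b / p\<^sup>2"]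
    have "(S has_real_derivative p * (1 - b / p\<^sup>2 * (2 * (s + L)) / 4 - (b / p\<^sup>2)\<^sup>2 * (3 * (s + L)\<^sup>2) / 24)) (at s)"
      unfolding S_def[abs_def] .
    moreover have "p * (1 - b / p\<^sup>2 * (2 * (s + L)) / 4 - (b / p\<^sup>2)\<^sup>2 * (3 * (s + L)\<^sup>2) / 24) = S' s"
    proof -
      have gen: "p * (1 - c * (2 * y) / 4 - c\<^sup>2 * (3 * y\<^sup>2) / 24) = p * (1 - (c * y) / 2 - (c * y)\<^sup>2 / 8)" for c y
        by (simp add: power_mult_distrib algebra_simps)
      have xs: "x s = b / p\<^sup>2 * (s + L)" by (simp add: x_def)
      show ?thesis unfolding S'_def xs by (rule gen)
    qed
    ultimately show ?thesis by simp
  qed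
  have dS': "(S' has_real_derivative S'' s) (at s)" for s
  proof -
    have "((\<lambda>s. p * (1 - x s / 2 - (x s)\<^sup>2 / 8)) has_real_derivative p * (- c / 2 - x s * c / 4)) (at s)"
      if "(x has_real_derivative c) (at s)" for c
      by (auto intro!: derivative_eq_intros that)
    from this[OF dx] show ?thesis unfolding S'_def[abs_def] S''_def by simp
  qed
  have sx: "smooth (\<lambda>s. of_real (x s))"
  proof -
    have "smooth (\<lambda>s. of_real (b / p\<^sup>2) * of_real s + of_real (b / p\<^sup>2 * L))"
      by (intro smooth_add smooth_mult smooth_const smooth_of_real_ident)
    moreover have "complex_of_real (b / p\<^sup>2) * of_real s + of_real (b / p\<^sup>2 * L) = of_real (x s)" for s
      by (simp add: x_def add_divide_distrib distrib_left)
    ultimately show ?thesis by simp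
  qed
  have sS': "smooth (\<lambda>s. of_real (S' s))"
  proof -
    have "smooth (\<lambda>s. of_real p * (1 + (of_real (- (1/2)) * of_real (x s) + of_real (- (1/8)) * (of_real (x s))\<^sup>2)))"
      by (intro smooth_mult smooth_add smooth_const sx smooth_power)
    moreover have "complex_of_real p * (1 + (of_real (- (1/2)) * of_real (x s) + of_real (- (1/8)) * (of_real (x s))\<^sup>2)) = of_real (S' s)" for s
      by (simp add: S'_def algebra_simps)
    ultimately show ?thesis by simp
  qed
  define a where "a s = cutoff_at R (1 * s + L)" for s
  note cut = cutoff_at[OF pR(2)]
  have sa: "smooth a" unfolding a_def by (rule smooth_affine[OF cut(2)])
  have ta: "test_fun a" unfolding a_def by (rule test_fun_affine[OF cut(1)]) simp
  have da: "dv a = (\<lambda>s. dv (cutoff_at R) (1 * s + L))"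
    unfolding a_def[abs_def] by (subst dv_affine[OF cut(2)]) simp
  have dda: "dv (dv a) = (\<lambda>s. dv (dv (cutoff_at R)) (1 * s + L))"
    unfolding da by (subst dv_affine[OF smooth_deriv(2)[OF cut(2)]]) simp
  have a1: "cmod (a s) \<le> 1" for s unfolding a_def by (rule cut(3))
  have a2: "cmod (dv a s) \<le> K / R" for s
  proof -
    have "cmod (dv a s) = inverse R * cmod (dv cutoff (inverse R * (1 * s + L)))"
      unfolding da cut(6) norm_mult norm_of_real using pR(2) by simp
    also have "\<dots> \<le> inverse R * K" using pR(2) by (intro mult_left_mono K) simp
    finally show ?thesis by (simp add: divide_inverse mult.commute)
  qed
  have a3: "cmod (dv (dv a) s) \<le> K / R\<^sup>2" for s
  proof -
    have "cmod (dv (dv a) s) = (inverse R)\<^sup>2 * cmod (dv (dv cutoff) (inverse R * (1 * s + L)))"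
      unfolding dda cut(7) norm_mult norm_power norm_of_real using pR(2) by simp
    also have "\<dots> \<le> (inverse R)\<^sup>2 * K" by (intro mult_left_mono K) simp
    finally show ?thesis by (simp add: divide_inverse mult.commute power_inverse)
  qed
  define e where "e s = exp (\<i> * complex_of_real (S s))" for s
  have e1: "cmod (e s) = 1" for s by (simp add: e_def)
  define f where "f s = a s * e s" for s
  note ph = phase_derivatives[OF dS dS' sS' sa, folded e_def, folded f_def]
  have tf: "test_fun f" unfolding f_def by (rule test_fun_mult[OF ta ph(1)])
  have out: "f s = 0 \<and> dv f s = 0 \<and> dv (dv f) s = 0" if s: "\<bar>s + L\<bar> > 2 * R" for s
  proof -
    let ?U = "{s. \<bar>s + L\<bar> > 2 * R}"
    have U: "open ?U" by (intro open_Collect_less continuous_intros)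
    have 0: "f t = 0" if "t \<in> ?U" for t using cut(5)[of "1 * t + L"] that by (simp add: f_def a_def)
    have 1: "dv f t = 0" if "t \<in> ?U" for t by (rule dv_locally_zero[OF U that 0])
    have 2: "dv (dv f) t = 0" if "t \<in> ?U" for t by (rule dv_locally_zero[OF U that 1])
    show ?thesis using 0 1 2 s by simp
  qed
  have inn: "cmod (f s) = 1" if s: "\<bar>s + L\<bar> \<le> R" for s
    using cut(4)[of "1 * s + L"] s by (simp add: f_def a_def norm_mult e1)
  have f1: "cmod (f s) \<le> 1" for s using a1 by (simp add: f_def norm_mult e1)
  have res: "cmod (- dv (dv f) s + of_real (b * s - \<mu>) * f s) \<le> \<epsilon>" for s
  proof (cases "\<bar>s + L\<bar> > 2 * R")
    case True
    then show ?thesis using out \<epsilon> by simp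
  next
    case False
    define X where "X = 2 * b * (inverse t)^4"
    have xX: "\<bar>x s\<bar> \<le> X"
    proof -
      have "\<bar>x s\<bar> = b * \<bar>s + L\<bar> / p\<^sup>2" using b by (simp add: x_def abs_mult)
      also have "\<dots> \<le> b * (2 * R) / p\<^sup>2" using False b by (intro divide_right_mono mult_left_mono) auto
      also have "\<dots> = X"
        using t(4) unfolding X_def R_def p2t by (simp add: field_simps flip: power_add)
      finally show ?thesis .
    qed
    have X1: "X < 1" "X \<ge> 0" using t(2) b t(4) by (auto simp: X_def)
    have x1: "\<bar>x s\<bar> \<le> 1" using xX X1 by linarith
    have S'b: "\<bar>S' s\<bar> \<le> 2 * p"
    proof -
      have "(x s)\<^sup>2 \<le> 1" using x1 by (simp add: abs_square_le_1)
      then have "\<bar>1 - x s / 2 - (x s)\<^sup>2 / 8\<bar> \<le> 2" using x1 zero_le_power2[of "x s"] by linarith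
      then show ?thesis unfolding S'_def abs_mult using pR(1) by simp
    qed
    have S''b: "\<bar>S'' s\<bar> \<le> b / p"
    proof -
      have "S'' s = (b / p) * (- (1/2) - x s / 4)"
        using pR(1) by (simp add: S''_def power2_eq_square field_simps)
      moreover have "\<bar>- (1/2) - x s / 4\<bar> \<le> 1" using x1 by linarith
      ultimately show ?thesis
        using mult_left_mono[of "\<bar>- (1/2) - x s / 4\<bar>" 1 "b / p"] b pR(1) by (simp add: abs_mult)
    qed
    \<comment> \<open>The square of the Taylor polynomial is 1 - x + x^3 / 8 + x^4 / 64, so the
      eikonal equation fails at third order only.\<close>
    have eik: "(S' s)\<^sup>2 + (b * s - \<mu>) = p\<^sup>2 * ((x s)^3 / 8 + (x s)^4 / 64)"
    proof -
      have "p\<^sup>2 * x s = b * (s + L)" using pR(1) by (simp add: x_def)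
      then have "b * s - \<mu> = p\<^sup>2 * x s - p\<^sup>2" using p2 by (simp add: algebra_simps)
      then show ?thesis
        unfolding S'_def by (simp add: power2_eq_square power3_eq_cube power4_eq_xxxx algebra_simps)
    qed
    have eikb: "\<bar>(S' s)\<^sup>2 + (b * s - \<mu>)\<bar> \<le> p\<^sup>2 * X^3"
    proof -
      have "\<bar>(x s)^3 / 8 + (x s)^4 / 64\<bar> \<le> \<bar>x s\<bar>^3 / 8 + \<bar>x s\<bar>^4 / 64"
        by (rule order_trans[OF abs_triangle_ineq]) (simp add: power_abs)
      also have "\<bar>x s\<bar>^4 \<le> \<bar>x s\<bar>^3" using x1 by (intro power_decreasing) auto
      also have "\<bar>x s\<bar>^3 / 8 + \<bar>x s\<bar>^3 / 64 \<le> \<bar>x s\<bar>^3" by simp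
      also have "\<dots> \<le> X^3" using xX by (intro power_mono) auto
      finally have "\<bar>(x s)^3 / 8 + (x s)^4 / 64\<bar> \<le> X^3" by simp
      then show ?thesis unfolding eik abs_mult using pR(1) by (simp add: mult_left_mono)
    qed
    \<comment> \<open>The amplitude is the bare cutoff, without the WKB factor that would cancel the
      term with S''; this term is only of size b / p and may stay.\<close>
    have "- dv (dv f) s + of_real (b * s - \<mu>) * f s
      = (- dv (dv a) s - 2 * \<i> * of_real (S' s) * dv a s - \<i> * of_real (S'' s) * a s + of_real ((S' s)\<^sup>2 + (b * s - \<mu>)) * a s) * e s"
      unfolding ph(2) f_def by (simp add: algebra_simps)
    then have "cmod (- dv (dv f) s + of_real (b * s - \<mu>) * f s)
      = cmod (- dv (dv a) s - 2 * \<i> * of_real (S' s) * dv a s - \<i> * of_real (S'' s) * a s + of_real ((S' s)\<^sup>2 + (b * s - \<mu>)) * a s)"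
      by (simp add: norm_mult e1)
    also have "\<dots> \<le> cmod (dv (dv a) s) + cmod (2 * \<i> * of_real (S' s) * dv a s) + cmod (\<i> * of_real (S'' s) * a s)
        + cmod (of_real ((S' s)\<^sup>2 + (b * s - \<mu>)) * a s)"
      using norm_triangle_ineq4[of "- dv (dv a) s" "2 * \<i> * of_real (S' s) * dv a s"]
        norm_triangle_ineq4[of "- dv (dv a) s - 2 * \<i> * of_real (S' s) * dv a s" "\<i> * of_real (S'' s) * a s"]
        norm_triangle_ineq[of "- dv (dv a) s - 2 * \<i> * of_real (S' s) * dv a s - \<i> * of_real (S'' s) * a s" "of_real ((S' s)\<^sup>2 + (b * s - \<mu>)) * a s"]
      by (simp only: norm_minus_cancel)
    also have "\<dots> \<le> K / R\<^sup>2 + 2 * (2 * p) * (K / R) + b / p * 1 + p\<^sup>2 * X^3 * 1"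
    proof (intro add_mono a3)
      show "cmod (2 * \<i> * of_real (S' s) * dv a s) \<le> 2 * (2 * p) * (K / R)"
      proof -
        have "(2 * \<bar>S' s\<bar>) * cmod (dv a s) \<le> (2 * (2 * p)) * (K / R)"
          by (rule mult_mono) (use S'b a2[of s] pR in auto)
        then show ?thesis by (simp add: norm_mult)
      qed
      show "cmod (\<i> * of_real (S'' s) * a s) \<le> b / p * 1"
      proof -
        have "\<bar>S'' s\<bar> * cmod (a s) \<le> b / p * 1"
          by (rule mult_mono) (use S''b a1[of s] pR b in auto)
        then show ?thesis by (simp add: norm_mult)
      qed
      show "cmod (of_real ((S' s)\<^sup>2 + (b * s - \<mu>)) * a s) \<le> p\<^sup>2 * X^3 * 1"
        unfolding norm_mult norm_of_real by (rule mult_mono[OF eikb a1]) (use X1 in auto)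
    qed
    also have "\<dots> = K * (inverse t)^12 + 4 * K * inverse t + b * (inverse t)^5 + 8 * b^3 * (inverse t)^2"
    proof -
      have "K / R\<^sup>2 = K * (inverse t)^12" by (simp add: R_def divide_inverse power_inverse flip: power_mult)
      moreover have "2 * (2 * p) * (K / R) = 4 * K * inverse t"
        using t(4) by (simp add: p_def R_def field_simps flip: power_Suc)
      moreover have "b / p * 1 = b * (inverse t)^5" by (simp add: p_def divide_inverse power_inverse)
      moreover have "p\<^sup>2 * X^3 * 1 = 8 * b^3 * (inverse t)^2"
      proof -
        have "p\<^sup>2 * X^3 = 8 * b^3 * (t^10 * (inverse t)^12)"
          by (simp add: X_def p2t power_mult_distrib flip: power_mult)
        also have "(inverse t)^12 = (inverse t)^10 * (inverse t)^2" by (simp flip: power_add)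
        also have "t^10 * ((inverse t)^10 * (inverse t)^2) = ((inverse t)^10 * t^10) * (inverse t)^2"
          by (simp only: mult.assoc mult.left_commute)
        also have "\<dots> = (inverse t)^2" by (simp only: it mult_1)
        finally show ?thesis by simp
      qed
      ultimately show ?thesis by simp
    qed
    finally show ?thesis using t(1) by linarith
  qed
  show ?thesis using tf pR(2) RL f1 inn out res by blast
qed

section \<open>Weyl sequences on the straight end of the strip\<close>

context stark
begin

lemma cos_\<eta>_pos: "cos \<eta> > 0"
  using h3 by (intro cos_gt_zero_pi) (auto simp: abs_less_iff)

text \<open>For s < 0 the curvature vanishes, so the metric is flat and only the linear field
  remains. Its slope F cos \<eta> in s is positive by (h3).\<close>

lemma potential_left:
  assumes "s < 0"
  shows "metric_g \<gamma> (s, u) = 1" "metric_h (s, u) = 0" "potential (s, u) = F * cos \<eta> * s + F * sin \<eta> * u"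
  using assms outside_zero[of s]
  by (auto simp: metric_g_def metric_h_def potential_def W_def V0_def algebra_simps)

text \<open>The energy splits as \<nu> = E + (\<nu> - E), with E fixed by the transverse factor
  before the longitudinal one is chosen. Residual and norm of the product are compared on boxes of
  length 4 R and 2 R.\<close>

lemma approximate_eigenfunction:
  assumes \<epsilon>: "\<epsilon> > 0"
  shows "\<exists>\<psi>\<in>dirichlet_tensors d. L2_norm (strip_measure d)
      (\<lambda>x. sop (metric_g \<gamma>) metric_h potential \<psi> x - of_real \<nu> * \<psi> x) < \<epsilon> * L2_norm (strip_measure d) \<psi>"
proof -
  let ?M = "strip_measure d"
  define b c where "b = F * cos \<eta>" and "c = F * sin \<eta>"
  have b: "b > 0" using F_pos cos_\<eta>_pos by (simp add: b_def)
  \<comment> \<open>Two residuals of size \<epsilon> / 8 give at most \<epsilon> / 4 on a box of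
    area 4 R d, hence squared norm at most \<epsilon>^2 R d / 4. The squared norm of \<psi> is at
    least R d / 2, so half of \<epsilon>^2 is to spare.\<close>
  have \<epsilon>8: "\<epsilon> / 8 > 0" using \<epsilon> by simp
  obtain r :: "real \<Rightarrow> real" and E where r: "smooth (\<lambda>u. of_real (r u))" "r 0 = 0" "r d = 0" "\<And>u. \<bar>r u\<bar> \<le> 1"
      "\<And>u. 0 < u \<Longrightarrow> u < d \<Longrightarrow> cmod (- dv (dv (\<lambda>u. of_real (r u))) u + of_real (c * u - E) * of_real (r u)) \<le> \<epsilon> / 8"
      "\<And>a b. a \<le> b \<Longrightarrow> (b - a) * (d / 4) \<le> (LINT x|?M. indicator {a..b} (fst x) * (r (snd x))\<^sup>2)"
    using transverse_quasimode[OF d_pos \<epsilon>8, of c] by blast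
  obtain f L R where f: "test_fun f" "R > 0" "2 * R < L" "\<And>s. cmod (f s) \<le> 1"
      "\<And>s. \<bar>s + L\<bar> \<le> R \<Longrightarrow> cmod (f s) = 1"
      "\<And>s. \<bar>s + L\<bar> > 2 * R \<Longrightarrow> f s = 0 \<and> dv f s = 0 \<and> dv (dv f) s = 0"
      "\<And>s. cmod (- dv (dv f) s + of_real (b * s - (\<nu> - E)) * f s) \<le> \<epsilon> / 8"
    using longitudinal_quasimode[OF b \<epsilon>8, of "\<nu> - E"] by blast
  obtain q where q: "test_fun q" "q 0 = of_real (r 0)" "q d = of_real (r d)"
      "\<And>u. 0 < u \<Longrightarrow> u < d \<Longrightarrow> q u = of_real (r u)"
      "\<And>u. 0 < u \<Longrightarrow> u < d \<Longrightarrow> dv (dv q) u = dv (dv (\<lambda>u. of_real (r u))) u"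
    using strip_test_extension[OF d_pos r(1)] by blast
  define \<psi> where "\<psi> x = f (fst x) * q (snd x)" for x :: "real \<times> real"
  have \<psi>D: "\<psi> \<in> dirichlet_tensors d"
    unfolding dirichlet_tensors_def \<psi>_def[abs_def] using q(2,3) r(2,3)
    by (auto intro!: tensor_span.tensor f(1) q(1))
  obtain B where coeff: "strip_coefficients d (metric_g \<gamma>) metric_h (1 / (1 + \<delta>)\<^sup>2) (1 / (1 - \<delta>)\<^sup>2) B"
    using strip_coefficients_metric by blast
  interpret c: strip_coefficients d "metric_g \<gamma>" metric_h "1 / (1 + \<delta>)\<^sup>2" "1 / (1 - \<delta>)\<^sup>2" B by (rule coeff)
  obtain B' where "\<forall>s u. 0 < u \<longrightarrow> u < d \<longrightarrow> \<bar>potential (s, u)\<bar> \<le> B' * (1 + \<bar>s\<bar>)"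
    using potential_bound by blast
  then have adm: "c.admissible potential"
    by (intro c.admissible_linear[OF potential_measurable]) blast
  define T where "T x = sop (metric_g \<gamma>) metric_h potential \<psi> x - of_real \<nu> * \<psi> x" for x
  have TL: "T \<in> L2 ?M"
    unfolding T_def[abs_def] using c.dirichlet_tensorsD[OF \<psi>D] by (intro L2_diff L2_scale c.sop_L2 adm)
  have \<psi>L: "\<psi> \<in> L2 ?M" by (rule c.dirichlet_tensorsD(5)[OF \<psi>D])
  have Tb: "(cmod (T (s, u)))\<^sup>2 \<le> (\<epsilon> / 4)\<^sup>2 * (indicator {- L - 2 * R..- L + 2 * R} s * 1)" if u: "0 < u" "u < d" for s u
  proof (cases "\<bar>s + L\<bar> > 2 * R")
    case True
    then have "f s = 0" "dv f s = 0" "dv (dv f) s = 0" using f(6) by auto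
    then have "T (s, u) = 0"
      unfolding T_def \<psi>_def[abs_def] sop_tensor[OF f(1) q(1)] by simp
    then show ?thesis by simp
  next
    case False
    then have s: "s < 0" using f(3) by linarith
    \<comment> \<open>On the window s < 0, so the operator separates and each quasimode residual is
      multiplied by the other factor, which is bounded by 1.\<close>
    have "T (s, u) = (- dv (dv f) s + of_real (b * s - (\<nu> - E)) * f s) * of_real (r u)
        + f s * (- dv (dv (\<lambda>u. of_real (r u))) u + of_real (c * u - E) * of_real (r u))"
      unfolding T_def \<psi>_def[abs_def] sop_tensor[OF f(1) q(1)] potential_left[OF s] b_def[symmetric] c_def[symmetric]
      by (simp add: q(4)[OF u] q(5)[OF u] algebra_simps)
    also have "cmod \<dots> \<le> cmod ((- dv (dv f) s + of_real (b * s - (\<nu> - E)) * f s) * of_real (r u))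
        + cmod (f s * (- dv (dv (\<lambda>u. of_real (r u))) u + of_real (c * u - E) * of_real (r u)))"
      by (rule norm_triangle_ineq)
    also have "\<dots> \<le> \<epsilon> / 8 * 1 + 1 * (\<epsilon> / 8)"
      unfolding norm_mult[of "- dv (dv f) s + of_real (b * s - (\<nu> - E)) * f s"] norm_mult[of "f s"]
      using r(4)[of u] \<epsilon> by (intro add_mono mult_mono f(4) f(7) r(5) u) auto
    finally have "cmod (T (s, u)) \<le> \<epsilon> / 4" by simp
    moreover have "s \<in> {- L - 2 * R..- L + 2 * R}" using False by auto
    ultimately show ?thesis by (simp add: power_mono)
  qed
  have RR: "- L - 2 * R \<le> - L + 2 * R" "- L - R \<le> - L + R" using f(2) by auto
  have id: "((\<lambda>u::real. u) has_real_derivative 1) (at u)" for u by (rule DERIV_ident)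
  note box = strip_box_integral[OF d_pos RR(1) id continuous_on_const]
  have "(L2_norm ?M T)\<^sup>2 = (LINT x|?M. (cmod (T x))\<^sup>2)" by (rule L2_norm_sq)
  also have "\<dots> \<le> (LINT x|?M. (\<epsilon> / 4)\<^sup>2 * (indicator {- L - 2 * R..- L + 2 * R} (fst x) * 1))"
    by (rule integral_mono_AE[OF L2_integrable_sq[OF TL] integrable_mult_right[OF box(1)]])
       (rule AE_stripI, use Tb in simp)
  also have "\<dots> = (\<epsilon> / 4)\<^sup>2 * (4 * R * d)"
    unfolding integral_mult_right_zero box(2) by simp
  also have "\<dots> < \<epsilon>\<^sup>2 * (2 * R * (d / 4))"
  proof -
    have "0 < \<epsilon>\<^sup>2 * (R * d)" using \<epsilon> f(2) d_pos by simp
    then show ?thesis by (simp add: power_divide ac_simps)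
  qed
  also have "\<dots> \<le> \<epsilon>\<^sup>2 * (L2_norm ?M \<psi>)\<^sup>2"
  proof (rule mult_left_mono)
    have rc: "continuous_on UNIV (\<lambda>u. (r u)\<^sup>2)"
    proof -
      have "continuous_on UNIV (\<lambda>u. Re (of_real (r u)))" by (intro continuous_intros smooth_continuous r(1))
      then show ?thesis by (intro continuous_intros) simp
    qed
    \<comment> \<open>For integrability of the squared profile alone, the integral from 0 serves as
      antiderivative.\<close>
    have dr: "((\<lambda>u::real. LBINT y=0..u. (r y)\<^sup>2) has_real_derivative (r u)\<^sup>2) (at u)" for u
      using LBINT_has_vector_derivative[OF rc, of 0 u]
      by (simp add: has_real_derivative_iff_has_vector_derivative zero_ereal_def)
    have "2 * R * (d / 4) \<le> (LINT x|?M. indicator {- L - R..- L + R} (fst x) * (r (snd x))\<^sup>2)"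
      using r(6)[OF RR(2)] by simp
    also have "\<dots> \<le> (LINT x|?M. (cmod (\<psi> x))\<^sup>2)"
    proof (rule integral_mono_AE[OF strip_box_integral(1)[OF d_pos RR(2) dr rc] L2_integrable_sq[OF \<psi>L]])
      show "AE x in ?M. indicator {- L - R..- L + R} (fst x) * (r (snd x))\<^sup>2 \<le> (cmod (\<psi> x))\<^sup>2"
      proof (rule AE_stripI)
        fix s u assume u: "0 < u" "u < d"
        show "indicator {- L - R..- L + R} (fst (s, u)) * (r (snd (s, u)))\<^sup>2 \<le> (cmod (\<psi> (s, u)))\<^sup>2"
        proof (cases "s \<in> {- L - R..- L + R}")
          case True
          then have "\<bar>s + L\<bar> \<le> R" by auto
          then have "cmod (\<psi> (s, u)) = \<bar>r u\<bar>" using f(5)[of s] by (simp add: \<psi>_def norm_mult q(4)[OF u])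
          then show ?thesis using True by simp
        qed simp
      qed
    qed
    also have "\<dots> = (L2_norm ?M \<psi>)\<^sup>2" by (rule L2_norm_sq[symmetric])
    finally show "2 * R * (d / 4) \<le> (L2_norm ?M \<psi>)\<^sup>2" .
  qed simp
  also have "\<dots> = (\<epsilon> * L2_norm ?M \<psi>)\<^sup>2" by (simp add: power_mult_distrib)
  finally have "L2_norm ?M T < \<epsilon> * L2_norm ?M \<psi>"
    by (rule power2_less_imp_less) (use \<epsilon> in simp)
  then show ?thesis using \<psi>D unfolding T_def[abs_def] by blast
qed

theorem stark_spectrum:
  "essentially_self_adjoint (strip_measure d) (stark_operator d \<gamma> s\<^sub>0 \<eta> F) \<and>
   op_spectrum (strip_measure d) (op_closure (strip_measure d) (stark_operator d \<gamma> s\<^sub>0 \<eta> F)) = (\<real> :: complex set)"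
proof -
  obtain B where coeff: "strip_coefficients d (metric_g \<gamma>) metric_h (1 / (1 + \<delta>)\<^sup>2) (1 / (1 - \<delta>)\<^sup>2) B"
    using strip_coefficients_metric by blast
  interpret c: strip_coefficients d "metric_g \<gamma>" metric_h "1 / (1 + \<delta>)\<^sup>2" "1 / (1 - \<delta>)\<^sup>2" B by (rule coeff)
  obtain B' where "\<forall>s u. 0 < u \<longrightarrow> u < d \<longrightarrow> \<bar>potential (s, u)\<bar> \<le> B' * (1 + \<bar>s\<bar>)"
    using potential_bound by blast
  then have V: "\<And>s u. 0 < u \<Longrightarrow> u < d \<Longrightarrow> \<bar>potential (s, u)\<bar> \<le> B' * (1 + \<bar>s\<bar>)" by blast
  note adm = c.admissible_linear[OF potential_measurable V]
  have eq: "stark_operator d \<gamma> s\<^sub>0 \<eta> F = c.op potential"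
    by (simp add: stark_operator_eq c.op_def)
  have "of_real \<nu> \<in> op_spectrum c.M (op_closure c.M (c.op potential))" for \<nu>
  proof (rule approximate_eigenvalue_in_spectrum[OF c.op_subset_L2[OF adm]])
    fix \<epsilon> :: real assume "\<epsilon> > 0"
    then obtain \<psi> where "\<psi> \<in> dirichlet_tensors d" "L2_norm c.M
        (\<lambda>x. sop (metric_g \<gamma>) metric_h potential \<psi> x - of_real \<nu> * \<psi> x) < \<epsilon> * L2_norm c.M \<psi>"
      using approximate_eigenfunction by blast
    then show "\<exists>(p, q)\<in>c.op potential. L2_norm c.M (\<lambda>x. q x - of_real \<nu> * p x) < \<epsilon> * L2_norm c.M p"
      using c.op_I[OF adm] dirichlet_tensors_subset by blast
  qed
  then have "\<real> \<subseteq> op_spectrum c.M (op_closure c.M (c.op potential))" by (auto simp: Reals_def)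
  then show ?thesis
    using c.op_essentially_self_adjoint[OF potential_measurable V] unfolding eq by blast
qed

end

theorem theorem1:
  fixes d s\<^sub>0 \<eta> F :: real and \<gamma> :: "real \<Rightarrow> real"
  assumes d_pos: "d > 0"
    and s0_pos: "s\<^sub>0 > 0"
    and supp: "closure {s. \<gamma> s \<noteq> 0} = {0..s\<^sub>0}"
    and not_self_intersecting: "inj_on (strip_map \<gamma>) (strip d)"
    and h1: "\<gamma> C1_differentiable_on UNIV" "deriv \<gamma> C1_differentiable_on UNIV"
    and h2: "d * (SUP s. \<bar>\<gamma> s\<bar>) < 1"
    and h3: "\<bar>\<eta>\<bar> < pi / 2" "\<bar>\<eta> - angle \<gamma> s\<^sub>0\<bar> < pi / 2"
    and F_pos: "F > 0"
  shows "essentially_self_adjoint (strip_measure d) (stark_operator d \<gamma> s\<^sub>0 \<eta> F) \<and>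
         op_spectrum (strip_measure d) (op_closure (strip_measure d) (stark_operator d \<gamma> s\<^sub>0 \<eta> F))
           = (\<real> :: complex set)"
proof -
  interpret stark d s\<^sub>0 \<eta> F \<gamma>
    by unfold_locales (rule d_pos s0_pos supp h1 h2 h3(1) F_pos)+
  show ?thesis by (rule stark_spectrum)
qed

end
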